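(* Fix a wavenumber $\kappa>0$, an incident direction $d=(d_1,d_2)\in\mathbb{S}$ and a constant $q_0\neq 1$, and let $u^{in}(x)=d^\perp e^{i\kappa x\cdot d}$ with $d^\perp=(-d_2,d_1)$. Let $D$ and $\tilde D$ be two (arbitrary, possibly rotated and translated) open rectangles in $\mathbb{R}^2$, and let $u^\infty$ and $\tilde u^\infty$ be the far-field patterns of the TE scattering problem (described in the context) for $D$ and $\tilde D$ respectively, with the same $\kappa$, $d$ and $q_0$. If $u^\infty(\hat x)=\tilde u^\infty(\hat x)$ for all $\hat x\in\mathbb{S}$, then $D=\tilde D$. In other words, the boundary $\partial D$ of a rectangle is uniquely determined by the far-field pattern on all of $\mathbb{S}$ incited by a single incoming plane wave.
   Context: Notation: $\mathbb{S}=\{x\in\mathbb{R}^2:|x|=1\}$. For a scalar function $f$ and a vector field $u=(u_1,u_2)$ on (subsets of) $\mathbb{R}^2$, the two-dimensional curl operators are $\overrightarrow{\nabla}\times f=(\partial_2 f,-\partial_1 f)$ and $\nabla\times u=\partial_1u_2-\partial_2u_1$. For $a=(a_1,a_2)$ write $a^\perp=(-a_2,a_1)$. TE scattering problem for a bounded open set $D\subset\mathbb{R}^2$ with connected exterior $D^e=\mathbb{R}^2\setminus\overline D$: let $q=1$ in $D^e$ and $q=q_0$ in $\overline D$. Let $\nu$ be the unit normal on $\partial D$ pointing into $D^e$ and $\tau=\nu^\perp$. The total field $u=(u_1,u_2)\in\{u\in L^2_{loc}(\mathbb{R}^2)^2:\nabla\times u\in H^1_{loc}(\mathbb{R}^2)\}$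 satisfies $\overrightarrow{\nabla}\times(\nabla\times u)-\kappa^2 q u=0$ in $\mathbb{R}^2$ (in particular in $D$ and in $D^e$), the transmission conditions $\nabla\times u^+=\nabla\times u^-$ and $\tau\cdot u^+=\tau\cdot u^-$ on $\partial D$ (superscripts $\pm$ denote limits from $D^e$ and from $D$ respectively), and the scattered field $u^{sc}=u-u^{in}$ in $D^e$ satisfies the Silver–Müller radiation condition $\lim_{|x|\to\infty}\sqrt{|x|}\,\{\nabla\times u^{sc}-i\kappa\,u^{sc}\cdot\hat x^\perp\}=0$ uniformly in $\hat x=x/|x|\in\mathbb{S}$. This problem has a unique solution, and $u^{sc}(x)=\frac{e^{i\kappa r}}{\sqrt r}\{u^\infty(\hat x)\hat x^\perp+O(1/r)\}$ as $r=|x|\to\infty$ uniformly in $\hat x$; the scalar function $u^\infty$ on $\mathbb{S}$ is the far-field pattern. *)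

theory Defs
  imports "HOL-Analysis.Analysis"
begin

type_synonym pt = "real ^ 2"

definition unit_circle :: "pt set" where
  "unit_circle = {x. norm x = 1}"

definition perp :: "pt \<Rightarrow> pt" where
  "perp a = vector [- (a $ 2), a $ 1]"

definition dpart :: "(pt \<Rightarrow> real) \<Rightarrow> 2 \<Rightarrow> pt \<Rightarrow> real" where
  "dpart f i x = frechet_derivative f (at x) (axis i 1)"

text \<open>Real-valued C^1 test functions with compact support (equivalent to C_c^infinity
  for defining first-order distributional derivatives of L^1_loc functions).\<close>
definition test_fn :: "(pt \<Rightarrow> real) \<Rightarrow> bool" where
  "test_fn \<phi> \<longleftrightarrow> (\<forall>x. \<phi> differentiable (at x)) \<and>
      (\<forall>i. continuous_on UNIV (dpart \<phi> i)) \<and> compact (closure {x. \<phi> x \<noteq> 0})"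

definition L2_loc :: "(pt \<Rightarrow> complex) \<Rightarrow> bool" where
  "L2_loc f \<longleftrightarrow> f \<in> borel_measurable lborel \<and>
      (\<forall>K. compact K \<longrightarrow> set_integrable lborel K (\<lambda>x. (norm (f x))\<^sup>2))"

definition H1_loc :: "(pt \<Rightarrow> complex) \<Rightarrow> bool" where
  "H1_loc f \<longleftrightarrow> L2_loc f \<and>
     (\<forall>i. \<exists>g. L2_loc g \<and> (\<forall>\<phi>. test_fn \<phi> \<longrightarrow>
        (\<integral>x. f x * of_real (dpart \<phi> i x) \<partial>lborel) = - (\<integral>x. g x * of_real (\<phi> x) \<partial>lborel)))"

definition coeff_q :: "complex \<Rightarrow> pt set \<Rightarrow> pt \<Rightarrow> complex" where
  "coeff_q q0 D x = (if x \<in> closure D then q0 else 1)"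

definition u_in :: "real \<Rightarrow> pt \<Rightarrow> pt \<Rightarrow> complex ^ 2" where
  "u_in \<kappa> d x = (\<chi> j. complex_of_real (perp d $ j) * exp (\<i> * complex_of_real (\<kappa> * (x \<bullet> d))))"

text \<open>Its curl, computed in closed form: curl u^in = i kappa exp(i kappa x.d) (using |d| = 1).\<close>
definition curl_u_in :: "real \<Rightarrow> pt \<Rightarrow> pt \<Rightarrow> complex" where
  "curl_u_in \<kappa> d x = \<i> * complex_of_real \<kappa> * exp (\<i> * complex_of_real (\<kappa> * (x \<bullet> d)))"

text \<open>Total field of the TE problem, in weak (distributional) form on all of R^2, which
  encodes the equation in D and in the exterior together with the transmission conditions.
  u is the field, w its distributional curl (required in H^1_loc).  The representative is
  taken continuous in the (open) exterior, where the true solution is smooth, so that the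
  pointwise radiation condition makes sense.\<close>
definition TE_total_field ::
  "real \<Rightarrow> pt \<Rightarrow> complex \<Rightarrow> pt set \<Rightarrow> (pt \<Rightarrow> complex ^ 2) \<Rightarrow> (pt \<Rightarrow> complex) \<Rightarrow> bool" where
  "TE_total_field \<kappa> d q0 D u w \<longleftrightarrow>
     L2_loc (\<lambda>x. u x $ 1) \<and> L2_loc (\<lambda>x. u x $ 2) \<and>
     \<comment> \<open>w = curl u in the distributional sense\<close>
     (\<forall>\<phi>. test_fn \<phi> \<longrightarrow>
        (\<integral>x. w x * of_real (\<phi> x) \<partial>lborel) =
        (\<integral>x. u x $ 1 * of_real (dpart \<phi> 2 x) - u x $ 2 * of_real (dpart \<phi> 1 x) \<partial>lborel)) \<and>
     H1_loc w \<and>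
     \<comment> \<open>curl curl u - kappa^2 q u = 0 in the distributional sense on R^2\<close>
     (\<forall>\<psi>1 \<psi>2. test_fn \<psi>1 \<longrightarrow> test_fn \<psi>2 \<longrightarrow>
        (\<integral>x. w x * of_real (dpart \<psi>2 1 x - dpart \<psi>1 2 x)
             - complex_of_real (\<kappa>\<^sup>2) * coeff_q q0 D x *
               (u x $ 1 * of_real (\<psi>1 x) + u x $ 2 * of_real (\<psi>2 x)) \<partial>lborel) = 0) \<and>
     continuous_on (- closure D) u \<and> continuous_on (- closure D) w \<and>
     \<comment> \<open>Silver-Mueller radiation condition for u^sc = u - u^in, uniformly in x/|x|\<close>
     ((\<lambda>x. complex_of_real (sqrt (norm x)) *
          ((w x - curl_u_in \<kappa> d x)
           - \<i> * complex_of_real \<kappa> *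
             (\<Sum>j\<in>UNIV. (u x $ j - u_in \<kappa> d x $ j) *
                 complex_of_real (perp (x /\<^sub>R norm x) $ j))))
       \<longlongrightarrow> 0) at_infinity"

definition is_far_field ::
  "real \<Rightarrow> pt \<Rightarrow> complex \<Rightarrow> pt set \<Rightarrow> (pt \<Rightarrow> complex) \<Rightarrow> bool" where
  "is_far_field \<kappa> d q0 D uinf \<longleftrightarrow>
     (\<exists>u w. TE_total_field \<kappa> d q0 D u w \<and>
        (\<exists>C R. \<forall>x. norm x \<ge> R \<longrightarrow>
           norm ((\<chi> j. u x $ j - u_in \<kappa> d x $ j)
                 - ((exp (\<i> * complex_of_real (\<kappa> * norm x)) / complex_of_real (sqrt (norm x))
                     * uinf (x /\<^sub>R norm x))
                    *s (\<chi> j. complex_of_real (perp (x /\<^sub>R norm x) $ j))))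
           \<le> C / (norm x) powr (3/2)))"

definition is_open_rectangle :: "pt set \<Rightarrow> bool" where
  "is_open_rectangle D \<longleftrightarrow> (\<exists>c a b. a \<noteq> 0 \<and> b \<noteq> 0 \<and> a \<bullet> b = 0 \<and>
     D = {c + s *\<^sub>R a + t *\<^sub>R b | s t. 0 < s \<and> s < 1 \<and> 0 < t \<and> t < 1})"

end

theory Submission
  imports Defs
begin

text \<open>The scalar field \<open>w = curl u\<close> solves the Helmholtz equation outside the rectangle, and it is determined
  there by the far-field pattern (Rellich). If the closed rectangles differ, some extreme point \<open>p\<close> of the
  convex hull of their union is a corner of one of them, say \<open>D\<close>, and lies outside the other one, \<open>D'\<close>; by
  unique continuation the two fields agree outside \<open>D\<close> near \<open>p\<close>, where \<open>w'\<close> is real analytic. Testing the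
  difference of the two equations against \<open>exp (- a s - b t)\<close>, a solution of the equation inside \<open>D\<close> when
  \<open>a\<^sup>2 + b\<^sup>2 = - \<kappa>\<^sup>2 q0\<close>, over the right-angled corner leaves only boundary terms in the Taylor coefficients
  of \<open>w'\<close> at \<open>p\<close>. As \<open>a\<close> and \<open>b\<close> tend to infinity, parity in \<open>a\<close>, \<open>b\<close> and the Helmholtz recurrence
  for the derivatives of \<open>w'\<close> force all derivatives along a side to vanish, because \<open>q0 \<noteq> 1\<close>.
  One of the two directions of that side leads from \<open>p\<close> to infinity without meeting \<open>D'\<close>, so \<open>w'\<close> vanishes
  along a ray, which contradicts \<open>w' \<rightarrow> curl u_in\<close>, a function of modulus \<open>\<kappa>\<close>.\<close>

section \<open>Directional derivatives and integration by parts\<close>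

text \<open>Inside the rectangle only local integrability of \<open>w\<close> is used near a corner.
  The corner argument takes neither a trace nor a derivative of \<open>w\<close> there:
  \<open>w - w'\<close> is multiplied by (Laplacian + kappa^2 q0) phi, which vanishes except where
  the cutoff in phi varies, and there the exponential is small. All boundary terms come from
  \<open>w'\<close>, which is smooth across the corner. Regularity and analyticity of weak solutions
  rest on a mean value formula with kernel (s - |y - x|^2)_+^3, whose constant is read off from one
  plane wave, so that no Bessel function has to be introduced. In Rellich's lemma an energy estimate
  for the radial equation plays the same part. The expansion at the corner holds only where a and b
  have large real part, which forbids changing their signs. The conic a^2 + b^2 = - kappa^2 q0 has a
  rational parametrisation; on it the expansion becomes a bound on the degree of a polynomial and
  then holds for all four choices of signs, which is what parity requires. For derivatives of even
  order the leading terms cancel, and the information sits two powers lower.\<close>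

definition pd :: "pt \<Rightarrow> (pt \<Rightarrow> 'a::real_normed_vector) \<Rightarrow> pt \<Rightarrow> 'a" where
  "pd e f x = frechet_derivative f (at x) e"

definition C1_on :: "pt set \<Rightarrow> (pt \<Rightarrow> 'a::real_normed_vector) \<Rightarrow> bool" where
  "C1_on G f \<longleftrightarrow> (\<forall>x\<in>G. f differentiable (at x)) \<and> (\<forall>e. continuous_on G (pd e f))"

definition supp :: "(pt \<Rightarrow> 'a::zero) \<Rightarrow> pt set" where
  "supp f = closure {x. f x \<noteq> 0}"

lemma supp_eq_0: "x \<notin> supp f \<Longrightarrow> f x = 0"
  using closure_subset[of "{x. f x \<noteq> 0}"] by (auto simp: supp_def)

lemma closed_supp [simp]: "closed (supp f)"
  by (simp add: supp_def)

lemma supp_subset: "closed K \<Longrightarrow> (\<And>x. x \<notin> K \<Longrightarrow> f x = 0) \<Longrightarrow> supp f \<subseteq> K"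
  unfolding supp_def by (rule closure_minimal) auto

lemma pt_decomp: "(e::pt) = (e $ 1) *\<^sub>R axis 1 1 + (e $ 2) *\<^sub>R axis 2 1"
  by (simp add: vec_eq_iff forall_2 axis_def)

lemma pd_eqI: "(f has_derivative f') (at x) \<Longrightarrow> pd e f x = f' e"
  unfolding pd_def using frechet_derivative_at by metis

lemma dpart_eq_pd: "dpart f i = pd (axis i 1) f"
  by (rule ext) (simp add: dpart_def pd_def)

lemma has_derivative_pd:
  "f differentiable (at x) \<Longrightarrow> (f has_derivative (\<lambda>e. pd e f x)) (at x)"
  unfolding pd_def by (simp add: frechet_derivative_works)

lemma linear_pd: "f differentiable (at x) \<Longrightarrow> linear (\<lambda>e. pd e f x)"
  using has_derivative_pd has_derivative_linear by blast

lemma pd_add_dir: "f differentiable (at x) \<Longrightarrow> pd (d + e) f x = pd d f x + pd e f x"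
  using linear_pd linear_add by fastforce

lemma pd_scale_dir: "f differentiable (at x) \<Longrightarrow> pd (c *\<^sub>R e) f x = c *\<^sub>R pd e f x"
  using linear_pd linear_scale by fastforce

lemma pd_decomp: "f differentiable (at x) \<Longrightarrow>
    pd e f x = (e $ 1) *\<^sub>R pd (axis 1 1) f x + (e $ 2) *\<^sub>R pd (axis 2 1) f x"
  by (subst pt_decomp[of e]) (simp add: pd_add_dir pd_scale_dir)

text \<open>True also where the functions are not differentiable: both have the same set of
  derivatives at the point, so the choice operator behind \<open>frechet_derivative\<close> picks
  the same one.\<close>

lemma pd_cong_open:
  assumes "open G" "x \<in> G" "\<And>y. y \<in> G \<Longrightarrow> f y = g y"
  shows "pd e f x = pd e g x"
proof -
  have "(f has_derivative f') (at x) \<longleftrightarrow> (g has_derivative f') (at x)" for f'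
    using has_derivative_transform_within_open[OF _ assms(1,2), of f f' UNIV g]
      has_derivative_transform_within_open[OF _ assms(1,2), of g f' UNIV f] assms(3) by auto
  then show ?thesis by (simp add: pd_def frechet_derivative_def)
qed

lemma differentiable_cong_open:
  assumes "open G" "x \<in> G" "\<And>y. y \<in> G \<Longrightarrow> f y = g y"
  shows "f differentiable (at x) \<longleftrightarrow> g differentiable (at x)"
  using has_derivative_transform_within_open[OF _ assms(1,2), of f _ UNIV g]
    has_derivative_transform_within_open[OF _ assms(1,2), of g _ UNIV f] assms(3)
  unfolding differentiable_def by (auto 4 4)

lemma C1_on_subset: "C1_on G f \<Longrightarrow> H \<subseteq> G \<Longrightarrow> C1_on H f"
  unfolding C1_on_def using continuous_on_subset by blast

lemma C1_on_continuous: "C1_on G f \<Longrightarrow> continuous_on G f"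
  unfolding C1_on_def
  by (meson continuous_at_imp_continuous_on differentiable_imp_continuous_within)

text \<open>By linearity in the direction, continuity of the two partial derivatives gives
  continuity of every directional derivative; from here on coordinates are replaced by arbitrary
  directions.\<close>

lemma test_fn_iff: "test_fn \<phi> \<longleftrightarrow> C1_on UNIV \<phi> \<and> compact (supp \<phi>)"
proof
  assume t: "test_fn \<phi>"
  then have d: "\<phi> differentiable (at x)" for x by (simp add: test_fn_def)
  have "continuous_on UNIV (pd e \<phi>)" for e
  proof -
    have eq: "pd e \<phi> = (\<lambda>x. (e $ 1) *\<^sub>R pd (axis 1 1) \<phi> x + (e $ 2) *\<^sub>R pd (axis 2 1) \<phi> x)"
      using pd_decomp[OF d] by blast
    show ?thesis using t unfolding eq test_fn_def dpart_eq_pd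
      by (intro continuous_intros) auto
  qed
  then show "C1_on UNIV \<phi> \<and> compact (supp \<phi>)"
    using t by (simp add: C1_on_def test_fn_def supp_def)
qed (simp add: C1_on_def test_fn_def supp_def dpart_eq_pd)

section \<open>Integrals of compactly supported functions and integration by parts\<close>

lemma integral_compact_support:
  fixes f :: "pt \<Rightarrow> complex"
  assumes "continuous_on (cbox a b) f" "\<And>x. x \<notin> cbox a b \<Longrightarrow> f x = 0"
  shows "integrable lborel f" "(\<integral>x. f x \<partial>lborel) = integral (cbox a b) f"
proof -
  have si: "set_integrable lborel (cbox a b) f"
    unfolding set_integrable_def using borel_integrable_compact[OF compact_cbox assms(1)] .
  have eq: "(\<lambda>x. indicator (cbox a b) x *\<^sub>R f x) = f"
    using assms(2) by (auto simp: indicator_def fun_eq_iff)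
  show "integrable lborel f" using si by (simp add: set_integrable_def eq)
  show "(\<integral>x. f x \<partial>lborel) = integral (cbox a b) f"
    using set_borel_integral_eq_integral(2)[OF si] by (simp add: set_lebesgue_integral_def eq)
qed

lemma integrable_continuous_support:
  fixes f :: "pt \<Rightarrow> complex"
  assumes "continuous_on UNIV f" "compact K" "\<And>x. x \<notin> K \<Longrightarrow> f x = 0"
  shows "integrable lborel f"
proof -
  obtain a where "K \<subseteq> cbox (-a) a" using compact_imp_bounded[OF assms(2)] bounded_subset_cbox_symmetric by blast
  then show ?thesis using assms(1,3)
    by (intro integral_compact_support(1)[of "-a" a]) (auto intro: continuous_on_subset)
qed

text \<open>For a function that is not measurable both sides are the default value 0 of the
  integral, because translation preserves non-measurability.\<close>

lemma integral_translation:
  fixes f :: "pt \<Rightarrow> complex"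
  shows "(\<integral>x. f (c + x) \<partial>lborel) = (\<integral>x. f x \<partial>lborel)"
proof (cases "f \<in> borel_measurable borel")
  case True
  have "(\<integral>x. f x \<partial>lborel) = (\<integral>x. f x \<partial>(distr lborel borel ((+) c)))"
    by (simp add: lborel_distr_plus)
  also have "\<dots> = (\<integral>x. f (c + x) \<partial>lborel)"
    by (rule integral_distr) (use True in auto)
  finally show ?thesis by simp
next
  case False
  have "\<not> integrable lborel f" using False borel_measurable_integrable by fastforce
  moreover have "\<not> integrable lborel (\<lambda>x. f (c + x))"
  proof
    assume "integrable lborel (\<lambda>x. f (c + x))"
    then have [measurable]: "(\<lambda>x. f (c + x)) \<in> borel_measurable borel"
      using borel_measurable_integrable by fastforce
    have "(\<lambda>x. (\<lambda>y. f (c + y)) (x - c)) \<in> borel_measurable borel" by measurable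
    then show False using False by simp
  qed
  ultimately show ?thesis by (simp add: not_integrable_integral_eq)
qed

lemma has_vector_derivative_line:
  assumes "f differentiable (at (x + t *\<^sub>R e))"
  shows "((\<lambda>t. f (x + t *\<^sub>R e)) has_vector_derivative pd e f (x + t *\<^sub>R e)) (at t within S)"
proof -
  have "((\<lambda>t. x + t *\<^sub>R e) has_derivative (\<lambda>s. s *\<^sub>R e)) (at t within S)"
    by (auto intro!: derivative_eq_intros)
  from has_derivative_compose[OF this has_derivative_pd[OF assms]]
  show ?thesis by (simp add: has_vector_derivative_def pd_scale_dir[OF assms])
qed

text \<open>By translation invariance the integral of h (x + t e) does not depend on t; its
  derivative at t = 0 is the integral of \<open>pd e h\<close>.\<close>

lemma integral_pd_eq_0:
  fixes h :: "pt \<Rightarrow> complex"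
  assumes h: "C1_on UNIV h" and K: "compact K" and z: "\<And>x. x \<notin> K \<Longrightarrow> h x = 0"
  shows "(\<integral>x. pd e h x \<partial>lborel) = 0"
proof -
  have d: "h differentiable (at x)" for x using h by (simp add: C1_on_def)
  have c: "continuous_on UNIV (pd e h)" "continuous_on UNIV h"
    using h C1_on_continuous by (auto simp: C1_on_def)
  \<comment> \<open>Contains the supports of all translates by t e with |t| <= 1, so that Leibniz'
    rule can be applied on one fixed box.\<close>
  define K' where "K' = (\<lambda>(x,t). x - t *\<^sub>R e) ` (K \<times> {-1..1::real})"
  have "compact K'" unfolding K'_def
    by (intro compact_continuous_image compact_Times K compact_Icc) (auto intro!: continuous_intros simp: case_prod_unfold)
  then obtain a where a: "K' \<subseteq> cbox (-a) a" using compact_imp_bounded bounded_subset_cbox_symmetric by blast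
  have z2: "h (x + t *\<^sub>R e) = 0" if "x \<notin> cbox (-a) a" "t \<in> {-1..1}" for x t
  proof (rule z, rule notI)
    assume "x + t *\<^sub>R e \<in> K"
    then have "x \<in> K'" unfolding K'_def using that(2) by (intro image_eqI[of _ _ "(x + t *\<^sub>R e, t)"]) auto
    then show False using a that by auto
  qed
  let ?U = "{-1<..<1::real}"
  have L: "((\<lambda>t. integral (cbox (-a) a) (\<lambda>x. h (x + t *\<^sub>R e))) has_vector_derivative
      integral (cbox (-a) a) (\<lambda>x. pd e h (x + 0 *\<^sub>R e))) (at 0 within ?U)"
  proof (rule leibniz_rule_vector_derivative)
    show "((\<lambda>t. h (x + t *\<^sub>R e)) has_vector_derivative pd e h (x + t *\<^sub>R e)) (at t within ?U)" for x t
      by (rule has_vector_derivative_line[OF d])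
    show "(\<lambda>x. h (x + t *\<^sub>R e)) integrable_on cbox (-a) a" for t
      by (intro integrable_continuous continuous_on_compose2[OF c(2)]) (auto intro!: continuous_intros)
    show "continuous_on (?U \<times> cbox (-a) a) (\<lambda>(t, x). pd e h (x + t *\<^sub>R e))"
      unfolding case_prod_unfold
      by (intro continuous_on_compose2[OF c(1)]) (auto intro!: continuous_intros)
  qed auto
  have eq: "(\<integral>x. h x \<partial>lborel) = integral (cbox (-a) a) (\<lambda>x. h (x + t *\<^sub>R e))" if "t \<in> ?U" for t
  proof -
    have "integral (cbox (-a) a) (\<lambda>x. h (x + t *\<^sub>R e)) = (\<integral>x. h (x + t *\<^sub>R e) \<partial>lborel)"
      by (rule integral_compact_support(2)[symmetric])
        (use that z2 in \<open>auto intro!: continuous_on_compose2[OF c(2)] continuous_intros\<close>)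
    also have "\<dots> = (\<integral>x. h x \<partial>lborel)"
      using integral_translation[of h "t *\<^sub>R e"] by (simp add: add.commute)
    finally show ?thesis by (rule sym)
  qed
  have "((\<lambda>t. \<integral>x. h x \<partial>lborel) has_vector_derivative
      integral (cbox (-a) a) (\<lambda>x. pd e h (x + 0 *\<^sub>R e))) (at 0 within ?U)"
    by (rule has_vector_derivative_transform[OF _ eq L]) simp
  moreover have "at (0::real) within ?U = at 0" by (rule at_within_open) auto
  ultimately have "integral (cbox (-a) a) (\<lambda>x. pd e h (x + 0 *\<^sub>R e)) = 0"
    using vector_derivative_unique_at[OF _ has_vector_derivative_const[of "\<integral>x. h x \<partial>lborel" "at (0::real)"]] by metis
  then have "integral (cbox (-a) a) (pd e h) = 0" by simp
  moreover have "(\<integral>x. pd e h x \<partial>lborel) = integral (cbox (-a) a) (pd e h)"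
  proof (rule integral_compact_support(2))
    show "continuous_on (cbox (-a) a) (pd e h)" using c(1) continuous_on_subset by blast
    fix x assume x: "x \<notin> cbox (-a) a"
    have "pd e h x = pd e (\<lambda>_. 0) x"
      by (rule pd_cong_open[of "- cbox (-a) a"]) (use x z2[of _ 0] in \<open>auto intro: closed_cbox\<close>)
    also have "\<dots> = 0" by (rule pd_eqI) simp
    finally show "pd e h x = 0" .
  qed
  ultimately show ?thesis by simp
qed

lemma pd_outside:
  assumes "closed K" "\<And>x. x \<notin> K \<Longrightarrow> f x = 0" "x \<notin> K"
  shows "pd e f x = 0"
proof -
  have "pd e f x = pd e (\<lambda>_. 0) x"
    by (rule pd_cong_open[of "- K"]) (use assms in auto)
  also have "\<dots> = 0" by (rule pd_eqI) simp
  finally show ?thesis .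
qed

lemma pd_of_real:
  assumes "f differentiable (at x)"
  shows "(\<lambda>x. complex_of_real (f x)) differentiable (at x)"
    "pd e (\<lambda>x. complex_of_real (f x)) x = of_real (pd e f x)"
proof -
  have D: "((\<lambda>x. complex_of_real (f x)) has_derivative (\<lambda>e. of_real (pd e f x))) (at x)"
    using bounded_linear.has_derivative[OF bounded_linear_of_real has_derivative_pd[OF assms]] .
  then show "(\<lambda>x. complex_of_real (f x)) differentiable (at x)" by (auto simp: differentiable_def)
  show "pd e (\<lambda>x. complex_of_real (f x)) x = of_real (pd e f x)" using pd_eqI[OF D] .
qed

lemma pd_mult:
  fixes f g :: "pt \<Rightarrow> 'a::real_normed_algebra"
  assumes "f differentiable (at x)" "g differentiable (at x)"
  shows "(\<lambda>x. f x * g x) differentiable (at x)"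
    "pd e (\<lambda>x. f x * g x) x = f x * pd e g x + pd e f x * g x"
proof -
  have D: "((\<lambda>x. f x * g x) has_derivative (\<lambda>e. f x * pd e g x + pd e f x * g x)) (at x)"
    using has_derivative_mult[OF has_derivative_pd[OF assms(1)] has_derivative_pd[OF assms(2)]] .
  then show "(\<lambda>x. f x * g x) differentiable (at x)" by (auto simp: differentiable_def)
  show "pd e (\<lambda>x. f x * g x) x = f x * pd e g x + pd e f x * g x" using pd_eqI[OF D] .
qed

text \<open>The product is continuous on \<open>G\<close> and identically zero on the open set
  \<open>- K\<close>, and these two sets cover the plane.\<close>

lemma integrable_mult_test:
  fixes f :: "pt \<Rightarrow> complex" and g :: "pt \<Rightarrow> complex"
  assumes "open G" "continuous_on G f" "continuous_on G g" "compact K" "K \<subseteq> G" "\<And>x. x \<notin> K \<Longrightarrow> g x = 0"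
  shows "continuous_on UNIV (\<lambda>x. f x * g x)" "integrable lborel (\<lambda>x. f x * g x)"
proof -
  have "continuous_on (G \<union> - K) (\<lambda>x. f x * g x)"
  proof (rule continuous_on_open_Un)
    show "continuous_on G (\<lambda>x. f x * g x)" using assms by (intro continuous_intros)
    show "continuous_on (- K) (\<lambda>x. f x * g x)"
      by (rule continuous_on_eq[of _ "\<lambda>_. 0"]) (use assms in auto)
  qed (use assms compact_imp_closed in auto)
  moreover have "G \<union> - K = UNIV" using assms by auto
  ultimately show c: "continuous_on UNIV (\<lambda>x. f x * g x)" by simp
  show "integrable lborel (\<lambda>x. f x * g x)"
    by (rule integrable_continuous_support[OF c assms(4)]) (use assms in auto)
qed

text \<open>The product f phi is C^1 on the whole plane although \<open>f\<close> is controlled only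
  on \<open>G\<close>: outside the support of phi it vanishes on an open set. Its derivative
  therefore integrates to 0.\<close>

lemma integration_by_parts:
  fixes f :: "pt \<Rightarrow> complex"
  assumes G: "open G" "C1_on G f" and t: "test_fn \<phi>" and s: "supp \<phi> \<subseteq> G"
  shows "(\<integral>x. pd e f x * of_real (\<phi> x) \<partial>lborel) = - (\<integral>x. f x * of_real (pd e \<phi> x) \<partial>lborel)"
proof -
  let ?K = "supp \<phi>"
  have K: "compact ?K" and c\<phi>: "C1_on UNIV \<phi>" using t by (auto simp: test_fn_iff)
  have d\<phi>: "\<phi> differentiable (at x)" for x using c\<phi> by (simp add: C1_on_def)
  have df: "f differentiable (at x)" if "x \<in> G" for x using G that by (simp add: C1_on_def)
  have z: "\<phi> x = 0" if "x \<notin> ?K" for x using that by (rule supp_eq_0)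
  have zd: "pd e \<phi> x = 0" if "x \<notin> ?K" for x e by (rule pd_outside[of ?K]) (use that z in auto)
  let ?h = "\<lambda>x. f x * of_real (\<phi> x)"
  have h: "?h differentiable (at x) \<and> pd e ?h x = f x * of_real (pd e \<phi> x) + pd e f x * of_real (\<phi> x)" for x e
  proof (cases "x \<in> G")
    case True
    then show ?thesis using pd_mult[OF df[OF True] pd_of_real(1)[OF d\<phi>]] pd_of_real(2)[OF d\<phi>] by simp
  next
    case False
    then have x: "x \<notin> ?K" using s by auto
    have "?h differentiable (at x) \<longleftrightarrow> (\<lambda>_. 0::complex) differentiable (at x)"
      by (rule differentiable_cong_open[of "- ?K"]) (use x z in auto)
    moreover have "pd e ?h x = 0" by (rule pd_outside[of ?K]) (use x z in auto)
    ultimately show ?thesis using z[OF x] zd[OF x] by simp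
  qed
  have i1: "continuous_on UNIV (\<lambda>x. f x * complex_of_real (pd e \<phi> x))"
           "integrable lborel (\<lambda>x. f x * complex_of_real (pd e \<phi> x))" for e
    by (rule integrable_mult_test[OF G(1) _ _ K s],
       use C1_on_continuous[OF G(2)] c\<phi> zd in
         \<open>auto simp: C1_on_def intro!: continuous_intros continuous_on_subset[of UNIV _ G]\<close>)+
  have i2: "continuous_on UNIV (\<lambda>x. pd e f x * complex_of_real (\<phi> x))"
           "integrable lborel (\<lambda>x. pd e f x * complex_of_real (\<phi> x))" for e
    by (rule integrable_mult_test[OF G(1) _ _ K s],
       use G C1_on_continuous[OF c\<phi>] z in
         \<open>auto simp: C1_on_def intro!: continuous_intros continuous_on_subset[of UNIV _ G]\<close>)+
  have "C1_on UNIV ?h" unfolding C1_on_def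
  proof (intro conjI ballI allI)
    show "?h differentiable (at x)" for x using h by blast
    show "continuous_on UNIV (pd e ?h)" for e
      using continuous_on_add[OF i1(1)[of e] i2(1)[of e]] h by (subst continuous_on_cong[OF refl]) auto
  qed
  then have "(\<integral>x. pd e ?h x \<partial>lborel) = 0" by (rule integral_pd_eq_0[OF _ K]) (use z in auto)
  moreover have "(\<integral>x. pd e ?h x \<partial>lborel) = (\<integral>x. f x * of_real (pd e \<phi> x) + pd e f x * of_real (\<phi> x) \<partial>lborel)"
    by (rule Bochner_Integration.integral_cong[OF refl]) (use h in blast)
  moreover have "\<dots> = (\<integral>x. f x * of_real (pd e \<phi> x) \<partial>lborel) + (\<integral>x. pd e f x * of_real (\<phi> x) \<partial>lborel)"
    by (rule Bochner_Integration.integral_add[OF i1(2) i2(2)])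
  ultimately show ?thesis by (simp add: add_eq_0_iff)
qed

section \<open>Polynomial bumps\<close>

text \<open>C^2 instead of smooth functions, so that the truncated polynomials \<open>bump 3\<close>
  are admissible.\<close>

definition test_fn2 :: "(pt \<Rightarrow> real) \<Rightarrow> bool" where
  "test_fn2 \<phi> \<longleftrightarrow> test_fn \<phi> \<and> (\<forall>e. test_fn (pd e \<phi>))"

definition lap :: "(pt \<Rightarrow> 'a::real_normed_vector) \<Rightarrow> pt \<Rightarrow> 'a" where
  "lap f x = pd (axis 1 1) (pd (axis 1 1) f) x + pd (axis 2 1) (pd (axis 2 1) f) x"

text \<open>The distributional Helmholtz equation, with all derivatives on the test function;
  continuity is included so that point values are meaningful.\<close>

definition wsol :: "real \<Rightarrow> pt set \<Rightarrow> (pt \<Rightarrow> complex) \<Rightarrow> bool" where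
  "wsol \<kappa> G v \<longleftrightarrow> open G \<and> continuous_on G v \<and>
     (\<forall>\<phi>. test_fn2 \<phi> \<and> supp \<phi> \<subseteq> G \<longrightarrow> (\<integral>x. v x * of_real (lap \<phi> x + \<kappa>\<^sup>2 * \<phi> x) \<partial>lborel) = 0)"

text \<open>The parameter \<open>s\<close> is the squared radius. Differentiation in
  \<open>s\<close> then merely lowers the exponent, and this turns the equation for a solution into
  an ordinary differential equation for its moments.\<close>

definition bump :: "nat \<Rightarrow> real \<Rightarrow> pt \<Rightarrow> pt \<Rightarrow> real" where
  "bump k s x y = (max 0 (s - (y - x) \<bullet> (y - x))) ^ k"

lemma pos_part_power_deriv:
  "((\<lambda>z::real. max 0 z ^ Suc (Suc k)) has_real_derivative real (k + 2) * max 0 z ^ Suc k) (at z)"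
proof (cases z "0::real" rule: linorder_cases)
  case less
  have "((\<lambda>z::real. max 0 z ^ Suc (Suc k)) has_real_derivative 0) (at z)"
    by (rule has_field_derivative_transform_within_open[of "\<lambda>_. 0" _ _ "{..<0}"]) (use less in auto)
  then show ?thesis using less by simp
next
  case greater
  have "((\<lambda>z::real. z ^ Suc (Suc k)) has_real_derivative real (k + 2) * z ^ Suc k) (at z)"
    by (rule DERIV_cong[OF DERIV_pow]) simp
  then have "((\<lambda>z::real. max 0 z ^ Suc (Suc k)) has_real_derivative real (k + 2) * z ^ Suc k) (at z)"
    by (rule has_field_derivative_transform_within_open[of _ _ _ "{0<..}"]) (use greater in auto)
  then show ?thesis using greater by simp
next
  case equal
  have "((\<lambda>h::real. (max 0 (0 + h) ^ Suc (Suc k) - max 0 0 ^ Suc (Suc k)) / h) \<longlongrightarrow> 0) (at 0)"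
  proof (rule Lim_null_comparison)
    show "\<forall>\<^sub>F h::real in at 0. norm ((max 0 (0 + h) ^ Suc (Suc k) - max 0 0 ^ Suc (Suc k)) / h) \<le> \<bar>h\<bar> ^ Suc k"
    proof (rule always_eventually, rule allI)
      fix h :: real
      show "norm ((max 0 (0 + h) ^ Suc (Suc k) - max 0 0 ^ Suc (Suc k)) / h) \<le> \<bar>h\<bar> ^ Suc k"
      proof (cases "h > 0")
        case False
        then have "max 0 h = 0" by simp
        then have "(max 0 (0 + h) ^ Suc (Suc k) - max 0 0 ^ Suc (Suc k)) / h = 0" by simp
        then show ?thesis by (simp only: norm_zero) (rule zero_le_power, simp)
      qed (simp add: max_def)
    qed
    have "((\<lambda>h::real. \<bar>h\<bar> ^ Suc k) \<longlongrightarrow> \<bar>0\<bar> ^ Suc k) (at 0)" by (intro tendsto_intros)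
    then show "((\<lambda>h::real. \<bar>h\<bar> ^ Suc k) \<longlongrightarrow> 0) (at 0)" by simp
  qed
  then show ?thesis by (simp add: DERIV_def equal)
qed

lemma bump_nonneg: "0 \<le> bump k s x y"
  by (simp add: bump_def)

lemma bump_zero: "0 < k \<Longrightarrow> s \<le> (norm (y - x))\<^sup>2 \<Longrightarrow> bump k s x y = 0"
  by (simp add: bump_def power2_norm_eq_inner)

lemma bump_zero_cball:
  assumes "0 < k" "0 \<le> r" "s \<le> r\<^sup>2" "y \<notin> cball x r"
  shows "bump k s x y = 0"
proof (rule bump_zero[OF assms(1)])
  have "r < norm (y - x)" using assms(4) by (simp add: dist_norm norm_minus_commute)
  then have "r\<^sup>2 \<le> (norm (y - x))\<^sup>2" using assms(2) by (intro power_mono) auto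
  then show "s \<le> (norm (y - x))\<^sup>2" using assms(3) by linarith
qed

lemma bump_le: "0 \<le> s \<Longrightarrow> bump k s x y \<le> s ^ k"
  unfolding bump_def by (intro power_mono) (auto simp: max_def)

lemma continuous_on_bump [continuous_intros]:
  assumes "continuous_on S f" "continuous_on S g" "continuous_on S h"
  shows "continuous_on S (\<lambda>z. bump k (f z) (g z) (h z))"
  unfolding bump_def by (intro continuous_intros assms)

lemma bump_deriv_y:
  "((\<lambda>y. bump (Suc (Suc k)) s x y) has_derivative
     (\<lambda>h. - 2 * real (k + 2) * bump (Suc k) s x y * ((y - x) \<bullet> h))) (at y)"
proof -
  have "((\<lambda>y. s - (y - x) \<bullet> (y - x)) has_derivative (\<lambda>h. - 2 * ((y - x) \<bullet> h))) (at y)"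
    by (auto intro!: derivative_eq_intros simp: inner_commute)
  from has_derivative_compose[OF this pos_part_power_deriv[of k, unfolded has_field_derivative_def]]
  show ?thesis unfolding bump_def by (simp add: algebra_simps)
qed

lemma bump_deriv_x:
  "((\<lambda>x. bump (Suc (Suc k)) s x y) has_derivative
     (\<lambda>h. 2 * real (k + 2) * bump (Suc k) s x y * ((y - x) \<bullet> h))) (at x within S)"
proof -
  have "((\<lambda>x. s - (y - x) \<bullet> (y - x)) has_derivative (\<lambda>h. 2 * ((y - x) \<bullet> h))) (at x within S)"
    by (auto intro!: derivative_eq_intros simp: inner_commute)
  from has_derivative_compose[OF this pos_part_power_deriv[of k, unfolded has_field_derivative_def]]
  show ?thesis unfolding bump_def by (simp add: algebra_simps)
qed

lemma bump_deriv_s: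
  "((\<lambda>s. bump (Suc (Suc k)) s x y) has_real_derivative real (k + 2) * bump (Suc k) s x y) (at s within S)"
proof -
  have "((\<lambda>s. s - (y - x) \<bullet> (y - x)) has_real_derivative 1) (at s within S)"
    by (auto intro!: derivative_eq_intros)
  from DERIV_chain2[OF pos_part_power_deriv this]
  show ?thesis unfolding bump_def by simp
qed

lemma pd_bump: "pd e (bump (Suc (Suc k)) s x) y = - 2 * real (k + 2) * bump (Suc k) s x y * ((y - x) \<bullet> e)"
  using pd_eqI[OF bump_deriv_y] .

lemma pd_pd_bump:
  "(pd e (bump (Suc (Suc (Suc k))) s x)) differentiable (at y)"
  "pd e' (pd e (bump (Suc (Suc (Suc k))) s x)) y =
     4 * real (k + 3) * real (k + 2) * bump (Suc k) s x y * ((y - x) \<bullet> e) * ((y - x) \<bullet> e')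
      - 2 * real (k + 3) * bump (Suc (Suc k)) s x y * (e' \<bullet> e)"
proof -
  have D: "((\<lambda>y. - 2 * real (k + 3) * bump (Suc (Suc k)) s x y * ((y - x) \<bullet> e)) has_derivative
     (\<lambda>h. 4 * real (k + 3) * real (k + 2) * bump (Suc k) s x y * ((y - x) \<bullet> e) * ((y - x) \<bullet> h)
      - 2 * real (k + 3) * bump (Suc (Suc k)) s x y * (h \<bullet> e))) (at y)"
    by (rule derivative_eq_intros bump_deriv_y refl | simp add: algebra_simps)+
  have eq: "pd e (bump (Suc (Suc (Suc k))) s x) = (\<lambda>y. - 2 * real (k + 3) * bump (Suc (Suc k)) s x y * ((y - x) \<bullet> e))"
    by (rule ext) (simp add: pd_bump add.commute)
  show "(pd e (bump (Suc (Suc (Suc k))) s x)) differentiable (at y)"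
    unfolding eq using D by (auto simp: differentiable_def)
  show "pd e' (pd e (bump (Suc (Suc (Suc k))) s x)) y =
     4 * real (k + 3) * real (k + 2) * bump (Suc k) s x y * ((y - x) \<bullet> e) * ((y - x) \<bullet> e')
      - 2 * real (k + 3) * bump (Suc (Suc k)) s x y * (e' \<bullet> e)"
    unfolding eq using pd_eqI[OF D] .
qed

lemma supp_bump: "0 < k \<Longrightarrow> 0 \<le> r \<Longrightarrow> s \<le> r\<^sup>2 \<Longrightarrow> supp (bump k s x) \<subseteq> cball x r"
  by (intro supp_subset closed_cball bump_zero_cball) auto

lemma compact_supp: "compact K \<Longrightarrow> supp f \<subseteq> K \<Longrightarrow> compact (supp f)"
  by (metis closed_supp compact_Int_closed inf.absorb_iff2)

text \<open>The exponent 3 is the least one for which the power of a positive part is C^2.\<close>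

lemma bump_test_fn2: "test_fn2 (bump 3 s x)"
proof -
  have three: "(3::nat) = Suc (Suc (Suc 0))" by simp
  define r where "r = sqrt \<bar>s\<bar>"
  have r: "0 \<le> r" "s \<le> r\<^sup>2" by (auto simp: r_def)
  have sub: "supp (bump 3 s x) \<subseteq> cball x r" using r by (intro supp_bump) auto
  have c0: "C1_on UNIV (bump 3 s x)" unfolding C1_on_def three
    using bump_deriv_y by (auto simp: differentiable_def pd_bump[abs_def] intro!: continuous_intros exI)
  have c1: "C1_on UNIV (pd e (bump 3 s x))" for e
    unfolding C1_on_def three by (auto simp: pd_pd_bump(1) pd_pd_bump(2)[abs_def] intro!: continuous_intros)
  have "supp (pd e (bump 3 s x)) \<subseteq> cball x r" for e
    by (intro supp_subset closed_cball pd_outside[of "cball x r"]) (auto intro!: bump_zero_cball[OF _ r])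
  with sub c0 c1 show ?thesis unfolding test_fn2_def test_fn_iff using compact_supp[OF compact_cball] by blast
qed

text \<open>In the plane the Laplacian is 24 |y - x|^2 \<open>bump 1\<close> - 12
  \<open>bump 2\<close>. Writing |y - x|^2 as s minus the base of the power leaves bumps only, that
  is, derivatives of \<open>bump 3\<close> with respect to \<open>s\<close>.\<close>

lemma lap_bump: "lap (bump 3 s x) y = 24 * s * bump 1 s x y - 36 * bump 2 s x y"
proof -
  have three: "(3::nat) = Suc (Suc (Suc 0))" by simp
  have n: "(y - x) \<bullet> (y - x) = ((y - x) \<bullet> axis 1 1)\<^sup>2 + ((y - x) \<bullet> axis 2 1)\<^sup>2"
    by (simp add: inner_vec_def sum_2 power2_eq_square axis_def)
  have a: "axis i (1::real) \<bullet> (axis i 1 :: pt) = 1" for i by (simp add: inner_axis_axis)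
  have "lap (bump 3 s x) y = 24 * bump 1 s x y * ((y - x) \<bullet> (y - x)) - 12 * bump 2 s x y"
    unfolding lap_def three pd_pd_bump(2) n by (simp add: a power2_eq_square algebra_simps eval_nat_numeral)
  moreover have "bump 1 s x y * ((y - x) \<bullet> (y - x)) = s * bump 1 s x y - bump 2 s x y"
    by (auto simp: bump_def max_def power2_eq_square algebra_simps)
  ultimately show ?thesis by (simp add: algebra_simps)
qed

section \<open>Size of bump integrals\<close>

lemma cball_subset_cbox: "0 \<le> r \<Longrightarrow> cball x r \<subseteq> cbox (x - vec r) (x + vec (r::real))" for x :: pt
proof
  fix y assume "0 \<le> r" "y \<in> cball x r"
  then have "norm (y - x) \<le> r" by (simp add: dist_norm norm_minus_commute)
  then have "\<bar>(y - x) $ i\<bar> \<le> r" for i using component_le_norm_cart[of "y - x" i] by linarith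
  then show "y \<in> cbox (x - vec r) (x + vec r)" by (simp add: mem_box_cart abs_le_iff) (smt (verit) )
qed

lemma measure_cbox_vec: "0 \<le> r \<Longrightarrow> measure lborel (cbox (x - vec r) (x + vec (r::real))) = 4 * r\<^sup>2" for x :: pt
  by (simp add: measure_lborel_cbox_eq Basis_vec_def axis_eq_axis UN_UN_flatten inner_axis algebra_simps UNIV_2 power2_eq_square)

text \<open>The disc is estimated by its circumscribed square, whence the area 4 r^2.\<close>

lemma norm_integral_le_cball:
  fixes f :: "pt \<Rightarrow> complex"
  assumes "integrable lborel f" "0 \<le> r" "0 \<le> B" "\<And>y. y \<in> cball x r \<Longrightarrow> norm (f y) \<le> B" "\<And>y. y \<notin> cball x r \<Longrightarrow> f y = 0"
  shows "norm (\<integral>y. f y \<partial>lborel) \<le> B * (4 * r\<^sup>2)"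
proof -
  let ?Q = "cbox (x - vec r) (x + vec r)"
  have "norm (\<integral>y. f y \<partial>lborel) \<le> (\<integral>y. norm (f y) \<partial>lborel)" by simp
  also have "\<dots> \<le> (\<integral>y. B * indicator ?Q y \<partial>lborel)"
  proof (rule integral_mono)
    show "integrable lborel (\<lambda>y. norm (f y))" using assms by simp
    show "integrable lborel (\<lambda>y. B * indicator ?Q y)"
      by (intro integrable_mult_right integrable_real_indicator) (use emeasure_lborel_cbox_finite in auto)
    show "norm (f y) \<le> B * indicator ?Q y" for y
      using assms cball_subset_cbox[OF assms(2), of x] by (cases "y \<in> cball x r") (auto simp: indicator_def)
  qed
  also have "\<dots> = B * (4 * r\<^sup>2)" using measure_cbox_vec[OF assms(2)] by simp
  finally show ?thesis .
qed

text \<open>On the square of half-side sqrt s / 2 about \<open>x\<close> one has |y - x|^2 <= s/2,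
  so the bump is at least (s/2)^3 there; the area of this square is s.\<close>

lemma integral_bump_lower:
  assumes "0 \<le> s"
  shows "integrable lborel (bump 3 s x)" "s ^ 4 / 8 \<le> (\<integral>y. bump 3 s x y \<partial>lborel)"
proof -
  define r where "r = sqrt s"
  have r: "0 \<le> r" "s = r\<^sup>2" using assms by (auto simp: r_def)
  have i: "integrable lborel (\<lambda>y. complex_of_real (bump 3 s x y))"
    by (rule integrable_continuous_support[of _ "cball x r"])
      (auto intro!: continuous_intros bump_zero_cball[OF _ r(1)] simp: r)
  show I: "integrable lborel (bump 3 s x)" using integrable_Re[OF i] by simp
  let ?Q = "cbox (x - vec (r/2)) (x + vec (r/2))"
  have "s ^ 4 / 8 = (\<integral>y. (s/2) ^ 3 * indicator ?Q y \<partial>lborel)"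
    using measure_cbox_vec[of "r/2" x] r by (simp add: power2_eq_square field_simps eval_nat_numeral)
  also have "\<dots> \<le> (\<integral>y. bump 3 s x y \<partial>lborel)"
  proof (rule integral_mono)
    show "integrable lborel (\<lambda>y. (s/2) ^ 3 * indicator ?Q y)"
      by (intro integrable_mult_right integrable_real_indicator) (use emeasure_lborel_cbox_finite in auto)
    show "(s/2) ^ 3 * indicator ?Q y \<le> bump 3 s x y" for y
    proof (cases "y \<in> ?Q")
      case True
      then have "x $ i - r / 2 \<le> y $ i \<and> y $ i \<le> x $ i + r / 2" for i
        by (auto simp: mem_box_cart)
      then have a: "\<bar>(y - x) $ i\<bar> \<le> r / 2" for i
        unfolding vector_minus_component abs_le_iff by (smt (verit, best))
      have sq: "((y - x) $ i)\<^sup>2 \<le> (r/2)\<^sup>2" for i using power_mono[OF a[of i], of 2] by simp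
      have "(y - x) \<bullet> (y - x) = ((y - x) $ 1)\<^sup>2 + ((y - x) $ 2)\<^sup>2"
        by (simp add: inner_vec_def sum_2 power2_eq_square)
      then have "(y - x) \<bullet> (y - x) \<le> (r/2)\<^sup>2 + (r/2)\<^sup>2" using sq[of 1] sq[of 2] by linarith
      then have "(y - x) \<bullet> (y - x) \<le> s / 2" by (simp add: r power_divide)
      then have "(s/2) ^ 3 \<le> bump 3 s x y" unfolding bump_def using assms by (intro power_mono) auto
      then show ?thesis using True by simp
    qed (simp add: bump_nonneg)
  qed (rule I)
  finally show "s ^ 4 / 8 \<le> (\<integral>y. bump 3 s x y \<partial>lborel)" .
qed

section \<open>Moments of a solution as functions of the squared radius\<close>

lemma bump_moment_deriv:
  fixes v :: "pt \<Rightarrow> complex"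
  assumes v: "continuous_on UNIV v"
  shows "((\<lambda>s. \<integral>y. v y * of_real (bump (Suc (Suc k)) s x y) \<partial>lborel) has_vector_derivative
      real (k + 2) *\<^sub>R (\<integral>y. v y * of_real (bump (Suc k) s x y) \<partial>lborel)) (at s)"
proof -
  \<comment> \<open>A radius that serves all parameters between s - 1 and s + 1, so that one box
    carries every integral near \<open>s\<close>.\<close>
  define r where "r = sqrt (\<bar>s\<bar> + 1)"
  have r: "0 \<le> r" "r\<^sup>2 = \<bar>s\<bar> + 1" by (auto simp: r_def)
  define Q where "Q = cbox (x - vec r) (x + vec r)"
  let ?U = "{s - 1<..<s + 1}"
  have z: "bump (Suc k) t x y = 0" if "t \<in> ?U" "y \<notin> Q" for t y k
    by (rule bump_zero_cball[OF _ r(1)]) (use that cball_subset_cbox[OF r(1), of x] in \<open>auto simp: Q_def r(2)\<close>)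
  have eq: "(\<integral>y. v y * of_real (bump (Suc k) t x y) \<partial>lborel) = integral Q (\<lambda>y. v y * of_real (bump (Suc k) t x y))"
    if "t \<in> ?U" for t k
    unfolding Q_def by (rule integral_compact_support(2))
      (use z[OF that] in \<open>auto simp: Q_def intro!: continuous_intros continuous_on_subset[OF v]\<close>)
  have "((\<lambda>t. integral Q (\<lambda>y. v y * of_real (bump (Suc (Suc k)) t x y))) has_vector_derivative
      integral Q (\<lambda>y. v y * of_real (real (k + 2) * bump (Suc k) s x y))) (at s within ?U)"
    unfolding Q_def
  proof (rule leibniz_rule_vector_derivative)
    fix t y
    have "((\<lambda>t. v y * of_real (bump (Suc (Suc k)) t x y)) has_vector_derivative
      v y * of_real (real (k + 2) * bump (Suc k) t x y)) (at t within ?U)"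
      by (intro has_vector_derivative_mult_right has_vector_derivative_of_real
          has_real_derivative_iff_has_vector_derivative[THEN iffD1] bump_deriv_s)
    then show "((\<lambda>t. v y * of_real (bump (Suc (Suc k)) t x y)) has_vector_derivative
      v y * of_real (real (k + 2) * bump (Suc k) t x y)) (at t within ?U)" .
  next
    show "(\<lambda>y. v y * of_real (bump (Suc (Suc k)) t x y)) integrable_on cbox (x - vec r) (x + vec r)" for t
      by (intro integrable_continuous continuous_intros continuous_on_subset[OF v]) auto
    show "continuous_on (?U \<times> cbox (x - vec r) (x + vec r)) (\<lambda>(t, y). v y * of_real (real (k + 2) * bump (Suc k) t x y))"
      unfolding case_prod_unfold
      by (intro continuous_intros continuous_on_compose2[OF v]) auto
  qed auto
  moreover have "at s within ?U = at s" by (rule at_within_open) auto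
  ultimately have L: "((\<lambda>t. integral Q (\<lambda>y. v y * of_real (bump (Suc (Suc k)) t x y))) has_vector_derivative
      real (k + 2) *\<^sub>R integral Q (\<lambda>y. v y * of_real (bump (Suc k) s x y))) (at s within ?U)"
    by (simp add: scaleR_conv_of_real mult.left_commute flip: integral_mult_right)
  have "((\<lambda>s. \<integral>y. v y * of_real (bump (Suc (Suc k)) s x y) \<partial>lborel) has_vector_derivative
      real (k + 2) *\<^sub>R integral Q (\<lambda>y. v y * of_real (bump (Suc k) s x y))) (at s within ?U)"
    by (rule has_vector_derivative_transform[OF _ eq L]) auto
  then show ?thesis using eq[of s k] \<open>at s within ?U = at s\<close> by simp
qed

lemma bump_moment_bound:
  fixes v :: "pt \<Rightarrow> complex"
  assumes v: "continuous_on UNIV v" and k: "0 < k" and r: "0 \<le> r" "s = r\<^sup>2" and B: "\<And>y. y \<in> cball x r \<Longrightarrow> norm (v y) \<le> B"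
  shows "integrable lborel (\<lambda>y. v y * of_real (bump k s x y))"
    "norm (\<integral>y. v y * of_real (bump k s x y) \<partial>lborel) \<le> 4 * B * s ^ Suc k"
proof -
  have B0: "0 \<le> B" using B[of x] r by (auto intro: order_trans[OF norm_ge_zero])
  have z: "bump k s x y = 0" if "y \<notin> cball x r" for y
    by (rule bump_zero_cball[OF k]) (use r that in auto)
  show i: "integrable lborel (\<lambda>y. v y * of_real (bump k s x y))"
    by (rule integrable_continuous_support[of _ "cball x r"]) (use v z in \<open>auto intro!: continuous_intros\<close>)
  have "norm (\<integral>y. v y * of_real (bump k s x y) \<partial>lborel) \<le> (B * s ^ k) * (4 * r\<^sup>2)"
  proof (rule norm_integral_le_cball[OF i r(1)])
    show "0 \<le> B * s ^ k" using B0 r by simp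
    show "norm (v y * of_real (bump k s x y)) \<le> B * s ^ k" if "y \<in> cball x r" for y
      using B[OF that] bump_le[of s k x y] bump_nonneg[of k s x y] B0 r by (simp add: norm_mult mult_mono)
  qed (use z in auto)
  then show "norm (\<integral>y. v y * of_real (bump k s x y) \<partial>lborel) \<le> 4 * B * s ^ Suc k" using r by (simp add: mult_ac)
qed

text \<open>The moments of a solution against \<open>bump 3 s x\<close> solve \<open>4 s M'' - 12 M' + \<kappa>\<^sup>2 M = 0\<close>, whose
  solutions behave like \<open>1\<close> or \<open>s ^ 4\<close> at \<open>0\<close>; if \<open>M = o(s ^ 4)\<close> then \<open>M\<close> vanishes.\<close>

lemma singular_ode_unique:
  fixes M M2 M1 :: "real \<Rightarrow> complex"
  assumes D: "\<And>s. 0 < s \<Longrightarrow> s \<le> S \<Longrightarrow> (M has_vector_derivative 3 * M2 s) (at s)"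
    "\<And>s. 0 < s \<Longrightarrow> s \<le> S \<Longrightarrow> (M2 has_vector_derivative 2 * M1 s) (at s)"
    and ode: "\<And>s. 0 < s \<Longrightarrow> s \<le> S \<Longrightarrow> 24 * of_real s * M1 s - 36 * M2 s + of_real (\<kappa>\<^sup>2) * M s = 0"
    and B: "\<And>s. 0 < s \<Longrightarrow> s \<le> S \<Longrightarrow> norm (M s) \<le> A * s ^ 4"
    and lim: "((\<lambda>s. M2 s / of_real (s ^ 3)) \<longlongrightarrow> 0) (at_right 0)"
    and S: "\<kappa>\<^sup>2 * S \<le> 2" and s: "0 < s" "s \<le> S"
  shows "M s = 0"
proof -
  \<comment> \<open>The bound improves itself: a constant A may be replaced by A/2 as long as
    kappa^2 s <= 2. Iteration sends the constant to 0.\<close>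
  have step: "norm (M s) \<le> A / 2 * s ^ 4" if B: "\<And>s. 0 < s \<Longrightarrow> s \<le> S \<Longrightarrow> norm (M s) \<le> A * s ^ 4"
    and s: "0 < s" "s \<le> S" for A s
  proof -
    have A0: "0 \<le> A" using B[OF s] s by (smt (verit) norm_ge_zero zero_less_power mult_less_0_iff)
    \<comment> \<open>The factor s^(-3) is the integrating factor of the equation for
      \<open>M2\<close>: it leaves N' = - kappa^2 M / (12 s^4), which the assumed bound on
      \<open>M\<close> controls. The value at 0 is the limit provided by \<open>lim\<close>.\<close>
    define N where "N t = (if t = 0 then 0 else M2 t / of_real (t ^ 3))" for t :: real
    have N0: "(N \<longlongrightarrow> 0) (at_right 0)"
      by (rule Lim_transform_eventually[OF lim]) (auto simp: N_def eventually_at_filter)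
    have ND: "(N has_vector_derivative - of_real (\<kappa>\<^sup>2 / 12 / t ^ 4) * M t) (at t)" if t: "0 < t" "t \<le> S" for t
    proof -
      have t0: "complex_of_real t \<noteq> 0" using t by simp
      have d1: "((\<lambda>t. inverse (t ^ 3)) has_real_derivative - 3 / t ^ 4) (at t)"
        using t by (auto intro!: derivative_eq_intros simp: field_simps eval_nat_numeral)
      have "((\<lambda>t. M2 t * of_real (inverse (t ^ 3))) has_vector_derivative
          M2 t * of_real (- 3 / t ^ 4) + 2 * M1 t * of_real (inverse (t ^ 3))) (at t)"
        by (intro has_vector_derivative_mult D(2) t has_vector_derivative_of_real
          has_real_derivative_iff_has_vector_derivative[THEN iffD1] d1)
      moreover have "M2 t * of_real (- 3 / t ^ 4) + 2 * M1 t * of_real (inverse (t ^ 3))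
          = - of_real (\<kappa>\<^sup>2 / 12 / t ^ 4) * M t"
      proof -
        define E where "E = M2 t * of_real (- 3 / t ^ 4) + 2 * M1 t * of_real (inverse (t ^ 3))"
        have "E * (12 * of_real (t ^ 4)) = 24 * of_real t * M1 t - 36 * M2 t"
          using t0 by (simp add: E_def field_simps eval_nat_numeral)
        also have "\<dots> = - of_real (\<kappa>\<^sup>2) * M t" using ode[OF t] by (simp add: algebra_simps)
        finally have "E = - of_real (\<kappa>\<^sup>2) * M t / (12 * of_real (t ^ 4))" using t0 by (subst nonzero_eq_divide_eq) auto
        then show ?thesis by (simp add: E_def)
      qed
      ultimately have "((\<lambda>t. M2 t * of_real (inverse (t ^ 3))) has_vector_derivative
          - of_real (\<kappa>\<^sup>2 / 12 / t ^ 4) * M t) (at t)"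
        by simp
      then show ?thesis
        by (rule has_vector_derivative_transform_within_open[of _ _ _ "{0<..}"]) (use t in \<open>auto simp: N_def field_simps\<close>)
    qed
    have cN: "continuous_on {0..t} N" if "0 < t" "t \<le> S" for t
    proof (rule continuous_on_IccI)
      show "(N \<longlongrightarrow> N 0) (at_right 0)" using N0 by (simp add: N_def)
      show "(N \<longlongrightarrow> N t) (at_left t)"
        using has_vector_derivative_continuous[OF ND[OF that]] by (auto simp: continuous_at intro: tendsto_within_subset)
      show "N \<midarrow>u\<rightarrow> N u" if "0 < u" "u < t" for u
        using has_vector_derivative_continuous[OF ND[of u]] that \<open>t \<le> S\<close> by (auto simp: continuous_at)
    qed (use that in auto)
    have Nb: "norm (N t) \<le> \<kappa>\<^sup>2 / 12 * A * t" if t: "0 < t" "t \<le> S" for t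
    proof -
      have "norm (N t - N 0) \<le> \<kappa>\<^sup>2 / 12 * A * t - \<kappa>\<^sup>2 / 12 * A * 0"
      proof (rule differentiable_bound_general[OF t(1) cN[OF t]])
        fix u assume u: "0 < u" "u < t"
        show "(N has_vector_derivative - of_real (\<kappa>\<^sup>2 / 12 / u ^ 4) * M u) (at u)" using ND[of u] u t by simp
        show "((\<lambda>t. \<kappa>\<^sup>2 / 12 * A * t) has_vector_derivative \<kappa>\<^sup>2 / 12 * A) (at u)"
          by (auto intro!: derivative_eq_intros simp: has_real_derivative_iff_has_vector_derivative[symmetric])
        have "norm (- of_real (\<kappa>\<^sup>2 / 12 / u ^ 4) * M u) = \<kappa>\<^sup>2 / 12 / u ^ 4 * norm (M u)"
          by (simp add: norm_mult norm_divide norm_power)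
        also have "\<dots> \<le> \<kappa>\<^sup>2 / 12 / u ^ 4 * (A * u ^ 4)"
          using B[of u] u t by (intro mult_left_mono) auto
        also have "\<dots> = \<kappa>\<^sup>2 / 12 * A" using u by simp
        finally show "norm (- of_real (\<kappa>\<^sup>2 / 12 / u ^ 4) * M u) \<le> \<kappa>\<^sup>2 / 12 * A" .
      qed (auto intro!: continuous_intros)
      then show ?thesis by (simp add: N_def)
    qed
    have M2b: "norm (M2 t) \<le> \<kappa>\<^sup>2 / 12 * A * t ^ 4" if t: "0 < t" "t \<le> S" for t
    proof -
      have "M2 t = N t * of_real (t ^ 3)" using t by (simp add: N_def)
      then have "norm (M2 t) = norm (N t) * t ^ 3" using t by (simp add: norm_mult norm_power)
      also have "\<dots> \<le> (\<kappa>\<^sup>2 / 12 * A * t) * t ^ 3" by (rule mult_right_mono[OF Nb[OF t]]) (use t in simp)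
      also have "\<dots> = \<kappa>\<^sup>2 / 12 * A * t ^ 4" by (simp add: eval_nat_numeral)
      finally show ?thesis .
    qed
    define M' where "M' t = (if t = 0 then 0 else M t)" for t :: real
    have M'D: "(M' has_vector_derivative 3 * M2 t) (at t)" if t: "0 < t" "t \<le> S" for t
      by (rule has_vector_derivative_transform_within_open[OF D(1)[OF t], of "{0<..}"]) (use t in \<open>auto simp: M'_def\<close>)
    have M'0: "(M' \<longlongrightarrow> 0) (at_right 0)"
    proof (rule Lim_null_comparison)
      show "\<forall>\<^sub>F t in at_right 0. norm (M' t) \<le> A * t ^ 4"
        unfolding eventually_at_right_field using B s by (intro exI[of _ S]) (auto simp: M'_def)
      have "((\<lambda>t. A * t ^ 4) \<longlongrightarrow> A * 0 ^ 4) (at_right 0)" by (intro tendsto_intros)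
      then show "((\<lambda>t. A * t ^ 4) \<longlongrightarrow> 0) (at_right 0)" by simp
    qed
    have "norm (M' s - M' 0) \<le> \<kappa>\<^sup>2 / 4 * A * s ^ 4 * s - \<kappa>\<^sup>2 / 4 * A * s ^ 4 * 0"
    proof (rule differentiable_bound_general[OF s(1)])
      show "continuous_on {0..s} M'"
      proof (rule continuous_on_IccI)
        show "(M' \<longlongrightarrow> M' 0) (at_right 0)" using M'0 by (simp add: M'_def)
        show "(M' \<longlongrightarrow> M' s) (at_left s)"
          using has_vector_derivative_continuous[OF M'D[OF s]] by (auto simp: continuous_at intro: tendsto_within_subset)
        show "M' \<midarrow>u\<rightarrow> M' u" if "0 < u" "u < s" for u
          using has_vector_derivative_continuous[OF M'D[of u]] that s by (auto simp: continuous_at)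
      qed (use s in auto)
      fix u assume u: "0 < u" "u < s"
      show "(M' has_vector_derivative 3 * M2 u) (at u)" using M'D[of u] u s by simp
      show "((\<lambda>t. \<kappa>\<^sup>2 / 4 * A * s ^ 4 * t) has_vector_derivative \<kappa>\<^sup>2 / 4 * A * s ^ 4) (at u)"
        by (auto intro!: derivative_eq_intros simp: has_real_derivative_iff_has_vector_derivative[symmetric])
      have "norm (3 * M2 u) = 3 * norm (M2 u)" by (simp add: norm_mult)
      also have "\<dots> \<le> 3 * (\<kappa>\<^sup>2 / 12 * A * u ^ 4)" using M2b[of u] u s by (intro mult_left_mono) auto
      also have "\<dots> \<le> 3 * (\<kappa>\<^sup>2 / 12 * A * s ^ 4)"
        using u A0 by (intro mult_left_mono power_mono) auto
      finally show "norm (3 * M2 u) \<le> \<kappa>\<^sup>2 / 4 * A * s ^ 4" by (simp add: mult_ac)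
    qed (auto intro!: continuous_intros)
    then have "norm (M s) \<le> (\<kappa>\<^sup>2 * s) / 4 * (A * s ^ 4)" using s by (simp add: M'_def mult_ac)
    also have "\<dots> \<le> 2 / 4 * (A * s ^ 4)"
      using s S A0 mult_left_mono[OF s(2), of "\<kappa>\<^sup>2"] by (intro mult_right_mono divide_right_mono) auto
    finally show ?thesis by simp
  qed
  have iter: "norm (M s) \<le> A / 2 ^ n * s ^ 4" if "0 < s" "s \<le> S" for n s
    using that
  proof (induction n arbitrary: s)
    case (Suc n)
    show ?case using step[OF Suc.IH Suc.prems] by simp
  qed (use B in simp)
  have "(\<lambda>n. A * s ^ 4 * (1/2) ^ n) \<longlonglongrightarrow> A * s ^ 4 * 0" by (intro tendsto_intros LIMSEQ_power_zero) simp
  moreover have "norm (M s) \<le> A * s ^ 4 * (1/2) ^ n" for n using iter[OF s, of n] by (simp add: power_divide mult_ac)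
  ultimately have "norm (M s) \<le> A * s ^ 4 * 0" by (intro LIMSEQ_le_const) auto
  then show ?thesis by simp
qed

section \<open>Weak solutions of the Helmholtz equation\<close>

lemma wsol_D:
  assumes "wsol \<kappa> G v"
  shows "open G" "continuous_on G v"
    "\<And>\<phi>. test_fn2 \<phi> \<Longrightarrow> supp \<phi> \<subseteq> G \<Longrightarrow> (\<integral>x. v x * of_real (lap \<phi> x + \<kappa>\<^sup>2 * \<phi> x) \<partial>lborel) = 0"
  using assms by (auto simp: wsol_def)

lemma wsol_subset: "wsol \<kappa> G v \<Longrightarrow> open H \<Longrightarrow> H \<subseteq> G \<Longrightarrow> wsol \<kappa> H v"
  unfolding wsol_def using continuous_on_subset by blast

lemma test_fn2_D:
  assumes "test_fn2 \<phi>"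
  shows "compact (supp \<phi>)" "\<phi> differentiable (at x)" "continuous_on UNIV \<phi>"
    "pd e \<phi> differentiable (at x)" "continuous_on UNIV (pd e \<phi>)"
    "continuous_on UNIV (pd e' (pd e \<phi>))" "continuous_on UNIV (lap \<phi>)"
    "test_fn \<phi>" "test_fn (pd e \<phi>)"
proof -
  have t: "test_fn \<phi>" "test_fn (pd e \<phi>)" for e using assms by (auto simp: test_fn2_def)
  show "compact (supp \<phi>)" "\<phi> differentiable (at x)" "continuous_on UNIV \<phi>"
    "pd e \<phi> differentiable (at x)" "continuous_on UNIV (pd e \<phi>)" "test_fn \<phi>" "test_fn (pd e \<phi>)"
    using t by (auto simp: test_fn_iff C1_on_def intro: C1_on_continuous)
  show c: "continuous_on UNIV (pd e' (pd e \<phi>))" for e e' using t by (auto simp: test_fn_iff C1_on_def)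
  show "continuous_on UNIV (lap \<phi>)" unfolding lap_def[abs_def] by (intro continuous_intros c)
qed

lemma pd_outside_supp: "x \<notin> supp f \<Longrightarrow> pd e f x = 0"
  by (rule pd_outside[of "supp f"]) (auto simp: supp_eq_0)

lemma pd_pd_outside_supp: "x \<notin> supp f \<Longrightarrow> pd e' (pd e f) x = 0"
  by (rule pd_outside[of "supp f"]) (auto simp: pd_outside_supp)

lemma lap_outside_supp: "x \<notin> supp f \<Longrightarrow> lap f x = 0"
  by (simp add: lap_def pd_pd_outside_supp)

lemma supp_pd: "supp (pd e f) \<subseteq> supp f"
  by (rule supp_subset) (auto simp: pd_outside_supp)

lemma integrable_wsol_test:
  assumes "open G" "continuous_on G v" "test_fn2 \<phi>" "supp \<phi> \<subseteq> G"
  shows "integrable lborel (\<lambda>x. v x * complex_of_real (lap \<phi> x + c * \<phi> x))"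
  by (rule integrable_mult_test(2)[OF assms(1,2) _ test_fn2_D(1)[OF assms(3)] assms(4)])
    (use test_fn2_D[OF assms(3)] in \<open>auto intro!: continuous_intros continuous_on_subset[of UNIV _ G]
      simp: lap_outside_supp supp_eq_0\<close>)

lemma wsol_lincomb:
  assumes v: "wsol \<kappa> G v" and w: "wsol \<kappa> G w"
  shows "wsol \<kappa> G (\<lambda>x. c * v x + c' * w x)"
  unfolding wsol_def
proof (intro conjI allI impI)
  show "open G" "continuous_on G (\<lambda>x. c * v x + c' * w x)"
    using wsol_D[OF v] wsol_D[OF w] by (auto intro!: continuous_intros)
  fix \<phi> assume \<phi>: "test_fn2 \<phi> \<and> supp \<phi> \<subseteq> G"
  let ?L = "\<lambda>x. complex_of_real (lap \<phi> x + \<kappa>\<^sup>2 * \<phi> x)"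
  have i: "integrable lborel (\<lambda>x. v x * ?L x)" "integrable lborel (\<lambda>x. w x * ?L x)"
    using integrable_wsol_test wsol_D(1,2)[OF v] wsol_D(2)[OF w] \<phi> by blast+
  have "(\<integral>x. (c * v x + c' * w x) * ?L x \<partial>lborel) = (\<integral>x. c * (v x * ?L x) + c' * (w x * ?L x) \<partial>lborel)"
    by (rule Bochner_Integration.integral_cong) (auto simp: algebra_simps)
  also have "\<dots> = c * (\<integral>x. v x * ?L x \<partial>lborel) + c' * (\<integral>x. w x * ?L x \<partial>lborel)"
    using i by simp
  also have "\<dots> = 0" using wsol_D(3)[OF v] wsol_D(3)[OF w] \<phi> by simp
  finally show "(\<integral>x. (c * v x + c' * w x) * ?L x \<partial>lborel) = 0" .
qed

section \<open>The mean value formula\<close>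

lemma continuous_extension:
  fixes v :: "pt \<Rightarrow> complex"
  assumes "continuous_on G v" "cball x r \<subseteq> G"
  obtains v' where "continuous_on UNIV v'" "\<And>y. y \<in> cball x r \<Longrightarrow> v' y = v y"
  using Tietze_unbounded[of "cball x r" v UNIV] continuous_on_subset[OF assms] by auto

lemma bump_cball_cong:
  assumes "\<And>y. y \<in> cball x r \<Longrightarrow> v' y = v y" "0 \<le> r" "s \<le> r\<^sup>2" "0 < k"
  shows "v y * complex_of_real (bump k s x y) = v' y * complex_of_real (bump k s x y)"
  using assms bump_zero_cball[OF assms(4,2,3), of y x] by (cases "y \<in> cball x r") auto

text \<open>Testing the equation with \<open>bump 3 s x\<close> and inserting
  \<open>lap_bump\<close> yields the hypotheses of \<open>singular_ode_unique\<close> for the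
  moments. The assumption \<open>v x = 0\<close> enters only through the limit: it makes the second
  moment o(s^3).\<close>

lemma wsol_mean_zero:
  assumes v: "wsol \<kappa> G v" and r: "cball x r \<subseteq> G" "0 < r" "\<kappa>\<^sup>2 * r\<^sup>2 \<le> 2" and vx: "v x = 0"
  shows "(\<integral>y. v y * of_real (bump 3 (r\<^sup>2) x y) \<partial>lborel) = 0"
proof -
  \<comment> \<open>The moments are integrals over the plane of a globally continuous function; the
    bumps see only the ball, where \<open>v'\<close> and \<open>v\<close> agree.\<close>
  obtain v' where v': "continuous_on UNIV v'" and eq: "\<And>y. y \<in> cball x r \<Longrightarrow> v' y = v y"
    using continuous_extension[OF wsol_D(2)[OF v] r(1)] by blast
  define M where "M k s = (\<integral>y. v' y * of_real (bump k s x y) \<partial>lborel)" for k s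
  have sq: "sqrt s \<le> r" "cball x (sqrt s) \<subseteq> cball x r" if "s \<le> r\<^sup>2" for s
    using that r(2) real_le_lsqrt[of r s] by (auto simp: subset_iff)
  have "compact (v' ` cball x r)"
    by (intro compact_continuous_image compact_cball continuous_on_subset[OF v']) auto
  then obtain K where K: "\<And>y. y \<in> cball x r \<Longrightarrow> norm (v' y) \<le> K"
    using compact_imp_bounded bounded_iff by (metis imageI)
  have i: "integrable lborel (\<lambda>y. v' y * of_real (bump k s x y))" and Mb: "norm (M k s) \<le> 4 * B * s ^ Suc k"
    if "0 < k" "0 < s" "\<And>y. y \<in> cball x (sqrt s) \<Longrightarrow> norm (v' y) \<le> B" for k s B
    using bump_moment_bound[OF v' that(1), of "sqrt s" s x B] that by (auto simp: M_def)
  have "M 3 (r\<^sup>2) = 0"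
  proof (rule singular_ode_unique[of "r\<^sup>2" "M 3" "M 2" "M 1" \<kappa> "4 * K"])
    fix s assume s: "0 < s" "s \<le> r\<^sup>2"
    show "(M 3 has_vector_derivative 3 * M 2 s) (at s)"
      using bump_moment_deriv[OF v', of 1 x s] by (simp add: M_def[abs_def] scaleR_conv_of_real eval_nat_numeral)
    show "(M 2 has_vector_derivative 2 * M 1 s) (at s)"
      using bump_moment_deriv[OF v', of 0 x s] by (simp add: M_def[abs_def] scaleR_conv_of_real eval_nat_numeral)
    show "norm (M 3 s) \<le> 4 * K * s ^ 4"
    proof -
      have "norm (M 3 s) \<le> 4 * K * s ^ Suc 3"
        using s K sq(2)[OF s(2)] by (intro Mb) (auto simp del: mem_cball)
      then show ?thesis by simp
    qed
    have "supp (bump 3 s x) \<subseteq> G" using supp_bump[of 3 r s x] r s by auto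
    then have "0 = (\<integral>y. v y * of_real (lap (bump 3 s x) y + \<kappa>\<^sup>2 * bump 3 s x y) \<partial>lborel)"
      using wsol_D(3)[OF v bump_test_fn2] by simp
    also have "\<dots> = (\<integral>y. 24 * of_real s * (v' y * of_real (bump 1 s x y)) - 36 * (v' y * of_real (bump 2 s x y))
        + of_real (\<kappa>\<^sup>2) * (v' y * of_real (bump 3 s x y)) \<partial>lborel)"
    proof (intro Bochner_Integration.integral_cong refl)
      fix y
      have e: "v' y * complex_of_real (bump k s x y) = v y * complex_of_real (bump k s x y)" if "0 < k" for k
        by (rule bump_cball_cong[symmetric]) (use eq r s that in auto)
      have e': "v' y * complex_of_real (bump 1 s x y) = v y * complex_of_real (bump 1 s x y)"
        "v' y * complex_of_real (bump 2 s x y) = v y * complex_of_real (bump 2 s x y)"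
        "v' y * complex_of_real (bump 3 s x y) = v y * complex_of_real (bump 3 s x y)" by (rule e; simp)+
      show "v y * of_real (lap (bump 3 s x) y + \<kappa>\<^sup>2 * bump 3 s x y) = 24 * of_real s * (v' y * of_real (bump 1 s x y))
        - 36 * (v' y * of_real (bump 2 s x y)) + of_real (\<kappa>\<^sup>2) * (v' y * of_real (bump 3 s x y))"
        unfolding e' lap_bump by (simp add: algebra_simps)
    qed
    also have "\<dots> = 24 * of_real s * M 1 s - 36 * M 2 s + of_real (\<kappa>\<^sup>2) * M 3 s"
    proof -
      have i: "integrable lborel (\<lambda>y. v' y * of_real (bump k s x y))" if "0 < k" for k
        using K sq(2)[OF s(2)] by (intro i[OF that s(1), of K]) blast
      show ?thesis unfolding M_def using i[of 1] i[of 2] i[of 3] by simp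
    qed
    finally show "24 * of_real s * M 1 s - 36 * M 2 s + of_real (\<kappa>\<^sup>2) * M 3 s = 0" by simp
  next
    show "((\<lambda>s. M 2 s / complex_of_real (s ^ 3)) \<longlongrightarrow> 0) (at_right 0)"
    proof (rule tendstoI)
      fix e :: real assume e: "0 < e"
      have "v' x = 0" using eq[of x] vx r by simp
      then obtain d where d: "0 < d" "\<And>y. dist y x < d \<Longrightarrow> norm (v' y) < e / 8"
        using v' e unfolding continuous_on_iff by (metis UNIV_I dist_0_norm dist_commute divide_pos_pos zero_less_numeral)
      have "norm (M 2 s / complex_of_real (s ^ 3)) < e" if s: "0 < s" "s < d\<^sup>2" for s
      proof -
        \<comment> \<open>On the disc of radius sqrt s the function is below e/8 and the bump at
          most s^2; with the area bound 4 s this gives e/2 after division by s^3.\<close>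
        have "sqrt s < d" using s d(1) by (simp add: real_less_lsqrt)
        then have "norm (M 2 s) \<le> 4 * (e / 8) * s ^ 3"
          using Mb[of 2 s "e / 8"] s d(2) by (force simp: eval_nat_numeral dist_commute intro: less_imp_le)
        then have *: "norm (M 2 s) / s ^ 3 \<le> e / 2" using s by (simp add: field_simps)
          have "norm (M 2 s / complex_of_real (s ^ 3)) = norm (M 2 s) / s ^ 3"
              using s by (simp add: norm_divide norm_power)
        with * show ?thesis using e by linarith
      qed
      then show "\<forall>\<^sub>F s in at_right 0. dist (M 2 s / complex_of_real (s ^ 3)) 0 < e"
        unfolding eventually_at_right_field using d(1) by (intro exI[of _ "d\<^sup>2"]) auto
    qed
  qed (use r in auto)
  then show ?thesis
  proof -
    have e: "v y * complex_of_real (bump 3 (r\<^sup>2) x y) = v' y * complex_of_real (bump 3 (r\<^sup>2) x y)" for y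
      by (rule bump_cball_cong) (use eq r in auto)
    show ?thesis using \<open>M 3 (r\<^sup>2) = 0\<close> unfolding M_def e .
  qed
qed

text \<open>A solution without zeros whose translates are multiples of itself. It serves to compute
  the constant in the mean value formula.\<close>

definition plane_wave :: "real \<Rightarrow> pt \<Rightarrow> complex" where
  "plane_wave \<kappa> x = exp (\<i> * of_real (\<kappa> * x $ 1))"

lemma plane_wave_deriv: "(plane_wave \<kappa> has_derivative (\<lambda>e. \<i> * of_real (\<kappa> * e $ 1) * plane_wave \<kappa> x)) (at x)"
proof -
  have "((\<lambda>x::pt. \<i> * complex_of_real (\<kappa> * x $ 1)) has_derivative (\<lambda>e. \<i> * of_real (\<kappa> * e $ 1))) (at x)"
    by (intro bounded_linear_imp_has_derivative bounded_linear_const_mult bounded_linear_compose[OF bounded_linear_of_real] bounded_linear_vec_nth)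
  from has_derivative_compose[OF this DERIV_exp[unfolded has_field_derivative_def]]
  show ?thesis unfolding plane_wave_def[abs_def] by (simp add: mult_ac)
qed

lemma pd_plane_wave: "pd e (plane_wave \<kappa>) x = \<i> * of_real (\<kappa> * e $ 1) * plane_wave \<kappa> x"
  using pd_eqI[OF plane_wave_deriv] .

lemma C1_on_plane_wave: "C1_on UNIV (plane_wave \<kappa>)"
proof -
  have "continuous_on UNIV (plane_wave \<kappa>)" unfolding plane_wave_def[abs_def] by (intro continuous_intros)
  then show ?thesis unfolding C1_on_def
    using plane_wave_deriv by (auto simp: differentiable_def pd_plane_wave[abs_def] intro!: continuous_intros)
qed

lemma wsol_plane_wave: "wsol \<kappa> UNIV (plane_wave \<kappa>)"
  unfolding wsol_def
proof (intro conjI allI impI)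
  show c: "continuous_on UNIV (plane_wave \<kappa>)" using C1_on_continuous[OF C1_on_plane_wave] .
  fix \<phi> assume "test_fn2 \<phi> \<and> supp \<phi> \<subseteq> UNIV"
  then have \<phi>: "test_fn2 \<phi>" by simp
  have i: "integrable lborel (\<lambda>x. plane_wave \<kappa> x * of_real (g x))" if "continuous_on UNIV g" "\<And>x. x \<notin> supp \<phi> \<Longrightarrow>
      g x = 0" for g
    by (rule integrable_mult_test(2)[OF open_UNIV c _ test_fn2_D(1)[OF \<phi>]]) (use that in \<open>auto intro!: continuous_intros\<close>)
  have 1: "(\<integral>x. plane_wave \<kappa> x * of_real (pd e (pd e \<phi>) x) \<partial>lborel)
      = - of_real ((\<kappa> * e $ 1)\<^sup>2) * (\<integral>x. plane_wave \<kappa> x * of_real (\<phi> x) \<partial>lborel)" for e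
  proof -
    have A: "(\<integral>x. plane_wave \<kappa> x * of_real (pd e \<psi> x) \<partial>lborel)
        = - (\<i> * of_real (\<kappa> * e $ 1)) * (\<integral>x. plane_wave \<kappa> x * of_real (\<psi> x) \<partial>lborel)"
      if "test_fn \<psi>" for \<psi>
    proof -
      have "(\<integral>x. pd e (plane_wave \<kappa>) x * of_real (\<psi> x) \<partial>lborel) = - (\<integral>x. plane_wave \<kappa> x * of_real (pd e \<psi> x) \<partial>lborel)"
        by (rule integration_by_parts[OF open_UNIV C1_on_plane_wave that]) simp
      moreover have "(\<integral>x. pd e (plane_wave \<kappa>) x * of_real (\<psi> x) \<partial>lborel)
          = \<i> * of_real (\<kappa> * e $ 1) * (\<integral>x. plane_wave \<kappa> x * of_real (\<psi> x) \<partial>lborel)"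
        unfolding pd_plane_wave by (subst integral_mult_right_zero[symmetric]) (simp add: mult_ac)
      ultimately show ?thesis by (simp add: minus_equation_iff)
    qed
    show ?thesis unfolding A[OF test_fn2_D(9)[OF \<phi>]] A[OF test_fn2_D(8)[OF \<phi>]]
        by (simp add: power2_eq_square algebra_simps)
  qed
  have "(\<integral>x. plane_wave \<kappa> x * of_real (lap \<phi> x + \<kappa>\<^sup>2 * \<phi> x) \<partial>lborel)
     = (\<integral>x. plane_wave \<kappa> x * of_real (pd (axis 1 1) (pd (axis 1 1) \<phi>) x)
         + plane_wave \<kappa> x * of_real (pd (axis 2 1) (pd (axis 2 1) \<phi>) x)
          + of_real (\<kappa>\<^sup>2) * (plane_wave \<kappa> x * of_real (\<phi> x)) \<partial>lborel)"
    by (intro Bochner_Integration.integral_cong refl) (simp add: lap_def algebra_simps)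
  also have "\<dots> = (\<integral>x. plane_wave \<kappa> x * of_real (pd (axis 1 1) (pd (axis 1 1) \<phi>) x) \<partial>lborel)
      + (\<integral>x. plane_wave \<kappa> x * of_real (pd (axis 2 1) (pd (axis 2 1) \<phi>) x) \<partial>lborel)
          + of_real (\<kappa>\<^sup>2) * (\<integral>x. plane_wave \<kappa> x * of_real (\<phi> x) \<partial>lborel)"
    using i[OF test_fn2_D(3)[OF \<phi>]] i[OF test_fn2_D(6)[OF \<phi>]] by (simp add: supp_eq_0 pd_pd_outside_supp)
  also have "\<dots> = 0" unfolding 1 by (simp add: axis_def)
  finally show "(\<integral>x. plane_wave \<kappa> x * of_real (lap \<phi> x + \<kappa>\<^sup>2 * \<phi> x) \<partial>lborel) = 0" .
qed simp

definition bump_mass :: "real \<Rightarrow> real \<Rightarrow> complex" where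
  "bump_mass \<kappa> s = (\<integral>y. plane_wave \<kappa> y * of_real (bump 3 s 0 y) \<partial>lborel)"

lemma cos_ge_half: "\<bar>x\<bar> \<le> 1 \<Longrightarrow> 1 / 2 \<le> cos (x::real)"
  using cos_monotone_0_pi_le[of "\<bar>x\<bar>" "pi / 3"] pi_gt3 by (simp add: cos_60)

text \<open>For kappa r <= 1 the real part cos (kappa y_1) of the wave is at least 1/2 on the
  support of the bump, so at least half of the integral of the bump survives.\<close>

lemma bump_mass_lower:
  assumes "0 < r" "0 \<le> \<kappa>" "\<kappa> * r \<le> 1"
  shows "r ^ 8 / 16 \<le> norm (bump_mass \<kappa> (r\<^sup>2))"
proof -
  have i: "integrable lborel (\<lambda>y. plane_wave \<kappa> y * of_real (bump 3 (r\<^sup>2) 0 y))"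
    by (rule bump_moment_bound(1)[of _ _ r _ 0 1])
      (use assms C1_on_continuous[OF C1_on_plane_wave] in \<open>auto simp: plane_wave_def\<close>)
  have "r ^ 8 / 16 = (r\<^sup>2) ^ 4 / 8 / 2" by simp
  also have "\<dots> \<le> (\<integral>y. bump 3 (r\<^sup>2) 0 y \<partial>lborel) / 2" using integral_bump_lower(2)[of "r\<^sup>2" 0] by simp
  also have "\<dots> = (\<integral>y. bump 3 (r\<^sup>2) 0 y / 2 \<partial>lborel)" by simp
  also have "\<dots> \<le> (\<integral>y. Re (plane_wave \<kappa> y * of_real (bump 3 (r\<^sup>2) 0 y)) \<partial>lborel)"
  proof (rule integral_mono)
    show "integrable lborel (\<lambda>y. bump 3 (r\<^sup>2) 0 y / 2)" using integral_bump_lower(1)[of "r\<^sup>2" 0] by simp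
    show "integrable lborel (\<lambda>y. Re (plane_wave \<kappa> y * of_real (bump 3 (r\<^sup>2) 0 y)))" using integrable_Re[OF i] .
    fix y
    show "bump 3 (r\<^sup>2) 0 y / 2 \<le> Re (plane_wave \<kappa> y * of_real (bump 3 (r\<^sup>2) 0 y))"
    proof (cases "y \<in> cball 0 r")
      case True
      then have "\<bar>y $ 1\<bar> \<le> r" using component_le_norm_cart[of y 1] by simp
      then have "\<bar>\<kappa> * y $ 1\<bar> \<le> 1" using assms mult_left_mono[of "\<bar>y $ 1\<bar>" r \<kappa>] by (simp add: abs_mult)
      then have "1 / 2 \<le> cos (\<kappa> * y $ 1)" by (rule cos_ge_half)
      then have "1 / 2 * bump 3 (r\<^sup>2) 0 y \<le> cos (\<kappa> * y $ 1) * bump 3 (r\<^sup>2) 0 y"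
          using bump_nonneg by (intro mult_right_mono)
      then show ?thesis by (simp add: plane_wave_def Re_exp)
    next
      case False
      then show ?thesis using bump_zero_cball[of 3 r "r\<^sup>2" y 0] assms by simp
    qed
  qed
  also have "\<dots> = Re (bump_mass \<kappa> (r\<^sup>2))" unfolding bump_mass_def using i by (rule integral_Re)
  also have "\<dots> \<le> norm (bump_mass \<kappa> (r\<^sup>2))" by (rule complex_Re_le_cmod)
  finally show ?thesis .
qed

text \<open>Subtracting the multiple of the plane wave that agrees with \<open>v\<close> at
  \<open>x\<close> gives a solution vanishing at \<open>x\<close>, to which
  \<open>wsol_mean_zero\<close> applies. For the wave itself a translation to the origin produces
  the factor \<open>bump_mass\<close>.\<close>

lemma wsol_mean_value:
  assumes v: "wsol \<kappa> G v" and r: "cball x r \<subseteq> G" "0 < r" and \<kappa>: "0 \<le> \<kappa>" "\<kappa> * r \<le> 1"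
  shows "(\<integral>y. v y * of_real (bump 3 (r\<^sup>2) x y) \<partial>lborel) = v x * bump_mass \<kappa> (r\<^sup>2)"
proof -
  have px: "plane_wave \<kappa> x \<noteq> 0" by (simp add: plane_wave_def)
  have p: "wsol \<kappa> G (plane_wave \<kappa>)" using wsol_subset[OF wsol_plane_wave wsol_D(1)[OF v]] by simp
  let ?c = "- v x / plane_wave \<kappa> x"
  have "wsol \<kappa> G (\<lambda>y. 1 * v y + ?c * plane_wave \<kappa> y)" by (rule wsol_lincomb[OF v p])
  moreover have "(\<kappa> * r)\<^sup>2 \<le> 1\<^sup>2" using \<kappa> r by (intro power_mono) auto
  ultimately have "(\<integral>y. (1 * v y + ?c * plane_wave \<kappa> y) * of_real (bump 3 (r\<^sup>2) x y) \<partial>lborel) = 0"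
    using r px by (intro wsol_mean_zero) (auto simp: power_mult_distrib)
  moreover have i: "integrable lborel (\<lambda>y. u y * of_real (bump 3 (r\<^sup>2) x y))" if "wsol \<kappa> G u" for u
    by (rule integrable_mult_test(2)[OF wsol_D(1,2)[OF that] _ compact_cball r(1)])
      (use r in \<open>auto intro!: continuous_intros bump_zero_cball[of 3 r]\<close>)
  have "(\<integral>y. (1 * v y + ?c * plane_wave \<kappa> y) * of_real (bump 3 (r\<^sup>2) x y) \<partial>lborel)
     = (\<integral>y. v y * of_real (bump 3 (r\<^sup>2) x y) + ?c * (plane_wave \<kappa> y * of_real (bump 3 (r\<^sup>2) x y)) \<partial>lborel)"
    by (intro Bochner_Integration.integral_cong refl) (simp add: algebra_simps)
  moreover have "\<dots> = (\<integral>y. v y * of_real (bump 3 (r\<^sup>2) x y) \<partial>lborel)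
      + ?c * (\<integral>y. plane_wave \<kappa> y * of_real (bump 3 (r\<^sup>2) x y) \<partial>lborel)"
    using i[OF v] i[OF p] by simp
  moreover have "(\<integral>y. plane_wave \<kappa> y * of_real (bump 3 (r\<^sup>2) x y) \<partial>lborel) = plane_wave \<kappa> x * bump_mass \<kappa> (r\<^sup>2)"
  proof -
    have "(\<integral>y. plane_wave \<kappa> y * of_real (bump 3 (r\<^sup>2) x y) \<partial>lborel)
        = (\<integral>y. plane_wave \<kappa> (x + y) * of_real (bump 3 (r\<^sup>2) x (x + y)) \<partial>lborel)"
      by (rule integral_translation[symmetric])
    also have "\<dots> = (\<integral>y. plane_wave \<kappa> x * (plane_wave \<kappa> y * of_real (bump 3 (r\<^sup>2) 0 y)) \<partial>lborel)"
      by (intro Bochner_Integration.integral_cong refl) (simp add: plane_wave_def bump_def exp_add[symmetric] algebra_simps)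
    finally show ?thesis by (simp add: bump_mass_def)
  qed
  ultimately show ?thesis using px by simp
qed

section \<open>Interior regularity from the mean value formula\<close>

definition bump_kernel :: "real \<Rightarrow> pt \<Rightarrow> pt \<Rightarrow> complex \<Rightarrow> pt \<Rightarrow>\<^sub>L complex" where
  "bump_kernel s x y c = blinfun_scaleR_left (of_real (6 * bump 2 s x y) * c) o\<^sub>L blinfun_inner_right (y - x)"

lemma bump_kernel_apply: "blinfun_apply (bump_kernel s x y c) e = of_real (6 * bump 2 s x y * ((y - x) \<bullet> e)) * c"
  by (simp add: bump_kernel_def blinfun_inner_right.rep_eq scaleR_conv_of_real mult_ac)

text \<open>Differentiation under the integral sign in the centre \<open>x\<close>. The kernel is
  packaged as the bounded linear map \<open>bump_kernel\<close>, the form in which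
  \<open>leibniz_rule\<close> takes a total derivative.\<close>

lemma bump_conv_deriv:
  fixes v :: "pt \<Rightarrow> complex" and s :: real
  assumes v: "continuous_on UNIV v"
  defines "F \<equiv> \<lambda>x. \<integral>y. v y * of_real (bump 3 s x y) \<partial>lborel"
  shows "C1_on UNIV F" "pd e F x = (\<integral>y. v y * of_real (6 * bump 2 s x y * ((y - x) \<bullet> e)) \<partial>lborel)"
proof -
  define r where "r = sqrt \<bar>s\<bar>"
  have r: "0 \<le> r" "s \<le> r\<^sup>2" by (auto simp: r_def)
  have three: "(3::nat) = Suc (Suc 1)" and two: "(2::nat) = Suc 1" by simp_all
  have c1: "continuous_on S (\<lambda>(x, y). bump_kernel s x y (v y))" for S
    unfolding bump_kernel_def case_prod_unfold
    by (intro bounded_bilinear.continuous_on[OF bounded_bilinear_blinfun_compose]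
        bounded_linear.continuous_on[OF bounded_linear_blinfun_scaleR_left]
        bounded_linear.continuous_on[OF bounded_linear_blinfun_inner_right]
        continuous_intros continuous_on_compose2[OF v]) auto
  have main: "(F has_derivative (\<lambda>e. \<integral>y. v y * of_real (6 * bump 2 s x y * ((y - x) \<bullet> e)) \<partial>lborel)) (at x)
      \<and> (\<forall>e. continuous_on (ball x0 1) (\<lambda>x. \<integral>y. v y * of_real (6 * bump 2 s x y * ((y - x) \<bullet> e)) \<partial>lborel))"
    if x: "x \<in> ball x0 1" for x x0
  proof -
    \<comment> \<open>Radius r for the bump and 1 for the motion of \<open>x\<close> inside the unit
      ball about \<open>x0\<close>.\<close>
    define Q where "Q = cbox (x0 - vec (r+1)) (x0 + vec (r+1))"
    have z: "bump k s x y = 0" if "x \<in> ball x0 1" "y \<notin> Q" "0 < k" for x y k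
    proof (rule bump_zero_cball[OF that(3) r])
      have "y \<notin> cball x0 (r+1)" using cball_subset_cbox[of "r+1" x0] r that(2) by (auto simp: Q_def)
      then show "y \<notin> cball x r" using that(1) dist_triangle[of x0 y x] by (auto simp: mem_cball mem_ball)
    qed
    have eqF: "F x = integral Q (\<lambda>y. v y * of_real (bump 3 s x y))" if "x \<in> ball x0 1" for x
      unfolding F_def Q_def by (rule integral_compact_support(2))
        (use z[OF that] in \<open>auto simp: Q_def intro!: continuous_intros continuous_on_subset[OF v]\<close>)
    have eqD: "(\<integral>y. v y * of_real (6 * bump 2 s x y * ((y - x) \<bullet> e)) \<partial>lborel)
        = integral Q (\<lambda>y. v y * of_real (6 * bump 2 s x y * ((y - x) \<bullet> e)))" if "x \<in> ball x0 1" for x e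
      unfolding Q_def by (rule integral_compact_support(2))
        (use z[OF that] in \<open>auto simp: Q_def intro!: continuous_intros continuous_on_subset[OF v]\<close>)
    have L: "((\<lambda>x. integral Q (\<lambda>y. v y * of_real (bump 3 s x y))) has_derivative
        blinfun_apply (integral Q (\<lambda>y. bump_kernel s x y (v y)))) (at x within ball x0 1)"
      unfolding Q_def
    proof (rule leibniz_rule)
      fix x y
      have "((\<lambda>x. v y * complex_of_real (bump 3 s x y)) has_derivative
         (\<lambda>h. v y * complex_of_real (2 * real (1 + 2) * bump (Suc 1) s x y * ((y - x) \<bullet> h)))) (at x within ball x0 1)"
        using has_derivative_mult_right[OF bounded_linear.has_derivative[OF bounded_linear_of_real bump_deriv_x[of 1 s y x "ball x0 1"]]]
        unfolding three by simp
      then show "((\<lambda>x. v y * complex_of_real (bump 3 s x y)) has_derivative blinfun_apply (bump_kernel s x y (v y))) (at x within ball x0 1)"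
        by (rule has_derivative_eq_rhs) (simp add: fun_eq_iff bump_kernel_apply two mult_ac)
    next
      show "(\<lambda>y. v y * complex_of_real (bump 3 s x y)) integrable_on cbox (x0 - vec (r+1)) (x0 + vec (r+1))" for x
        by (intro integrable_continuous continuous_intros continuous_on_subset[OF v]) auto
    qed (use x c1 in auto)
    have ki: "(\<lambda>y. bump_kernel s x y (v y)) integrable_on Q" for x unfolding Q_def
    proof (rule integrable_continuous)
      show "continuous_on (cbox (x0 - vec (r + 1)) (x0 + vec (r + 1))) (\<lambda>y. bump_kernel s x y (v y))"
        using continuous_on_compose2[OF c1[of UNIV], of "cbox (x0 - vec (r + 1)) (x0 + vec (r + 1))" "\<lambda>y. (x, y)"]
        by (simp add: continuous_on_Pair)
    qed
    have ap: "blinfun_apply (integral Q (\<lambda>y. bump_kernel s x y (v y))) e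
       = integral Q (\<lambda>y. v y * of_real (6 * bump 2 s x y * ((y - x) \<bullet> e)))" for x e
      unfolding blinfun_apply_integral[OF ki] by (simp add: bump_kernel_apply mult_ac)
    have "(F has_derivative blinfun_apply (integral Q (\<lambda>y. bump_kernel s x y (v y)))) (at x within ball x0 1)"
      by (rule has_derivative_transform[OF x eqF L])
    then have "(F has_derivative (\<lambda>e. \<integral>y. v y * of_real (6 * bump 2 s x y * ((y - x) \<bullet> e)) \<partial>lborel)) (at x)"
      unfolding at_within_open[OF x open_ball] by (rule has_derivative_eq_rhs) (rule ext, simp only: eqD[OF x] ap)
    moreover have "continuous_on (ball x0 1) (\<lambda>x. \<integral>y. v y * of_real (6 * bump 2 s x y * ((y - x) \<bullet> e)) \<partial>lborel)" for e
    proof -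
      have "continuous_on (ball x0 1) (\<lambda>x. integral Q (\<lambda>y. v y * of_real (6 * bump 2 s x y * ((y - x) \<bullet> e))))"
        unfolding Q_def by (rule integral_continuous_on_param)
          (auto simp: case_prod_unfold intro!: continuous_intros continuous_on_compose2[OF v])
      then show ?thesis by (rule continuous_on_eq) (rule eqD[symmetric])
    qed
    ultimately show ?thesis by blast
  qed
  have pdF: "pd e F x = (\<integral>y. v y * of_real (6 * bump 2 s x y * ((y - x) \<bullet> e)) \<partial>lborel)" for e x
    using pd_eqI[OF main[of x x, THEN conjunct1]] by simp
  show "pd e F x = (\<integral>y. v y * of_real (6 * bump 2 s x y * ((y - x) \<bullet> e)) \<partial>lborel)" by (rule pdF)
  show "C1_on UNIV F" unfolding C1_on_def
  proof (intro conjI ballI allI)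
    show "F differentiable at x" for x using main[of x x] unfolding differentiable_def by (auto simp del: of_real_mult)
    show "continuous_on UNIV (pd e F)" for e
    proof (rule continuous_at_imp_continuous_on, rule ballI)
      fix x
      have "continuous_on (ball x 1) (pd e F)" using main[of x x] by (auto simp: pdF[abs_def] simp del: of_real_mult)
      then show "isCont (pd e F) x" by (simp add: continuous_on_eq_continuous_at)
    qed
  qed
qed

text \<open>For \<open>x\<close> within r of \<open>x0\<close> the mean value formula uses values of
  \<open>v\<close> within 2 r of \<open>x0\<close> only. Near \<open>x0\<close> the solution is
  therefore a convolution of one continuous function with a C^2 kernel, from which its regularity
  can be read off.\<close>

lemma wsol_local_repr:
  assumes v: "wsol \<kappa> G v" and r: "cball x0 (2 * r) \<subseteq> G" "0 < r" and \<kappa>: "0 \<le> \<kappa>" "\<kappa> * r \<le> 1"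
  obtains v' where "continuous_on UNIV v'" "\<And>y. y \<in> cball x0 (2 * r) \<Longrightarrow> v' y = v y"
    "\<And>x. x \<in> cball x0 r \<Longrightarrow> (\<integral>y. v' y * of_real (bump 3 (r\<^sup>2) x y) \<partial>lborel) / bump_mass \<kappa> (r\<^sup>2) = v x"
proof -
  obtain v' where v': "continuous_on UNIV v'" and eq: "\<And>y. y \<in> cball x0 (2 * r) \<Longrightarrow> v' y = v y"
    using continuous_extension[OF wsol_D(2)[OF v] r(1)] by blast
  have "bump_mass \<kappa> (r\<^sup>2) \<noteq> 0" using bump_mass_lower[OF r(2) \<kappa>] r(2) zero_less_power[OF r(2), of 8]
      by (auto simp del: zero_less_power)
  moreover have "(\<integral>y. v' y * of_real (bump 3 (r\<^sup>2) x y) \<partial>lborel) = v x * bump_mass \<kappa> (r\<^sup>2)" if x: "x \<in> cball x0 r" for x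
  proof -
    have sub: "cball x r \<subseteq> cball x0 (2 * r)"
    proof
      fix y assume "y \<in> cball x r"
      then show "y \<in> cball x0 (2 * r)" using x dist_triangle[of x0 y x] by simp
    qed
    have e: "v' y * of_real (bump 3 (r\<^sup>2) x y) = v y * of_real (bump 3 (r\<^sup>2) x y)" for y
      by (rule bump_cball_cong) (use sub eq r in auto)
    show ?thesis unfolding e by (rule wsol_mean_value[OF v _ r(2) \<kappa>]) (use sub r(1) in blast)
  qed
  ultimately show ?thesis using that[OF v' eq] by simp
qed

lemma small_radius:
  fixes x :: "'a::metric_space"
  assumes "open G" "x \<in> G" "0 \<le> \<kappa>"
  obtains r where "0 < r" "cball x (2 * r) \<subseteq> G" "\<kappa> * r \<le> (1::real)"
proof -
  obtain e where e: "0 < e" "cball x e \<subseteq> G" using assms open_contains_cball by blast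
  \<comment> \<open>The summand 1 in the denominator covers kappa = 0.\<close>
  define r where "r = min (e / 2) (1 / (\<kappa> + 1))"
  have "0 < r" "2 * r \<le> e" "r \<le> 1 / (\<kappa> + 1)" using e assms by (auto simp: r_def)
  moreover have "\<kappa> * r \<le> \<kappa> * (1 / (\<kappa> + 1))" by (intro mult_left_mono) (use \<open>r \<le> 1 / (\<kappa> + 1)\<close> assms in auto)
  moreover have "\<kappa> * (1 / (\<kappa> + 1)) \<le> 1" using assms by (simp add: field_simps)
  moreover have "cball x (2 * r) \<subseteq> G" using e(2) \<open>2 * r \<le> e\<close> by (auto simp: mem_cball)
  ultimately show ?thesis using that by force
qed

lemma pd_divide:
  fixes F :: "pt \<Rightarrow> complex"
  assumes "F differentiable (at x)"
  shows "(\<lambda>x. F x / c) differentiable (at x)" "pd e (\<lambda>x. F x / c) x = pd e F x / c"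
proof -
  have D: "((\<lambda>x. F x / c) has_derivative (\<lambda>e. pd e F x / c)) (at x)"
    using bounded_linear.has_derivative[OF bounded_linear_divide has_derivative_pd[OF assms]] .
  then show "(\<lambda>x. F x / c) differentiable (at x)" by (auto simp: differentiable_def)
  show "pd e (\<lambda>x. F x / c) x = pd e F x / c" using pd_eqI[OF D] .
qed

lemma wsol_C1:
  assumes v: "wsol \<kappa> G v" and \<kappa>: "0 \<le> \<kappa>"
  shows "C1_on G v"
proof -
  have main: "v differentiable (at x) \<and> isCont (pd e v) x" if x: "x \<in> G" for x e
  proof -
    obtain r where r: "0 < r" "cball x (2 * r) \<subseteq> G" "\<kappa> * r \<le> 1"
      using small_radius[OF wsol_D(1)[OF v] x \<kappa>] by blast
    obtain v' where v': "continuous_on UNIV v'" "\<And>y. y \<in> cball x (2 * r) \<Longrightarrow> v' y = v y"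
      "\<And>x'. x' \<in> cball x r \<Longrightarrow> (\<integral>y. v' y * of_real (bump 3 (r\<^sup>2) x' y) \<partial>lborel) / bump_mass \<kappa> (r\<^sup>2) = v x'"
      by (rule wsol_local_repr[OF v r(2,1) \<kappa> r(3)]) (rule that)
    define F where "F = (\<lambda>x'. \<integral>y. v' y * of_real (bump 3 (r\<^sup>2) x' y) \<partial>lborel)"
    have F: "C1_on UNIV F" unfolding F_def by (rule bump_conv_deriv(1)[OF v'(1)])
    then have dF: "F differentiable (at x')" for x' by (simp add: C1_on_def)
    have eq: "F x' / bump_mass \<kappa> (r\<^sup>2) = v x'" if "x' \<in> ball x r" for x' using v'(3)[of x'] that by (simp add: F_def)
    have xb: "x \<in> ball x r" using r by simp
    have "v differentiable (at x)"
      using differentiable_cong_open[of "ball x r" x "\<lambda>x'. F x' / bump_mass \<kappa> (r\<^sup>2)" v, OF open_ball xb eq]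
        pd_divide(1)[OF dF] by blast
    moreover have "isCont (pd e v) x"
    proof -
      have "continuous_on (ball x r) (\<lambda>x'. pd e F x' / bump_mass \<kappa> (r\<^sup>2))"
        unfolding divide_inverse using F by (intro continuous_intros) (auto simp: C1_on_def intro: continuous_on_subset)
      moreover have "pd e F x' / bump_mass \<kappa> (r\<^sup>2) = pd e v x'" if "x' \<in> ball x r" for x'
        using pd_cong_open[of "ball x r" x' "\<lambda>x'. F x' / bump_mass \<kappa> (r\<^sup>2)" v e, OF open_ball that eq]
        by (simp add: pd_divide(2)[OF dF])
      ultimately have "continuous_on (ball x r) (pd e v)" by (rule continuous_on_eq)
      then show ?thesis using xb by (simp add: continuous_on_eq_continuous_at)
    qed
    ultimately show ?thesis ..
  qed
  then show ?thesis unfolding C1_on_def by (auto intro: continuous_at_imp_continuous_on)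
qed

text \<open>With rho = r/2 and |e| = 1 the derivative of the convolution is at most 24 K rho^7 and
  the mass at least rho^8 / 16. The quotient is 384 K / rho = 768 K / r, rounded up to 800 K /
  r.\<close>

lemma wsol_grad_bound:
  assumes v: "wsol \<kappa> G v" and r: "cball x r \<subseteq> G" "0 < r" and \<kappa>: "0 \<le> \<kappa>" "\<kappa> * r \<le> 1"
    and K: "\<And>y. y \<in> cball x r \<Longrightarrow> norm (v y) \<le> K"
  shows "norm (pd e v x) \<le> 800 * K / r * norm e"
proof -
  define \<rho> where "\<rho> = r / 2"
  have \<rho>: "0 < \<rho>" "r = 2 * \<rho>" "\<kappa> * \<rho> \<le> 1" using r \<kappa> by (auto simp: \<rho>_def intro: order_trans[rotated])
  have K0: "0 \<le> K" using K[of x] r by (auto intro: order_trans[OF norm_ge_zero])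
  obtain v' where v': "continuous_on UNIV v'" "\<And>y. y \<in> cball x (2 * \<rho>) \<Longrightarrow> v' y = v y"
      "\<And>x'. x' \<in> cball x \<rho> \<Longrightarrow> (\<integral>y. v' y * of_real (bump 3 (\<rho>\<^sup>2) x' y) \<partial>lborel) / bump_mass \<kappa> (\<rho>\<^sup>2) = v x'"
    by (rule wsol_local_repr[OF v r(1)[unfolded \<rho>(2)] \<rho>(1) \<kappa>(1) \<rho>(3)]) (rule that)
  define F where "F = (\<lambda>x'. \<integral>y. v' y * of_real (bump 3 (\<rho>\<^sup>2) x' y) \<partial>lborel)"
  have dF: "F differentiable (at x')" for x'
    using bump_conv_deriv(1)[OF v'(1)] unfolding F_def by (simp add: C1_on_def)
  have eq: "F x' / bump_mass \<kappa> (\<rho>\<^sup>2) = v x'" if "x' \<in> ball x \<rho>" for x' using v'(3)[of x'] that by (simp add: F_def)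
  have "pd e v x = pd e F x / bump_mass \<kappa> (\<rho>\<^sup>2)"
    using pd_cong_open[of "ball x \<rho>" x "\<lambda>x'. F x' / bump_mass \<kappa> (\<rho>\<^sup>2)" v e, OF open_ball _ eq] \<rho>
    by (simp add: pd_divide(2)[OF dF])
  moreover have "norm (pd e F x) \<le> (6 * K * \<rho> ^ 5 * norm e) * (4 * \<rho>\<^sup>2)"
    unfolding F_def bump_conv_deriv(2)[OF v'(1)]
  proof (rule norm_integral_le_cball)
    have z: "bump 2 (\<rho>\<^sup>2) x y = 0" if "y \<notin> cball x \<rho>" for y
      by (rule bump_zero_cball[of 2 \<rho>]) (use that \<rho> in auto)
    show "integrable lborel (\<lambda>y. v' y * of_real (6 * bump 2 (\<rho>\<^sup>2) x y * ((y - x) \<bullet> e)))"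
      by (rule integrable_continuous_support[of _ "cball x \<rho>"]) (use z v' in \<open>auto intro!: continuous_intros\<close>)
    show "v' y * of_real (6 * bump 2 (\<rho>\<^sup>2) x y * ((y - x) \<bullet> e)) = 0" if "y \<notin> cball x \<rho>" for y using z[OF that] by simp
    fix y assume y: "y \<in> cball x \<rho>"
    have "\<bar>(y - x) \<bullet> e\<bar> \<le> norm (y - x) * norm e" by (rule Cauchy_Schwarz_ineq2)
    also have "\<dots> \<le> \<rho> * norm e" using y by (intro mult_right_mono) (auto simp: dist_norm norm_minus_commute)
    finally have 1: "\<bar>(y - x) \<bullet> e\<bar> \<le> \<rho> * norm e" .
    have 2: "\<bar>bump 2 (\<rho>\<^sup>2) x y\<bar> \<le> \<rho> ^ 4" using bump_le[of "\<rho>\<^sup>2" 2 x y] bump_nonneg[of 2 "\<rho>\<^sup>2" x y] by simp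
    have 3: "norm (v' y) \<le> K" using K[of y] v'(2)[of y] y \<rho> by simp
    have "norm (v' y * of_real (6 * bump 2 (\<rho>\<^sup>2) x y * ((y - x) \<bullet> e)))
        = norm (v' y) * (6 * \<bar>bump 2 (\<rho>\<^sup>2) x y\<bar> * \<bar>(y - x) \<bullet> e\<bar>)"
      by (simp add: norm_mult abs_mult)
    also have "\<dots> \<le> K * (6 * \<rho> ^ 4 * (\<rho> * norm e))"
      using 1 2 3 K0 \<rho> by (intro mult_mono mult_left_mono mult_nonneg_nonneg) auto
    also have "\<dots> = 6 * K * \<rho> ^ 5 * norm e" by (simp add: eval_nat_numeral)
    finally show "norm (v' y * of_real (6 * bump 2 (\<rho>\<^sup>2) x y * ((y - x) \<bullet> e))) \<le> 6 * K * \<rho> ^ 5 * norm e" .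
  qed (use \<rho> K0 in auto)
  moreover have "\<rho> ^ 8 / 16 \<le> norm (bump_mass \<kappa> (\<rho>\<^sup>2))" by (rule bump_mass_lower[OF \<rho>(1) \<kappa>(1) \<rho>(3)])
  ultimately have "norm (pd e v x) \<le> (6 * K * \<rho> ^ 5 * norm e) * (4 * \<rho>\<^sup>2) / (\<rho> ^ 8 / 16)"
    unfolding norm_divide by (simp only: norm_divide) (intro frac_le, use \<rho> K0 in auto)
  also have "\<dots> = 384 * K / \<rho> * norm e" using \<rho> by (simp add: field_simps eval_nat_numeral)
  also have "\<dots> \<le> 800 * K / r * norm e" unfolding \<rho>(2) using \<rho>(1) K0 by (simp add: field_simps)
  finally show ?thesis .
qed

section \<open>Derivatives of solutions are solutions\<close>

lemma pd_translate:
  assumes "f differentiable (at (x + a))"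
  shows "(\<lambda>x. f (x + a)) differentiable (at x)" "pd e (\<lambda>x. f (x + a)) x = pd e f (x + a)"
proof -
  have "((\<lambda>x. x + a) has_derivative (\<lambda>h. h)) (at x)" by (auto intro!: derivative_eq_intros)
  from has_derivative_compose[OF this has_derivative_pd[OF assms]]
  have D: "((\<lambda>x. f (x + a)) has_derivative (\<lambda>e. pd e f (x + a))) (at x)" by simp
  then show "(\<lambda>x. f (x + a)) differentiable (at x)" by (auto simp: differentiable_def)
  show "pd e (\<lambda>x. f (x + a)) x = pd e f (x + a)" using pd_eqI[OF D] .
qed

lemma supp_translate: "supp (\<lambda>x. f (x + a)) \<subseteq> (\<lambda>x. x - a) ` supp f"
proof (rule supp_subset)
  show "closed ((\<lambda>x. x - a) ` supp f)" by (rule closed_translation_subtract) simp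
  fix x assume "x \<notin> (\<lambda>x. x - a) ` supp f"
  then have "x + a \<notin> supp f" by (metis add_diff_cancel_right' imageI)
  then show "f (x + a) = 0" by (rule supp_eq_0)
qed

lemma test_fn2_translate:
  assumes \<phi>: "test_fn2 \<phi>"
  shows "test_fn2 (\<lambda>x. \<phi> (x + a))" "lap (\<lambda>x. \<phi> (x + a)) x = lap \<phi> (x + a)"
proof -
  have t: "test_fn (\<lambda>x. \<psi> (x + a))" "pd e (\<lambda>x. \<psi> (x + a)) = (\<lambda>x. pd e \<psi> (x + a))" if "test_fn \<psi>" for \<psi> e
  proof -
    have d: "\<psi> differentiable (at x)" for x using that by (simp add: test_fn_iff C1_on_def)
    show p: "pd e (\<lambda>x. \<psi> (x + a)) = (\<lambda>x. pd e \<psi> (x + a))" for e by (rule ext) (rule pd_translate(2)[OF d])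
    have "compact ((\<lambda>x. x - a) ` supp \<psi>)" using that
      by (intro compact_continuous_image) (auto simp: test_fn_iff intro!: continuous_intros)
    then have "compact (supp (\<lambda>x. \<psi> (x + a)))" by (rule compact_supp) (rule supp_translate)
    moreover have "continuous_on UNIV (\<lambda>x. pd e \<psi> (x + a))" for e
      by (rule continuous_on_compose2[of UNIV "pd e \<psi>"])
        (use that in \<open>auto simp: test_fn_iff C1_on_def intro!: continuous_intros\<close>)
    ultimately show "test_fn (\<lambda>x. \<psi> (x + a))" unfolding test_fn_iff C1_on_def p
      using pd_translate(1)[OF d] by blast
  qed
  show "test_fn2 (\<lambda>x. \<phi> (x + a))"
    unfolding test_fn2_def t(2)[OF test_fn2_D(8)[OF \<phi>]] using t(1)[OF test_fn2_D(8)[OF \<phi>]] t(1)[OF test_fn2_D(9)[OF \<phi>]]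
        by auto
  show "lap (\<lambda>x. \<phi> (x + a)) x = lap \<phi> (x + a)"
    unfolding lap_def t(2)[OF test_fn2_D(8)[OF \<phi>]] t(2)[OF test_fn2_D(9)[OF \<phi>]] ..
qed

lemma vector_derivative_quotient:
  fixes g :: "real \<Rightarrow> complex"
  assumes g: "(g has_vector_derivative d) (at 0)" and h: "h \<longlonglongrightarrow> 0" "\<And>n. h n \<noteq> 0"
  shows "(\<lambda>n. (g (h n) - g 0) / of_real (h n)) \<longlonglongrightarrow> d"
proof -
  have "((\<lambda>y. norm (g y - g 0 - (y - 0) *\<^sub>R d) / norm (y - 0)) \<longlongrightarrow> 0) (at 0)"
    using g unfolding has_vector_derivative_def has_derivative_iff_norm by blast
  moreover have "filterlim h (at 0) sequentially" using h by (simp add: filterlim_at)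
  ultimately have "(\<lambda>n. norm (g (h n) - g 0 - (h n - 0) *\<^sub>R d) / norm (h n - 0)) \<longlonglongrightarrow> 0"
    by (rule filterlim_compose)
  moreover have "norm (g (h n) - g 0 - (h n - 0) *\<^sub>R d) / norm (h n - 0)
      = norm ((g (h n) - g 0) / of_real (h n) - d)" for n
  proof -
    have "(g (h n) - g 0) / of_real (h n) - d = (g (h n) - g 0 - h n *\<^sub>R d) / of_real (h n)"
      using h(2)[of n] by (simp add: field_simps scaleR_conv_of_real)
    then show ?thesis by (simp add: norm_divide)
  qed
  ultimately have "(\<lambda>n. norm ((g (h n) - g 0) / of_real (h n) - d)) \<longlonglongrightarrow> 0" by simp
  then show ?thesis by (metis LIM_zero_cancel tendsto_norm_zero_iff)
qed

text \<open>Difference quotients of \<open>v\<close> integrate to 0 against the test expression,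
  because the shift can be moved onto the test function. They converge to \<open>pd e v\<close> and
  are dominated by a bound for \<open>pd e v\<close> on a compact set. Iterating the lemma makes
  solutions smooth.\<close>

lemma wsol_pd:
  assumes v: "wsol \<kappa> G v" and \<kappa>: "0 \<le> \<kappa>"
  shows "wsol \<kappa> G (pd e v)"
  unfolding wsol_def
proof (intro conjI allI impI)
  note C1 = wsol_C1[OF v \<kappa>]
  have dv: "v differentiable (at x)" if "x \<in> G" for x using C1 that by (simp add: C1_on_def)
  show oG: "open G" and cont: "continuous_on G (pd e v)" using wsol_D(1)[OF v] C1 by (auto simp: C1_on_def)
  fix \<phi> assume \<phi>': "test_fn2 \<phi> \<and> supp \<phi> \<subseteq> G"
  then have \<phi>: "test_fn2 \<phi>" and K: "compact (supp \<phi>)" "supp \<phi> \<subseteq> G" by (auto intro: test_fn2_D)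
  define L where "L = (\<lambda>x. complex_of_real (lap \<phi> x + \<kappa>\<^sup>2 * \<phi> x))"
  have Lc: "continuous_on S L" for S
    unfolding L_def using test_fn2_D[OF \<phi>] by (auto intro!: continuous_intros continuous_on_subset[of UNIV _ S])
  have L0: "L x = 0" if "x \<notin> supp \<phi>" for x using that by (simp add: L_def lap_outside_supp supp_eq_0)
  obtain d where d: "0 < d" "(\<Union>x\<in>supp \<phi>. cball x d) \<subseteq> G"
    using compact_subset_open_imp_cball_epsilon_subset[OF K(1) oG K(2)] by blast
  \<comment> \<open>Steps of size up to delta along \<open>e\<close> keep the support of the test
    function inside \<open>G\<close>; the summand 1 covers e = 0.\<close>
  define \<delta> where "\<delta> = d / (norm e + 1)"
  have "0 < norm e + 1" by (simp add: add_nonneg_pos)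
  then have \<delta>: "0 < \<delta>" "\<delta> * norm e \<le> d" using d(1) by (auto simp: \<delta>_def field_simps)
  have inG: "x + t *\<^sub>R e \<in> G" if "x \<in> supp \<phi>" "\<bar>t\<bar> \<le> \<delta>" for x t
  proof -
    have "\<bar>t\<bar> * norm e \<le> \<delta> * norm e" using that by (intro mult_right_mono) auto
    then have "x + t *\<^sub>R e \<in> cball x d" using \<delta>(2) by (simp add: dist_norm)
    then show ?thesis using d(2) that by blast
  qed
  define K' where "K' = (\<lambda>(x,t). x + t *\<^sub>R e) ` (supp \<phi> \<times> {-\<delta>..\<delta>})"
  have K': "compact K'" "K' \<subseteq> G" unfolding K'_def
    using inG by (auto intro!: compact_continuous_image compact_Times K continuous_intros simp: case_prod_unfold abs_le_iff)
  then have "compact (pd e v ` K')" using cont continuous_on_subset compact_continuous_image by metis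
  then obtain B where B: "\<And>y. y \<in> K' \<Longrightarrow> norm (pd e v y) \<le> B"
    using compact_imp_bounded bounded_iff by (metis imageI)
  define h where "h n = \<delta> / real (Suc n)" for n
  have h: "0 < h n" "h n \<le> \<delta>" "h n \<noteq> 0" for n
    using \<delta> by (auto simp: h_def field_simps)
  have h0: "h \<longlonglongrightarrow> 0" unfolding h_def by (rule LIMSEQ_Suc[OF lim_const_over_n])
  \<comment> \<open>\<open>s n\<close> is the difference quotient times the test expression
    \<open>L\<close>; its shifted part \<open>c n\<close> integrates to 0 because a translated test
    function is again admissible.\<close>
  define s where "s n = (\<lambda>x. (v (x + h n *\<^sub>R e) - v x) / of_real (h n) * L x)" for n
  define c where "c n = (\<lambda>x. v (x + h n *\<^sub>R e) * L x)" for n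
  have ci: "integrable lborel (c n)" and i0: "integrable lborel (\<lambda>x. v x * L x)" for n
  proof -
    have "open ((\<lambda>x. x + h n *\<^sub>R e) -` G \<inter> G)"
      using oG by (intro open_Int open_vimage) (auto intro!: continuous_intros)
    then show "integrable lborel (c n)" unfolding c_def
      by (rule integrable_mult_test(2)[OF _ _ Lc K(1)])
        (use inG[of _ "h n"] h[of n] K L0 in \<open>auto intro!: continuous_on_compose2[OF wsol_D(2)[OF v]] continuous_intros\<close>)
    show "integrable lborel (\<lambda>x. v x * L x)"
      by (rule integrable_mult_test(2)[OF oG wsol_D(2)[OF v] Lc K L0])
  qed
  have c0: "(\<integral>x. c n x \<partial>lborel) = 0" for n
  proof -
    let ?\<psi> = "\<lambda>x. \<phi> (x + - (h n *\<^sub>R e))"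
    have "(\<integral>x. c n x \<partial>lborel) = (\<integral>x. c n (- (h n *\<^sub>R e) + x) \<partial>lborel)" by (rule integral_translation[symmetric])
    also have "\<dots> = (\<integral>x. v x * of_real (lap ?\<psi> x + \<kappa>\<^sup>2 * ?\<psi> x) \<partial>lborel)"
      unfolding c_def L_def test_fn2_translate(2)[OF \<phi>] by (simp add: add.commute)
    also have "\<dots> = 0"
    proof (rule wsol_D(3)[OF v test_fn2_translate(1)[OF \<phi>]])
      show "supp ?\<psi> \<subseteq> G" using supp_translate[of \<phi> "- (h n *\<^sub>R e)"] inG[of _ "h n"] h[of n] by auto
    qed
    finally show ?thesis .
  qed
  have s0: "(\<integral>x. s n x \<partial>lborel) = 0" and si: "integrable lborel (s n)" for n
  proof -
    have eq: "s n = (\<lambda>x. (c n x - v x * L x) / of_real (h n))"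
        by (auto simp: s_def c_def algebra_simps diff_divide_distrib)
    have v0: "(\<integral>x. v x * L x \<partial>lborel) = 0" unfolding L_def using wsol_D(3)[OF v \<phi> K(2)] .
    show "(\<integral>x. s n x \<partial>lborel) = 0" unfolding eq using ci[of n] i0 c0[of n] v0 by simp
    show "integrable lborel (s n)" unfolding eq using ci[of n] i0 by simp
  qed
  have "(\<lambda>n. \<integral>x. s n x \<partial>lborel) \<longlonglongrightarrow> (\<integral>x. pd e v x * L x \<partial>lborel)"
  proof (rule integral_dominated_convergence[where w="\<lambda>x. B * norm (L x)"])
    have "integrable lborel L" by (rule integrable_continuous_support[OF Lc K(1) L0])
    then show "integrable lborel (\<lambda>x. B * norm (L x))" by simp
    have "integrable lborel (\<lambda>x. pd e v x * L x)" by (rule integrable_mult_test(2)[OF oG cont Lc K L0])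
    then show "(\<lambda>x. pd e v x * L x) \<in> borel_measurable lborel" by simp
    show "s n \<in> borel_measurable lborel" for n using si[of n] by simp
    show "AE x in lborel. (\<lambda>n. s n x) \<longlonglongrightarrow> pd e v x * L x"
    proof (rule AE_I2)
      fix x show "(\<lambda>n. s n x) \<longlonglongrightarrow> pd e v x * L x"
      proof (cases "x \<in> supp \<phi>")
        case True
        have "((\<lambda>t. v (x + t *\<^sub>R e)) has_vector_derivative pd e v (x + 0 *\<^sub>R e)) (at 0)"
          by (rule has_vector_derivative_line) (use dv True K in auto)
        from vector_derivative_quotient[OF this h0 h(3)]
        have "(\<lambda>n. (v (x + h n *\<^sub>R e) - v x) / of_real (h n)) \<longlonglongrightarrow> pd e v x" by simp
        then show ?thesis unfolding s_def by (intro tendsto_intros)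
      qed (simp add: s_def L0)
    qed
    show "AE x in lborel. norm (s n x) \<le> B * norm (L x)" for n
    proof (rule AE_I2)
      fix x show "norm (s n x) \<le> B * norm (L x)"
      proof (cases "x \<in> supp \<phi>")
        case True
        have "norm (v (x + h n *\<^sub>R e) - v (x + 0 *\<^sub>R e)) \<le> B * h n - B * 0"
        proof (rule differentiable_bound_general[OF h(1)[of n], of "\<lambda>t. v (x + t *\<^sub>R e)" "\<lambda>t. B * t"])
          show "continuous_on {0..h n} (\<lambda>t. v (x + t *\<^sub>R e))"
            by (intro continuous_on_compose2[OF wsol_D(2)[OF v]] continuous_intros) (use inG[OF True] h[of n] in auto)
          fix t assume t: "0 < t" "t < h n"
          then have tG: "x + t *\<^sub>R e \<in> G" using inG[OF True, of t] h[of n] by auto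
          show "((\<lambda>t. v (x + t *\<^sub>R e)) has_vector_derivative pd e v (x + t *\<^sub>R e)) (at t)"
            by (rule has_vector_derivative_line[OF dv[OF tG]])
          show "((*) B has_vector_derivative B) (at t)"
            by (auto intro!: derivative_eq_intros simp: has_real_derivative_iff_has_vector_derivative[symmetric])
          show "norm (pd e v (x + t *\<^sub>R e)) \<le> B"
            by (rule B) (use True t h[of n] in \<open>auto simp: K'_def intro!: image_eqI[of _ _ "(x, t)"]\<close>)
        qed (auto intro!: continuous_intros)
        then have "norm ((v (x + h n *\<^sub>R e) - v x) / of_real (h n)) \<le> B"
          using h[of n] by (simp add: norm_divide field_simps)
        then show ?thesis unfolding s_def norm_mult by (intro mult_right_mono) auto
      qed (simp add: s_def L0)
    qed
  qed
  then have "(\<lambda>n. 0::complex) \<longlonglongrightarrow> (\<integral>x. pd e v x * L x \<partial>lborel)" by (simp add: s0)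
  then show "(\<integral>x. pd e v x * of_real (lap \<phi> x + \<kappa>\<^sup>2 * \<phi> x) \<partial>lborel) = 0"
    unfolding LIMSEQ_const_iff L_def by (rule sym)
qed

text \<open>The fundamental lemma of the calculus of variations, with a single bump concentrated
  near \<open>x\<close> as test function.\<close>

lemma bump_test_zero:
  fixes h :: "pt \<Rightarrow> complex"
  assumes G: "open G" "continuous_on G h" and x: "x \<in> G"
    and z: "\<And>\<phi>. test_fn2 \<phi> \<Longrightarrow> supp \<phi> \<subseteq> G \<Longrightarrow> (\<integral>x. h x * of_real (\<phi> x) \<partial>lborel) = 0"
  shows "h x = 0"
proof (rule ccontr)
  assume hx: "h x \<noteq> 0"
  \<comment> \<open>With s = r^2, replacing h by its value at \<open>x\<close> costs at most 4
    epsilon s^4 = |h x| s^4 / 16, while the main term is at least |h x| s^4 / 8.\<close>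
  define \<epsilon> where "\<epsilon> = norm (h x) / 64"
  have \<epsilon>: "0 < \<epsilon>" using hx by (simp add: \<epsilon>_def)
  obtain r1 where r1: "0 < r1" "cball x r1 \<subseteq> G" using G x open_contains_cball by blast
  have "isCont h x" using G x by (simp add: continuous_on_eq_continuous_at)
  then obtain r2 where r2: "0 < r2" "\<And>y. dist y x < r2 \<Longrightarrow> dist (h y) (h x) < \<epsilon>"
    using \<epsilon> unfolding continuous_at_eps_delta by blast
  define r where "r = min r1 (r2 / 2)"
  have "0 < r" "r \<le> r1" "r < r2" using r1 r2(1) by (auto simp: r_def)
  have r: "0 < r" "cball x r \<subseteq> G" using \<open>0 < r\<close> \<open>r \<le> r1\<close> r1 by auto
  have r3: "norm (h y - h x) \<le> \<epsilon>" if "y \<in> cball x r" for y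
    using r2(2)[of y] that \<open>r < r2\<close> by (simp add: dist_norm norm_minus_commute)
  let ?b = "\<lambda>y. complex_of_real (bump 3 (r\<^sup>2) x y)"
  have zb: "bump 3 (r\<^sup>2) x y = 0" if "y \<notin> cball x r" for y by (rule bump_zero_cball[of 3 r]) (use that r in auto)
  have i1: "integrable lborel (\<lambda>y. h y * ?b y)"
    by (rule integrable_mult_test(2)[OF G _ compact_cball r(2)]) (use zb in \<open>auto intro!: continuous_intros\<close>)
  have i2: "integrable lborel (\<lambda>y. h x * ?b y)"
    by (rule integrable_mult_test(2)[OF open_UNIV _ _ compact_cball[of x r]]) (use zb in \<open>auto intro!: continuous_intros\<close>)
  have "supp (bump 3 (r\<^sup>2) x) \<subseteq> G" using supp_bump[of 3 r "r\<^sup>2" x] r by auto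
  then have z0: "(\<integral>y. h y * ?b y \<partial>lborel) = 0" by (rule z[OF bump_test_fn2])
  have "norm (\<integral>y. (h y - h x) * ?b y \<partial>lborel) \<le> (\<epsilon> * (r\<^sup>2) ^ 3) * (4 * r\<^sup>2)"
  proof (rule norm_integral_le_cball[where x=x])
    show "integrable lborel (\<lambda>y. (h y - h x) * ?b y)" using i1 i2 by (simp add: left_diff_distrib)
    fix y assume y: "y \<in> cball x r"
    show "norm ((h y - h x) * ?b y) \<le> \<epsilon> * (r\<^sup>2) ^ 3"
      unfolding norm_mult using r3[OF y] bump_le[of "r\<^sup>2" 3 x y] bump_nonneg[of 3 "r\<^sup>2" x y] \<epsilon>
      by (intro mult_mono) auto
  qed (use r \<epsilon> zb in auto)
  moreover have "(\<integral>y. (h y - h x) * ?b y \<partial>lborel) = - (h x * (\<integral>y. ?b y \<partial>lborel))"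
    using i1 i2 z0 by (simp add: left_diff_distrib)
  moreover have "(\<integral>y. ?b y \<partial>lborel) = of_real (\<integral>y. bump 3 (r\<^sup>2) x y \<partial>lborel)" by (rule integral_complex_of_real)
  ultimately have "norm (h x) * \<bar>\<integral>y. bump 3 (r\<^sup>2) x y \<partial>lborel\<bar> \<le> (\<epsilon> * (r\<^sup>2) ^ 3) * (4 * r\<^sup>2)"
    by (simp add: norm_mult)
  moreover have "norm (h x) * ((r\<^sup>2) ^ 4 / 8) \<le> norm (h x) * \<bar>\<integral>y. bump 3 (r\<^sup>2) x y \<partial>lborel\<bar>"
    using integral_bump_lower(2)[of "r\<^sup>2" x] by (intro mult_left_mono) auto
  moreover have "(\<epsilon> * (r\<^sup>2) ^ 3) * (4 * r\<^sup>2) = norm (h x) * (r\<^sup>2) ^ 4 / 16"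
    by (simp add: \<epsilon>_def eval_nat_numeral)
  ultimately have "norm (h x) * (r\<^sup>2) ^ 4 / 8 \<le> norm (h x) * (r\<^sup>2) ^ 4 / 16" by linarith
  moreover have "0 < norm (h x) * (r\<^sup>2) ^ 4" using hx r by simp
  ultimately show False by linarith
qed

text \<open>Second derivatives of \<open>v\<close> are solutions by \<open>wsol_pd\<close>, hence
  continuous. Both derivatives can then be moved from the test function back to \<open>v\<close>,
  and \<open>bump_test_zero\<close> passes to the pointwise equation.\<close>

lemma wsol_helmholtz:
  assumes v: "wsol \<kappa> G v" and \<kappa>: "0 \<le> \<kappa>" and x: "x \<in> G"
  shows "lap v x = - of_real (\<kappa>\<^sup>2) * v x"
proof -
  note C1 = wsol_C1[OF v \<kappa>]
  note C1e = wsol_C1[OF wsol_pd[OF v \<kappa>] \<kappa>]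
  note oG = wsol_D(1)[OF v]
  have c: "continuous_on G (pd e (pd e v))" for e using wsol_D(2)[OF wsol_pd[OF wsol_pd[OF v \<kappa>] \<kappa>]] .
  have "lap v x + of_real (\<kappa>\<^sup>2) * v x = 0"
  proof (rule bump_test_zero[OF oG _ x])
    show "continuous_on G (\<lambda>x. lap v x + of_real (\<kappa>\<^sup>2) * v x)"
      unfolding lap_def using c wsol_D(2)[OF v] by (intro continuous_intros)
    fix \<phi> assume \<phi>: "test_fn2 \<phi>" and s: "supp \<phi> \<subseteq> G"
    have i: "integrable lborel (\<lambda>x. f x * complex_of_real (g x))"
      if "continuous_on G f" "continuous_on UNIV g" "\<And>x. x \<notin> supp \<phi> \<Longrightarrow> g x = 0" for f g
      by (rule integrable_mult_test(2)[OF oG that(1) _ test_fn2_D(1)[OF \<phi>] s])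
        (use that in \<open>auto intro!: continuous_intros continuous_on_subset[OF that(2)]\<close>)
    have ibp: "(\<integral>x. pd e (pd e v) x * of_real (\<phi> x) \<partial>lborel) = (\<integral>x. v x * of_real (pd e (pd e \<phi>) x) \<partial>lborel)" for e
      using integration_by_parts[OF oG C1e test_fn2_D(8)[OF \<phi>] s, of e]
        integration_by_parts[OF oG C1 test_fn2_D(9)[OF \<phi>] order_trans[OF supp_pd s], of e e] by simp
    have "(\<integral>x. (lap v x + of_real (\<kappa>\<^sup>2) * v x) * of_real (\<phi> x) \<partial>lborel)
       = (\<integral>x. pd (axis 1 1) (pd (axis 1 1) v) x * of_real (\<phi> x) + pd (axis 2 1) (pd (axis 2 1) v) x * of_real (\<phi> x)
           + of_real (\<kappa>\<^sup>2) * (v x * of_real (\<phi> x)) \<partial>lborel)"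
      by (intro Bochner_Integration.integral_cong refl) (simp add: lap_def algebra_simps)
    also have "\<dots> = (\<integral>x. pd (axis 1 1) (pd (axis 1 1) v) x * of_real (\<phi> x) \<partial>lborel)
       + (\<integral>x. pd (axis 2 1) (pd (axis 2 1) v) x * of_real (\<phi> x) \<partial>lborel)
           + of_real (\<kappa>\<^sup>2) * (\<integral>x. v x * of_real (\<phi> x) \<partial>lborel)"
      using i[OF c test_fn2_D(3)[OF \<phi>]] i[OF wsol_D(2)[OF v] test_fn2_D(3)[OF \<phi>]] by (simp add: supp_eq_0)
    also have "\<dots> = (\<integral>x. v x * of_real (pd (axis 1 1) (pd (axis 1 1) \<phi>) x)
        + v x * of_real (pd (axis 2 1) (pd (axis 2 1) \<phi>) x)
        + of_real (\<kappa>\<^sup>2) * (v x * of_real (\<phi> x)) \<partial>lborel)"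
      unfolding ibp using i[OF wsol_D(2)[OF v] test_fn2_D(6)[OF \<phi>]] i[OF wsol_D(2)[OF v] test_fn2_D(3)[OF \<phi>]]
      by (simp add: supp_eq_0 pd_pd_outside_supp)
    also have "\<dots> = (\<integral>x. v x * of_real (lap \<phi> x + \<kappa>\<^sup>2 * \<phi> x) \<partial>lborel)"
      by (intro Bochner_Integration.integral_cong refl) (simp add: lap_def algebra_simps)
    also have "\<dots> = 0" by (rule wsol_D(3)[OF v \<phi> s])
    finally show "(\<integral>x. (lap v x + of_real (\<kappa>\<^sup>2) * v x) * of_real (\<phi> x) \<partial>lborel) = 0" .
  qed
  then show ?thesis by (simp add: add_eq_0_iff)
qed

section \<open>Analyticity and unique continuation\<close>

abbreviation pdn :: "pt \<Rightarrow> nat \<Rightarrow> (pt \<Rightarrow> complex) \<Rightarrow> pt \<Rightarrow> complex" where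
  "pdn e n \<equiv> (pd e ^^ n)"

lemma wsol_pdn: "wsol \<kappa> G v \<Longrightarrow> 0 \<le> \<kappa> \<Longrightarrow> wsol \<kappa> G (pdn e n v)"
  by (induction n) (auto intro: wsol_pd)

lemma pdn_cong_open:
  assumes "open G" "\<And>y. y \<in> G \<Longrightarrow> f y = g y" "x \<in> G"
  shows "pdn e n f x = pdn e n g x"
  using assms(3)
proof (induction n arbitrary: x)
  case (Suc n)
  then show ?case using pd_cong_open[OF assms(1) Suc.prems, of "pdn e n f" "pdn e n g" e] by simp
qed (use assms in auto)

lemma pdn_zero: "pdn e n (\<lambda>_. 0) x = 0"
proof -
  have "pd e (\<lambda>_. 0 :: complex) = (\<lambda>_. 0)" by (rule ext, rule pd_eqI) simp
  then have "pdn e n (\<lambda>_. 0) = (\<lambda>_. 0)" by (induction n) auto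
  then show ?thesis by simp
qed

lemma pd_cmult:
  fixes f :: "pt \<Rightarrow> complex"
  assumes "f differentiable (at x)"
  shows "(\<lambda>x. c * f x) differentiable (at x)" "pd e (\<lambda>x. c * f x) x = c * pd e f x"
proof -
  have D: "((\<lambda>x. c * f x) has_derivative (\<lambda>e. c * pd e f x)) (at x)"
    using has_derivative_mult_right[OF has_derivative_pd[OF assms]] .
  then show "(\<lambda>x. c * f x) differentiable (at x)" by (auto simp: differentiable_def)
  show "pd e (\<lambda>x. c * f x) x = c * pd e f x" using pd_eqI[OF D] .
qed

lemma wsol_differentiable: "wsol \<kappa> G v \<Longrightarrow> 0 \<le> \<kappa> \<Longrightarrow> x \<in> G \<Longrightarrow> v differentiable (at x)"
  using wsol_C1 by (auto simp: C1_on_def)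

lemma pdn_uminus:
  assumes v: "wsol \<kappa> G v" "0 \<le> \<kappa>" and x: "x \<in> G"
  shows "pdn (- e) n v x = (-1) ^ n * pdn e n v x"
  using x
proof (induction n arbitrary: x)
  case (Suc n)
  note d = wsol_differentiable[OF wsol_pdn[OF v] v(2) Suc.prems]
  have "pdn (- e) (Suc n) v x = pd (- e) (\<lambda>x. (-1) ^ n * pdn e n v x) x"
    using pd_cong_open[OF wsol_D(1)[OF v(1)] Suc.prems Suc.IH, of _ "- e"] by simp
  also have "\<dots> = (-1) ^ n * pd (- e) (pdn e n v) x" by (rule pd_cmult(2)[OF d])
  also have "pd (- e) (pdn e n v) x = - pd e (pdn e n v) x" using pd_scale_dir[OF d, of "-1" e] by simp
  finally show ?case by simp
qed simp

text \<open>A Cauchy estimate: each of the m differentiations uses up one m-th of the radius. The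
  growth m^m is of factorial type, that is, the growth of derivatives of an analytic
  function.\<close>

lemma wsol_pdn_bound:
  assumes v: "wsol \<kappa> G v" and \<kappa>: "0 \<le> \<kappa>" "\<kappa> * R \<le> 1" and R: "0 < R" "cball x R \<subseteq> G"
    and K: "\<And>y. y \<in> cball x R \<Longrightarrow> norm (v y) \<le> K" and e: "norm e = 1" and m: "0 < m"
  shows "norm (pdn e m v x) \<le> K * (800 * real m / R) ^ m"
proof -
  have K0: "0 \<le> K" using K[of x] R by (auto intro: order_trans[OF norm_ge_zero])
  define r where "r = R / real m"
  have r: "0 < r" "\<kappa> * r \<le> 1" "real m * r = R"
  proof -
    show "0 < r" "real m * r = R" using R m by (auto simp: r_def)
    have "r \<le> R" using R m by (simp add: r_def field_simps)
    then show "\<kappa> * r \<le> 1" using \<kappa> mult_left_mono[of r R \<kappa>] by linarith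
  qed
  \<comment> \<open>After j derivatives the bound is kept on the ball of radius (m - j) r, so that
    every application of \<open>wsol_grad_bound\<close> has a ball of radius r at its
    disposal.\<close>
  have "norm (pdn e j v y) \<le> K * (800 / r) ^ j" if "j \<le> m" "y \<in> cball x (real (m - j) * r)" for j y
    using that
  proof (induction j arbitrary: y)
    case 0
    then show ?case using K[of y] r by simp
  next
    case (Suc j)
    have sub: "cball y r \<subseteq> cball x (real (m - j) * r)"
    proof
      fix z assume "z \<in> cball y r"
      then have "dist x z \<le> real (m - Suc j) * r + r" using Suc.prems(2) dist_triangle[of x z y] by simp
      also have "\<dots> = real (m - j) * r" using Suc.prems(1) by (simp add: of_nat_diff algebra_simps)
      finally show "z \<in> cball x (real (m - j) * r)" by simp
    qed
    have "real (m - j) * r \<le> R" using r mult_right_mono[of "real (m - j)" "real m" r] by simp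
    then have sub2: "cball y r \<subseteq> G" using sub R(2) by (auto simp: mem_cball subset_iff)
    have "norm (pd e (pdn e j v) y) \<le> 800 * (K * (800 / r) ^ j) / r * norm e"
      by (rule wsol_grad_bound[OF wsol_pdn[OF v \<kappa>(1)] sub2 r(1) \<kappa>(1) r(2)])
        (use Suc sub in auto)
    then show ?case using e by (simp add: mult_ac)
  qed
  from this[of m x] have "norm (pdn e m v x) \<le> K * (800 / r) ^ m" by simp
  then show ?thesis by (simp add: r_def)
qed

text \<open>Taylor's formula when all coefficients at 0 vanish. Each induction step shifts the
  sequence by one and integrates the bound once.\<close>

lemma taylor_vanishing:
  fixes f :: "nat \<Rightarrow> real \<Rightarrow> complex"
  assumes "\<And>k t. 0 \<le> t \<Longrightarrow> t \<le> T \<Longrightarrow> (f k has_vector_derivative f (Suc k) t) (at t)"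
    and "\<And>k. f k 0 = 0" and "\<And>t. 0 \<le> t \<Longrightarrow> t \<le> T \<Longrightarrow> norm (f m t) \<le> B" and "0 \<le> t" "t \<le> T"
  shows "norm (f 0 t) \<le> B * t ^ m / fact m"
  using assms
proof (induction m arbitrary: f t)
  case (Suc m)
  have IH: "norm (f 1 u) \<le> B * u ^ m / fact m" if "0 \<le> u" "u \<le> T" for u
    using Suc.IH[of "\<lambda>k. f (Suc k)" u] Suc.prems that by simp
  show ?case
  proof (cases "t = 0")
    case True
    then show ?thesis using Suc.prems(2)[of 0] by simp
  next
    case False
    then have t: "0 < t" using Suc.prems by simp
    have "norm (f 0 t - f 0 0) \<le> B * t ^ Suc m / fact (Suc m) - B * 0 ^ Suc m / fact (Suc m)"
    proof (rule differentiable_bound_general[OF t])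
      show "continuous_on {0..t} (f 0)"
      proof (rule continuous_at_imp_continuous_on, rule ballI)
        fix x assume "x \<in> {0..t}"
        then show "isCont (f 0) x" using Suc.prems(1)[of x 0] Suc.prems(5)
            by (intro has_vector_derivative_continuous) auto
      qed
      fix u assume u: "0 < u" "u < t"
      show "(f 0 has_vector_derivative f 1 u) (at u)" using Suc.prems(1)[of u 0] u Suc.prems(5) by simp
      have "((\<lambda>t. B * t ^ Suc m / fact (Suc m)) has_real_derivative B * (real (Suc m) * u ^ m) / fact (Suc m)) (at u)"
        by (auto intro!: derivative_eq_intros simp del: power_Suc fact_Suc)
      moreover have "B * (real (Suc m) * u ^ m) / fact (Suc m) = B * u ^ m / fact m"
        by (simp add: field_simps del: of_nat_Suc)
      ultimately show "((\<lambda>t. B * t ^ Suc m / fact (Suc m)) has_vector_derivative B * u ^ m / fact m) (at u)"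
        by (simp add: has_real_derivative_iff_has_vector_derivative)
      show "norm (f 1 u) \<le> B * u ^ m / fact m" using IH u Suc.prems(5) by simp
    qed (auto intro!: continuous_intros)
    then show ?thesis using Suc.prems(2)[of 0] by simp
  qed
qed simp

text \<open>The quotient m^m / m! is one term of the series for exp m, and e <= 3.\<close>

lemma power_self_le_fact: "real m ^ m \<le> 3 ^ m * fact m"
proof -
  have "real m ^ m / fact m \<le> (\<Sum>n<Suc m. real m ^ n / fact n)"
    by (rule member_le_sum[of m]) auto
  also have "\<dots> \<le> exp (real m)"
    using sum_le_suminf[OF summable_exp_generic[of "real m"], of "{..<Suc m}"]
    by (simp add: exp_def scaleR_conv_of_real divide_inverse mult.commute)
  also have "\<dots> = exp 1 ^ m" by (simp add: exp_of_nat_mult[symmetric])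
  also have "\<dots> \<le> 3 ^ m" by (intro power_mono exp_le) auto
  finally show ?thesis by (simp add: divide_le_eq)
qed

text \<open>The remainder of order m is at most K (1600 t/R)^m m^m / m! <= K (4800 t/R)^m. For t <=
  R/10000 the ratio is below 1/2, and m tends to infinity.\<close>

lemma wsol_vanish_segment:
  assumes v: "wsol \<kappa> G v" and \<kappa>: "0 \<le> \<kappa>" "\<kappa> * R \<le> 1" and R: "0 < R" "cball x R \<subseteq> G" and e: "norm e = 1"
    and z: "\<And>k. pdn e k v x = 0" and t: "0 \<le> t" "t \<le> R / 10000"
  shows "v (x + t *\<^sub>R e) = 0"
proof -
  have "compact (v ` cball x R)"
    by (intro compact_continuous_image compact_cball continuous_on_subset[OF wsol_D(2)[OF v] R(2)])
  then obtain K where K: "\<And>y. y \<in> cball x R \<Longrightarrow> norm (v y) \<le> K"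
    using compact_imp_bounded bounded_iff by (metis imageI)
  have K0: "0 \<le> K" using K[of x] R by (auto intro: order_trans[OF norm_ge_zero])
  have bound: "norm (v (x + t *\<^sub>R e)) \<le> K * (1/2) ^ m" if m: "0 < m" for m
  proof -
    \<comment> \<open>Half of the radius remains available around every point of the segment, whence
      R/2 in the derivative bounds below.\<close>
    have inb: "cball (x + u *\<^sub>R e) (R/2) \<subseteq> cball x R" if "0 \<le> u" "u \<le> R / 10000" for u
    proof
      fix y assume "y \<in> cball (x + u *\<^sub>R e) (R/2)"
      then have "dist x y \<le> u + R / 2" using dist_triangle[of x y "x + u *\<^sub>R e"] e that by (simp add: dist_norm)
      then show "y \<in> cball x R" using that R by simp
    qed
    have inG: "x + u *\<^sub>R e \<in> G" if "0 \<le> u" "u \<le> R / 10000" for u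
      using inb[OF that] R by (auto simp: subset_iff)
    have "norm (pdn e 0 v (x + t *\<^sub>R e)) \<le> (K * (800 * real m / (R/2)) ^ m) * t ^ m / fact m"
    proof (rule taylor_vanishing[where f="\<lambda>k t. pdn e k v (x + t *\<^sub>R e)" and T="R / 10000"])
      fix k u assume u: "0 \<le> u" "u \<le> R / 10000"
      show "((\<lambda>t. pdn e k v (x + t *\<^sub>R e)) has_vector_derivative pdn e (Suc k) v (x + u *\<^sub>R e)) (at u)"
        using has_vector_derivative_line[OF wsol_differentiable[OF wsol_pdn[OF v \<kappa>(1)] \<kappa>(1) inG[OF u]]] by simp
      show "norm (pdn e m v (x + u *\<^sub>R e)) \<le> K * (800 * real m / (R/2)) ^ m"
        by (rule wsol_pdn_bound[OF v \<kappa>(1) _ _ _ _ e m])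
          (use \<kappa> R inb[OF u] K in \<open>auto intro: order_trans[OF _ \<kappa>(2)] mult_left_mono simp del: mem_cball\<close>)
    qed (use z t in auto)
    also have "\<dots> = K * (1600 * t / R) ^ m * (real m ^ m / fact m)"
      by (simp add: power_mult_distrib power_divide mult_ac)
    also have "\<dots> \<le> K * (1600 * t / R) ^ m * 3 ^ m"
      using K0 t R power_self_le_fact[of m] by (intro mult_left_mono) (auto simp: divide_le_eq)
    also have "\<dots> = K * (4800 * t / R) ^ m" by (simp add: power_mult_distrib[symmetric] mult_ac)
    also have "\<dots> \<le> K * (1/2) ^ m"
      using K0 t R by (intro mult_left_mono power_mono) (auto simp: field_simps)
    finally show ?thesis by simp
  qed
  have "(\<lambda>m. K * (1/2) ^ m) \<longlonglongrightarrow> K * 0" by (intro tendsto_intros LIMSEQ_power_zero) simp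
  then have "norm (v (x + t *\<^sub>R e)) \<le> K * 0"
    by (rule LIMSEQ_le_const) (use bound in \<open>auto intro!: exI[of _ 1]\<close>)
  then show ?thesis by simp
qed

text \<open>The interior \<open>Z\<close> of the zero set is relatively closed in \<open>G\<close>:
  near a point of its closure choose z in \<open>Z\<close> so close that a whole ball is covered by
  short segments starting at z, where all derivatives vanish.\<close>

lemma wsol_unique_continuation:
  assumes v: "wsol \<kappa> G v" and \<kappa>: "0 \<le> \<kappa>" and con: "connected G"
    and U: "open U" "U \<inter> G \<noteq> {}" "\<And>x. x \<in> U \<inter> G \<Longrightarrow> v x = 0" and x: "x \<in> G"
  shows "v x = 0"
proof -
  note oG = wsol_D(1)[OF v]
  define Z where "Z = interior {x \<in> G. v x = 0}"
  have ZG: "Z \<subseteq> G" and Z0: "\<And>x. x \<in> Z \<Longrightarrow> v x = 0" using interior_subset by (fastforce simp: Z_def)+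
  have oZ: "open Z" by (simp add: Z_def)
  have "U \<inter> G \<subseteq> Z" unfolding Z_def using U oG by (intro interior_maximal) auto
  then have "Z \<noteq> {}" using U by auto
  have "x \<in> Z" if x: "x \<in> G" "x \<in> closure Z" for x
  proof -
    obtain R where R: "0 < R" "cball x (2 * R) \<subseteq> G" "\<kappa> * R \<le> 1" using small_radius[OF oG x(1) \<kappa>] by blast
    \<comment> \<open>Distance R/20000 for z and again for y keeps |y - z| below R/10000, the range
      of \<open>wsol_vanish_segment\<close>.\<close>
    obtain z where z: "z \<in> Z" "dist z x < R / 20000"
      using x(2) R(1) unfolding closure_approachable by (meson divide_pos_pos zero_less_numeral)
    have zR: "cball z R \<subseteq> G"
    proof
      fix y assume "y \<in> cball z R"
      then have "dist x y \<le> R / 20000 + R" using z(2) dist_triangle[of x y z] by (simp add: dist_commute)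
      then show "y \<in> G" using R by (auto simp: subset_iff)
    qed
    have "ball x (R / 20000) \<subseteq> {x \<in> G. v x = 0}"
    proof
      fix y assume y: "y \<in> ball x (R / 20000)"
      have "v y = 0"
      proof (cases "y = z")
        case False
        define e where "e = (y - z) /\<^sub>R norm (y - z)"
        have e: "norm e = 1" "y = z + norm (y - z) *\<^sub>R e" using False by (auto simp: e_def)
        have "dist y z \<le> dist y x + dist z x" by (metis dist_triangle dist_commute)
        then have "norm (y - z) \<le> R / 10000" using y z(2) by (simp add: dist_norm norm_minus_commute)
        moreover have "pdn e k v z = 0" for k
          using pdn_cong_open[of Z v "\<lambda>_. 0" z k e, OF oZ Z0 z(1)] unfolding pdn_zero .
        ultimately have "v (z + norm (y - z) *\<^sub>R e) = 0"
          by (intro wsol_vanish_segment[OF v \<kappa> R(3,1) zR e(1)]) auto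
        then show ?thesis using e(2) by simp
      qed (use Z0 z in auto)
      moreover have "y \<in> G" using y R by (auto simp: subset_iff)
      ultimately show "y \<in> {x \<in> G. v x = 0}" by simp
    qed
    then have "ball x (R / 20000) \<subseteq> Z" unfolding Z_def by (rule interior_maximal) simp
    then show ?thesis using R(1) by auto
  qed
  then have "G \<inter> closure Z = Z" using ZG closure_subset by blast
  then have "closedin (top_of_set G) Z" by (metis closed_closure closedin_closed_Int)
  moreover have "openin (top_of_set G) Z" using ZG by (simp add: Z_def openin_open_eq oG open_openin_trans)
  ultimately have "Z = G" using con \<open>Z \<noteq> {}\<close> unfolding connected_clopen by blast
  then show ?thesis using Z0 x by blast
qed

text \<open>The parameters at which all derivatives along \<open>e\<close> vanish form a closed and
  open subset of the half-line. Only derivatives in the direction of the ray are involved, which is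
  exactly what the corner provides.\<close>

lemma wsol_vanish_ray:
  assumes v: "wsol \<kappa> G v" and \<kappa>: "0 \<le> \<kappa>" and e: "norm e = 1"
    and ray: "\<And>t. 0 \<le> t \<Longrightarrow> x + t *\<^sub>R e \<in> G" and z: "\<And>k. pdn e k v x = 0" and t: "0 \<le> t"
  shows "v (x + t *\<^sub>R e) = 0"
proof -
  note oG = wsol_D(1)[OF v]
  let ?S = "{0::real..}"
  define A where "A = {t \<in> ?S. \<forall>k. pdn e k v (x + t *\<^sub>R e) = 0}"
  have cont: "continuous_on ?S (\<lambda>t. pdn e k v (x + t *\<^sub>R e))" for k
    by (intro continuous_on_compose2[OF wsol_D(2)[OF wsol_pdn[OF v \<kappa>]]] continuous_intros) (use ray in auto)
  have "A = (\<Inter>k. {t \<in> ?S. pdn e k v (x + t *\<^sub>R e) = 0})" by (auto simp: A_def)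
  moreover have "closed {t \<in> ?S. pdn e k v (x + t *\<^sub>R e) = 0}" for k
    using continuous_closed_preimage_constant[OF cont[of k], of 0] by simp
  ultimately have cl: "closed A" by auto
  have op: "\<exists>d>0. ball t d \<inter> ?S \<subseteq> A" if "t \<in> A" for t
  proof -
    have t: "0 \<le> t" "\<And>k. pdn e k v (x + t *\<^sub>R e) = 0" using that by (auto simp: A_def)
    obtain R where R: "0 < R" "cball (x + t *\<^sub>R e) (2 * R) \<subseteq> G" "\<kappa> * R \<le> 1"
      using small_radius[OF oG ray[OF t(1)] \<kappa>] by blast
    have R': "cball (x + t *\<^sub>R e) R \<subseteq> G" using R by (auto simp: subset_iff)
    have "ball t (R / 10000) \<inter> ?S \<subseteq> A"
    proof
      fix s assume s: "s \<in> ball t (R / 10000) \<inter> ?S"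
      have "pdn e k v (x + s *\<^sub>R e) = 0" for k
      proof (cases "t \<le> s")
        case True
        have zz: "pdn e j (pdn e k v) (x + t *\<^sub>R e) = 0" for j
          using t(2)[of "j + k"] by (simp add: funpow_add)
        have "pdn e k v (x + t *\<^sub>R e + (s - t) *\<^sub>R e) = 0"
          by (rule wsol_vanish_segment[OF wsol_pdn[OF v \<kappa>] \<kappa> R(3,1) R' e zz]) (use True s in \<open>auto simp: dist_real_def\<close>)
        then show ?thesis by (simp add: algebra_simps)
      next
        case False
        \<comment> \<open>Parameters below t are reached in the direction - e, in which the
          derivatives change only by a sign.\<close>
        have zz: "pdn (- e) j (pdn e k v) (x + t *\<^sub>R e) = 0" for j
          using t(2)[of "j + k"] pdn_uminus[OF wsol_pdn[OF v \<kappa>] \<kappa> ray[OF t(1)], of j e k e] by (simp add: funpow_add)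
        have "pdn e k v (x + t *\<^sub>R e + (t - s) *\<^sub>R (- e)) = 0"
          by (rule wsol_vanish_segment[OF wsol_pdn[OF v \<kappa>] \<kappa> R(3,1) R' _ zz]) (use e False s in \<open>auto simp: dist_real_def\<close>)
        then show ?thesis by (simp add: algebra_simps)
      qed
      then show "s \<in> A" using s by (simp add: A_def)
    qed
    then show ?thesis using R(1) by (intro exI[of _ "R / 10000"]) simp
  qed
  have "openin (top_of_set ?S) A"
    unfolding openin_contains_ball using op by (auto simp: A_def)
  moreover have "closedin (top_of_set ?S) A" using cl by (auto simp: closedin_closed A_def)
  moreover have "0 \<in> A" using z by (simp add: A_def)
  ultimately have "A = ?S" using connected_Ici[of "0::real"] unfolding connected_clopen by blast
  then have "t \<in> A" using t by simp
  then have "pdn e 0 v (x + t *\<^sub>R e) = 0" unfolding A_def by blast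
  then show ?thesis by simp
qed

section \<open>Rellich's lemma\<close>

lemma pd_pd_decomp:
  assumes v: "wsol \<kappa> G v" "0 \<le> \<kappa>" and x: "x \<in> G"
  shows "pd e (pd f v) x =
     of_real (e $ 1 * f $ 1) * pd (axis 1 1) (pd (axis 1 1) v) x
         + of_real (e $ 1 * f $ 2) * pd (axis 1 1) (pd (axis 2 1) v) x
   + of_real (e $ 2 * f $ 1) * pd (axis 2 1) (pd (axis 1 1) v) x
       + of_real (e $ 2 * f $ 2) * pd (axis 2 1) (pd (axis 2 1) v) x"
proof -
  note oG = wsol_D(1)[OF v(1)]
  have d: "pd a v differentiable (at x)" for a using wsol_differentiable[OF wsol_pd[OF v] v(2) x] .
  have inner: "pd f v y = of_real (f $ 1) * pd (axis 1 1) v y + of_real (f $ 2) * pd (axis 2 1) v y" if "y \<in> G" for y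
    using pd_decomp[OF wsol_differentiable[OF v that], of f] by (simp add: scaleR_conv_of_real)
  have pa: "pd a (pd f v) x = of_real (f $ 1) * pd a (pd (axis 1 1) v) x
      + of_real (f $ 2) * pd a (pd (axis 2 1) v) x" for a
  proof -
    have "pd a (pd f v) x = pd a (\<lambda>y. of_real (f $ 1) * pd (axis 1 1) v y + of_real (f $ 2) * pd (axis 2 1) v y) x"
      by (rule pd_cong_open[OF oG x inner])
    also have "\<dots> = of_real (f $ 1) * pd a (pd (axis 1 1) v) x + of_real (f $ 2) * pd a (pd (axis 2 1) v) x"
      by (rule pd_eqI) (intro has_derivative_add has_derivative_mult_right has_derivative_pd d)
    finally show ?thesis .
  qed
  show ?thesis
    using pd_decomp[OF d, of e f] by (simp add: pa scaleR_conv_of_real algebra_simps)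
qed

text \<open>Rotation invariance of the Laplacian: \<open>f\<close> is (- e_2, e_1) up to the sign D,
  and both mixed derivatives carry the coefficient e_1 e_2 + f_1 f_2 = 0.\<close>

lemma helmholtz_orthonormal:
  assumes v: "wsol \<kappa> G v" "0 \<le> \<kappa>" and x: "x \<in> G"
    and on: "norm e = 1" "norm f = 1" "e \<bullet> f = 0"
  shows "pd e (pd e v) x + pd f (pd f v) x = - of_real (\<kappa>\<^sup>2) * v x"
proof -
  have e: "(e $ 1)\<^sup>2 + (e $ 2)\<^sup>2 = 1" "(f $ 1)\<^sup>2 + (f $ 2)\<^sup>2 = 1" and ef: "e $ 1 * f $ 1 + e $ 2 * f $ 2 = 0"
    using on by (simp_all add: norm_eq_1 inner_vec_def sum_2 power2_eq_square)
  define D where "D = e $ 1 * f $ 2 - e $ 2 * f $ 1"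
  have f1: "f $ 1 = - e $ 2 * D" using e(1) ef unfolding D_def by algebra
  have f2: "f $ 2 = e $ 1 * D" using e(1) ef unfolding D_def by algebra
  have D: "D\<^sup>2 = 1" using e f1 f2 by algebra
  have 1: "e $ 1 * e $ 1 + f $ 1 * f $ 1 = 1" "e $ 2 * e $ 2 + f $ 2 * f $ 2 = 1" "e $ 1 * e $ 2 + f $ 1 * f $ 2 = 0"
    unfolding f1 f2 using e(1) D by algebra+
  let ?v = "\<lambda>i j. pd (axis i 1) (pd (axis j 1) v) x"
  have "pd e (pd e v) x + pd f (pd f v) x = of_real (e $ 1 * e $ 1 + f $ 1 * f $ 1) * ?v 1 1
    + of_real (e $ 1 * e $ 2 + f $ 1 * f $ 2) * (?v 1 2 + ?v 2 1) + of_real (e $ 2 * e $ 2 + f $ 2 * f $ 2) * ?v 2 2"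
    unfolding pd_pd_decomp[OF v x, of e e] pd_pd_decomp[OF v x, of f f] by (simp add: algebra_simps)
  also have "\<dots> = lap v x" unfolding 1 lap_def by simp
  finally show ?thesis using wsol_helmholtz[OF v x] by simp
qed

text \<open>The energy of h = sqrt r g changes at a relative rate of at most C / r^2, which is
  integrable at infinity, so a positive energy stays bounded away from 0. On the other hand h tends
  to 0 by assumption, and then h' does so as well by the equation.\<close>

lemma rellich_ode:
  fixes g g1 g2 :: "real \<Rightarrow> complex"
  assumes R: "0 \<le> R" and \<kappa>: "0 < \<kappa>"
    and D: "\<And>r. R < r \<Longrightarrow> (g has_vector_derivative g1 r) (at r)" "\<And>r. R < r \<Longrightarrow> (g1 has_vector_derivative g2 r) (at r)"
    and ode: "\<And>r. R < r \<Longrightarrow> of_real (r\<^sup>2) * g2 r + of_real r * g1 r + of_real (\<kappa>\<^sup>2 * r\<^sup>2 - n\<^sup>2) * g r = 0"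
    and lim: "((\<lambda>r. of_real (sqrt r) * g r) \<longlongrightarrow> 0) at_top"
    and r0: "R < r0"
  shows "g r0 = 0"
proof -
  \<comment> \<open>The substitution h = sqrt r g removes the first-order term of Bessel's equation
    and contributes the 1/4, leaving h'' = (m / r^2 - kappa^2) h.\<close>
  define m where "m = n\<^sup>2 - 1 / 4"
  define h where "h r = of_real (sqrt r) * g r" for r
  define h1 where "h1 r = of_real (sqrt r) * g1 r + of_real (1 / (2 * sqrt r)) * g r" for r
  define h2 where "h2 r = (m / r\<^sup>2 - \<kappa>\<^sup>2) *\<^sub>R h r" for r
  have sq: "((\<lambda>r. sqrt r) has_real_derivative 1 / (2 * sqrt r)) (at r)" if "0 < r" for r
    by (rule DERIV_cong[OF DERIV_real_sqrt[OF that]]) (simp add: field_simps)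
  have sq': "((\<lambda>r. 1 / (2 * sqrt r)) has_real_derivative - 1 / (4 * r * sqrt r)) (at r)" if "0 < r" for r
    using that by (auto intro!: derivative_eq_intros simp: field_simps)
  have hD: "(h has_vector_derivative h1 r) (at r)" if r: "R < r" for r
  proof -
    have r': "0 < r" using R r by simp
    have "(h has_vector_derivative of_real (sqrt r) * g1 r + of_real (1 / (2 * sqrt r)) * g r) (at r)"
      unfolding h_def by (intro has_vector_derivative_mult has_vector_derivative_of_real D r
        has_real_derivative_iff_has_vector_derivative[THEN iffD1] sq r')
    then show ?thesis by (simp add: h1_def)
  qed
  have h1D: "(h1 has_vector_derivative h2 r) (at r)" if r: "R < r" for r
  proof -
    have r': "0 < r" using R r by simp
    have "(h1 has_vector_derivative (of_real (sqrt r) * g2 r + of_real (1 / (2 * sqrt r)) * g1 r)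
        + (of_real (1 / (2 * sqrt r)) * g1 r + of_real (- 1 / (4 * r * sqrt r)) * g r)) (at r)"
      unfolding h1_def by (intro has_vector_derivative_add has_vector_derivative_mult has_vector_derivative_of_real D r
        has_real_derivative_iff_has_vector_derivative[THEN iffD1] sq sq' r')
    moreover have "(of_real (sqrt r) * g2 r + of_real (1 / (2 * sqrt r)) * g1 r)
        + (of_real (1 / (2 * sqrt r)) * g1 r + of_real (- 1 / (4 * r * sqrt r)) * g r) = h2 r"
    proof -
      define s where "s = complex_of_real (sqrt r)"
      have s0: "s \<noteq> 0" and s2: "of_real r = s\<^sup>2" using r' by (auto simp: s_def of_real_power[symmetric] simp del: of_real_power)
      have o: "s ^ 4 * g2 r + s\<^sup>2 * g1 r + (of_real (\<kappa>\<^sup>2) * s ^ 4 - of_real (n\<^sup>2)) * g r = 0"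
        using ode[OF r] s2 by (simp add: power_mult[symmetric])
      have "s ^ 3 * ((s * g2 r + 1 / (2 * s) * g1 r) + (1 / (2 * s) * g1 r + - 1 / (4 * s\<^sup>2 * s) * g r))
        = s ^ 4 * g2 r + s\<^sup>2 * g1 r - g r / 4" using s0 by (simp add: field_simps eval_nat_numeral)
      also have "\<dots> = (of_real (n\<^sup>2) - 1 / 4 - of_real (\<kappa>\<^sup>2) * s ^ 4) * g r" using o by (simp add: algebra_simps)
      also have "\<dots> = s ^ 3 * (((of_real (n\<^sup>2) - 1 / 4) / (s\<^sup>2)\<^sup>2 - of_real (\<kappa>\<^sup>2)) * (s * g r))"
        using s0 by (simp add: field_simps eval_nat_numeral)
      finally have "(s * g2 r + 1 / (2 * s) * g1 r) + (1 / (2 * s) * g1 r + - 1 / (4 * s\<^sup>2 * s) * g r)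
        = ((of_real (n\<^sup>2) - 1 / 4) / (s\<^sup>2)\<^sup>2 - of_real (\<kappa>\<^sup>2)) * (s * g r)" using s0 by simp
      then show ?thesis using s2 by (simp add: h2_def h_def m_def s_def scaleR_conv_of_real)
    qed
    ultimately show ?thesis by simp
  qed
  define E where "E r = h1 r \<bullet> h1 r + \<kappa>\<^sup>2 * (h r \<bullet> h r)" for r
  define E' where "E' r = 2 * (m / r\<^sup>2) * (h1 r \<bullet> h r)" for r
  have ED: "(E has_real_derivative E' r) (at r)" if r: "R < r" for r
  proof -
    have "(E has_vector_derivative ((h1 r \<bullet> h2 r + h2 r \<bullet> h1 r) + (\<kappa>\<^sup>2 * (h r \<bullet> h1 r + h1 r \<bullet> h r)))) (at r)"
      unfolding E_def
      by (intro has_vector_derivative_add has_vector_derivative_mult_right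
         bounded_bilinear.has_vector_derivative[OF bounded_bilinear_inner] hD h1D r)
    moreover have "(h1 r \<bullet> h2 r + h2 r \<bullet> h1 r) + (\<kappa>\<^sup>2 * (h r \<bullet> h1 r + h1 r \<bullet> h r)) = E' r"
      by (simp add: h2_def E'_def inner_commute algebra_simps)
    ultimately show ?thesis by (simp add: has_real_derivative_iff_has_vector_derivative)
  qed
  \<comment> \<open>From 2 kappa |h'| |h| <= E the derivative of the energy is at most (|m| / kappa)
    E / r^2.\<close>
  define C where "C = \<bar>m\<bar> / \<kappa>"
  have E0: "0 \<le> E r" for r by (simp add: E_def)
  have E'b: "\<bar>E' r\<bar> \<le> C / r\<^sup>2 * E r" for r
  proof -
    have "2 * \<kappa> * \<bar>h1 r \<bullet> h r\<bar> \<le> 2 * \<kappa> * (norm (h1 r) * norm (h r))"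
      using \<kappa> Cauchy_Schwarz_ineq2[of "h1 r" "h r"] by (intro mult_left_mono) auto
    also have "\<dots> \<le> E r"
      using zero_le_power2[of "norm (h1 r) - \<kappa> * norm (h r)"]
      by (simp add: E_def dot_square_norm power2_diff power_mult_distrib mult_ac)
    finally have "2 * \<bar>h1 r \<bullet> h r\<bar> \<le> E r / \<kappa>" using \<kappa> by (simp add: field_simps)
    then have "\<bar>m\<bar> / r\<^sup>2 * (2 * \<bar>h1 r \<bullet> h r\<bar>) \<le> \<bar>m\<bar> / r\<^sup>2 * (E r / \<kappa>)" by (intro mult_left_mono) auto
    then show ?thesis by (simp add: E'_def C_def abs_mult mult_ac)
  qed
  \<comment> \<open>The derivative C / r^2 of - C / r compensates the fastest possible decay of the
    energy.\<close>
  have mono: "E r0 * exp (- C / r0) \<le> E r" if r: "r0 \<le> r" for r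
  proof -
    have "E r0 * exp (- C / r0) \<le> E r * exp (- C / r)"
    proof (rule DERIV_nonneg_imp_nondecreasing[OF r])
      fix x assume x: "r0 \<le> x" "x \<le> r"
      then have xR: "R < x" "0 < x" using r0 R by auto
      have "((\<lambda>x. - C / x) has_real_derivative C / x\<^sup>2) (at x)"
        using xR by (auto intro!: derivative_eq_intros simp: power2_eq_square)
      then have "((\<lambda>x. E x * exp (- C / x)) has_real_derivative E' x * exp (- C / x)
          + exp (- C / x) * (C / x\<^sup>2) * E x) (at x)"
        by (intro DERIV_mult ED xR DERIV_fun_exp)
      moreover have "0 \<le> E' x * exp (- C / x) + exp (- C / x) * (C / x\<^sup>2) * E x"
      proof -
        have "0 \<le> (E' x + C / x\<^sup>2 * E x) * exp (- C / x)" using E'b[of x] by (intro mult_nonneg_nonneg) auto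
        then show ?thesis by (simp add: algebra_simps)
      qed
      ultimately show "\<exists>y. ((\<lambda>x. E x * exp (- C / x)) has_real_derivative y) (at x) \<and> 0 \<le> y" by blast
    qed
    also have "\<dots> \<le> E r * 1" using r r0 R \<kappa> E0 by (intro mult_left_mono) (auto simp: C_def)
    finally show ?thesis by simp
  qed
  have "E r0 \<le> 0"
  proof (rule ccontr)
    assume "\<not> E r0 \<le> 0"
    define c where "c = E r0 * exp (- C / r0)"
    have c: "0 < c" using \<open>\<not> E r0 \<le> 0\<close> by (simp add: c_def)
    \<comment> \<open>Such that |h'| <= B epsilon: two values of h contribute 2 epsilon, the
      remainder over a step of length 1 contributes (kappa^2 + |m|) epsilon.\<close>
    define B where "B = \<kappa>\<^sup>2 + \<bar>m\<bar> + 2"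
    have B: "0 < B" by (simp add: B_def add_nonneg_pos)
    \<comment> \<open>Makes the energy at \<open>r\<close> at most c/2, half of its lower bound
      c.\<close>
    define \<epsilon> where "\<epsilon> = sqrt (c / (2 * (B\<^sup>2 + \<kappa>\<^sup>2)))"
    have Bk: "0 < B\<^sup>2 + \<kappa>\<^sup>2" using B by (simp add: add_pos_nonneg)
    have "\<epsilon>\<^sup>2 = c / (2 * (B\<^sup>2 + \<kappa>\<^sup>2))" unfolding \<epsilon>_def using c Bk by (intro real_sqrt_pow2) auto
    moreover have "a \<noteq> 0 \<Longrightarrow> a * (c / (2 * a)) = c / 2" for a by simp
    ultimately have \<epsilon>: "0 < \<epsilon>" "(B\<^sup>2 + \<kappa>\<^sup>2) * \<epsilon>\<^sup>2 = c / 2" using c Bk by (auto simp: \<epsilon>_def simp del: distrib_left_numeral)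
    have "\<forall>\<^sub>F r in at_top. norm (h r) < \<epsilon>" using tendstoD[OF lim \<epsilon>(1)] by (simp add: h_def)
    then obtain r1 where r1: "\<And>r. r1 \<le> r \<Longrightarrow> norm (h r) < \<epsilon>" by (auto simp: eventually_at_top_linorder)
    define r where "r = max r1 (max r0 1)"
    have r: "r1 \<le> r" "r0 \<le> r" "1 \<le> r" by (auto simp: r_def)
    have h2b: "norm (h2 t) \<le> (\<kappa>\<^sup>2 + \<bar>m\<bar>) * \<epsilon>" if "r \<le> t" for t
    proof -
      have "1 \<le> t\<^sup>2" using that r by (simp add: one_le_power)
      then have "\<bar>m\<bar> / t\<^sup>2 \<le> \<bar>m\<bar>" by (simp add: divide_le_eq mult_le_cancel_left1)
      then have "\<bar>m / t\<^sup>2 - \<kappa>\<^sup>2\<bar> \<le> \<kappa>\<^sup>2 + \<bar>m\<bar>" using abs_triangle_ineq4[of "m / t\<^sup>2" "\<kappa>\<^sup>2"] by simp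
      then show ?thesis unfolding h2_def norm_scaleR using r1[of t] that r
        by (intro mult_mono) (auto intro: less_imp_le)
    qed
    have h1b: "norm (h1 t - h1 r) \<le> (\<kappa>\<^sup>2 + \<bar>m\<bar>) * \<epsilon>" if t: "r \<le> t" "t \<le> r + 1" for t
    proof (cases "t = r")
      case False
      have "norm (h1 t - h1 r) \<le> (\<kappa>\<^sup>2 + \<bar>m\<bar>) * \<epsilon> * t - (\<kappa>\<^sup>2 + \<bar>m\<bar>) * \<epsilon> * r"
      proof (rule differentiable_bound_general[where \<phi>="\<lambda>t. (\<kappa>\<^sup>2 + \<bar>m\<bar>) * \<epsilon> * t"])
        show "r < t" using False t by simp
        show "continuous_on {r..t} h1"
        proof (rule continuous_at_imp_continuous_on, rule ballI)
          fix x assume "x \<in> {r..t}" then show "isCont h1 x"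
            using h1D[of x] r r0 by (intro has_vector_derivative_continuous) auto
        qed
        fix x assume "r < x" "x < t"
        then show "(h1 has_vector_derivative h2 x) (at x)" "norm (h2 x) \<le> (\<kappa>\<^sup>2 + \<bar>m\<bar>) * \<epsilon>"
          using h1D[of x] r r0 h2b[of x] by auto
        show "((*) ((\<kappa>\<^sup>2 + \<bar>m\<bar>) * \<epsilon>) has_vector_derivative (\<kappa>\<^sup>2 + \<bar>m\<bar>) * \<epsilon>) (at x)"
          by (auto intro!: derivative_eq_intros simp: has_real_derivative_iff_has_vector_derivative[symmetric])
      qed (auto intro!: continuous_intros)
      also have "\<dots> = (\<kappa>\<^sup>2 + \<bar>m\<bar>) * \<epsilon> * (t - r)" by (simp add: algebra_simps)
      also have "\<dots> \<le> (\<kappa>\<^sup>2 + \<bar>m\<bar>) * \<epsilon> * 1" using t \<epsilon> by (intro mult_left_mono) auto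
      finally show ?thesis by simp
    qed (use \<epsilon> in simp)
    \<comment> \<open>Over a unit step h (r + 1) - h r differs from h' r by no more than the
      oscillation of h'. This turns smallness of h into smallness of h'.\<close>
    have "norm ((h (r + 1) - (r + 1) *\<^sub>R h1 r) - (h r - r *\<^sub>R h1 r)) \<le> (\<kappa>\<^sup>2 + \<bar>m\<bar>) * \<epsilon> * (r + 1) - (\<kappa>\<^sup>2 + \<bar>m\<bar>) * \<epsilon> * r"
    proof (rule differentiable_bound_general[where f="\<lambda>t. h t - t *\<^sub>R h1 r" and f'="\<lambda>t. h1 t - h1 r"
        and \<phi>="\<lambda>t. (\<kappa>\<^sup>2 + \<bar>m\<bar>) * \<epsilon> * t"])
      have d: "((\<lambda>t. h t - t *\<^sub>R h1 r) has_vector_derivative h1 x - h1 r) (at x)" if "r \<le> x" for x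
        using hD[of x] that r r0 by (auto intro!: derivative_eq_intros)
      show "continuous_on {r..r+1} (\<lambda>t. h t - t *\<^sub>R h1 r)"
      proof (rule continuous_at_imp_continuous_on, rule ballI)
        fix x assume "x \<in> {r..r+1}" then show "isCont (\<lambda>t. h t - t *\<^sub>R h1 r) x"
          by (intro has_vector_derivative_continuous[OF d]) auto
      qed
      fix x assume "r < x" "x < r + 1"
      then show "((\<lambda>t. h t - t *\<^sub>R h1 r) has_vector_derivative h1 x - h1 r) (at x)" "norm (h1 x - h1 r) \<le> (\<kappa>\<^sup>2 + \<bar>m\<bar>) * \<epsilon>"
        using d h1b by auto
      show "((*) ((\<kappa>\<^sup>2 + \<bar>m\<bar>) * \<epsilon>) has_vector_derivative (\<kappa>\<^sup>2 + \<bar>m\<bar>) * \<epsilon>) (at x)"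
        by (auto intro!: derivative_eq_intros simp: has_real_derivative_iff_has_vector_derivative[symmetric])
    qed (auto intro!: continuous_intros)
    then have d1: "norm (h (r + 1) - h r - h1 r) \<le> (\<kappa>\<^sup>2 + \<bar>m\<bar>) * \<epsilon>" by (simp add: algebra_simps)
    have "h1 r = h (r + 1) - h r - (h (r + 1) - h r - h1 r)" by simp
    then have "norm (h1 r) \<le> norm (h (r + 1)) + norm (h r) + norm (h (r + 1) - h r - h1 r)"
      by (metis norm_triangle_ineq4 add_right_mono order_trans)
    also have "\<dots> \<le> B * \<epsilon>" using d1 r1[of r] r1[of "r + 1"] r by (simp add: B_def algebra_simps)
    finally have "(norm (h1 r))\<^sup>2 \<le> (B * \<epsilon>)\<^sup>2" by (intro power_mono) auto
    moreover have "(norm (h r))\<^sup>2 \<le> \<epsilon>\<^sup>2" using r1[of r] r by (intro power_mono) auto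
    ultimately have "E r \<le> (B * \<epsilon>)\<^sup>2 + \<kappa>\<^sup>2 * \<epsilon>\<^sup>2"
      unfolding E_def dot_square_norm by (intro add_mono mult_left_mono) auto
    also have "\<dots> = c / 2" using \<epsilon>(2) by (simp add: power_mult_distrib algebra_simps)
    finally show False using mono[OF r(2)] c by (simp add: c_def)
  qed
  then have "\<kappa>\<^sup>2 * (h r0 \<bullet> h r0) \<le> 0" by (simp add: E_def) (smt (verit) inner_ge_zero)
  then have "h r0 \<bullet> h r0 \<le> 0" using \<kappa> by (simp add: mult_le_0_iff)
  then have "h r0 = 0" by (metis inner_ge_zero inner_eq_zero_iff order_antisym)
  then show ?thesis using r0 R by (simp add: h_def)
qed

section \<open>Polar coordinates and Fourier coefficients on the circle\<close>

definition radial :: "real \<Rightarrow> pt" where "radial \<theta> = vector [cos \<theta>, sin \<theta>]"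
definition angular :: "real \<Rightarrow> pt" where "angular \<theta> = vector [- sin \<theta>, cos \<theta>]"

lemma radial_simps [simp]: "radial \<theta> $ 1 = cos \<theta>" "radial \<theta> $ 2 = sin \<theta>" "angular \<theta> $ 1 = - sin \<theta>" "angular \<theta> $ 2 = cos \<theta>"
  by (auto simp: radial_def angular_def)

lemma norm_radial [simp]: "norm (radial \<theta>) = 1" "norm (angular \<theta>) = 1" "radial \<theta> \<bullet> angular \<theta> = 0"
  by (auto simp: norm_eq_1 inner_vec_def sum_2 power2_eq_square[symmetric])

lemma radial_alt: "radial \<theta> = cos \<theta> *\<^sub>R axis 1 1 + sin \<theta> *\<^sub>R axis 2 1" "angular \<theta>
    = - sin \<theta> *\<^sub>R axis 1 1 + cos \<theta> *\<^sub>R axis 2 1"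
  by (auto simp: vec_eq_iff forall_2 axis_def)

lemma continuous_radial [continuous_intros]:
  fixes f :: "'a::t2_space \<Rightarrow> real"
  shows
  "continuous_on S f \<Longrightarrow> continuous_on S (\<lambda>x. radial (f x))" "continuous_on S f \<Longrightarrow> continuous_on S (\<lambda>x. angular (f x))"
  unfolding radial_alt by (auto intro!: continuous_intros)

lemma radial_deriv: "(radial has_vector_derivative angular \<theta>) (at \<theta> within S)"
  unfolding radial_alt[abs_def] by (auto intro!: derivative_eq_intros)

lemma polar_coords: "\<exists>\<theta>\<in>{0..2*pi}. x = norm x *\<^sub>R radial \<theta>" for x :: pt
proof (cases "x = 0")
  case False
  have "(x $ 1 / norm x)\<^sup>2 + (x $ 2 / norm x)\<^sup>2 = (x \<bullet> x) / (norm x)\<^sup>2"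
    by (simp add: inner_vec_def sum_2 power_divide power2_eq_square add_divide_distrib)
  also have "\<dots> = 1" using False by (simp add: dot_square_norm)
  finally obtain t where t: "0 \<le> t" "t < 2 * pi" "x $ 1 / norm x = cos t" "x $ 2 / norm x = sin t"
    using sincos_total_2pi by blast
  then have "x $ 1 = norm x * cos t" "x $ 2 = norm x * sin t" using False by (simp_all add: divide_eq_eq mult.commute)
  then have "x = norm x *\<^sub>R radial t" by (simp only: vec_eq_iff forall_2 vector_scaleR_component radial_simps real_scaleR_def)
  then show ?thesis using t by (intro bexI[of _ t]) auto
qed (auto intro!: bexI[of _ 0])

text \<open>The argument is a function on the plane evaluated on the circle, which builds in
  periodicity and continuity across the angle 0.\<close>

definition fourier_coeff :: "(pt \<Rightarrow> complex) \<Rightarrow> int \<Rightarrow> complex" where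
  "fourier_coeff f n = integral {0..2*pi} (\<lambda>\<theta>. f (radial \<theta>) * cis (of_int n * \<theta>))"

lemma fourier_coeff_integrable:
  assumes "continuous_on (sphere 0 1) f"
  shows "(\<lambda>\<theta>. f (radial \<theta>) * cis (of_int n * \<theta>)) integrable_on {0..2*pi}"
  unfolding cbox_interval[symmetric] cis_conv_exp
  by (intro integrable_continuous continuous_intros continuous_on_compose2[OF assms]) auto

text \<open>On the circle a linear form is a combination of cis theta and cis (- theta), so
  multiplying by it shifts the index by 1 in both directions. Vanishing of all coefficients is thus
  inherited by products with polynomials.\<close>

lemma fourier_coeff_poly_mult:
  assumes "real_polynomial_function p"
  shows "continuous_on (sphere 0 1) f \<Longrightarrow> \<forall>n. fourier_coeff f n = 0 \<Longrightarrow>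
    continuous_on (sphere 0 1) (\<lambda>x. f x * of_real (p x)) \<and> (\<forall>n. fourier_coeff (\<lambda>x. f x * of_real (p x)) n = 0)"
  using assms
proof (induction p arbitrary: f rule: real_polynomial_function.induct)
  case (linear p)
  interpret p: bounded_linear p by fact
  define a b where "a = p (axis 1 1)" and "b = p (axis 2 1)"
  have pe: "p (radial \<theta>) = a * cos \<theta> + b * sin \<theta>" for \<theta> by (simp add: radial_alt p.add p.scaleR a_def b_def mult.commute)
  have c: "continuous_on (sphere 0 1) (\<lambda>x. f x * of_real (p x))"
    using linear(2) p.continuous_on[OF continuous_on_id] by (intro continuous_intros) auto
  have "fourier_coeff (\<lambda>x. f x * of_real (p x)) n = 0" for n
  proof -
    have eq: "f (radial \<theta>) * of_real (p (radial \<theta>)) * cis (of_int n * \<theta>) =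
      (of_real a / 2 - \<i> * of_real b / 2) * (f (radial \<theta>) * cis (of_int (n + 1) * \<theta>))
      + (of_real a / 2 + \<i> * of_real b / 2) * (f (radial \<theta>) * cis (of_int (n - 1) * \<theta>))" for \<theta>
    proof -
      have c1: "cis (of_int (n + 1) * \<theta>) = cis (of_int n * \<theta>) * cis \<theta>" "cis (of_int (n - 1) * \<theta>)
          = cis (of_int n * \<theta>) * cis (- \<theta>)"
        by (simp_all add: cis_mult algebra_simps)
      have pc: "of_real (p (radial \<theta>)) = (of_real a / 2 - \<i> * of_real b / 2) * cis \<theta> + (of_real a / 2
          + \<i> * of_real b / 2) * cis (- \<theta>)"
        by (simp add: pe complex_eq_iff)
      show ?thesis unfolding c1 pc by (simp add: algebra_simps)
    qed
    have "fourier_coeff (\<lambda>x. f x * of_real (p x)) n = (of_real a / 2 - \<i> * of_real b / 2) * fourier_coeff f (n + 1)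
      + (of_real a / 2 + \<i> * of_real b / 2) * fourier_coeff f (n - 1)"
      unfolding fourier_coeff_def eq integral_mult_right[symmetric]
      by (intro integral_add integrable_on_mult_right fourier_coeff_integrable linear(2))
    then show ?thesis using linear(3) by simp
  qed
  with c show ?case by blast
next
  case (const c)
  have "fourier_coeff (\<lambda>x. f x * of_real c) n = fourier_coeff f n * of_real c" for n
    unfolding fourier_coeff_def by (simp add: mult.commute mult.left_commute flip: integral_mult_right)
  then show ?case using const by (auto intro!: continuous_intros)
next
  case (add p q)
  have "fourier_coeff (\<lambda>x. f x * of_real (p x + q x)) n = fourier_coeff (\<lambda>x. f x * of_real (p x)) n
      + fourier_coeff (\<lambda>x. f x * of_real (q x)) n" for n
    unfolding fourier_coeff_def using fourier_coeff_integrable[of "\<lambda>x. f x * of_real (p x)" n] fourier_coeff_integrable[of "\<lambda>x. f x * of_real (q x)" n] add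
    by (subst integral_add[symmetric]) (auto simp: algebra_simps)
  moreover have "continuous_on (sphere 0 1) (\<lambda>x. f x * of_real (p x) + f x * of_real (q x))"
    by (rule continuous_on_add) (use add in blast)+
  ultimately show ?case using add by (simp add: distrib_left)
next
  case (mult p q)
  have "continuous_on (sphere 0 1) (\<lambda>x. (f x * of_real (p x)) * of_real (q x)) \<and> (\<forall>n. fourier_coeff (\<lambda>x. (f x * of_real (p x)) * of_real (q x)) n = 0)"
    using mult by blast
  then show ?case by (simp add: mult.assoc)
qed

text \<open>Against a polynomial the integral is the zeroth coefficient of a product and vanishes;
  polynomials are uniformly dense by Stone-Weierstrass.\<close>

lemma fourier_unique_aux:
  assumes f: "continuous_on (sphere 0 1) f" "\<forall>n. fourier_coeff f n = 0"
      and g: "continuous_on (sphere 0 1) (g :: pt \<Rightarrow> real)"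
  shows "integral {0..2*pi} (\<lambda>\<theta>. f (radial \<theta>) * of_real (g (radial \<theta>))) = 0"
proof -
  have "compact (f ` sphere 0 1)" by (intro compact_continuous_image f compact_sphere)
  then obtain B where B: "\<And>y. y \<in> sphere 0 1 \<Longrightarrow> norm (f y) \<le> B"
    using compact_imp_bounded bounded_iff by (metis imageI)
  have B0: "0 \<le> B" using B[of "radial 0"] by (auto intro: order_trans[OF norm_ge_zero])
  have "norm (integral {0..2*pi} (\<lambda>\<theta>. f (radial \<theta>) * of_real (g (radial \<theta>)))) \<le> 0 + e" if e: "0 < e" for e
  proof -
    define d where "d = e / ((B + 1) * (2 * pi))"
    have d: "0 < d" using e B0 by (simp add: d_def)
    obtain p where p: "real_polynomial_function p" "\<And>x. x \<in> sphere 0 1 \<Longrightarrow> \<bar>g x - p x\<bar> < d"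
      using Stone_Weierstrass_real_polynomial_function[OF compact_sphere g d] by blast
    have pc: "continuous_on (sphere 0 1) (\<lambda>x. f x * of_real (p x))"
        and p0: "fourier_coeff (\<lambda>x. f x * of_real (p x)) 0 = 0"
      using fourier_coeff_poly_mult[OF p(1) f] by auto
    have i1: "(\<lambda>\<theta>. f (radial \<theta>) * of_real (p (radial \<theta>))) integrable_on {0..2*pi}"
        using fourier_coeff_integrable[OF pc, of 0] by simp
    have i2: "(\<lambda>\<theta>. f (radial \<theta>) * of_real (g (radial \<theta>))) integrable_on {0..2*pi}"
      using fourier_coeff_integrable[of "\<lambda>x. f x * of_real (g x)" 0] f g by (simp add: continuous_intros)
    have "integral {0..2*pi} (\<lambda>\<theta>. f (radial \<theta>) * of_real (g (radial \<theta>)))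
        = integral {0..2*pi} (\<lambda>\<theta>. f (radial \<theta>) * of_real (g (radial \<theta>)) - f (radial \<theta>) * of_real (p (radial \<theta>)))"
      using p0 by (simp add: integral_diff[OF i2 i1] fourier_coeff_def)
    moreover have "norm \<dots> \<le> integral {0..2*pi} (\<lambda>\<theta>. B * d)"
    proof (rule integral_norm_bound_integral)
      fix \<theta> :: real
      have "norm (f (radial \<theta>) * of_real (g (radial \<theta>) - p (radial \<theta>))) \<le> B * d"
        unfolding norm_mult norm_of_real using B[of "radial \<theta>"] p(2)[of "radial \<theta>"] B0 by (intro mult_mono) auto
      then show "norm (f (radial \<theta>) * of_real (g (radial \<theta>)) - f (radial \<theta>) * of_real (p (radial \<theta>))) \<le> B * d"
          by (simp add: algebra_simps)
    qed (use i1 i2 in \<open>auto intro: integrable_diff\<close>)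
    moreover have "integral {0..2*pi} (\<lambda>\<theta>. B * d) \<le> (B + 1) * d * (2 * pi)"
      using B0 d by (simp add: algebra_simps)
    moreover have "(B + 1) * d * (2 * pi) = e" using B0 by (simp add: d_def)
    ultimately show ?thesis by simp
  qed
  then have "norm (integral {0..2*pi} (\<lambda>\<theta>. f (radial \<theta>) * of_real (g (radial \<theta>)))) \<le> 0" by (rule field_le_epsilon)
  then show ?thesis by simp
qed

lemma fourier_unique:
  assumes f: "continuous_on (sphere 0 1) f" "\<forall>n. fourier_coeff f n = 0" and \<theta>: "\<theta> \<in> {0..2*pi}"
  shows "f (radial \<theta>) = 0"
proof -
  \<comment> \<open>Used with \<open>L\<close> = Re or Im and g = L o f: testing f against g and
    applying \<open>L\<close> gives the integral of g^2.\<close>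
  have zero: "g (radial \<theta>) = 0" if g: "continuous_on (sphere 0 1) g" "\<And>x. L (f x * of_real (g x))
      = g x * g x" "bounded_linear L" for g and L :: "complex \<Rightarrow> real"
  proof -
    have i: "(\<lambda>\<theta>. f (radial \<theta>) * of_real (g (radial \<theta>))) integrable_on {0..2*pi}"
      using fourier_coeff_integrable[of "\<lambda>x. f x * of_real (g x)" 0] f g by (simp add: continuous_intros)
    have "integral {0..2*pi} (\<lambda>\<theta>. g (radial \<theta>) * g (radial \<theta>))
        = L (integral {0..2*pi} (\<lambda>\<theta>. f (radial \<theta>) * of_real (g (radial \<theta>))))"
      using integral_linear[OF i g(3)] by (simp add: o_def g(2))
    also have "\<dots> = 0" using fourier_unique_aux[OF f g(1)] linear_0 g(3) bounded_linear.linear by metis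
    finally have "integral {0..2*pi} (\<lambda>\<theta>. g (radial \<theta>) * g (radial \<theta>)) = 0" .
    moreover have "continuous_on {0..2*pi} (\<lambda>\<theta>. g (radial \<theta>) * g (radial \<theta>))"
      by (intro continuous_intros continuous_on_compose2[OF g(1)]) auto
    ultimately have "\<forall>\<theta>\<in>{0..2*pi}. g (radial \<theta>) * g (radial \<theta>) = 0"
      using integral_eq_0_iff[of 0 "2 * pi" "\<lambda>\<theta>. g (radial \<theta>) * g (radial \<theta>)"] by simp
    then show ?thesis using \<theta> by auto
  qed
  have "Re (f (radial \<theta>)) = 0" by (rule zero[where L=Re]) (use f in \<open>auto intro!: continuous_intros bounded_linear_Re\<close>)
  moreover have "Im (f (radial \<theta>)) = 0" by (rule zero[where L=Im]) (use f in \<open>auto intro!: continuous_intros bounded_linear_Im\<close>)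
  ultimately show ?thesis by (simp add: complex_eq_iff)
qed

text \<open>Before the second differentiation the angular derivative is expanded in the coordinate
  directions, because \<open>angular\<close> itself turns with theta. Its rotation produces the
  radial term.\<close>

lemma wsol_polar_derivs:
  assumes v: "wsol \<kappa> G v" "0 \<le> \<kappa>" and x: "r *\<^sub>R radial \<theta> \<in> G"
  shows "((\<lambda>\<theta>. v (r *\<^sub>R radial \<theta>)) has_vector_derivative of_real r * pd (angular \<theta>) v (r *\<^sub>R radial \<theta>)) (at \<theta> within S)"
    "((\<lambda>\<theta>. of_real r * (of_real (- sin \<theta>) * pd (axis 1 1) v (r *\<^sub>R radial \<theta>)
        + of_real (cos \<theta>) * pd (axis 2 1) v (r *\<^sub>R radial \<theta>)))
      has_vector_derivative - of_real r * pd (radial \<theta>) v (r *\<^sub>R radial \<theta>)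
        + of_real (r\<^sup>2) * pd (angular \<theta>) (pd (angular \<theta>) v) (r *\<^sub>R radial \<theta>)) (at \<theta> within S)"
proof -
  have line: "((\<lambda>\<theta>. u (r *\<^sub>R radial \<theta>)) has_vector_derivative of_real r * pd (angular \<theta>) u (r *\<^sub>R radial \<theta>)) (at \<theta> within S)"
    if u: "wsol \<kappa> G u" for u S
  proof -
    have d: "u differentiable (at (r *\<^sub>R radial \<theta>))" by (rule wsol_differentiable[OF u v(2) x])
    have "((\<lambda>\<theta>. r *\<^sub>R radial \<theta>) has_derivative (\<lambda>s. s *\<^sub>R (r *\<^sub>R angular \<theta>))) (at \<theta> within S)"
      using radial_deriv[of \<theta> S] unfolding has_vector_derivative_def
      by (auto intro!: derivative_eq_intros simp: fun_eq_iff mult.commute)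
    from has_derivative_compose[OF this has_derivative_pd[OF d]]
    have "((\<lambda>\<theta>. u (r *\<^sub>R radial \<theta>)) has_vector_derivative r *\<^sub>R pd (angular \<theta>) u (r *\<^sub>R radial \<theta>)) (at \<theta> within S)"
      by (simp add: has_vector_derivative_def pd_scale_dir[OF d])
    then show ?thesis by (simp add: scaleR_conv_of_real[where 'a=complex])
  qed
  show "((\<lambda>\<theta>. v (r *\<^sub>R radial \<theta>)) has_vector_derivative of_real r * pd (angular \<theta>) v (r *\<^sub>R radial \<theta>)) (at \<theta> within S)"
    by (rule line[OF v(1)])
  have s: "((\<lambda>\<theta>. complex_of_real (- sin \<theta>)) has_vector_derivative of_real (- cos \<theta>)) (at \<theta> within S)"
    "((\<lambda>\<theta>. complex_of_real (cos \<theta>)) has_vector_derivative of_real (- sin \<theta>)) (at \<theta> within S)"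
    by (rule has_vector_derivative_of_real; auto intro!: derivative_eq_intros simp: has_real_derivative_iff_has_vector_derivative[symmetric])+
  let ?v = "\<lambda>i. pd (axis i 1) v"
  let ?x = "r *\<^sub>R radial \<theta>"
  have w: "wsol \<kappa> G (?v i)" for i by (rule wsol_pd[OF v])
  have D: "((\<lambda>\<theta>. of_real r * (of_real (- sin \<theta>) * ?v 1 (r *\<^sub>R radial \<theta>) + of_real (cos \<theta>) * ?v 2 (r *\<^sub>R radial \<theta>)))
    has_vector_derivative of_real r * ((of_real (- sin \<theta>) * (of_real r * pd (angular \<theta>) (?v 1) ?x)
        + of_real (- cos \<theta>) * ?v 1 ?x)
      + (of_real (cos \<theta>) * (of_real r * pd (angular \<theta>) (?v 2) ?x) + of_real (- sin \<theta>) * ?v 2 ?x))) (at \<theta> within S)"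
    by (intro has_vector_derivative_mult_right has_vector_derivative_add has_vector_derivative_mult s line w)
  have p1: "pd (angular \<theta>) u ?x = of_real (- sin \<theta>) * pd (axis 1 1) u ?x + of_real (cos \<theta>) * pd (axis 2 1) u ?x"
    "pd (radial \<theta>) u ?x = of_real (cos \<theta>) * pd (axis 1 1) u ?x
        + of_real (sin \<theta>) * pd (axis 2 1) u ?x" if "wsol \<kappa> G u" for u
    using pd_decomp[OF wsol_differentiable[OF that v(2) x], of "angular \<theta>"] pd_decomp[OF wsol_differentiable[OF that v(2) x], of "radial \<theta>"]
    by (simp_all add: scaleR_conv_of_real)
  have "of_real r * ((of_real (- sin \<theta>) * (of_real r * pd (angular \<theta>) (?v 1) ?x) + of_real (- cos \<theta>) * ?v 1 ?x)
      + (of_real (cos \<theta>) * (of_real r * pd (angular \<theta>) (?v 2) ?x) + of_real (- sin \<theta>) * ?v 2 ?x))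
    = - of_real r * pd (radial \<theta>) v ?x + of_real (r\<^sup>2) * pd (angular \<theta>) (pd (angular \<theta>) v) ?x"
    unfolding p1(1)[OF w] p1(2)[OF v(1)] pd_pd_decomp[OF v x, of "angular \<theta>" "angular \<theta>"]
    by (simp add: algebra_simps power2_eq_square)
  with D show "((\<lambda>\<theta>. of_real r * (of_real (- sin \<theta>) * pd (axis 1 1) v (r *\<^sub>R radial \<theta>)
      + of_real (cos \<theta>) * pd (axis 2 1) v (r *\<^sub>R radial \<theta>)))
      has_vector_derivative - of_real r * pd (radial \<theta>) v (r *\<^sub>R radial \<theta>)
        + of_real (r\<^sup>2) * pd (angular \<theta>) (pd (angular \<theta>) v) (r *\<^sub>R radial \<theta>)) (at \<theta> within S)" by simp
qed

text \<open>Every Fourier coefficient of \<open>v\<close> on the circle of radius r solves Bessel's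
  equation in r and is o(r^(-1/2)), so \<open>rellich_ode\<close> annihilates it. Uniqueness of
  Fourier coefficients then applies on each circle.\<close>

theorem wsol_rellich:
  assumes v: "wsol \<kappa> {x. R < norm x} v" and \<kappa>: "0 < \<kappa>" and R: "0 \<le> R"
    and lim: "((\<lambda>x. of_real (sqrt (norm x)) * v x) \<longlongrightarrow> 0) at_infinity" and x: "R < norm x"
  shows "v x = 0"
proof -
  define G where "G = {x::pt. R < norm x}"
  have v: "wsol \<kappa> G v" using v by (simp add: G_def)
  have \<kappa>0: "0 \<le> \<kappa>" using \<kappa> by simp
  note cv = wsol_D(2)[OF v]
  have inG: "r *\<^sub>R radial \<theta> \<in> G" if "R < r" for r \<theta> using that R by (simp add: G_def)
  let ?I = "{0..2*pi}"
  have c1: "continuous_on ({R<..} \<times> cbox 0 (2*pi)) (\<lambda>(r, \<theta>). pd (radial \<theta>) v (r *\<^sub>R radial \<theta>))"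
    and c2: "continuous_on ({R<..} \<times> cbox 0 (2*pi)) (\<lambda>(r, \<theta>). pd (radial \<theta>) (pd (radial \<theta>) v) (r *\<^sub>R radial \<theta>))"
    and c0: "continuous_on ({R<..} \<times> cbox 0 (2*pi)) (\<lambda>(r, \<theta>). v (r *\<^sub>R radial \<theta>))"
    and c3: "continuous_on ({R<..} \<times> cbox 0 (2*pi)) (\<lambda>(r, \<theta>). pd (angular \<theta>) (pd (angular \<theta>) v) (r *\<^sub>R radial \<theta>))"
  proof -
    have c: "continuous_on ({R<..} \<times> cbox 0 (2*pi)) (\<lambda>z. u (fst z *\<^sub>R radial (snd z)))" if "wsol \<kappa> G u" for u
      by (intro continuous_on_compose2[OF wsol_D(2)[OF that]] continuous_intros) (use inG in auto)
    show "continuous_on ({R<..} \<times> cbox 0 (2*pi)) (\<lambda>(r, \<theta>). v (r *\<^sub>R radial \<theta>))"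
      using c[OF v] by (simp add: case_prod_unfold)
    note w1 = wsol_pd[OF v \<kappa>0]
    note w2 = wsol_pd[OF w1 \<kappa>0]
    have "continuous_on ({R<..} \<times> cbox 0 (2*pi)) (\<lambda>z. of_real (cos (snd z)) * pd (axis 1 1) v (fst z *\<^sub>R radial (snd z))
        + of_real (sin (snd z)) * pd (axis 2 1) v (fst z *\<^sub>R radial (snd z)))"
      by (intro continuous_on_add continuous_on_mult continuous_on_of_real continuous_on_cos continuous_on_sin continuous_on_snd continuous_on_id c[OF w1])
    then show "continuous_on ({R<..} \<times> cbox 0 (2*pi)) (\<lambda>(r, \<theta>). pd (radial \<theta>) v (r *\<^sub>R radial \<theta>))"
      by (rule continuous_on_eq)
        (use pd_decomp[OF wsol_differentiable[OF v \<kappa>0 inG], of _ "radial \<theta>" \<theta> for \<theta>] in \<open>auto simp: scaleR_conv_of_real\<close>)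
    have "continuous_on ({R<..} \<times> cbox 0 (2*pi)) (\<lambda>z. pd (a (snd z)) (pd (a (snd z)) v) (fst z *\<^sub>R radial (snd z)))"
      if a: "continuous_on ({R<..} \<times> cbox 0 (2*pi)) (\<lambda>z. a (snd z) $ 1)" "continuous_on ({R<..} \<times> cbox 0 (2*pi)) (\<lambda>z. a (snd z) $ 2)" for a
    proof (rule continuous_on_eq)
      show "continuous_on ({R<..} \<times> cbox 0 (2*pi)) (\<lambda>z.
          of_real (a (snd z) $ 1 * a (snd z) $ 1) * pd (axis 1 1) (pd (axis 1 1) v) (fst z *\<^sub>R radial (snd z))
        + of_real (a (snd z) $ 1 * a (snd z) $ 2) * pd (axis 1 1) (pd (axis 2 1) v) (fst z *\<^sub>R radial (snd z))
        + of_real (a (snd z) $ 2 * a (snd z) $ 1) * pd (axis 2 1) (pd (axis 1 1) v) (fst z *\<^sub>R radial (snd z))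
        + of_real (a (snd z) $ 2 * a (snd z) $ 2) * pd (axis 2 1) (pd (axis 2 1) v) (fst z *\<^sub>R radial (snd z)))"
        by (rule continuous_on_add continuous_on_mult continuous_on_of_real a c[OF w2])+
      show "\<dots> z = pd (a (snd z)) (pd (a (snd z)) v) (fst z *\<^sub>R radial (snd z))" if "z \<in> {R<..} \<times> cbox 0 (2*pi)" for z
        using that by (intro pd_pd_decomp[OF v \<kappa>0 inG, symmetric]) auto
    qed
    moreover have "continuous_on ({R<..} \<times> cbox 0 (2*pi)) (\<lambda>z. cos (snd z))" "continuous_on ({R<..} \<times> cbox 0 (2*pi)) (\<lambda>z. sin (snd z))"
      "continuous_on ({R<..} \<times> cbox 0 (2*pi)) (\<lambda>z. - sin (snd z))"
      by (intro continuous_intros)+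
    ultimately show "continuous_on ({R<..} \<times> cbox 0 (2*pi)) (\<lambda>(r, \<theta>). pd (radial \<theta>) (pd (radial \<theta>) v) (r *\<^sub>R radial \<theta>))"
      "continuous_on ({R<..} \<times> cbox 0 (2*pi)) (\<lambda>(r, \<theta>). pd (angular \<theta>) (pd (angular \<theta>) v) (r *\<^sub>R radial \<theta>))"
      by (simp_all add: case_prod_unfold)
  qed
  have slice: "continuous_on ?I (\<lambda>\<theta>. f r \<theta>)" if "continuous_on ({R<..} \<times> cbox 0 (2*pi)) (\<lambda>(r, \<theta>). f r \<theta>)" "R < r" for f :: "real \<Rightarrow> real \<Rightarrow> complex" and r
  proof -
    have "continuous_on ?I (\<lambda>\<theta>. (\<lambda>(r, \<theta>). f r \<theta>) (r, \<theta>))"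
      by (rule continuous_on_compose2[OF that(1)]) (use that(2) in \<open>auto intro!: continuous_intros\<close>)
    then show ?thesis by simp
  qed
  have coeff0: "fourier_coeff (\<lambda>x. v (r *\<^sub>R x)) n = 0" if r: "R < r" for r n
  proof -
    define k where "k = real_of_int n"
    define c where "c \<theta> = cis (k * \<theta>)" for \<theta>
    have cc: "continuous_on S c" for S unfolding c_def cis_conv_exp by (intro continuous_intros)
    have cD: "(c has_vector_derivative \<i> * of_real k * c \<theta>) (at \<theta> within S)" for \<theta> S
    proof -
      have "((\<lambda>\<theta>. exp (\<theta> *\<^sub>R (\<i> * of_real k))) has_vector_derivative exp (\<theta> *\<^sub>R (\<i> * of_real k)) * (\<i> * of_real k)) (at \<theta> within S)"
        by (rule exp_scaleR_has_vector_derivative_right)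
      then show ?thesis unfolding c_def cis_conv_exp by (simp add: scaleR_conv_of_real mult_ac)
    qed
    define g where "g r = integral ?I (\<lambda>\<theta>. v (r *\<^sub>R radial \<theta>) * c \<theta>)" for r
    define g1 where "g1 r = integral ?I (\<lambda>\<theta>. pd (radial \<theta>) v (r *\<^sub>R radial \<theta>) * c \<theta>)" for r
    define g2 where "g2 r = integral ?I (\<lambda>\<theta>. pd (radial \<theta>) (pd (radial \<theta>) v) (r *\<^sub>R radial \<theta>) * c \<theta>)" for r
    have int: "(\<lambda>\<theta>. f r \<theta> * c \<theta>) integrable_on ?I"
      if "continuous_on ({R<..} \<times> cbox 0 (2*pi)) (\<lambda>(r, \<theta>). f r \<theta>)" "R < r" for f r
      unfolding cbox_interval[symmetric]
      by (intro integrable_continuous continuous_intros cc) (use slice[OF that] in simp)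
    have leib: "((\<lambda>r. integral ?I (\<lambda>\<theta>. f r \<theta> * c \<theta>)) has_vector_derivative integral ?I (\<lambda>\<theta>. f' r \<theta> * c \<theta>)) (at r)"
      if r: "R < r" and f: "continuous_on ({R<..} \<times> cbox 0 (2*pi)) (\<lambda>(r, \<theta>). f r \<theta>)"
        and f': "continuous_on ({R<..} \<times> cbox 0 (2*pi)) (\<lambda>(r, \<theta>). f' r \<theta>)"
        and D: "\<And>r \<theta>. R < r \<Longrightarrow> ((\<lambda>r. f r \<theta>) has_vector_derivative f' r \<theta>) (at r)" for f f' r
    proof -
      have "((\<lambda>r. integral (cbox 0 (2*pi)) (\<lambda>\<theta>. f r \<theta> * c \<theta>)) has_vector_derivative integral (cbox 0 (2*pi)) (\<lambda>\<theta>. f' r \<theta> * c \<theta>)) (at r within {R<..})"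
      proof (rule leibniz_rule_vector_derivative)
        fix s \<theta> assume "s \<in> {R<..}"
        then have "R < s" by simp
        then show "((\<lambda>r. f r \<theta> * c \<theta>) has_vector_derivative f' s \<theta> * c \<theta>) (at s within {R<..})"
          using has_vector_derivative_mult_left[OF has_vector_derivative_at_within[OF D]] by blast
        show "(\<lambda>\<theta>. f s \<theta> * c \<theta>) integrable_on cbox 0 (2*pi)" using int[OF f] \<open>s \<in> {R<..}\<close> by simp
      next
        have "continuous_on ({R<..} \<times> cbox 0 (2*pi)) (\<lambda>z. (\<lambda>(r, \<theta>). f' r \<theta>) z * c (snd z))"
          by (intro continuous_intros f' continuous_on_compose2[OF cc[of UNIV]]) auto
        then show "continuous_on ({R<..} \<times> cbox 0 (2*pi)) (\<lambda>(r, \<theta>). f' r \<theta> * c \<theta>)" by (simp add: case_prod_unfold)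
      qed (use r in auto)
      moreover have "at r within {R<..} = at r" by (rule at_within_open) (use r in auto)
      ultimately show ?thesis by simp
    qed
    have g1D: "(g has_vector_derivative g1 r) (at r)" if "R < r" for r unfolding g_def[abs_def] g1_def
    proof (rule leib[OF that c0 c1])
      fix r \<theta> assume "R < r"
      then show "((\<lambda>r. v (r *\<^sub>R radial \<theta>)) has_vector_derivative pd (radial \<theta>) v (r *\<^sub>R radial \<theta>)) (at r)"
        using has_vector_derivative_line[of v 0 r "radial \<theta>"] wsol_differentiable[OF v \<kappa>0 inG] by simp
    qed
    have g2D: "(g1 has_vector_derivative g2 r) (at r)" if "R < r" for r unfolding g1_def[abs_def] g2_def
    proof (rule leib[OF that c1 c2])
      fix r \<theta> assume "R < r"
      then show "((\<lambda>r. pd (radial \<theta>) v (r *\<^sub>R radial \<theta>)) has_vector_derivative pd (radial \<theta>) (pd (radial \<theta>) v) (r *\<^sub>R radial \<theta>)) (at r)"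
        using has_vector_derivative_line[of "pd (radial \<theta>) v" 0 r "radial \<theta>"] wsol_differentiable[OF wsol_pd[OF v \<kappa>0] \<kappa>0 inG] by simp
    qed
    \<comment> \<open>Moving both angular derivatives onto the exponential \<open>c\<close> produces
      the factor - k^2; the Helmholtz equation in the polar frame eliminates the second angular
      derivative.\<close>
    have ode: "of_real (r\<^sup>2) * g2 r + of_real r * g1 r + of_real (\<kappa>\<^sup>2 * r\<^sup>2 - k\<^sup>2) * g r = 0" if r: "R < r" for r
    proof -
      define V where "V \<theta> = v (r *\<^sub>R radial \<theta>)" for \<theta>
      define W where "W \<theta> = of_real r * (of_real (- sin \<theta>) * pd (axis 1 1) v (r *\<^sub>R radial \<theta>)
          + of_real (cos \<theta>) * pd (axis 2 1) v (r *\<^sub>R radial \<theta>))" for \<theta>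
      define W' where "W' \<theta> = - of_real r * pd (radial \<theta>) v (r *\<^sub>R radial \<theta>)
          + of_real (r\<^sup>2) * pd (angular \<theta>) (pd (angular \<theta>) v) (r *\<^sub>R radial \<theta>)" for \<theta>
      have VD: "(V has_vector_derivative W \<theta>) (at \<theta> within S)" for \<theta> S
      proof -
        have "of_real r * pd (angular \<theta>) v (r *\<^sub>R radial \<theta>) = W \<theta>"
          using pd_decomp[OF wsol_differentiable[OF v \<kappa>0 inG[OF r]], of "angular \<theta>" \<theta>]
              by (simp add: W_def scaleR_conv_of_real)
        then show ?thesis using wsol_polar_derivs(1)[OF v \<kappa>0 inG[OF r], of \<theta> S] by (simp add: V_def[abs_def])
      qed
      have WD: "(W has_vector_derivative W' \<theta>) (at \<theta> within S)" for \<theta> S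
        unfolding W_def[abs_def] W'_def by (rule wsol_polar_derivs(2)[OF v \<kappa>0 inG[OF r]])
      \<comment> \<open>The antiderivative is W c - V c'. Its values at 0 and 2 pi agree because n
        is an integer.\<close>
      have "((\<lambda>\<theta>. W' \<theta> * c \<theta> + of_real (k\<^sup>2) * (V \<theta> * c \<theta>)) has_integral
          (W (2*pi) * c (2*pi) - V (2*pi) * (\<i> * of_real k * c (2*pi))) - (W 0 * c 0 - V 0 * (\<i> * of_real k * c 0))) ?I"
      proof (rule fundamental_theorem_of_calculus)
        fix \<theta> :: real
        have "((\<lambda>\<theta>. W \<theta> * c \<theta> - V \<theta> * (\<i> * of_real k * c \<theta>)) has_vector_derivative
          (W \<theta> * (\<i> * of_real k * c \<theta>) + W' \<theta> * c \<theta>) - (V \<theta> * (\<i> * of_real k * (\<i> * of_real k * c \<theta>))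
              + W \<theta> * (\<i> * of_real k * c \<theta>))) (at \<theta> within ?I)"
          by (intro has_vector_derivative_diff has_vector_derivative_mult has_vector_derivative_mult_right VD WD cD)
        moreover have "(W \<theta> * (\<i> * of_real k * c \<theta>) + W' \<theta> * c \<theta>) - (V \<theta> * (\<i> * of_real k * (\<i> * of_real k * c \<theta>))
            + W \<theta> * (\<i> * of_real k * c \<theta>))
           = W' \<theta> * c \<theta> + of_real (k\<^sup>2) * (V \<theta> * c \<theta>)"
          by (simp add: algebra_simps power2_eq_square)
        ultimately show "((\<lambda>\<theta>. W \<theta> * c \<theta> - V \<theta> * (\<i> * of_real k * c \<theta>)) has_vector_derivative
          W' \<theta> * c \<theta> + of_real (k\<^sup>2) * (V \<theta> * c \<theta>)) (at \<theta> within ?I)" by simp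
      qed simp
      moreover have "c (2*pi) = c 0"
        using cis_multiple_2pi[of k] by (simp add: c_def k_def mult_ac)
      moreover have "radial (2*pi) = radial 0" by (simp add: vec_eq_iff forall_2)
      then have "V (2*pi) = V 0" "W (2*pi) = W 0" by (simp_all add: V_def W_def)
      ultimately have "((\<lambda>\<theta>. W' \<theta> * c \<theta> + of_real (k\<^sup>2) * (V \<theta> * c \<theta>)) has_integral 0) ?I" by simp
      then have z: "integral ?I (\<lambda>\<theta>. W' \<theta> * c \<theta> + of_real (k\<^sup>2) * (V \<theta> * c \<theta>)) = 0" by (rule integral_unique)
      define pf where "pf = integral ?I (\<lambda>\<theta>. pd (angular \<theta>) (pd (angular \<theta>) v) (r *\<^sub>R radial \<theta>) * c \<theta>)"
      note i0 = int[OF c0 r] and i1 = int[OF c1 r] and i2 = int[OF c2 r] and i3 = int[OF c3 r]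
      have "(\<lambda>\<theta>. W' \<theta> * c \<theta> + of_real (k\<^sup>2) * (V \<theta> * c \<theta>)) =
        (\<lambda>\<theta>. (- of_real r) * (pd (radial \<theta>) v (r *\<^sub>R radial \<theta>) * c \<theta>)
            + of_real (r\<^sup>2) * (pd (angular \<theta>) (pd (angular \<theta>) v) (r *\<^sub>R radial \<theta>) * c \<theta>)
          + of_real (k\<^sup>2) * (v (r *\<^sub>R radial \<theta>) * c \<theta>))"
        by (rule ext) (simp add: W'_def V_def algebra_simps)
      with z have z': "- of_real r * g1 r + of_real (r\<^sup>2) * pf + of_real (k\<^sup>2) * g r = 0"
        unfolding g_def g1_def pf_def
        by (simp only: integral_add[OF integrable_add[OF integrable_on_mult_right[OF i1] integrable_on_mult_right[OF i3]] integrable_on_mult_right[OF i0]]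
            integral_add[OF integrable_on_mult_right[OF i1] integrable_on_mult_right[OF i3]] integral_mult_right)
      have "g2 r + pf = integral ?I (\<lambda>\<theta>. (- of_real (\<kappa>\<^sup>2)) * (v (r *\<^sub>R radial \<theta>) * c \<theta>))"
        unfolding g2_def pf_def integral_add[OF i2 i3, symmetric]
      proof (rule integral_cong)
        fix \<theta>
        have "pd (radial \<theta>) (pd (radial \<theta>) v) (r *\<^sub>R radial \<theta>) + pd (angular \<theta>) (pd (angular \<theta>) v) (r *\<^sub>R radial \<theta>)
            = - of_real (\<kappa>\<^sup>2) * v (r *\<^sub>R radial \<theta>)"
          by (rule helmholtz_orthonormal[OF v \<kappa>0 inG[OF r]]) simp_all
        then show "pd (radial \<theta>) (pd (radial \<theta>) v) (r *\<^sub>R radial \<theta>) * c \<theta>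
            + pd (angular \<theta>) (pd (angular \<theta>) v) (r *\<^sub>R radial \<theta>) * c \<theta>
            = - of_real (\<kappa>\<^sup>2) * (v (r *\<^sub>R radial \<theta>) * c \<theta>)" by (simp add: distrib_right[symmetric] mult.assoc)
      qed
      then have "g2 r + pf = - of_real (\<kappa>\<^sup>2) * g r" unfolding g_def integral_mult_right .
      then have pf: "pf = - of_real (\<kappa>\<^sup>2) * g r - g2 r" by (simp add: algebra_simps)
      show ?thesis using z' unfolding pf by (simp add: algebra_simps)
    qed
    have "((\<lambda>r. of_real (sqrt r) * g r) \<longlongrightarrow> 0) at_top"
    proof (rule tendstoI)
      fix e :: real assume e: "0 < e"
      have "\<forall>\<^sub>F x in at_infinity. norm (of_real (sqrt (norm x)) * v x) < e / (4 * pi)"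
        using tendstoD[OF lim, of "e / (4 * pi)"] e by simp
      then obtain b where b: "\<And>x. b \<le> norm x \<Longrightarrow> norm (of_real (sqrt (norm x)) * v x) < e / (4 * pi)"
        unfolding eventually_at_infinity by blast
      have "dist (of_real (sqrt r) * g r) 0 < e" if r: "max b (R + 1) \<le> r" for r
      proof -
        have r': "R < r" "0 \<le> r" "b \<le> r" using r R by auto
        have "of_real (sqrt r) * g r = integral ?I (\<lambda>\<theta>. of_real (sqrt r) * (v (r *\<^sub>R radial \<theta>) * c \<theta>))"
          unfolding g_def by simp
        also have "norm \<dots> \<le> integral ?I (\<lambda>\<theta>. e / (4 * pi))"
        proof (rule integral_norm_bound_integral)
          show "(\<lambda>\<theta>. of_real (sqrt r) * (v (r *\<^sub>R radial \<theta>) * c \<theta>)) integrable_on ?I"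
            by (intro integrable_on_mult_right int[OF c0 r'(1)])
          fix \<theta> :: real
          show "norm (of_real (sqrt r) * (v (r *\<^sub>R radial \<theta>) * c \<theta>)) \<le> e / (4 * pi)"
            using b[of "r *\<^sub>R radial \<theta>"] r' by (simp add: norm_mult c_def)
        qed (rule integrable_const_ivl)
        also have "\<dots> = e / 2" by simp
        finally show ?thesis using e by simp
      qed
      then show "\<forall>\<^sub>F r in at_top. dist (of_real (sqrt r) * g r) 0 < e" unfolding eventually_at_top_linorder by blast
    qed
    from rellich_ode[OF R \<kappa> g1D g2D ode this r] have "g r = 0" by simp
    then show ?thesis by (simp add: fourier_coeff_def g_def c_def k_def)
  qed
  obtain \<theta> where \<theta>: "\<theta> \<in> ?I" "x = norm x *\<^sub>R radial \<theta>" using polar_coords[of x] by blast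
  have "continuous_on (sphere 0 1) (\<lambda>y. v (norm x *\<^sub>R y))"
    by (intro continuous_on_compose2[OF cv] continuous_intros) (use x R in \<open>auto simp: G_def\<close>)
  then have "v (norm x *\<^sub>R radial \<theta>) = 0" by (rule fourier_unique) (use coeff0[OF x] \<theta> in auto)
  then show ?thesis using \<theta> by simp
qed

section \<open>The TE scattering problem\<close>

text \<open>The inequality |f| <= 1 + |f|^2 makes locally square integrable functions locally
  integrable.\<close>

lemma L2_loc_integrable_mult:
  fixes f g :: "pt \<Rightarrow> complex"
  assumes f: "L2_loc f" and g: "continuous_on UNIV g" and K: "compact K" "\<And>x. x \<notin> K \<Longrightarrow> g x = 0"
  shows "integrable lborel (\<lambda>x. f x * g x)"
proof -
  have [measurable]: "f \<in> borel_measurable lborel" using f by (simp add: L2_loc_def)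
  have [measurable]: "g \<in> borel_measurable lborel" using borel_measurable_continuous_onI[OF g] by simp
  have si: "set_integrable lborel K (\<lambda>x. (norm (f x))\<^sup>2)" using f K(1) by (simp add: L2_loc_def)
  have "compact (g ` K)" by (intro compact_continuous_image K continuous_on_subset[OF g]) auto
  then obtain B where B: "\<And>y. y \<in> K \<Longrightarrow> norm (g y) \<le> B"
    using compact_imp_bounded bounded_iff by (metis imageI)
  have i1: "integrable lborel (indicator K :: pt \<Rightarrow> real)"
    using K(1) by (intro integrable_real_indicator) (use emeasure_compact_finite borel_closed[OF compact_imp_closed[OF K(1)]] in auto)
  have i2: "integrable lborel (\<lambda>x. \<bar>B\<bar> * (indicator K x + indicator K x *\<^sub>R (norm (f x))\<^sup>2))"
    using i1 si unfolding set_integrable_def by (intro integrable_mult_right Bochner_Integration.integrable_add)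
  show ?thesis
  proof (rule Bochner_Integration.integrable_bound[OF i2])
    show "AE x in lborel. norm (f x * g x) \<le> norm (\<bar>B\<bar> * (indicator K x + indicator K x *\<^sub>R (norm (f x))\<^sup>2))"
    proof (rule AE_I2)
      fix x show "norm (f x * g x) \<le> norm (\<bar>B\<bar> * (indicator K x + indicator K x *\<^sub>R (norm (f x))\<^sup>2))"
      proof (cases "x \<in> K")
        case True
        have "norm (f x) \<le> 1 + (norm (f x))\<^sup>2"
        proof -
          have "0 \<le> (norm (f x) - 1)\<^sup>2" by simp
          then have "2 * norm (f x) \<le> 1 + (norm (f x))\<^sup>2" by (simp add: power2_diff)
          then show ?thesis using norm_ge_zero[of "f x"] by linarith
        qed
        then have "norm (f x) * norm (g x) \<le> (1 + (norm (f x))\<^sup>2) * \<bar>B\<bar>" using B[OF True] by (intro mult_mono) auto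
        then show ?thesis using True by (simp add: norm_mult mult.commute)
      qed (simp add: K)
    qed
  qed simp
qed

lemma TE_D:
  assumes "TE_total_field \<kappa> d q0 D u w"
  shows "L2_loc (\<lambda>x. u x $ 1)" "L2_loc (\<lambda>x. u x $ 2)" "L2_loc w"
    "continuous_on (- closure D) u" "continuous_on (- closure D) w"
    "\<And>\<phi>. test_fn \<phi> \<Longrightarrow> (\<integral>x. w x * of_real (\<phi> x) \<partial>lborel) =
        (\<integral>x. u x $ 1 * of_real (pd (axis 2 1) \<phi> x) - u x $ 2 * of_real (pd (axis 1 1) \<phi> x) \<partial>lborel)"
    "\<And>\<psi>1 \<psi>2. test_fn \<psi>1 \<Longrightarrow> test_fn \<psi>2 \<Longrightarrow>
        (\<integral>x. w x * of_real (pd (axis 1 1) \<psi>2 x - pd (axis 2 1) \<psi>1 x)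
             - complex_of_real (\<kappa>\<^sup>2) * coeff_q q0 D x *
               (u x $ 1 * of_real (\<psi>1 x) + u x $ 2 * of_real (\<psi>2 x)) \<partial>lborel) = 0"
  using assms unfolding TE_total_field_def H1_loc_def dpart_eq_pd by blast+

lemma test_fn_uminus:
  assumes "test_fn \<phi>"
  shows "test_fn (\<lambda>x. - \<phi> x)" "pd e (\<lambda>x. - \<phi> x) x = - pd e \<phi> x"
proof -
  have d: "\<phi> differentiable (at x)" for x using assms by (simp add: test_fn_iff C1_on_def)
  have p: "pd e (\<lambda>x. - \<phi> x) x = - pd e \<phi> x" for e x
    by (rule pd_eqI) (rule has_derivative_minus[OF has_derivative_pd[OF d]])
  show "pd e (\<lambda>x. - \<phi> x) x = - pd e \<phi> x" by (rule p)
  have "supp (\<lambda>x. - \<phi> x) = supp \<phi>" by (simp add: supp_def)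
  then show "test_fn (\<lambda>x. - \<phi> x)"
    using assms d by (auto simp: test_fn_iff C1_on_def p[abs_def] intro!: continuous_intros derivative_intros)
qed

lemma test_fn_zero: "test_fn (\<lambda>_. 0)" "pd e (\<lambda>_. 0::real) x = 0"
proof -
  have p: "pd e (\<lambda>_. 0::real) x = 0" for e x by (rule pd_eqI) simp
  then show "pd e (\<lambda>_. 0::real) x = 0" .
  show "test_fn (\<lambda>_. 0)" by (auto simp: test_fn_iff C1_on_def supp_def p[abs_def])
qed

text \<open>The rotated gradient of a scalar test function is an admissible vector test field; this turns
  the system for \<open>(u, w)\<close> into a scalar equation for \<open>w\<close>.\<close>

lemma TE_scalar:
  assumes TE: "TE_total_field \<kappa> d q0 D u w" and \<phi>: "test_fn2 \<phi>"
  shows "(\<integral>x. w x * of_real (lap \<phi> x) + complex_of_real (\<kappa>\<^sup>2) * coeff_q q0 D x *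
      (u x $ 1 * of_real (pd (axis 2 1) \<phi> x) - u x $ 2 * of_real (pd (axis 1 1) \<phi> x)) \<partial>lborel) = 0"
proof -
  let ?\<psi> = "\<lambda>x. - pd (axis 1 1) \<phi> x"
  have "(\<integral>x. w x * of_real (lap \<phi> x) + complex_of_real (\<kappa>\<^sup>2) * coeff_q q0 D x *
      (u x $ 1 * of_real (pd (axis 2 1) \<phi> x) - u x $ 2 * of_real (pd (axis 1 1) \<phi> x)) \<partial>lborel)
    = (\<integral>x. - (w x * of_real (pd (axis 1 1) ?\<psi> x - pd (axis 2 1) (pd (axis 2 1) \<phi>) x)
             - complex_of_real (\<kappa>\<^sup>2) * coeff_q q0 D x *
               (u x $ 1 * of_real (pd (axis 2 1) \<phi> x) + u x $ 2 * of_real (?\<psi> x))) \<partial>lborel)"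
    by (intro Bochner_Integration.integral_cong refl)
      (simp add: test_fn_uminus(2)[OF test_fn2_D(9)[OF \<phi>]] lap_def algebra_simps)
  also have "\<dots> = 0"
    unfolding Bochner_Integration.integral_minus neg_equal_0_iff_equal
    by (rule TE_D(7)[OF TE test_fn2_D(9)[OF \<phi>] test_fn_uminus(1)[OF test_fn2_D(9)[OF \<phi>]]])
  finally show ?thesis .
qed

lemma coeff_q_outside: "x \<notin> closure D \<Longrightarrow> coeff_q q0 D x = 1"
  by (simp add: coeff_q_def)

text \<open>Where the coefficient is 1, the weak relation between \<open>u\<close> and its curl
  converts the integral of \<open>u\<close> against the rotated gradient into that of
  \<open>w\<close> against the test function.\<close>

lemma TE_wsol:
  assumes TE: "TE_total_field \<kappa> d q0 D u w"
  shows "wsol \<kappa> (- closure D) w"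
  unfolding wsol_def
proof (intro conjI allI impI)
  show "open (- closure D)" "continuous_on (- closure D) w" using TE_D(5)[OF TE] by auto
  fix \<phi> assume "test_fn2 \<phi> \<and> supp \<phi> \<subseteq> - closure D"
  then have \<phi>: "test_fn2 \<phi>" and s: "supp \<phi> \<subseteq> - closure D" by auto
  note K = test_fn2_D(1)[OF \<phi>]
  have iu: "integrable lborel (\<lambda>x. u x $ i * of_real (pd e \<phi> x))" if "i = 1 \<or> i = 2" for i e
  proof -
    have "L2_loc (\<lambda>x. u x $ i)" using TE_D(1,2)[OF TE] that by auto
    then show ?thesis
      by (rule L2_loc_integrable_mult[OF _ _ K]) (auto intro!: continuous_intros test_fn2_D(5)[OF \<phi>] simp: pd_outside_supp)
  qed
  have iw: "integrable lborel (\<lambda>x. w x * of_real (g x))" if "continuous_on UNIV g" "\<And>x. x \<notin> supp \<phi> \<Longrightarrow> g x = 0" for g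
    by (rule L2_loc_integrable_mult[OF TE_D(3)[OF TE] _ K]) (use that in \<open>auto intro!: continuous_intros\<close>)
  let ?u = "\<lambda>x. u x $ 1 * complex_of_real (pd (axis 2 1) \<phi> x) - u x $ 2 * complex_of_real (pd (axis 1 1) \<phi> x)"
  have "0 = (\<integral>x. w x * of_real (lap \<phi> x) + complex_of_real (\<kappa>\<^sup>2) * coeff_q q0 D x * ?u x \<partial>lborel)"
    using TE_scalar[OF TE \<phi>] by simp
  also have "\<dots> = (\<integral>x. w x * of_real (lap \<phi> x) + complex_of_real (\<kappa>\<^sup>2) * ?u x \<partial>lborel)"
  proof (intro Bochner_Integration.integral_cong refl)
    fix x
    show "w x * of_real (lap \<phi> x) + complex_of_real (\<kappa>\<^sup>2) * coeff_q q0 D x * ?u x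
        = w x * of_real (lap \<phi> x) + complex_of_real (\<kappa>\<^sup>2) * ?u x"
      by (cases "x \<in> supp \<phi>") (use s in \<open>auto simp: coeff_q_outside pd_outside_supp\<close>)
  qed
  also have "\<dots> = (\<integral>x. w x * of_real (lap \<phi> x) \<partial>lborel) + of_real (\<kappa>\<^sup>2) * (\<integral>x. ?u x \<partial>lborel)"
    using iw[OF test_fn2_D(7)[OF \<phi>]] iu by (simp add: lap_outside_supp)
  also have "(\<integral>x. ?u x \<partial>lborel) = (\<integral>x. w x * of_real (\<phi> x) \<partial>lborel)"
    using TE_D(6)[OF TE test_fn2_D(8)[OF \<phi>]] by simp
  also have "(\<integral>x. w x * of_real (lap \<phi> x) \<partial>lborel) + of_real (\<kappa>\<^sup>2) * (\<integral>x. w x * of_real (\<phi> x) \<partial>lborel)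
      = (\<integral>x. w x * of_real (lap \<phi> x) + of_real (\<kappa>\<^sup>2) * (w x * of_real (\<phi> x)) \<partial>lborel)"
    using iw[OF test_fn2_D(7)[OF \<phi>]] iw[OF test_fn2_D(3)[OF \<phi>]] by (simp add: lap_outside_supp supp_eq_0)
  also have "\<dots> = (\<integral>x. w x * of_real (lap \<phi> x + \<kappa>\<^sup>2 * \<phi> x) \<partial>lborel)"
    by (intro Bochner_Integration.integral_cong refl) (simp add: algebra_simps)
  finally show "(\<integral>x. w x * of_real (lap \<phi> x + \<kappa>\<^sup>2 * \<phi> x) \<partial>lborel) = 0" by simp
qed

text \<open>The curl equation in strong form. Vector test fields with only one nonzero component
  separate the two coordinates of \<open>u\<close>.\<close>

lemma TE_field_eq:
  assumes TE: "TE_total_field \<kappa> d q0 D u w" and \<kappa>: "0 \<le> \<kappa>" and x: "x \<notin> closure D"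
  shows "of_real (\<kappa>\<^sup>2) * u x $ 1 = pd (axis 2 1) w x" "of_real (\<kappa>\<^sup>2) * u x $ 2 = - pd (axis 1 1) w x"
proof -
  let ?G = "- closure D"
  note v = TE_wsol[OF TE]
  note C1 = wsol_C1[OF v \<kappa>]
  have oG: "open ?G" by auto
  have cu: "continuous_on ?G (\<lambda>x. u x $ i)" for i using TE_D(4)[OF TE] by (intro continuous_intros)
  have cw: "continuous_on ?G (pd e w)" for e using C1 by (simp add: C1_on_def)
  have i: "integrable lborel (\<lambda>x. f x * complex_of_real (g x))"
    if "test_fn2 \<phi>" "supp \<phi> \<subseteq> ?G" "continuous_on ?G f" "continuous_on UNIV g" "\<And>x. x \<notin> supp \<phi> \<Longrightarrow> g x = 0" for f g \<phi>
    by (rule integrable_mult_test(2)[OF oG that(3) _ test_fn2_D(1)[OF that(1)] that(2)])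
      (use that in \<open>auto intro!: continuous_intros continuous_on_subset[OF that(4)]\<close>)
  have ibp: "(\<integral>x. w x * of_real (pd e \<phi> x) \<partial>lborel) = - (\<integral>x. pd e w x * of_real (\<phi> x) \<partial>lborel)"
    if "test_fn2 \<phi>" "supp \<phi> \<subseteq> ?G" for \<phi> e
    using integration_by_parts[OF oG C1 test_fn2_D(8)[OF that(1)] that(2), of e] by simp
  have "pd (axis 2 1) w x - of_real (\<kappa>\<^sup>2) * u x $ 1 = 0"
  proof (rule bump_test_zero[OF oG])
    show "continuous_on ?G (\<lambda>x. pd (axis 2 1) w x - of_real (\<kappa>\<^sup>2) * u x $ 1)" by (intro continuous_intros cw cu)
    fix \<phi> assume \<phi>: "test_fn2 \<phi>" "supp \<phi> \<subseteq> ?G"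
    have "0 = (\<integral>x. w x * of_real (0 - pd (axis 2 1) \<phi> x) - complex_of_real (\<kappa>\<^sup>2) * coeff_q q0 D x *
               (u x $ 1 * of_real (\<phi> x) + u x $ 2 * of_real 0) \<partial>lborel)"
      using TE_D(7)[OF TE test_fn2_D(8)[OF \<phi>(1)] test_fn_zero(1)] unfolding test_fn_zero(2) by simp
    also have "\<dots> = (\<integral>x. - (w x * of_real (pd (axis 2 1) \<phi> x))
        - complex_of_real (\<kappa>\<^sup>2) * (u x $ 1 * of_real (\<phi> x)) \<partial>lborel)"
    proof (intro Bochner_Integration.integral_cong refl)
      fix x show "w x * of_real (0 - pd (axis 2 1) \<phi> x) - complex_of_real (\<kappa>\<^sup>2) * coeff_q q0 D x *
               (u x $ 1 * of_real (\<phi> x) + u x $ 2 * of_real 0)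
                   = - (w x * of_real (pd (axis 2 1) \<phi> x)) - complex_of_real (\<kappa>\<^sup>2) * (u x $ 1 * of_real (\<phi> x))"
        by (cases "x \<in> supp \<phi>") (use \<phi> in \<open>auto simp: coeff_q_outside supp_eq_0\<close>)
    qed
    also have "\<dots> = (\<integral>x. pd (axis 2 1) w x * of_real (\<phi> x) \<partial>lborel)
        - of_real (\<kappa>\<^sup>2) * (\<integral>x. u x $ 1 * of_real (\<phi> x) \<partial>lborel)"
      using i[OF \<phi> wsol_D(2)[OF v] test_fn2_D(5)[OF \<phi>(1)]] i[OF \<phi> cu test_fn2_D(3)[OF \<phi>(1)]] ibp[OF \<phi>]
      by (simp add: pd_outside_supp supp_eq_0)
    also have "\<dots> = (\<integral>x. pd (axis 2 1) w x * of_real (\<phi> x) - of_real (\<kappa>\<^sup>2) * (u x $ 1 * of_real (\<phi> x)) \<partial>lborel)"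
      using i[OF \<phi> cw test_fn2_D(3)[OF \<phi>(1)]] i[OF \<phi> cu test_fn2_D(3)[OF \<phi>(1)]] by (simp add: supp_eq_0)
    finally show "(\<integral>x. (pd (axis 2 1) w x - of_real (\<kappa>\<^sup>2) * u x $ 1) * of_real (\<phi> x) \<partial>lborel) = 0"
      by (simp add: algebra_simps)
  qed (use x in auto)
  then show "of_real (\<kappa>\<^sup>2) * u x $ 1 = pd (axis 2 1) w x" by simp
  have "- pd (axis 1 1) w x - of_real (\<kappa>\<^sup>2) * u x $ 2 = 0"
  proof (rule bump_test_zero[OF oG])
    show "continuous_on ?G (\<lambda>x. - pd (axis 1 1) w x - of_real (\<kappa>\<^sup>2) * u x $ 2)" by (intro continuous_intros cw cu)
    fix \<phi> assume \<phi>: "test_fn2 \<phi>" "supp \<phi> \<subseteq> ?G"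
    have "0 = (\<integral>x. w x * of_real (pd (axis 1 1) \<phi> x - 0) - complex_of_real (\<kappa>\<^sup>2) * coeff_q q0 D x *
               (u x $ 1 * of_real 0 + u x $ 2 * of_real (\<phi> x)) \<partial>lborel)"
      using TE_D(7)[OF TE test_fn_zero(1) test_fn2_D(8)[OF \<phi>(1)]] unfolding test_fn_zero(2) by simp
    also have "\<dots> = (\<integral>x. w x * of_real (pd (axis 1 1) \<phi> x) - complex_of_real (\<kappa>\<^sup>2) * (u x $ 2 * of_real (\<phi> x)) \<partial>lborel)"
    proof (intro Bochner_Integration.integral_cong refl)
      fix x show "w x * of_real (pd (axis 1 1) \<phi> x - 0) - complex_of_real (\<kappa>\<^sup>2) * coeff_q q0 D x *
               (u x $ 1 * of_real 0 + u x $ 2 * of_real (\<phi> x))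
                   = w x * of_real (pd (axis 1 1) \<phi> x) - complex_of_real (\<kappa>\<^sup>2) * (u x $ 2 * of_real (\<phi> x))"
        by (cases "x \<in> supp \<phi>") (use \<phi> in \<open>auto simp: coeff_q_outside supp_eq_0\<close>)
    qed
    also have "\<dots> = - (\<integral>x. pd (axis 1 1) w x * of_real (\<phi> x) \<partial>lborel)
        - of_real (\<kappa>\<^sup>2) * (\<integral>x. u x $ 2 * of_real (\<phi> x) \<partial>lborel)"
      using i[OF \<phi> wsol_D(2)[OF v] test_fn2_D(5)[OF \<phi>(1)]] i[OF \<phi> cu test_fn2_D(3)[OF \<phi>(1)]] ibp[OF \<phi>]
      by (simp add: pd_outside_supp supp_eq_0)
    also have "\<dots> = (\<integral>x. - (pd (axis 1 1) w x * of_real (\<phi> x)) - of_real (\<kappa>\<^sup>2) * (u x $ 2 * of_real (\<phi> x)) \<partial>lborel)"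
      using i[OF \<phi> cw test_fn2_D(3)[OF \<phi>(1)]] i[OF \<phi> cu test_fn2_D(3)[OF \<phi>(1)]] by (simp add: supp_eq_0)
    finally show "(\<integral>x. (- pd (axis 1 1) w x - of_real (\<kappa>\<^sup>2) * u x $ 2) * of_real (\<phi> x) \<partial>lborel) = 0"
      by (simp add: algebra_simps)
  qed (use x in auto)
  then show "of_real (\<kappa>\<^sup>2) * u x $ 2 = - pd (axis 1 1) w x" by (simp add: algebra_simps)
qed

section \<open>Far field and radiation condition\<close>

definition far_bound :: "real \<Rightarrow> pt \<Rightarrow> (pt \<Rightarrow> complex ^ 2) \<Rightarrow> (pt \<Rightarrow> complex) \<Rightarrow> bool" where
  "far_bound \<kappa> d u uinf \<longleftrightarrow> (\<exists>C R. \<forall>x. norm x \<ge> R \<longrightarrow>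
           norm ((\<chi> j. u x $ j - u_in \<kappa> d x $ j)
                 - ((exp (\<i> * complex_of_real (\<kappa> * norm x)) / complex_of_real (sqrt (norm x))
                     * uinf (x /\<^sub>R norm x))
                    *s (\<chi> j. complex_of_real (perp (x /\<^sub>R norm x) $ j))))
           \<le> C / (norm x) powr (3/2))"

lemma is_far_field_iff:
  "is_far_field \<kappa> d q0 D uinf \<longleftrightarrow> (\<exists>u w. TE_total_field \<kappa> d q0 D u w \<and> far_bound \<kappa> d u uinf)"
  by (simp add: is_far_field_def far_bound_def)

definition radiation_defect :: "real \<Rightarrow> pt \<Rightarrow> (pt \<Rightarrow> complex ^ 2) \<Rightarrow> (pt \<Rightarrow> complex) \<Rightarrow> pt \<Rightarrow> complex" where
  "radiation_defect \<kappa> d u w x = complex_of_real (sqrt (norm x)) *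
          ((w x - curl_u_in \<kappa> d x)
           - \<i> * complex_of_real \<kappa> *
             (\<Sum>j\<in>UNIV. (u x $ j - u_in \<kappa> d x $ j) *
                 complex_of_real (perp (x /\<^sub>R norm x) $ j)))"

lemma TE_radiation_defect: "TE_total_field \<kappa> d q0 D u w \<Longrightarrow> (radiation_defect \<kappa> d u w \<longlongrightarrow> 0) at_infinity"
  unfolding TE_total_field_def radiation_defect_def[abs_def] by blast

lemma norm_perp: "norm (perp a) = norm a"
  by (simp add: perp_def norm_vec_def L2_set_def sum_2 add.commute)

lemma norm_sum_perp:
  fixes a :: "complex ^ 2"
  assumes "norm p = 1"
  shows "norm (\<Sum>j\<in>UNIV. a $ j * complex_of_real (perp p $ j)) \<le> 2 * norm a"
proof -
  have c: "\<bar>perp p $ j\<bar> \<le> 1" for j using component_le_norm_cart[of "perp p" j] by (simp add: norm_perp assms)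
  have "norm (a $ j * complex_of_real (perp p $ j)) \<le> norm a * 1" for j
    unfolding norm_mult norm_of_real by (intro mult_mono c Finite_Cartesian_Product.norm_nth_le) auto
  then have "norm (\<Sum>j\<in>UNIV. a $ j * complex_of_real (perp p $ j)) \<le> (\<Sum>j\<in>(UNIV::2 set). norm a * 1)"
    by (intro sum_norm_le) auto
  then show ?thesis by simp
qed

lemma norm_vec_perp: "norm (\<chi> j. complex_of_real (perp p $ j)) = norm p"
  by (simp add: norm_perp[symmetric, of p]) (simp add: norm_vec_def L2_set_def)

lemma norm_cscale: "norm (c *s (a :: complex ^ 'n)) = norm c * norm a"
  by (simp add: norm_vec_def norm_mult L2_set_right_distrib)

lemma tendsto_powr_at_infinity:
  assumes "0 < a"
  shows "((\<lambda>x::pt. C / norm x powr a) \<longlongrightarrow> 0) at_infinity"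
proof -
  have "((\<lambda>r::real. C * r powr (- a)) \<longlongrightarrow> C * 0) at_top"
    using assms by (intro tendsto_intros tendsto_neg_powr filterlim_ident) auto
  then have "((\<lambda>x::pt. C * norm x powr (- a)) \<longlongrightarrow> C * 0) at_infinity"
    by (rule filterlim_compose) (rule filterlim_norm_at_top)
  then show ?thesis by (simp add: powr_minus divide_inverse)
qed

text \<open>The incident field cancels. Equal patterns leave u - u' = O(r^(-3/2)), so sqrt r times
  its tangential component is O(1/r), and the two radiation conditions carry this over to w - w'.
  The conclusion is the decay required by \<open>wsol_rellich\<close>.\<close>

lemma far_field_difference:
  assumes TE: "TE_total_field \<kappa> d q0 D u w" "TE_total_field \<kappa> d q0 D' u' w'"
    and fb: "far_bound \<kappa> d u uinf" "far_bound \<kappa> d u' uinf'"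
    and eq: "\<forall>xh\<in>unit_circle. uinf xh = uinf' xh"
  shows "((\<lambda>x. of_real (sqrt (norm x)) * (w x - w' x)) \<longlongrightarrow> 0) at_infinity"
proof -
  obtain C R where C: "\<And>x. norm x \<ge> R \<Longrightarrow> norm ((\<chi> j. u x $ j - u_in \<kappa> d x $ j)
                 - ((exp (\<i> * complex_of_real (\<kappa> * norm x)) / complex_of_real (sqrt (norm x))
                     * uinf (x /\<^sub>R norm x)) *s (\<chi> j. complex_of_real (perp (x /\<^sub>R norm x) $ j))))
                         \<le> C / (norm x) powr (3/2)"
    using fb(1) unfolding far_bound_def by blast
  obtain C' R' where C': "\<And>x. norm x \<ge> R' \<Longrightarrow> norm ((\<chi> j. u' x $ j - u_in \<kappa> d x $ j)
                 - ((exp (\<i> * complex_of_real (\<kappa> * norm x)) / complex_of_real (sqrt (norm x))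
                     * uinf' (x /\<^sub>R norm x)) *s (\<chi> j. complex_of_real (perp (x /\<^sub>R norm x) $ j))))
                         \<le> C' / (norm x) powr (3/2)"
    using fb(2) unfolding far_bound_def by blast
  define T where "T x = of_real (sqrt (norm x)) * (\<Sum>j\<in>UNIV. (u x
      - u' x) $ j * complex_of_real (perp (x /\<^sub>R norm x) $ j))" for x
  have eqn: "of_real (sqrt (norm x)) * (w x - w' x) = (radiation_defect \<kappa> d u w x - radiation_defect \<kappa> d u' w' x)
      + \<i> * of_real \<kappa> * T x" for x
    by (simp add: radiation_defect_def T_def sum_2 algebra_simps)
  have T0: "(T \<longlongrightarrow> 0) at_infinity"
  proof (rule Lim_null_comparison[OF _ tendsto_powr_at_infinity[of 1 "2 * (C + C')"]])
    show "\<forall>\<^sub>F x in at_infinity. norm (T x) \<le> 2 * (C + C') / norm x powr 1"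
      unfolding eventually_at_infinity
    proof (intro exI allI impI)
      fix x :: pt assume "max 1 (max R R') \<le> norm x"
      then have x: "1 \<le> norm x" "R \<le> norm x" "R' \<le> norm x" by auto
      have "norm x \<noteq> 0" using x(1) by linarith
      then have n1: "norm (x /\<^sub>R norm x) = 1" by simp
      define A where "A = (exp (\<i> * complex_of_real (\<kappa> * norm x)) / complex_of_real (sqrt (norm x))
                     * uinf (x /\<^sub>R norm x)) *s (\<chi> j. complex_of_real (perp (x /\<^sub>R norm x) $ j))"
      have ui: "uinf' (x /\<^sub>R norm x) = uinf (x /\<^sub>R norm x)" using eq n1 by (simp add: unit_circle_def)
      have "norm (u x - u' x) = norm (((\<chi> j. u x $ j - u_in \<kappa> d x $ j) - A) - ((\<chi> j. u' x $ j - u_in \<kappa> d x $ j) - A))"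
        by (rule arg_cong[where f=norm]) (simp add: vec_eq_iff)
      also have "\<dots> \<le> norm ((\<chi> j. u x $ j - u_in \<kappa> d x $ j) - A) + norm ((\<chi> j. u' x $ j - u_in \<kappa> d x $ j) - A)"
        by (rule norm_triangle_ineq4)
      also have "\<dots> \<le> C / norm x powr (3/2) + C' / norm x powr (3/2)"
        using C[OF x(2)] C'[OF x(3)] unfolding A_def ui by (intro add_mono)
      also have "\<dots> = (C + C') / norm x powr (3/2)" by (simp add: add_divide_distrib)
      finally have b: "norm (u x - u' x) \<le> (C + C') / norm x powr (3/2)" .
      have "norm (T x) \<le> sqrt (norm x) * (2 * norm (u x - u' x))"
        unfolding T_def norm_mult using norm_sum_perp[OF n1, of "u x - u' x"] by (intro mult_mono) auto
      also have "\<dots> \<le> sqrt (norm x) * (2 * ((C + C') / norm x powr (3/2)))" using b by (intro mult_left_mono) auto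
      also have "\<dots> = 2 * (C + C') / norm x powr 1"
      proof -
        have "norm x powr (3/2) = norm x powr 1 * sqrt (norm x)"
          using x powr_add[of "norm x" 1 "1/2"] by (simp add: powr_half_sqrt)
        moreover have "0 < sqrt (norm x)" "0 < norm x powr 1" using x by auto
        ultimately show ?thesis by (simp add: field_simps)
      qed
      finally show "norm (T x) \<le> 2 * (C + C') / norm x powr 1" .
    qed
  qed simp
  have "((\<lambda>x. (radiation_defect \<kappa> d u w x - radiation_defect \<kappa> d u' w' x) + \<i> * of_real \<kappa> * T x) \<longlongrightarrow> (0 - 0)
      + \<i> * of_real \<kappa> * 0) at_infinity"
    by (intro tendsto_intros TE_radiation_defect[OF TE(1)] TE_radiation_defect[OF TE(2)] T0)
  then show ?thesis by (simp add: eqn)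
qed

text \<open>\<open>is_far_field\<close> imposes nothing on the pattern itself. Boundedness comes
  from comparing it, through the error estimate, with the continuous field \<open>u\<close> on one
  large sphere.\<close>

lemma far_pattern_bounded:
  assumes TE: "TE_total_field \<kappa> d q0 D u w" and fb: "far_bound \<kappa> d u uinf" and D: "bounded D"
  shows "\<exists>B. \<forall>y. norm y = 1 \<longrightarrow> norm (uinf y) \<le> B"
proof -
  obtain C R where C: "\<And>x. norm x \<ge> R \<Longrightarrow> norm ((\<chi> j. u x $ j - u_in \<kappa> d x $ j)
                 - ((exp (\<i> * complex_of_real (\<kappa> * norm x)) / complex_of_real (sqrt (norm x))
                     * uinf (x /\<^sub>R norm x)) *s (\<chi> j. complex_of_real (perp (x /\<^sub>R norm x) $ j))))
                         \<le> C / (norm x) powr (3/2)"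
    using fb unfolding far_bound_def by blast
  obtain b where b: "\<And>x. x \<in> closure D \<Longrightarrow> norm x \<le> b" using bounded_closure[OF D] bounded_iff by blast
  \<comment> \<open>Far enough out for the error estimate to hold and for the sphere to miss
    \<open>closure D\<close>.\<close>
  define r where "r = max (max 1 R) (b + 1)"
  have r: "1 \<le> r" "R \<le> r" "b < r" by (auto simp: r_def)
  have sub: "sphere 0 r \<subseteq> - closure D" using b r by fastforce
  have "continuous_on (sphere 0 r) (\<lambda>x. \<chi> j. u x $ j - u_in \<kappa> d x $ j)"
    unfolding u_in_def using continuous_on_subset[OF TE_D(4)[OF TE] sub] by (auto intro!: continuous_intros)
  then have "bounded ((\<lambda>x. \<chi> j. u x $ j - u_in \<kappa> d x $ j) ` sphere 0 r)"
    by (intro compact_imp_bounded compact_continuous_image compact_sphere)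
  then obtain M where "\<forall>z\<in>(\<lambda>x. \<chi> j. u x $ j - u_in \<kappa> d x $ j) ` sphere 0 r. norm z \<le> M"
    unfolding bounded_iff by blast
  then have M: "\<And>x. x \<in> sphere 0 r \<Longrightarrow> norm (\<chi> j. u x $ j - u_in \<kappa> d x $ j) \<le> M" by (rule bspec[OF _ imageI])
  have "norm (uinf y) \<le> sqrt r * (M + C / r powr (3/2))" if y: "norm y = 1" for y
  proof -
    let ?x = "r *\<^sub>R y"
    have x: "norm ?x = r" "?x /\<^sub>R r = y" using y r by auto
    define V where "V = (\<chi> j. u ?x $ j - u_in \<kappa> d ?x $ j)"
    define A where "A = (exp (\<i> * complex_of_real (\<kappa> * r)) / complex_of_real (sqrt r) * uinf y) *s (\<chi> j. complex_of_real (perp y $ j))"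
    have "norm A = norm (uinf y) / sqrt r"
      unfolding A_def norm_cscale norm_vec_perp using y r by (simp add: norm_mult norm_divide)
    moreover have "norm A \<le> norm V + norm (V - A)" using norm_triangle_ineq4[of V "V - A"] by simp
    moreover have "norm (V - A) \<le> C / r powr (3/2)" using C[of ?x] r unfolding x V_def A_def by simp
    moreover have "norm V \<le> M" unfolding V_def using M[of ?x] x r by (simp add: dist_norm)
    ultimately have "norm (uinf y) / sqrt r \<le> M + C / r powr (3/2)" by linarith
    then show ?thesis using r by (simp add: divide_le_eq mult.commute)
  qed
  then show ?thesis by blast
qed

text \<open>A bounded pattern makes the scattered part of \<open>u\<close> decay like r^(-1/2), and
  the radiation condition passes this on to \<open>w\<close>.\<close>

lemma total_field_tendsto_incident:
  assumes TE: "TE_total_field \<kappa> d q0 D u w" and fb: "far_bound \<kappa> d u uinf" and D: "bounded D"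
  shows "((\<lambda>x. w x - curl_u_in \<kappa> d x) \<longlongrightarrow> 0) at_infinity"
proof -
  obtain C R where C: "\<And>x. norm x \<ge> R \<Longrightarrow> norm ((\<chi> j. u x $ j - u_in \<kappa> d x $ j)
                 - ((exp (\<i> * complex_of_real (\<kappa> * norm x)) / complex_of_real (sqrt (norm x))
                     * uinf (x /\<^sub>R norm x)) *s (\<chi> j. complex_of_real (perp (x /\<^sub>R norm x) $ j))))
                         \<le> C / (norm x) powr (3/2)"
    using fb unfolding far_bound_def by blast
  obtain B where B: "\<And>y. norm y = 1 \<Longrightarrow> norm (uinf y) \<le> B" using far_pattern_bounded[OF assms] by blast
  define T where "T x = (\<Sum>j\<in>UNIV. (\<chi> j. u x $ j - u_in \<kappa> d x $ j) $ j * complex_of_real (perp (x /\<^sub>R norm x) $ j))" for x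
  have T0: "(T \<longlongrightarrow> 0) at_infinity"
  proof (rule Lim_null_comparison)
    show "((\<lambda>x. 2 * (C / norm x powr (3/2) + B / norm x powr (1/2))) \<longlongrightarrow> 0) (at_infinity :: pt filter)"
      using tendsto_mult[OF tendsto_const[of 2] tendsto_add[OF tendsto_powr_at_infinity[of "3/2" C] tendsto_powr_at_infinity[of "1/2" B]]] by simp
    show "\<forall>\<^sub>F x in at_infinity. norm (T x) \<le> 2 * (C / norm x powr (3/2) + B / norm x powr (1/2))"
      unfolding eventually_at_infinity
    proof (intro exI allI impI)
      fix x :: pt assume "max 1 R \<le> norm x"
      then have x: "1 \<le> norm x" "R \<le> norm x" by auto
      have "norm x \<noteq> 0" using x(1) by linarith
      then have n1: "norm (x /\<^sub>R norm x) = 1" by simp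
      define V where "V = (\<chi> j. u x $ j - u_in \<kappa> d x $ j)"
      define A where "A = (exp (\<i> * complex_of_real (\<kappa> * norm x)) / complex_of_real (sqrt (norm x))
                     * uinf (x /\<^sub>R norm x)) *s (\<chi> j. complex_of_real (perp (x /\<^sub>R norm x) $ j))"
      have "norm A = norm (uinf (x /\<^sub>R norm x)) / sqrt (norm x)"
        unfolding A_def norm_cscale norm_vec_perp n1 by (simp add: norm_mult norm_divide)
      also have "\<dots> \<le> B / norm x powr (1/2)" using B[OF n1] by (simp add: powr_half_sqrt divide_right_mono)
      finally have "norm A \<le> B / norm x powr (1/2)" .
      moreover have "norm V \<le> norm (V - A) + norm A" using norm_triangle_ineq[of "V - A" A] by simp
      moreover have "norm (V - A) \<le> C / norm x powr (3/2)" using C[OF x(2)] unfolding V_def A_def .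
      moreover have "norm (T x) \<le> 2 * norm V" unfolding T_def V_def by (rule norm_sum_perp[OF n1])
      ultimately have "norm V \<le> C / norm x powr (3/2) + B / norm x powr (1/2)" "norm (T x) \<le> 2 * norm V"
        by (auto intro: order_trans[OF _ add_mono])
      then show "norm (T x) \<le> 2 * (C / norm x powr (3/2) + B / norm x powr (1/2))"
        by (meson mult_left_mono order_trans zero_le_numeral)
    qed
  qed
  have "((\<lambda>x. radiation_defect \<kappa> d u w x * of_real (1 / norm x powr (1/2)) + \<i> * of_real \<kappa> * T x) \<longlongrightarrow> 0 * of_real 0
      + \<i> * of_real \<kappa> * 0) at_infinity"
    by (intro tendsto_intros TE_radiation_defect[OF TE] T0 tendsto_powr_at_infinity) auto
  moreover have "\<forall>\<^sub>F x in at_infinity. radiation_defect \<kappa> d u w x * of_real (1 / norm x powr (1/2)) + \<i> * of_real \<kappa> * T x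
      = w x - curl_u_in \<kappa> d x"
    unfolding eventually_at_infinity
  proof (intro exI allI impI)
    fix x :: pt assume "1 \<le> norm x"
    then have "complex_of_real (sqrt (norm x)) \<noteq> 0" by auto
    then show "radiation_defect \<kappa> d u w x * of_real (1 / norm x powr (1/2)) + \<i> * of_real \<kappa> * T x = w x - curl_u_in \<kappa> d x"
      by (simp add: radiation_defect_def T_def powr_half_sqrt field_simps)
  qed
  ultimately show ?thesis by (auto intro: Lim_transform_eventually)
qed

lemma total_field_nonzero_on_ray:
  assumes TE: "TE_total_field \<kappa> d q0 D u w" and fb: "far_bound \<kappa> d u uinf" and D: "bounded D"
    and \<kappa>: "0 < \<kappa>" and e: "norm e = 1" and z: "\<And>t. 0 \<le> t \<Longrightarrow> w (p + t *\<^sub>R e) = 0"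
  shows False
proof -
  have "\<forall>\<^sub>F x in at_infinity. norm (w x - curl_u_in \<kappa> d x) < \<kappa>"
    using tendstoD[OF total_field_tendsto_incident[OF TE fb D] \<kappa>] by simp
  then obtain b where b: "\<And>x. b \<le> norm x \<Longrightarrow> norm (w x - curl_u_in \<kappa> d x) < \<kappa>"
    unfolding eventually_at_infinity by blast
  define t where "t = norm p + max 0 b"
  have "t = norm (t *\<^sub>R e)" using e by (simp add: t_def)
  also have "\<dots> \<le> norm (p + t *\<^sub>R e) + norm p" using norm_triangle_ineq4[of "p + t *\<^sub>R e" p] by simp
  finally have "b \<le> norm (p + t *\<^sub>R e)" by (simp add: t_def)
  from b[OF this] z[of t] have "norm (curl_u_in \<kappa> d (p + t *\<^sub>R e)) < \<kappa>" by (simp add: t_def)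
  moreover have "norm (curl_u_in \<kappa> d (p + t *\<^sub>R e)) = \<kappa>" using \<kappa> by (simp add: curl_u_in_def norm_mult)
  ultimately show False by simp
qed

section \<open>Asymptotics at a right-angled corner\<close>

lemma orthogonal_transformation_frame:
  fixes e f :: pt
  assumes "norm e = 1" "norm f = 1" "e \<bullet> f = 0"
  shows "orthogonal_transformation (\<lambda>y::pt. y $ 1 *\<^sub>R e + y $ 2 *\<^sub>R f)"
proof -
  have "norm (y $ 1 *\<^sub>R e + y $ 2 *\<^sub>R f) = norm y" for y :: pt
  proof -
    have on: "e \<bullet> e = 1" "f \<bullet> f = 1" "e \<bullet> f = 0" "f \<bullet> e = 0"
      using assms by (simp_all add: norm_eq_1 inner_commute)
    have "(y $ 1 *\<^sub>R e + y $ 2 *\<^sub>R f) \<bullet> (y $ 1 *\<^sub>R e + y $ 2 *\<^sub>R f) = y $ 1 * y $ 1 + y $ 2 * y $ 2"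
      by (simp add: inner_add_left inner_add_right on)
    also have "\<dots> = y \<bullet> y" by (simp add: inner_vec_def sum_2)
    finally show ?thesis by (simp add: norm_eq_sqrt_inner)
  qed
  moreover have "linear (\<lambda>y::pt. y $ 1 *\<^sub>R e + y $ 2 *\<^sub>R f)"
    by (rule linearI) (auto simp: algebra_simps)
  ultimately show ?thesis by (simp add: orthogonal_transformation)
qed

text \<open>Lebesgue measure is determined by its values on boxes, and the preimage of a box is its
  image under the inverse, an orthogonal map, which preserves the measure.\<close>

lemma lborel_distr_orthogonal:
  fixes A :: "pt \<Rightarrow> pt"
  assumes A: "orthogonal_transformation A"
  shows "distr lborel borel A = lborel"
proof (rule lborel_eqI[symmetric])
  have lin: "linear A" using A by (simp add: orthogonal_transformation)
  have bij: "bij A" using A by (rule orthogonal_transformation_bij)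
  have oi: "orthogonal_transformation (inv A)" using A by (rule orthogonal_transformation_inv)
  have cA: "continuous_on UNIV A" using lin by (simp add: linear_continuous_on linear_conv_bounded_linear)
  have mA: "A \<in> borel_measurable lborel" using borel_measurable_continuous_onI[OF cA] by simp
  fix l u :: pt assume lu: "\<And>b. b \<in> Basis \<Longrightarrow> l \<bullet> b \<le> u \<bullet> b"
  have vim: "A -` box l u = inv A ` box l u" using bij by (simp add: bij_vimage_eq_inv_image)
  have op: "open (A -` box l u)" by (rule open_vimage[OF open_box cA])
  have bnd: "bounded (A -` box l u)" unfolding vim
    by (rule bounded_linear_image[OF bounded_box]) (use oi in \<open>simp add: orthogonal_transformation linear_conv_bounded_linear\<close>)
  have "emeasure (distr lborel borel A) (box l u) = emeasure lborel (A -` box l u)"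
    using mA by (subst emeasure_distr) auto
  also have "\<dots> = ennreal (measure lborel (A -` box l u))"
    using emeasure_bounded_finite[OF bnd] by (simp add: emeasure_eq_ennreal_measure)
  also have "measure lborel (A -` box l u) = measure lebesgue (inv A ` box l u)"
    using op by (simp add: vim[symmetric] measure_completion)
  also have "\<dots> = measure lebesgue (box l u)"
    by (rule measure_orthogonal_image[OF oi]) (auto simp: lmeasurable_box)
  also have "\<dots> = (\<Prod>b\<in>Basis. (u - l) \<bullet> b)" using lu by (simp add: measure_completion)
  finally show "emeasure (distr lborel borel A) (box l u) = ennreal (\<Prod>b\<in>Basis. (u - l) \<bullet> b)" .
qed simp

lemma lborel_distr_pair:
  "distr (lborel :: (real \<times> real) measure) borel (\<lambda>z. fst z *\<^sub>R axis 1 1 + snd z *\<^sub>R axis 2 1) = (lborel :: pt measure)"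
proof (rule lborel_eqI[symmetric])
  let ?J = "\<lambda>z::real \<times> real. fst z *\<^sub>R axis 1 1 + snd z *\<^sub>R axis 2 1 :: pt"
  have J: "?J \<in> borel_measurable lborel" by (auto intro!: borel_measurable_continuous_onI continuous_intros)
  fix l u :: pt assume lu: "\<And>b. b \<in> Basis \<Longrightarrow> l \<bullet> b \<le> u \<bullet> b"
  have le: "l $ i \<le> u $ i" for i using lu[of "axis i 1"] by (simp add: inner_axis)
  have "?J -` box l u = box (l $ 1, l $ 2) (u $ 1, u $ 2)"
    by (auto simp: mem_box_cart forall_2 mem_box Basis_prod_def ball_Un axis_def)
  then have "emeasure (distr lborel borel ?J) (box l u) = emeasure lborel (box (l $ 1, l $ 2) (u $ 1, u $ 2))"
    using J by (subst emeasure_distr) auto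
  also have "\<dots> = ennreal ((u $ 1 - l $ 1) * (u $ 2 - l $ 2))"
    using le by (subst emeasure_lborel_box) (auto simp: Basis_prod_def prod.union_disjoint prod.reindex inj_on_def)
  also have "(u $ 1 - l $ 1) * (u $ 2 - l $ 2) = (\<Prod>b\<in>Basis. (u - l) \<bullet> b)"
    by (simp add: Basis_vec_def axis_eq_axis UN_UN_flatten inner_axis UNIV_2)
  finally show "emeasure (distr lborel borel ?J) (box l u) = ennreal (\<Prod>b\<in>Basis. (u - l) \<bullet> b)" .
qed simp

text \<open>A translation, a rotation and the identification of \<open>real ^ 2\<close> with
  \<open>real \<times> real\<close>: the corner becomes a quadrant, and iterated integrals become
  available.\<close>

lemma integral_frame:
  fixes F :: "pt \<Rightarrow> complex" and e f p :: pt
  assumes on: "norm e = 1" "norm f = 1" "e \<bullet> f = 0" and F: "F \<in> borel_measurable borel"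
  shows "(\<integral>x. F x \<partial>lborel) = (\<integral>z. F (p + fst z *\<^sub>R e + snd z *\<^sub>R f) \<partial>(lborel :: (real \<times> real) measure))"
proof -
  let ?A = "\<lambda>y::pt. y $ 1 *\<^sub>R e + y $ 2 *\<^sub>R f"
  let ?J = "\<lambda>z::real \<times> real. fst z *\<^sub>R axis 1 1 + snd z *\<^sub>R axis 2 1 :: pt"
  have A: "?A \<in> borel_measurable borel" by (auto intro!: borel_measurable_continuous_onI continuous_intros)
  have J: "?J \<in> borel_measurable lborel" by (auto intro!: borel_measurable_continuous_onI continuous_intros)
  have T: "(\<lambda>x. F (p + x)) \<in> borel_measurable borel"
    using measurable_compose[OF _ F, of "\<lambda>x. p + x" borel] by simp
  have TA: "(\<lambda>y. F (p + ?A y)) \<in> borel_measurable borel" using measurable_compose[OF A T] .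
  have "(\<integral>x. F x \<partial>lborel) = (\<integral>x. F (p + x) \<partial>lborel)" by (rule integral_translation[symmetric])
  also have "\<dots> = (\<integral>x. F (p + x) \<partial>(distr lborel borel ?A))"
    using lborel_distr_orthogonal[OF orthogonal_transformation_frame[OF on]] by simp
  also have "\<dots> = (\<integral>y. F (p + ?A y) \<partial>lborel)" by (rule integral_distr) (use A T in auto)
  also have "\<dots> = (\<integral>y. F (p + ?A y) \<partial>(distr lborel borel ?J))" by (simp add: lborel_distr_pair)
  also have "\<dots> = (\<integral>z. F (p + ?A (?J z)) \<partial>lborel)" by (rule integral_distr) (use J TA in auto)
  also have "\<dots> = (\<integral>z. F (p + fst z *\<^sub>R e + snd z *\<^sub>R f) \<partial>lborel)"
    by (simp add: axis_def add.assoc)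
  finally show ?thesis .
qed

text \<open>With p3 the cube of the positive part, theta x = p3 (1 - p3 (x / eta - 1)) is C^2, equal
  to 1 up to eta and 0 from 2 eta on. The product theta x * theta (- x) treats both signs of
  x.\<close>

lemma cutoff_exists:
  assumes \<eta>: "0 < \<eta>"
  obtains \<zeta> \<zeta>1 \<zeta>2 :: "real \<Rightarrow> real" where
    "\<And>x. (\<zeta> has_real_derivative \<zeta>1 x) (at x)" "\<And>x. (\<zeta>1 has_real_derivative \<zeta>2 x) (at x)"
    "continuous_on UNIV \<zeta>2" "\<And>x. \<bar>x\<bar> \<le> \<eta> \<Longrightarrow> \<zeta> x = 1" "\<And>x. 2 * \<eta> \<le> \<bar>x\<bar> \<Longrightarrow> \<zeta> x = 0" "\<And>x. \<bar>\<zeta> x\<bar> \<le> 1"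
proof -
  define p3 p2 p1 :: "real \<Rightarrow> real" where "p3 z = max 0 z ^ 3" and "p2 z = 3 * max 0 z ^ 2" and "p1 z = 6 * max 0 z" for z
  have d3: "(p3 has_real_derivative p2 z) (at z)" for z
    using pos_part_power_deriv[of 1 z] by (simp add: p3_def[abs_def] p2_def eval_nat_numeral)
  have d2: "(p2 has_real_derivative p1 z) (at z)" for z
    unfolding p2_def[abs_def] p1_def using DERIV_cmult[OF pos_part_power_deriv[of 0 z], of 3]
        by (simp add: eval_nat_numeral)
  have cont: "continuous_on S p3" "continuous_on S p2" "continuous_on S p1" for S
    unfolding p3_def[abs_def] p2_def[abs_def] p1_def[abs_def] by (intro continuous_intros)+
  define \<theta> where "\<theta> x = p3 (1 - p3 (x / \<eta> - 1))" for x
  define \<theta>1 where "\<theta>1 x = p2 (1 - p3 (x / \<eta> - 1)) * (- (p2 (x / \<eta> - 1) * (1 / \<eta>)))" for x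
  define \<theta>2 where "\<theta>2 x = p1 (1 - p3 (x / \<eta> - 1)) * (- (p2 (x / \<eta> - 1) * (1 / \<eta>))) * (- (p2 (x / \<eta> - 1) * (1 / \<eta>)))
      + (- (p1 (x / \<eta> - 1) * (1 / \<eta>) * (1 / \<eta>))) * p2 (1 - p3 (x / \<eta> - 1))" for x
  have u: "((\<lambda>x. x / \<eta> - 1) has_real_derivative 1 / \<eta>) (at x)" for x using \<eta> by (auto intro!: derivative_eq_intros)
  have i: "((\<lambda>x. 1 - p3 (x / \<eta> - 1)) has_real_derivative - (p2 (x / \<eta> - 1) * (1 / \<eta>))) (at x)" for x
    using DERIV_diff[OF DERIV_const[of 1] DERIV_chain2[OF d3 u]] by simp
  have t1: "(\<theta> has_real_derivative \<theta>1 x) (at x)" for x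
    unfolding \<theta>_def[abs_def] \<theta>1_def by (rule DERIV_chain2[OF d3 i])
  have t2: "(\<theta>1 has_real_derivative \<theta>2 x) (at x)" for x
    unfolding \<theta>1_def[abs_def] \<theta>2_def
    by (rule DERIV_mult[OF DERIV_chain2[OF d2 i] DERIV_minus[OF DERIV_cmult_right[OF DERIV_chain2[OF d2 u]]]])
  have ct: "continuous_on S \<theta>2" for S unfolding \<theta>2_def[abs_def]
    by (intro continuous_intros continuous_on_compose2[OF cont(1)[of UNIV]] continuous_on_compose2[OF cont(2)[of UNIV]]
        continuous_on_compose2[OF cont(3)[of UNIV]]) (use \<eta> in auto)
  have m: "((\<lambda>x::real. - x) has_real_derivative -1) (at x)" for x by (auto intro!: derivative_eq_intros)
  define \<zeta> where "\<zeta> x = \<theta> x * \<theta> (- x)" for x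
  define \<zeta>1 where "\<zeta>1 x = \<theta>1 x * \<theta> (- x) + \<theta>1 (- x) * -1 * \<theta> x" for x
  define \<zeta>2 where "\<zeta>2 x = (\<theta>2 x * \<theta> (- x) + \<theta>1 (- x) * -1 * \<theta>1 x) + ((\<theta>2 (- x) * -1 * -1) * \<theta> x
      + \<theta>1 x * (\<theta>1 (- x) * -1))" for x
  have "(\<zeta> has_real_derivative \<zeta>1 x) (at x)" for x
    unfolding \<zeta>_def[abs_def] \<zeta>1_def by (rule DERIV_mult[OF t1 DERIV_chain2[OF t1 m]])
  moreover have "(\<zeta>1 has_real_derivative \<zeta>2 x) (at x)" for x
    unfolding \<zeta>1_def[abs_def] \<zeta>2_def
    by (rule DERIV_add[OF DERIV_mult[OF t2 DERIV_chain2[OF t1 m]] DERIV_mult[OF DERIV_cmult_right[OF DERIV_chain2[OF t2 m]] t1]])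
  moreover have "continuous_on UNIV \<zeta>2"
  proof -
    have c0: "continuous_on UNIV \<theta>" "continuous_on UNIV \<theta>1"
      using t1 t2 by (auto intro!: continuous_at_imp_continuous_on DERIV_isCont)
    show ?thesis unfolding \<zeta>2_def[abs_def]
      by (intro continuous_intros ct c0 continuous_on_compose2[OF ct[of UNIV]] continuous_on_compose2[OF c0(1)] continuous_on_compose2[OF c0(2)]) auto
  qed
  moreover have th1: "\<theta> x = 1" if "x \<le> \<eta>" for x
    using that \<eta> by (simp add: \<theta>_def p3_def max_def)
  moreover have th0: "\<theta> x = 0" if "2 * \<eta> \<le> x" for x
  proof -
    have "1 \<le> x / \<eta> - 1" using that \<eta> by (simp add: le_diff_eq le_divide_eq)
    then have "1 \<le> p3 (x / \<eta> - 1)" by (simp add: p3_def max_def one_le_power)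
    then show ?thesis by (simp add: \<theta>_def p3_def)
  qed
  have thb: "0 \<le> \<theta> x" "\<theta> x \<le> 1" for x
  proof -
    have "0 \<le> p3 (x / \<eta> - 1)" by (simp add: p3_def)
    then have "0 \<le> max 0 (1 - p3 (x / \<eta> - 1))" "max 0 (1 - p3 (x / \<eta> - 1)) \<le> 1" by auto
    then show "0 \<le> \<theta> x" "\<theta> x \<le> 1" unfolding \<theta>_def p3_def[of "1 - p3 (x / \<eta> - 1)"] by (auto intro: power_le_one)
  qed
  have "\<bar>x\<bar> \<le> \<eta> \<Longrightarrow> \<zeta> x = 1" for x using th1[of x] th1[of "-x"] by (simp add: \<zeta>_def abs_le_iff)
  moreover have "2 * \<eta> \<le> \<bar>x\<bar> \<Longrightarrow> \<zeta> x = 0" for x using th0[of x] th0[of "-x"] by (auto simp: \<zeta>_def abs_if split: if_splits)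
  moreover have "\<bar>\<zeta> x\<bar> \<le> 1" for x
    using thb[of x] thb[of "-x"] by (simp add: \<zeta>_def abs_mult mult_le_one)
  ultimately show ?thesis using that[of \<zeta> \<zeta>1 \<zeta>2] by blast
qed

text \<open>The exponentials at the corner have complex rates, whereas the weak formulation tests
  with real functions; real and imaginary parts mediate.\<close>

definition complex_test_fn2 :: "(pt \<Rightarrow> complex) \<Rightarrow> bool" where
  "complex_test_fn2 \<phi> \<longleftrightarrow> C1_on UNIV \<phi> \<and> (\<forall>e. C1_on UNIV (pd e \<phi>)) \<and> compact (supp \<phi>)"

lemma pd_bounded_linear:
  fixes L :: "complex \<Rightarrow> real"
  assumes "bounded_linear L" "f differentiable (at x)"
  shows "(\<lambda>x. L (f x)) differentiable (at x)" "pd e (\<lambda>x. L (f x)) x = L (pd e f x)"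
proof -
  have D: "((\<lambda>x. L (f x)) has_derivative (\<lambda>e. L (pd e f x))) (at x)"
    using bounded_linear.has_derivative[OF assms(1) has_derivative_pd[OF assms(2)]] .
  then show "(\<lambda>x. L (f x)) differentiable (at x)" by (auto simp: differentiable_def)
  show "pd e (\<lambda>x. L (f x)) x = L (pd e f x)" using pd_eqI[OF D] .
qed

lemma complex_test_fn2_part:
  assumes L: "bounded_linear (L :: complex \<Rightarrow> real)" and \<phi>: "complex_test_fn2 \<phi>"
  shows "test_fn2 (\<lambda>x. L (\<phi> x))" "pd e (\<lambda>x. L (\<phi> x)) x = L (pd e \<phi> x)"
    "lap (\<lambda>x. L (\<phi> x)) x = L (lap \<phi> x)" "supp (\<lambda>x. L (\<phi> x)) \<subseteq> supp \<phi>"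
proof -
  have L0: "L 0 = 0" using L by (simp add: linear_0 bounded_linear.linear)
  have C1: "C1_on UNIV (\<lambda>x. L (f x))" "pd e (\<lambda>x. L (f x)) = (\<lambda>x. L (pd e f x))" if "C1_on UNIV f" for f e
  proof -
    have d: "f differentiable (at x)" for x using that by (simp add: C1_on_def)
    show p: "pd e (\<lambda>x. L (f x)) = (\<lambda>x. L (pd e f x))" for e by (rule ext) (rule pd_bounded_linear(2)[OF L d])
    have "continuous_on UNIV (\<lambda>x. L (pd e f x))" for e
      by (rule bounded_linear.continuous_on[OF L]) (use that in \<open>simp add: C1_on_def\<close>)
    then show "C1_on UNIV (\<lambda>x. L (f x))" unfolding C1_on_def p using pd_bounded_linear(1)[OF L d] by blast
  qed
  have c: "C1_on UNIV \<phi>" "C1_on UNIV (pd e \<phi>)" "compact (supp \<phi>)" for e using \<phi> by (auto simp: complex_test_fn2_def)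
  have s: "supp (\<lambda>x. L (f x)) \<subseteq> supp f" for f :: "pt \<Rightarrow> complex" by (rule supp_subset) (auto simp: supp_eq_0 L0)
  show "supp (\<lambda>x. L (\<phi> x)) \<subseteq> supp \<phi>" by (rule s)
  show "pd e (\<lambda>x. L (\<phi> x)) x = L (pd e \<phi> x)" using C1(2)[OF c(1)] by metis
  show "lap (\<lambda>x. L (\<phi> x)) x = L (lap \<phi> x)"
    unfolding lap_def C1(2)[OF c(1)] C1(2)[OF c(2)] using L by (simp add: linear_add bounded_linear.linear)
  show "test_fn2 (\<lambda>x. L (\<phi> x))" unfolding test_fn2_def test_fn_iff C1(2)[OF c(1)]
    using C1(1)[OF c(1)] C1(1)[OF c(2)] compact_supp[OF c(3) s] compact_supp[OF c(3) order_trans[OF s supp_pd]] by auto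
qed

lemma complex_test_fn2_D:
  assumes "complex_test_fn2 \<phi>"
  shows "compact (supp \<phi>)" "\<phi> differentiable (at x)" "continuous_on UNIV \<phi>" "continuous_on UNIV (pd e \<phi>)"
    "continuous_on UNIV (lap \<phi>)"
proof -
  have c: "C1_on UNIV \<phi>" "C1_on UNIV (pd e \<phi>)" for e using assms by (auto simp: complex_test_fn2_def)
  show "compact (supp \<phi>)" "\<phi> differentiable (at x)" "continuous_on UNIV \<phi>" "continuous_on UNIV (pd e \<phi>)"
    using assms c C1_on_continuous by (auto simp: complex_test_fn2_def C1_on_def)
  have "continuous_on UNIV (pd e' (pd e \<phi>))" for e e' using c(2)[of e] by (simp add: C1_on_def)
  then show "continuous_on UNIV (lap \<phi>)" unfolding lap_def[abs_def] by (intro continuous_intros)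
qed

lemma integrable_coeff_q:
  assumes "integrable lborel (f :: pt \<Rightarrow> complex)"
  shows "integrable lborel (\<lambda>x. coeff_q q0 D x * f x)"
proof -
  have "integrable lborel (\<lambda>x. f x + (q0 - 1) * (indicator (closure D) x *\<^sub>R f x))"
    by (intro Bochner_Integration.integrable_add integrable_mult_right integrable_mult_indicator assms) auto
  moreover have "f x + (q0 - 1) * (indicator (closure D) x *\<^sub>R f x) = coeff_q q0 D x * f x" for x
    by (simp add: coeff_q_def indicator_def algebra_simps)
  ultimately show ?thesis by simp
qed

lemma TE_complex:
  assumes TE: "TE_total_field \<kappa> d q0 D u w" and \<phi>: "complex_test_fn2 \<phi>"
  defines "U \<equiv> \<lambda>x. u x $ 1 * pd (axis 2 1) \<phi> x - u x $ 2 * pd (axis 1 1) \<phi> x"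
  shows "integrable lborel (\<lambda>x. w x * lap \<phi> x + complex_of_real (\<kappa>\<^sup>2) * (coeff_q q0 D x * U x))"
    "(\<integral>x. w x * lap \<phi> x + complex_of_real (\<kappa>\<^sup>2) * (coeff_q q0 D x * U x) \<partial>lborel) = 0"
    "integrable lborel (\<lambda>x. w x * \<phi> x - U x)"
    "(\<integral>x. w x * \<phi> x - U x \<partial>lborel) = 0"
proof -
  define V where "V \<psi> x = u x $ 1 * of_real (pd (axis 2 1) \<psi> x)
      - u x $ 2 * of_real (pd (axis 1 1) \<psi> x)" for \<psi> :: "pt \<Rightarrow> real" and x
  define f where "f \<psi> x = w x * of_real (lap \<psi> x) + complex_of_real (\<kappa>\<^sup>2) * (coeff_q q0 D x * V \<psi> x)" for \<psi> x
  define g where "g \<psi> x = w x * of_real (\<psi> x) - V \<psi> x" for \<psi> x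
  have main: "integrable lborel (f \<psi>) \<and> (\<integral>x. f \<psi> x \<partial>lborel) = 0 \<and> integrable lborel (g \<psi>) \<and> (\<integral>x. g \<psi> x \<partial>lborel) = 0"
    if \<psi>: "test_fn2 \<psi>" for \<psi>
  proof -
    note K = test_fn2_D(1)[OF \<psi>]
    have i: "integrable lborel (\<lambda>x. h x * complex_of_real (k x))"
      if "L2_loc h" "continuous_on UNIV k" "\<And>x. x \<notin> supp \<psi> \<Longrightarrow> k x = 0" for h k
      by (rule L2_loc_integrable_mult[OF that(1) _ K]) (use that in \<open>auto intro!: continuous_intros\<close>)
    have iV: "integrable lborel (V \<psi>)" unfolding V_def
      by (intro Bochner_Integration.integrable_diff i TE_D[OF TE] test_fn2_D[OF \<psi>]) (auto simp: pd_outside_supp)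
    have iw: "integrable lborel (\<lambda>x. w x * of_real (lap \<psi> x))" "integrable lborel (\<lambda>x. w x * of_real (\<psi> x))"
      by (intro i TE_D[OF TE] test_fn2_D[OF \<psi>]; simp add: lap_outside_supp supp_eq_0)+
    have 1: "integrable lborel (f \<psi>)" unfolding f_def
      by (intro Bochner_Integration.integrable_add iw integrable_mult_right integrable_coeff_q iV)
    have 2: "integrable lborel (g \<psi>)" unfolding g_def by (intro Bochner_Integration.integrable_diff iw iV)
    have 3: "(\<integral>x. f \<psi> x \<partial>lborel) = 0" using TE_scalar[OF TE \<psi>] by (simp add: f_def V_def mult.assoc)
    have "(\<integral>x. g \<psi> x \<partial>lborel) = (\<integral>x. w x * of_real (\<psi> x) \<partial>lborel) - (\<integral>x. V \<psi> x \<partial>lborel)"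
      unfolding g_def by (rule Bochner_Integration.integral_diff[OF iw(2) iV])
    also have "\<dots> = 0" using TE_D(6)[OF TE test_fn2_D(8)[OF \<psi>]] by (simp add: V_def)
    finally show ?thesis using 1 2 3 by simp
  qed
  let ?r = "\<lambda>x. Re (\<phi> x)" and ?i = "\<lambda>x. Im (\<phi> x)"
  note r = complex_test_fn2_part[OF bounded_linear_Re \<phi>] and i = complex_test_fn2_part[OF bounded_linear_Im \<phi>]
  note mr = main[OF r(1)] and mi = main[OF i(1)]
  have U: "U x = V ?r x + \<i> * V ?i x" for x
    unfolding U_def V_def r(2) i(2) by (simp add: complex_eq_iff algebra_simps)
  have f: "w x * lap \<phi> x + complex_of_real (\<kappa>\<^sup>2) * (coeff_q q0 D x * U x) = f ?r x + \<i> * f ?i x" for x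
  proof -
    have l: "lap \<phi> x = of_real (Re (lap \<phi> x)) + \<i> * of_real (Im (lap \<phi> x))" by (simp add: complex_eq_iff)
    show ?thesis unfolding f_def U r(3) i(3) by (subst l) (simp add: algebra_simps)
  qed
  have g: "w x * \<phi> x - U x = g ?r x + \<i> * g ?i x" for x
  proof -
    have l: "\<phi> x = of_real (Re (\<phi> x)) + \<i> * of_real (Im (\<phi> x))" by (simp add: complex_eq_iff)
    show ?thesis unfolding g_def U by (subst l) (simp add: algebra_simps)
  qed
  show "integrable lborel (\<lambda>x. w x * lap \<phi> x + complex_of_real (\<kappa>\<^sup>2) * (coeff_q q0 D x * U x))"
    "(\<integral>x. w x * lap \<phi> x + complex_of_real (\<kappa>\<^sup>2) * (coeff_q q0 D x * U x) \<partial>lborel) = 0"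
    "integrable lborel (\<lambda>x. w x * \<phi> x - U x)"
    "(\<integral>x. w x * \<phi> x - U x \<partial>lborel) = 0"
    unfolding f g using mr mi by auto
qed

text \<open>To the difference of the two scalar equations kappa^2 q0 times the difference of the two
  curl relations is added. This eliminates \<open>u - u'\<close> inside \<open>D\<close>. Within
  \<open>B\<close> the fields agree outside \<open>D\<close>, so everything lives on
  \<open>closure D\<close>, where the coefficients q0 and 1 differ.\<close>

lemma corner_identity:
  assumes TE: "TE_total_field \<kappa> d q0 D u w" and TE': "TE_total_field \<kappa> d q0 D' u' w'" and \<kappa>: "0 < \<kappa>"
    and B: "open B" "B \<inter> closure D' = {}" "\<And>x. x \<in> B - closure D \<Longrightarrow> w x = w' x"
    and \<phi>: "complex_test_fn2 \<phi>" "supp \<phi> \<subseteq> B"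
  shows "(\<integral>x. indicator (closure D) x *\<^sub>R ((w x - w' x) * (lap \<phi> x + of_real (\<kappa>\<^sup>2) * q0 * \<phi> x)) \<partial>lborel)
    + (q0 - 1) * (\<integral>x. indicator (closure D) x *\<^sub>R (pd (axis 1 1) w' x * pd (axis 1 1) \<phi> x
        + pd (axis 2 1) w' x * pd (axis 2 1) \<phi> x) \<partial>lborel) = 0"
proof -
  let ?C = "closure D"
  define k where "k = complex_of_real (\<kappa>\<^sup>2)"
  have k0: "k \<noteq> 0" using \<kappa> by (simp add: k_def)
  define U where "U x = u x $ 1 * pd (axis 2 1) \<phi> x - u x $ 2 * pd (axis 1 1) \<phi> x" for x
  define U' where "U' x = u' x $ 1 * pd (axis 2 1) \<phi> x - u' x $ 2 * pd (axis 1 1) \<phi> x" for x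
  define g where "g = (\<lambda>x. pd (axis 1 1) w' x * pd (axis 1 1) \<phi> x + pd (axis 2 1) w' x * pd (axis 2 1) \<phi> x)"
  note T = TE_complex[OF TE \<phi>(1), folded U_def k_def] and T' = TE_complex[OF TE' \<phi>(1), folded U'_def k_def]
  note K = complex_test_fn2_D(1)[OF \<phi>(1)]
  have out: "\<phi> x = 0" "pd e \<phi> x = 0" "lap \<phi> x = 0" if "x \<notin> supp \<phi>" for x e
    using that by (auto simp: supp_eq_0 pd_outside_supp lap_outside_supp)
  have ueq: "U x = U' x" if "x \<in> B" "x \<notin> ?C" for x
  proof -
    have o: "open (B - ?C)" using B(1) by auto
    have "x \<notin> closure D'" using that B(2) by auto
    moreover have "pd e w x = pd e w' x" for e by (rule pd_cong_open[OF o]) (use that B in auto)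
    ultimately have "k * u x $ 1 = k * u' x $ 1" "k * u x $ 2 = k * u' x $ 2"
      using TE_field_eq[OF TE less_imp_le[OF \<kappa>] that(2)] TE_field_eq[OF TE' less_imp_le[OF \<kappa>], of x]
          by (simp_all add: k_def)
    then show ?thesis using k0 by (simp add: U_def U'_def)
  qed
  \<comment> \<open>The support of phi avoids \<open>closure D'\<close>, so
    \<open>TE_field_eq\<close> turns kappa^2 U' into the scalar product of the gradients of
    \<open>w'\<close> and phi.\<close>
  have U'g: "k * U' x = g x" for x
  proof (cases "x \<in> supp \<phi>")
    case True
    then have x: "x \<notin> closure D'" using \<phi>(2) B(2) by auto
    have "k * U' x = (k * u' x $ 1) * pd (axis 2 1) \<phi> x - (k * u' x $ 2) * pd (axis 1 1) \<phi> x"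
      by (simp add: U'_def algebra_simps)
    then show ?thesis unfolding k_def TE_field_eq[OF TE' less_imp_le[OF \<kappa>] x] by (simp add: g_def)
  qed (simp add: U'_def g_def out)
  \<comment> \<open>On \<open>closure D\<close> the coefficients are q0 and 1, and q0 U - U' = q0 (U
    - U') + (q0 - 1) U'.\<close>
  have p1: "(w x * lap \<phi> x + k * (coeff_q q0 D x * U x)) - (w' x * lap \<phi> x + k * (coeff_q q0 D' x * U' x))
     = indicator ?C x *\<^sub>R ((w x - w' x) * lap \<phi> x + k * (q0 * (U x - U' x)) + (q0 - 1) * g x)" for x
  proof (cases "x \<in> supp \<phi>")
    case True
    then have x: "x \<in> B" "x \<notin> closure D'" using \<phi>(2) B(2) by auto
    show ?thesis
    proof (cases "x \<in> ?C")
      case True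
      then show ?thesis using x by (simp add: coeff_q_def U'g[symmetric] algebra_simps)
    next
      case False
      then show ?thesis using x ueq[OF x(1) False] B(3)[of x] by (simp add: coeff_q_def)
    qed
  qed (simp add: U_def U'_def g_def out)
  have p2: "(w x * \<phi> x - U x) - (w' x * \<phi> x - U' x) = indicator ?C x *\<^sub>R ((w x - w' x) * \<phi> x - (U x - U' x))" for x
  proof (cases "x \<in> supp \<phi>")
    case True
    then have x: "x \<in> B" using \<phi>(2) by auto
    show ?thesis
    proof (cases "x \<in> ?C")
      case True
      then show ?thesis by (simp add: algebra_simps)
    next
      case False
      then show ?thesis using ueq[OF x False] B(3)[of x] x by simp
    qed
  qed (simp add: U_def U'_def out)
  have 1: "integrable lborel (\<lambda>x. indicator ?C x *\<^sub>R ((w x - w' x) * lap \<phi> x + k * (q0 * (U x - U' x)) + (q0 - 1) * g x))"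
    "(\<integral>x. indicator ?C x *\<^sub>R ((w x - w' x) * lap \<phi> x + k * (q0 * (U x - U' x)) + (q0 - 1) * g x) \<partial>lborel) = 0"
    unfolding p1[symmetric] using T(1,2) T'(1,2) by simp_all
  have 2: "integrable lborel (\<lambda>x. indicator ?C x *\<^sub>R ((w x - w' x) * \<phi> x - (U x - U' x)))"
    "(\<integral>x. indicator ?C x *\<^sub>R ((w x - w' x) * \<phi> x - (U x - U' x)) \<partial>lborel) = 0"
    unfolding p2[symmetric] using T(3,4) T'(3,4) by simp_all
  have iW: "integrable lborel (\<lambda>x. indicator ?C x *\<^sub>R ((w x - w' x) * (lap \<phi> x + k * q0 * \<phi> x)))"
  proof (rule integrable_mult_indicator)
    have "integrable lborel (\<lambda>x. h x * (lap \<phi> x + k * q0 * \<phi> x))" if "L2_loc h" for h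
      by (rule L2_loc_integrable_mult[OF that _ K]) (use complex_test_fn2_D[OF \<phi>(1)] out in \<open>auto intro!: continuous_intros\<close>)
    from Bochner_Integration.integrable_diff[OF this[OF TE_D(3)[OF TE]] this[OF TE_D(3)[OF TE']]]
    show "integrable lborel (\<lambda>x. (w x - w' x) * (lap \<phi> x + k * q0 * \<phi> x))" by (simp add: left_diff_distrib)
  qed simp
  have "C1_on B w'"
    using C1_on_subset[OF wsol_C1[OF TE_wsol[OF TE'] less_imp_le[OF \<kappa>]]] B(2) by blast
  then have cw: "continuous_on B (pd e w')" for e by (simp add: C1_on_def)
  have ig: "integrable lborel (\<lambda>x. indicator ?C x *\<^sub>R g x)"
  proof (rule integrable_mult_indicator)
    have "integrable lborel (\<lambda>x. pd e w' x * pd e \<phi> x)" for e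
      by (rule integrable_mult_test(2)[OF B(1) cw _ K \<phi>(2)])
        (use complex_test_fn2_D(4)[OF \<phi>(1)] out in \<open>auto intro: continuous_on_subset\<close>)
    then show "integrable lborel g" unfolding g_def by simp
  qed simp
  have "(\<integral>x. indicator ?C x *\<^sub>R ((w x - w' x) * (lap \<phi> x + k * q0 * \<phi> x)) \<partial>lborel)
      + (q0 - 1) * (\<integral>x. indicator ?C x *\<^sub>R g x \<partial>lborel)
    = (\<integral>x. indicator ?C x *\<^sub>R ((w x - w' x) * (lap \<phi> x + k * q0 * \<phi> x)) + (q0 - 1) * (indicator ?C x *\<^sub>R g x) \<partial>lborel)"
  proof -
    have ig': "integrable lborel (\<lambda>x. (q0 - 1) * (indicator ?C x *\<^sub>R g x))" by (intro integrable_mult_right ig)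
    show ?thesis unfolding Bochner_Integration.integral_add[OF iW ig'] integral_mult_right_zero ..
  qed
  \<comment> \<open>The terms with U - U' cancel between the two integrands; each of these
    integrates to 0 separately.\<close>
  also have "\<dots> = (\<integral>x. indicator ?C x *\<^sub>R ((w x - w' x) * lap \<phi> x + k * (q0 * (U x - U' x)) + (q0 - 1) * g x)
      + k * q0 * (indicator ?C x *\<^sub>R ((w x - w' x) * \<phi> x - (U x - U' x))) \<partial>lborel)"
    by (intro Bochner_Integration.integral_cong refl) (simp add: indicator_def algebra_simps)
  also have "\<dots> = 0"
  proof -
    have i2: "integrable lborel (\<lambda>x. k * q0 * (indicator ?C x *\<^sub>R ((w x - w' x) * \<phi> x - (U x - U' x))))"
      by (intro integrable_mult_right 2)
    show ?thesis unfolding Bochner_Integration.integral_add[OF 1(1) i2] integral_mult_right_zero 1(2) 2(2) by simp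
  qed
  finally show ?thesis unfolding g_def k_def .
qed

section \<open>Test functions in product form along the sides of the corner\<close>

definition frame_product :: "pt \<Rightarrow> pt \<Rightarrow> pt \<Rightarrow> (real \<Rightarrow> complex) \<Rightarrow> (real \<Rightarrow> complex) \<Rightarrow> pt \<Rightarrow> complex" where
  "frame_product p e f P Q x = P ((x - p) \<bullet> e) * Q ((x - p) \<bullet> f)"

lemma frame_product_deriv:
  assumes "\<And>t. (P has_vector_derivative P1 t) (at t)" "\<And>t. (Q has_vector_derivative Q1 t) (at t)"
  shows "(frame_product p e f P Q has_derivative (\<lambda>g. (g \<bullet> e) *\<^sub>R frame_product p e f P1 Q x
      + (g \<bullet> f) *\<^sub>R frame_product p e f P Q1 x)) (at x)"
    "frame_product p e f P Q differentiable (at x)"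
    "pd g (frame_product p e f P Q) x = (g \<bullet> e) *\<^sub>R frame_product p e f P1 Q x + (g \<bullet> f) *\<^sub>R frame_product p e f P Q1 x"
proof -
  have l: "((\<lambda>x. (x - p) \<bullet> e) has_derivative (\<lambda>g. g \<bullet> e)) (at x)" for e by (auto intro!: derivative_eq_intros)
  have 1: "((\<lambda>x. P ((x - p) \<bullet> e)) has_derivative (\<lambda>g. (g \<bullet> e) *\<^sub>R P1 ((x - p) \<bullet> e))) (at x)"
    using has_derivative_compose[OF l assms(1)[unfolded has_vector_derivative_def]] .
  have 2: "((\<lambda>x. Q ((x - p) \<bullet> f)) has_derivative (\<lambda>g. (g \<bullet> f) *\<^sub>R Q1 ((x - p) \<bullet> f))) (at x)"
    using has_derivative_compose[OF l assms(2)[unfolded has_vector_derivative_def]] .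
  show D: "(frame_product p e f P Q has_derivative (\<lambda>g. (g \<bullet> e) *\<^sub>R frame_product p e f P1 Q x
      + (g \<bullet> f) *\<^sub>R frame_product p e f P Q1 x)) (at x)"
    unfolding frame_product_def[abs_def] by (rule has_derivative_eq_rhs[OF has_derivative_mult[OF 1 2]]) (auto simp: fun_eq_iff)
  show "frame_product p e f P Q differentiable (at x)" using D by (auto simp: differentiable_def)
  show "pd g (frame_product p e f P Q) x = (g \<bullet> e) *\<^sub>R frame_product p e f P1 Q x
      + (g \<bullet> f) *\<^sub>R frame_product p e f P Q1 x"
    using pd_eqI[OF D] .
qed

lemma continuous_frame_product:
  assumes "continuous_on UNIV P" "continuous_on UNIV Q"
  shows "continuous_on S (frame_product p e f P Q)"
  unfolding frame_product_def[abs_def]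
  by (intro continuous_intros continuous_on_compose2[OF assms(1)] continuous_on_compose2[OF assms(2)]) auto

lemma frame_product_C1:
  assumes "\<And>t. (P has_vector_derivative P1 t) (at t)" "\<And>t. (Q has_vector_derivative Q1 t) (at t)"
    "continuous_on UNIV P1" "continuous_on UNIV Q1"
  shows "C1_on UNIV (frame_product p e f P Q)"
proof -
  have "continuous_on UNIV P" "continuous_on UNIV Q"
    using assms(1,2) by (auto intro!: continuous_at_imp_continuous_on has_vector_derivative_continuous)
  then show ?thesis unfolding C1_on_def frame_product_deriv(3)[OF assms(1,2), abs_def]
    using frame_product_deriv(2)[OF assms(1,2)] assms(3,4) by (auto intro!: continuous_intros continuous_frame_product)
qed

lemma frame_product_complex_test_fn2:
  fixes e f p :: pt
  assumes on: "norm e = 1" "norm f = 1" "e \<bullet> f = 0"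
    and P: "\<And>t. (P has_vector_derivative P1 t) (at t)" "\<And>t. (P1 has_vector_derivative P2 t) (at t)" "continuous_on UNIV P2"
    and Q: "\<And>t. (Q has_vector_derivative Q1 t) (at t)" "\<And>t. (Q1 has_vector_derivative Q2 t) (at t)" "continuous_on UNIV Q2"
    and z: "\<And>t. L \<le> \<bar>t\<bar> \<Longrightarrow> P t = 0" "\<And>t. L \<le> \<bar>t\<bar> \<Longrightarrow> Q t = 0" and L: "0 \<le> L"
  shows "complex_test_fn2 (frame_product p e f P Q)" "supp (frame_product p e f P Q) \<subseteq> cball p (2 * L)"
    "lap (frame_product p e f P Q) x = frame_product p e f P2 Q x + frame_product p e f P Q2 x"
proof -
  have c1: "continuous_on UNIV P1" "continuous_on UNIV Q1"
    using P(2) Q(2) by (auto intro!: continuous_at_imp_continuous_on has_vector_derivative_continuous)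
  have pd1: "pd g (frame_product p e f P Q) = (\<lambda>x. (g \<bullet> e) *\<^sub>R frame_product p e f P1 Q x
      + (g \<bullet> f) *\<^sub>R frame_product p e f P Q1 x)" for g
    by (rule ext) (rule frame_product_deriv(3)[OF P(1) Q(1)])
  have D2: "(pd g (frame_product p e f P Q) has_derivative (\<lambda>h. (g \<bullet> e) *\<^sub>R ((h \<bullet> e) *\<^sub>R frame_product p e f P2 Q x
      + (h \<bullet> f) *\<^sub>R frame_product p e f P1 Q1 x)
      + (g \<bullet> f) *\<^sub>R ((h \<bullet> e) *\<^sub>R frame_product p e f P1 Q1 x + (h \<bullet> f) *\<^sub>R frame_product p e f P Q2 x))) (at x)" for g x
    unfolding pd1 by (intro has_derivative_add has_derivative_scaleR_right frame_product_deriv(1) P Q)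
  have pd2: "pd h (pd g (frame_product p e f P Q)) x = (g \<bullet> e) *\<^sub>R ((h \<bullet> e) *\<^sub>R frame_product p e f P2 Q x
      + (h \<bullet> f) *\<^sub>R frame_product p e f P1 Q1 x)
      + (g \<bullet> f) *\<^sub>R ((h \<bullet> e) *\<^sub>R frame_product p e f P1 Q1 x + (h \<bullet> f) *\<^sub>R frame_product p e f P Q2 x)" for g h x
    using pd_eqI[OF D2] .
  have cPQ: "continuous_on UNIV P" "continuous_on UNIV Q"
    using P(1) Q(1) by (auto intro!: continuous_at_imp_continuous_on has_vector_derivative_continuous)
  have C2: "C1_on UNIV (pd g (frame_product p e f P Q))" for g
    unfolding C1_on_def pd2[abs_def] using D2 c1 P(3) Q(3) cPQ
    by (auto simp: differentiable_def intro!: continuous_intros continuous_frame_product)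
  show s: "supp (frame_product p e f P Q) \<subseteq> cball p (2 * L)"
  proof (rule supp_subset[OF closed_cball])
    fix x assume x: "x \<notin> cball p (2 * L)"
    show "frame_product p e f P Q x = 0"
    proof (rule ccontr)
      assume "frame_product p e f P Q x \<noteq> 0"
      then have "\<bar>(x - p) \<bullet> e\<bar> < L" "\<bar>(x - p) \<bullet> f\<bar> < L" using z by (force simp: frame_product_def not_le[symmetric])+
      moreover have "x - p = ((x - p) \<bullet> e) *\<^sub>R e + ((x - p) \<bullet> f) *\<^sub>R f"
      proof -
        have "orthogonal_transformation (\<lambda>y::pt. y $ 1 *\<^sub>R e + y $ 2 *\<^sub>R f)"
            by (rule orthogonal_transformation_frame[OF on])
        then have "surj (\<lambda>y::pt. y $ 1 *\<^sub>R e + y $ 2 *\<^sub>R f)" by (rule orthogonal_transformation_surj)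
        then obtain y :: pt where y: "x - p = y $ 1 *\<^sub>R e + y $ 2 *\<^sub>R f" by (rule surjE)
        have "e \<bullet> e = 1" "f \<bullet> f = 1" "e \<bullet> f = 0" "f \<bullet> e = 0" using on by (simp_all add: norm_eq_1 inner_commute)
        then show ?thesis unfolding y by (simp add: inner_add_left)
      qed
      then have "norm (x - p) \<le> \<bar>(x - p) \<bullet> e\<bar> * norm e + \<bar>(x - p) \<bullet> f\<bar> * norm f"
        by (metis norm_scaleR norm_triangle_ineq)
      ultimately have "norm (x - p) \<le> 2 * L" using on by simp
      then show False using x by (simp add: dist_norm norm_minus_commute)
    qed
  qed
  show "complex_test_fn2 (frame_product p e f P Q)" unfolding complex_test_fn2_def
    using frame_product_C1[OF P(1) Q(1) c1] C2 compact_supp[OF compact_cball s] by blast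
  have 1: "axis 1 1 \<bullet> e * (axis 1 1 \<bullet> e) + axis 2 1 \<bullet> e * (axis 2 1 \<bullet> e)
      = 1" "axis 1 1 \<bullet> f * (axis 1 1 \<bullet> f) + axis 2 1 \<bullet> f * (axis 2 1 \<bullet> f) = 1"
    "axis 1 1 \<bullet> e * (axis 1 1 \<bullet> f) + axis 2 1 \<bullet> e * (axis 2 1 \<bullet> f) = 0"
    using on by (auto simp: norm_eq_1 inner_vec_def sum_2 axis_def)
  have "lap (frame_product p e f P Q) x = (axis 1 1 \<bullet> e * (axis 1 1 \<bullet> e)
      + axis 2 1 \<bullet> e * (axis 2 1 \<bullet> e)) *\<^sub>R frame_product p e f P2 Q x
     + 2 *\<^sub>R (axis 1 1 \<bullet> e * (axis 1 1 \<bullet> f) + axis 2 1 \<bullet> e * (axis 2 1 \<bullet> f)) *\<^sub>R frame_product p e f P1 Q1 x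
     + (axis 1 1 \<bullet> f * (axis 1 1 \<bullet> f) + axis 2 1 \<bullet> f * (axis 2 1 \<bullet> f)) *\<^sub>R frame_product p e f P Q2 x"
    unfolding lap_def pd2 by (simp add: scaleR_conv_of_real algebra_simps)
  then show "lap (frame_product p e f P Q) x = frame_product p e f P2 Q x + frame_product p e f P Q2 x"
      unfolding 1 by simp
qed

section \<open>Integration by parts on a square\<close>

lemma continuous_on_slices:
  fixes f :: "real \<Rightarrow> real \<Rightarrow> complex"
  assumes "continuous_on ({0..L} \<times> {0..L}) (\<lambda>z. f (fst z) (snd z))" "y \<in> {0..L}"
  shows "continuous_on {0..L} (\<lambda>x. f x y)" "continuous_on {0..L} (f y)"
proof -
  have "continuous_on {0..L} (\<lambda>x. (\<lambda>z. f (fst z) (snd z)) (x, y))"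
    by (rule continuous_on_compose2[OF assms(1)]) (use assms(2) in \<open>auto intro!: continuous_intros\<close>)
  then show "continuous_on {0..L} (\<lambda>x. f x y)" by simp
  have "continuous_on {0..L} (\<lambda>x. (\<lambda>z. f (fst z) (snd z)) (y, x))"
    by (rule continuous_on_compose2[OF assms(1)]) (use assms(2) in \<open>auto intro!: continuous_intros\<close>)
  then show "continuous_on {0..L} (f y)" by simp
qed

lemma by_parts_1d:
  fixes P P' g g' :: "real \<Rightarrow> complex"
  assumes L: "0 \<le> L" and P: "\<And>t. t \<in> {0..L} \<Longrightarrow> (P has_vector_derivative P' t) (at t within {0..L})" "continuous_on {0..L} P'" "P L = 0"
    and g: "\<And>t. t \<in> {0..L} \<Longrightarrow> (g has_vector_derivative g' t) (at t within {0..L})" "continuous_on {0..L} g'"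
  shows "integral {0..L} (\<lambda>t. P' t * g t) = - (P 0 * g 0) - integral {0..L} (\<lambda>t. P t * g' t)"
proof -
  have cP: "continuous_on {0..L} P" and cg: "continuous_on {0..L} g"
    using has_vector_derivative_continuous[OF P(1)] has_vector_derivative_continuous[OF g(1)]
    by (auto simp: continuous_on_eq_continuous_within)
  have "((\<lambda>t. P t * g' t + P' t * g t) has_integral (P L * g L - P 0 * g 0)) {0..L}"
    by (rule fundamental_theorem_of_calculus[OF L]) (rule has_vector_derivative_mult[OF P(1) g(1)])
  then have "integral {0..L} (\<lambda>t. P t * g' t + P' t * g t) = - (P 0 * g 0)" using P(3) by (simp add: integral_unique)
  moreover have "integral {0..L} (\<lambda>t. P t * g' t + P' t * g t)
      = integral {0..L} (\<lambda>t. P t * g' t) + integral {0..L} (\<lambda>t. P' t * g t)"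
    by (rule integral_add; intro integrable_continuous_real continuous_intros cP cg P(2) g(2))
  ultimately show ?thesis by (simp add: algebra_simps)
qed

lemma by_parts_2d_snd:
  fixes g g' :: "real \<Rightarrow> real \<Rightarrow> complex"
  assumes L: "0 \<le> L" and P: "continuous_on {0..L} P"
    and Q: "\<And>t. t \<in> {0..L} \<Longrightarrow> (Q has_vector_derivative Q' t) (at t within {0..L})" "continuous_on {0..L} Q'" "Q L = 0"
    and g: "\<And>s t. s \<in> {0..L} \<Longrightarrow> t \<in> {0..L} \<Longrightarrow> (g s has_vector_derivative g' s t) (at t within {0..L})"
      "continuous_on ({0..L} \<times> {0..L}) (\<lambda>z. g (fst z) (snd z))" "continuous_on ({0..L} \<times> {0..L}) (\<lambda>z. g' (fst z) (snd z))"
  shows "integral {0..L} (\<lambda>s. integral {0..L} (\<lambda>t. P s * Q' t * g s t)) =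
    - (Q 0 * integral {0..L} (\<lambda>s. P s * g s 0)) - integral {0..L} (\<lambda>s. integral {0..L} (\<lambda>t. P s * Q t * g' s t))"
proof -
  have cQ: "continuous_on {0..L} Q"
    using has_vector_derivative_continuous[OF Q(1)] by (auto simp: continuous_on_eq_continuous_within)
  have in1: "integral {0..L} (\<lambda>t. P s * Q' t * g s t) = - (Q 0 * (P s * g s 0))
      - integral {0..L} (\<lambda>t. P s * Q t * g' s t)" if s: "s \<in> {0..L}" for s
  proof -
    have "integral {0..L} (\<lambda>t. P s * Q' t * g s t) = P s * integral {0..L} (\<lambda>t. Q' t * g s t)"
      by (simp add: mult.assoc flip: integral_mult_right)
    also have "integral {0..L} (\<lambda>t. Q' t * g s t) = - (Q 0 * g s 0) - integral {0..L} (\<lambda>t. Q t * g' s t)"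
      by (rule by_parts_1d[OF L Q g(1)[OF s]]) (use continuous_on_slices(2)[OF g(3) s] in auto)
    finally show ?thesis by (simp add: algebra_simps flip: integral_mult_right)
  qed
  have c2: "continuous_on {0..L} (\<lambda>s. integral {0..L} (\<lambda>t. P s * Q t * g' s t))"
    unfolding cbox_interval[symmetric]
  proof (rule integral_continuous_on_param)
    have "continuous_on ({0..L} \<times> {0..L}) (\<lambda>z. P (fst z) * Q (snd z) * g' (fst z) (snd z))"
      by (intro continuous_intros g continuous_on_compose2[OF P] continuous_on_compose2[OF cQ]) auto
    then show "continuous_on (cbox 0 L \<times> cbox 0 L) (\<lambda>(s, t). P s * Q t * g' s t)" by (simp add: case_prod_unfold)
  qed
  have c1: "continuous_on {0..L} (\<lambda>s. - (Q 0 * (P s * g s 0)))"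
    using continuous_on_slices(1)[OF g(2), of 0] L by (intro continuous_intros P) auto
  have "integral {0..L} (\<lambda>s. integral {0..L} (\<lambda>t. P s * Q' t * g s t))
     = integral {0..L} (\<lambda>s. - (Q 0 * (P s * g s 0)) - integral {0..L} (\<lambda>t. P s * Q t * g' s t))"
    by (rule integral_cong) (rule in1)
  also have "\<dots> = integral {0..L} (\<lambda>s. - (Q 0 * (P s * g s 0)))
      - integral {0..L} (\<lambda>s. integral {0..L} (\<lambda>t. P s * Q t * g' s t))"
    by (rule integral_diff; rule integrable_continuous_real; rule c1 c2)
  finally show ?thesis by simp
qed

lemma integral_swap_square:
  fixes h :: "real \<Rightarrow> real \<Rightarrow> complex"
  assumes "continuous_on ({0..L} \<times> {0..L}) (\<lambda>z. h (fst z) (snd z))"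
  shows "integral {0..L} (\<lambda>s. integral {0..L} (\<lambda>t. h s t)) = integral {0..L} (\<lambda>t. integral {0..L} (\<lambda>s. h s t))"
  using integral_swap_continuous[of 0 0 L L h] assms by (simp add: cbox_Pair_eq case_prod_unfold)

lemma by_parts_2d_fst:
  fixes g g' :: "real \<Rightarrow> real \<Rightarrow> complex"
  assumes L: "0 \<le> L" and Q: "continuous_on {0..L} Q"
    and P: "\<And>t. t \<in> {0..L} \<Longrightarrow> (P has_vector_derivative P' t) (at t within {0..L})" "continuous_on {0..L} P'" "P L = 0"
    and g: "\<And>s t. s \<in> {0..L} \<Longrightarrow> t \<in> {0..L} \<Longrightarrow> ((\<lambda>s. g s t) has_vector_derivative g' s t) (at s within {0..L})"
      "continuous_on ({0..L} \<times> {0..L}) (\<lambda>z. g (fst z) (snd z))" "continuous_on ({0..L} \<times> {0..L}) (\<lambda>z. g' (fst z) (snd z))"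
  shows "integral {0..L} (\<lambda>s. integral {0..L} (\<lambda>t. P' s * Q t * g s t)) =
    - (P 0 * integral {0..L} (\<lambda>t. Q t * g 0 t)) - integral {0..L} (\<lambda>s. integral {0..L} (\<lambda>t. P s * Q t * g' s t))"
proof -
  have cP: "continuous_on {0..L} P"
    using has_vector_derivative_continuous[OF P(1)] by (auto simp: continuous_on_eq_continuous_within)
  have sw: "continuous_on ({0..L} \<times> {0..L}) (\<lambda>z. h (snd z) (fst z))" if "continuous_on ({0..L} \<times> {0..L}) (\<lambda>z. h (fst z) (snd z))" for h :: "real \<Rightarrow> real \<Rightarrow> complex"
  proof -
    have "continuous_on ({0..L} \<times> {0..L}) (\<lambda>z. (\<lambda>z. h (fst z) (snd z)) (snd z, fst z))"
      by (rule continuous_on_compose2[OF that]) (auto intro!: continuous_intros)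
    then show ?thesis by simp
  qed
  have "integral {0..L} (\<lambda>s. integral {0..L} (\<lambda>t. P' s * Q t * g s t))
      = integral {0..L} (\<lambda>t. integral {0..L} (\<lambda>s. P' s * Q t * g s t))"
    by (rule integral_swap_square) (intro continuous_intros g continuous_on_compose2[OF Q] continuous_on_compose2[OF P(2)]; auto)
  also have "\<dots> = integral {0..L} (\<lambda>t. integral {0..L} (\<lambda>s. Q t * P' s * g s t))" by (simp add: mult.commute)
  also have "\<dots> = - (P 0 * integral {0..L} (\<lambda>t. Q t * g 0 t))
      - integral {0..L} (\<lambda>t. integral {0..L} (\<lambda>s. Q t * P s * g' s t))"
    by (rule by_parts_2d_snd[OF L Q P, of "\<lambda>t s. g s t"]) (use g sw[OF g(2)] sw[OF g(3)] in auto)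
  also have "integral {0..L} (\<lambda>t. integral {0..L} (\<lambda>s. Q t * P s * g' s t))
      = integral {0..L} (\<lambda>t. integral {0..L} (\<lambda>s. P s * Q t * g' s t))"
    by (simp add: mult.commute)
  also have "\<dots> = integral {0..L} (\<lambda>s. integral {0..L} (\<lambda>t. P s * Q t * g' s t))"
    by (rule integral_swap_square[symmetric]) (intro continuous_intros g continuous_on_compose2[OF Q] continuous_on_compose2[OF cP]; auto)
  finally show ?thesis .
qed

lemma frame_decomp:
  fixes e f :: pt
  assumes on: "norm e = 1" "norm f = 1" "e \<bullet> f = 0"
  shows "x = (x \<bullet> e) *\<^sub>R e + (x \<bullet> f) *\<^sub>R f"
proof -
  have "surj (\<lambda>y::pt. y $ 1 *\<^sub>R e + y $ 2 *\<^sub>R f)"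
    by (rule orthogonal_transformation_surj) (rule orthogonal_transformation_frame[OF on])
  then obtain y :: pt where y: "x = y $ 1 *\<^sub>R e + y $ 2 *\<^sub>R f" by (rule surjE)
  have "e \<bullet> e = 1" "f \<bullet> f = 1" "e \<bullet> f = 0" "f \<bullet> e = 0" using on by (simp_all add: norm_eq_1 inner_commute)
  then show ?thesis unfolding y by (simp add: inner_add_left)
qed

text \<open>One cutoff is fixed for all rates a and b, so that the bounds for its derivatives are
  uniform as the rates tend to infinity.\<close>

locale cutoff =
  fixes \<eta> :: real and \<zeta> \<zeta>1 \<zeta>2 :: "real \<Rightarrow> real"
  assumes \<eta>: "0 < \<eta>"
    and D\<zeta>: "\<And>x. (\<zeta> has_real_derivative \<zeta>1 x) (at x)" "\<And>x. (\<zeta>1 has_real_derivative \<zeta>2 x) (at x)"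
    and c\<zeta>: "continuous_on UNIV \<zeta>2"
    and one: "\<And>x. \<bar>x\<bar> \<le> \<eta> \<Longrightarrow> \<zeta> x = 1" and zero: "\<And>x. 2 * \<eta> \<le> \<bar>x\<bar> \<Longrightarrow> \<zeta> x = 0" and bd: "\<And>x. \<bar>\<zeta> x\<bar> \<le> 1"
begin

definition damped :: "complex \<Rightarrow> real \<Rightarrow> complex" where "damped a t = of_real (\<zeta> t) * exp (- a * of_real t)"
definition damped1 :: "complex \<Rightarrow> real \<Rightarrow> complex" where "damped1 a t
    = (of_real (\<zeta>1 t) - a * of_real (\<zeta> t)) * exp (- a * of_real t)"
definition damped2 :: "complex \<Rightarrow> real \<Rightarrow> complex" where
  "damped2 a t = (of_real (\<zeta>2 t) - 2 * a * of_real (\<zeta>1 t) + a\<^sup>2 * of_real (\<zeta> t)) * exp (- a * of_real t)"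

lemma exp_deriv: "((\<lambda>t. exp (- a * of_real t)) has_vector_derivative
    - a * exp (- a * of_real t)) (at t within S)" for a :: complex
proof -
  have "((\<lambda>t. exp (t *\<^sub>R (- a))) has_vector_derivative exp (t *\<^sub>R (- a)) * (- a)) (at t within S)"
    by (rule exp_scaleR_has_vector_derivative_right)
  then show ?thesis by (simp add: scaleR_conv_of_real mult_ac)
qed

lemma of_real_deriv: "(g has_real_derivative g') (at t) \<Longrightarrow> ((\<lambda>t. complex_of_real (g t)) has_vector_derivative of_real g') (at t)"
  by (rule has_vector_derivative_of_real) (simp add: has_real_derivative_iff_has_vector_derivative[symmetric])

lemma damped_deriv: "(damped a has_vector_derivative damped1 a t) (at t)"
proof -
  have "(damped a has_vector_derivative of_real (\<zeta> t) * (- a * exp (- a * of_real t))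
      + of_real (\<zeta>1 t) * exp (- a * of_real t)) (at t)"
    unfolding damped_def[abs_def] by (rule has_vector_derivative_mult[OF of_real_deriv[OF D\<zeta>(1)] exp_deriv])
  then show ?thesis by (simp add: damped1_def algebra_simps)
qed

lemma damped1_deriv: "(damped1 a has_vector_derivative damped2 a t) (at t)"
proof -
  have "(damped1 a has_vector_derivative (of_real (\<zeta>1 t) - a * of_real (\<zeta> t)) * (- a * exp (- a * of_real t))
      + (of_real (\<zeta>2 t) - a * of_real (\<zeta>1 t)) * exp (- a * of_real t)) (at t)"
    unfolding damped1_def[abs_def]
    by (intro has_vector_derivative_mult has_vector_derivative_diff has_vector_derivative_mult_right of_real_deriv[OF D\<zeta>(1)]
        of_real_deriv[OF D\<zeta>(2)] exp_deriv)
  then show ?thesis by (simp add: damped2_def algebra_simps power2_eq_square)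
qed

lemma cont_\<zeta>: "continuous_on S \<zeta>" "continuous_on S \<zeta>1" "continuous_on S \<zeta>2"
proof -
  show "continuous_on S \<zeta>" "continuous_on S \<zeta>1"
    using D\<zeta> by (auto intro!: continuous_at_imp_continuous_on DERIV_isCont)
  show "continuous_on S \<zeta>2" by (rule continuous_on_subset[OF c\<zeta>]) simp
qed

lemma damped_cont: "continuous_on S (damped a)" "continuous_on S (damped1 a)" "continuous_on S (damped2 a)"
  unfolding damped_def[abs_def] damped1_def[abs_def] damped2_def[abs_def] by (intro continuous_intros cont_\<zeta>)+

lemma \<zeta>_flat:
  shows "\<bar>t\<bar> < \<eta> \<Longrightarrow> \<zeta>1 t = 0 \<and> \<zeta>2 t = 0" and "2 * \<eta> < \<bar>t\<bar> \<Longrightarrow> \<zeta>1 t = 0 \<and> \<zeta>2 t = 0"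
proof -
  have flat: "\<zeta>1 t = 0 \<and> \<zeta>2 t = 0" if S: "open S" "t \<in> S" "\<And>x. x \<in> S \<Longrightarrow> \<zeta> x = c" for S t c
  proof -
    have 1: "\<zeta>1 x = 0" if x: "x \<in> S" for x
    proof -
      have "(\<zeta> has_real_derivative 0) (at x)"
        by (rule has_field_derivative_transform_within_open[OF DERIV_const S(1) x]) (simp add: S(3))
      then show ?thesis using D\<zeta>(1) DERIV_unique by blast
    qed
    have "(\<zeta>1 has_real_derivative 0) (at t)"
      by (rule has_field_derivative_transform_within_open[OF DERIV_const S(1,2)]) (simp add: 1)
    then show ?thesis using D\<zeta>(2) DERIV_unique 1[OF S(2)] by blast
  qed
  show "\<zeta>1 t = 0 \<and> \<zeta>2 t = 0" if "\<bar>t\<bar> < \<eta>"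
    by (rule flat[of "{-\<eta><..<\<eta>}" t 1]) (use that one in \<open>auto simp: abs_less_iff abs_le_iff\<close>)
  show "\<zeta>1 t = 0 \<and> \<zeta>2 t = 0" if "2 * \<eta> < \<bar>t\<bar>"
    by (rule flat[of "{..<-2*\<eta>} \<union> {2*\<eta><..}" t 0]) (use that zero in \<open>auto simp: abs_if split: if_splits\<close>)
qed

lemma damped_zero: "2 * \<eta> < \<bar>t\<bar> \<Longrightarrow> damped a t = 0 \<and> damped1 a t = 0 \<and> damped2 a t = 0"
  using \<zeta>_flat(2)[of t] zero[of t] by (simp add: damped_def damped1_def damped2_def)

lemma damped_at_0: "damped a 0 = 1" "damped1 a 0 = - a"
  using one[of 0] \<zeta>_flat(1)[of 0] \<eta> by (auto simp: damped_def damped1_def)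

lemma damped_bound: "0 \<le> t \<Longrightarrow> 0 \<le> Re a \<Longrightarrow> norm (damped a t) \<le> 1"
  using bd[of t] by (simp add: damped_def norm_mult mult_le_one)

definition cut_bound :: real where "cut_bound = (SOME z. 0 \<le> z \<and> (\<forall>t\<in>{0..3*\<eta>}. \<bar>\<zeta>1 t\<bar> \<le> z \<and> \<bar>\<zeta>2 t\<bar> \<le> z))"

lemma cut_bound: "0 \<le> cut_bound" "t \<in> {0..3*\<eta>} \<Longrightarrow> \<bar>\<zeta>1 t\<bar> \<le> cut_bound" "t \<in> {0..3*\<eta>} \<Longrightarrow> \<bar>\<zeta>2 t\<bar> \<le> cut_bound"
proof -
  have "bounded (\<zeta>1 ` {0..3*\<eta>})" "bounded (\<zeta>2 ` {0..3*\<eta>})"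
    by (intro compact_imp_bounded compact_continuous_image cont_\<zeta> compact_Icc)+
  then obtain z1 z2 where "\<forall>y\<in>\<zeta>1 ` {0..3*\<eta>}. \<bar>y\<bar> \<le> z1" "\<forall>y\<in>\<zeta>2 ` {0..3*\<eta>}. \<bar>y\<bar> \<le> z2"
    unfolding bounded_iff by auto
  then have "0 \<le> max 0 (max z1 z2) \<and> (\<forall>t\<in>{0..3*\<eta>}. \<bar>\<zeta>1 t\<bar> \<le> max 0 (max z1 z2) \<and> \<bar>\<zeta>2 t\<bar> \<le> max 0 (max z1 z2))"
    by (auto simp: le_max_iff_disj)
  then have "0 \<le> cut_bound \<and> (\<forall>t\<in>{0..3*\<eta>}. \<bar>\<zeta>1 t\<bar> \<le> cut_bound \<and> \<bar>\<zeta>2 t\<bar> \<le> cut_bound)"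
      unfolding cut_bound_def by (rule someI)
  then show "0 \<le> cut_bound" "t \<in> {0..3*\<eta>} \<Longrightarrow> \<bar>\<zeta>1 t\<bar> \<le> cut_bound" "t \<in> {0..3*\<eta>} \<Longrightarrow> \<bar>\<zeta>2 t\<bar> \<le> cut_bound" by auto
qed

text \<open>The difference contains only derivatives of the cutoff. They vanish for t < eta, and
  beyond eta the exponential is at most exp (- c eta).\<close>

lemma damped2_defect:
  assumes t: "t \<in> {0..3*\<eta>}" and a: "0 \<le> c" "c \<le> Re a" "norm a \<le> s" "1 \<le> s"
  shows "norm (damped2 a t - a\<^sup>2 * damped a t) \<le> 3 * cut_bound * s * exp (- c * \<eta>)"
proof -
  have eq: "damped2 a t - a\<^sup>2 * damped a t = (of_real (\<zeta>2 t) - 2 * a * of_real (\<zeta>1 t)) * exp (- a * of_real t)"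
    by (simp add: damped2_def damped_def algebra_simps)
  show ?thesis
  proof (cases "t < \<eta>")
    case True
    then have "\<zeta>1 t = 0" "\<zeta>2 t = 0" using \<zeta>_flat(1)[of t] t by auto
    then show ?thesis unfolding eq using cut_bound(1) a by simp
  next
    case False
    have "norm (complex_of_real (\<zeta>2 t) - 2 * a * of_real (\<zeta>1 t))
        \<le> norm (complex_of_real (\<zeta>2 t)) + norm (2 * a * of_real (\<zeta>1 t))"
      by (rule norm_triangle_ineq4)
    also have "\<dots> = \<bar>\<zeta>2 t\<bar> + 2 * norm a * \<bar>\<zeta>1 t\<bar>" by (simp add: norm_mult)
    also have "\<dots> \<le> cut_bound * s + 2 * s * cut_bound"
    proof (intro add_mono mult_mono)
      have "cut_bound * 1 \<le> cut_bound * s" using cut_bound(1) a by (intro mult_left_mono) auto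
      then show "\<bar>\<zeta>2 t\<bar> \<le> cut_bound * s" using cut_bound(3)[OF t] by linarith
    qed (use cut_bound t a in auto)
    finally have 1: "norm (complex_of_real (\<zeta>2 t) - 2 * a * of_real (\<zeta>1 t)) \<le> 3 * cut_bound * s" by (simp add: mult_ac)
    have "c * \<eta> \<le> Re a * t" using a False \<eta> by (intro mult_mono) auto
    then have 2: "norm (exp (- a * of_real t)) \<le> exp (- c * \<eta>)" by simp
    have "0 \<le> 3 * cut_bound * s" using cut_bound(1) a by simp
    then show ?thesis unfolding eq norm_mult using 1 2 by (intro mult_mono) auto
  qed
qed

text \<open>For a^2 + b^2 = - kappa^2 q0 this is (Laplacian + kappa^2 q0) applied to the product of
  the two damped exponentials: without the cutoff the product is a solution.\<close>

definition defect :: "complex \<Rightarrow> complex \<Rightarrow> real \<Rightarrow> real \<Rightarrow> complex" where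
  "defect a b s t = (damped2 a s - a\<^sup>2 * damped a s) * damped b t + damped a s * (damped2 b t - b\<^sup>2 * damped b t)"

lemma defect_bound:
  assumes "s \<in> {0..3*\<eta>}" "t \<in> {0..3*\<eta>}" "0 \<le> c" "c \<le> Re a" "c \<le> Re b" "norm a \<le> S" "norm b \<le> S" "1 \<le> S"
  shows "norm (defect a b s t) \<le> 6 * cut_bound * S * exp (- c * \<eta>)"
proof -
  have nn: "0 \<le> 3 * cut_bound * S * exp (- c * \<eta>)" using cut_bound(1) assms by simp
  have "norm (defect a b s t) \<le> norm (damped2 a s - a\<^sup>2 * damped a s) * norm (damped b t)
      + norm (damped a s) * norm (damped2 b t - b\<^sup>2 * damped b t)"
    unfolding defect_def by (rule order_trans[OF norm_triangle_ineq]) (simp add: norm_mult)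
  also have "\<dots> \<le> (3 * cut_bound * S * exp (- c * \<eta>)) * 1 + 1 * (3 * cut_bound * S * exp (- c * \<eta>))"
    using damped2_defect[of s c a S] damped2_defect[of t c b S] damped_bound[of s a] damped_bound[of t b] assms nn
    by (intro add_mono mult_mono) auto
  finally show ?thesis by (simp add: mult_ac)
qed

text \<open>The Dirichlet form \<open>J\<close> of test function and solution is computed twice:
  with the derivatives moved onto \<open>W\<close>, where the Helmholtz equation gives k, and with
  the derivatives moved onto the exponentials, which gives k q. In q times the first minus the
  second the volume integral drops out, and integrals over the two sides remain.\<close>

lemma quarter_integrals:
  fixes W W1 W2 W11 W22 :: "real \<Rightarrow> real \<Rightarrow> complex"
  defines "L \<equiv> 3 * \<eta>"
  assumes d: "\<And>s t. s \<in> {0..L} \<Longrightarrow> t \<in> {0..L} \<Longrightarrow> ((\<lambda>s. W s t) has_vector_derivative W1 s t) (at s within {0..L})"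
    "\<And>s t. s \<in> {0..L} \<Longrightarrow> t \<in> {0..L} \<Longrightarrow> (W s has_vector_derivative W2 s t) (at t within {0..L})"
    "\<And>s t. s \<in> {0..L} \<Longrightarrow> t \<in> {0..L} \<Longrightarrow> ((\<lambda>s. W1 s t) has_vector_derivative W11 s t) (at s within {0..L})"
    "\<And>s t. s \<in> {0..L} \<Longrightarrow> t \<in> {0..L} \<Longrightarrow> (W2 s has_vector_derivative W22 s t) (at t within {0..L})"
    and c: "continuous_on ({0..L} \<times> {0..L}) (\<lambda>z. W (fst z) (snd z))"
    "continuous_on ({0..L} \<times> {0..L}) (\<lambda>z. W1 (fst z) (snd z))" "continuous_on ({0..L} \<times> {0..L}) (\<lambda>z. W2 (fst z) (snd z))"
    "continuous_on ({0..L} \<times> {0..L}) (\<lambda>z. W11 (fst z) (snd z))" "continuous_on ({0..L} \<times> {0..L}) (\<lambda>z. W22 (fst z) (snd z))"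
    and helm: "\<And>s t. s \<in> {0..L} \<Longrightarrow> t \<in> {0..L} \<Longrightarrow> W11 s t + W22 s t = - k * W s t"
    and ab: "a\<^sup>2 + b\<^sup>2 = - k * q"
  defines "J \<equiv> integral {0..L} (\<lambda>s. integral {0..L} (\<lambda>t. damped1 a s * damped b t * W1 s t
      + damped a s * damped1 b t * W2 s t))"
    and "G0 \<equiv> integral {0..L} (\<lambda>t. damped b t * W 0 t)" and "G1 \<equiv> integral {0..L} (\<lambda>t. damped b t * W1 0 t)"
    and "F0 \<equiv> integral {0..L} (\<lambda>s. damped a s * W s 0)" and "F1 \<equiv> integral {0..L} (\<lambda>s. damped a s * W2 s 0)"
  shows "(q - 1) * J = - q * (G1 + F1) - (a * G0 + b * F0)
     + integral {0..L} (\<lambda>s. integral {0..L} (\<lambda>t. defect a b s t * W s t))"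
proof -
  have L: "0 \<le> L" using \<eta> by (simp add: L_def)
  \<comment> \<open>The side length 3 eta lies strictly beyond 2 eta, so the far sides of the square
    contribute no boundary terms.\<close>
  have damped_L: "damped a L = 0" "damped1 a L = 0" for a using damped_zero[of L a] \<eta> by (auto simp: L_def)
  let ?I = "\<lambda>h. integral {0..L} (\<lambda>s. integral {0..L} (\<lambda>t. h s t))"
  have lin: "?I (\<lambda>s t. f s t + g s t) = ?I f + ?I g"
    if f: "continuous_on ({0..L} \<times> {0..L}) (\<lambda>z. f (fst z) (snd z))"
        and g: "continuous_on ({0..L} \<times> {0..L}) (\<lambda>z. g (fst z) (snd z))" for f g :: "real \<Rightarrow> real \<Rightarrow> complex"
  proof -
    have ci: "continuous_on {0..L} (\<lambda>s. integral {0..L} (\<lambda>t. h s t))" if "continuous_on ({0..L} \<times> {0..L}) (\<lambda>z. h (fst z) (snd z))" for h :: "real \<Rightarrow> real \<Rightarrow> complex"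
      using integral_continuous_on_param[of "{0..L}" 0 L h] that by (simp add: case_prod_unfold)
    have "?I (\<lambda>s t. f s t + g s t) = integral {0..L} (\<lambda>s. integral {0..L} (\<lambda>t. f s t) + integral {0..L} (\<lambda>t. g s t))"
      by (intro integral_cong integral_add integrable_continuous_real continuous_on_slices(2)[OF f] continuous_on_slices(2)[OF g])
    also have "\<dots> = ?I f + ?I g"
      by (rule integral_add; rule integrable_continuous_real; rule ci; fact)
    finally show ?thesis .
  qed
  have cXX: "continuous_on ({0..L} \<times> {0..L}) (\<lambda>z. P (fst z) * Q (snd z) * h (fst z) (snd z))"
    if "continuous_on UNIV P" "continuous_on UNIV Q" "continuous_on ({0..L} \<times> {0..L}) (\<lambda>z. h (fst z) (snd z))" for P Q
        and h :: "real \<Rightarrow> real \<Rightarrow> complex"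
    by (intro continuous_intros that continuous_on_compose2[OF that(1)] continuous_on_compose2[OF that(2)]) auto
  have Xd: "(damped c has_vector_derivative damped1 c t) (at t within S)" "(damped1 c has_vector_derivative damped2 c t) (at t within S)" for c t S
    using damped_deriv damped1_deriv by (auto intro: has_vector_derivative_at_within)
  have J: "J = ?I (\<lambda>s t. damped1 a s * damped b t * W1 s t) + ?I (\<lambda>s t. damped a s * damped1 b t * W2 s t)"
    unfolding J_def by (rule lin; rule cXX; (rule damped_cont c))
  have i1: "?I (\<lambda>s t. damped1 a s * damped b t * W1 s t) = - G1 - ?I (\<lambda>s t. damped a s * damped b t * W11 s t)"
    using by_parts_2d_fst[OF L damped_cont(1) Xd(1) damped_cont(2) damped_L(1) d(3) c(2,4), of a b]
        by (simp add: damped_at_0 G1_def)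
  have i2: "?I (\<lambda>s t. damped a s * damped1 b t * W2 s t) = - F1 - ?I (\<lambda>s t. damped a s * damped b t * W22 s t)"
    using by_parts_2d_snd[OF L damped_cont(1) Xd(1) damped_cont(2) damped_L(1) d(4) c(3,5), of a b]
        by (simp add: damped_at_0 F1_def)
  have i3: "?I (\<lambda>s t. damped2 a s * damped b t * W s t) = a * G0 - ?I (\<lambda>s t. damped1 a s * damped b t * W1 s t)"
    using by_parts_2d_fst[OF L damped_cont(1) Xd(2) damped_cont(3) damped_L(2) d(1) c(1,2), of a b]
        by (simp add: damped_at_0 G0_def)
  have i4: "?I (\<lambda>s t. damped a s * damped2 b t * W s t) = b * F0 - ?I (\<lambda>s t. damped a s * damped1 b t * W2 s t)"
    using by_parts_2d_snd[OF L damped_cont(1) Xd(2) damped_cont(3) damped_L(2) d(2) c(1,3), of a b]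
        by (simp add: damped_at_0 F0_def)
  define V where "V = ?I (\<lambda>s t. damped a s * damped b t * W s t)"
  have scal: "?I (\<lambda>s t. m * h s t) = m * ?I h" for m :: complex and h by simp
  have "?I (\<lambda>s t. damped a s * damped b t * W11 s t) + ?I (\<lambda>s t. damped a s * damped b t * W22 s t)
      = ?I (\<lambda>s t. damped a s * damped b t * W11 s t + damped a s * damped b t * W22 s t)"
    by (rule lin[symmetric]; rule cXX; (rule damped_cont c))
  also have "\<dots> = ?I (\<lambda>s t. (- k) * (damped a s * damped b t * W s t))"
    by (intro integral_cong) (simp only: distrib_left[symmetric] helm, simp add: mult_ac)
  also have "\<dots> = - k * V" unfolding scal V_def ..
  finally have WW: "?I (\<lambda>s t. damped a s * damped b t * W11 s t) + ?I (\<lambda>s t. damped a s * damped b t * W22 s t)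
      = - k * V" .
  have "J = x + y \<Longrightarrow> x = - G1 - u \<Longrightarrow> y = - F1 - v \<Longrightarrow> u + v = - k * V \<Longrightarrow> J = - G1 - F1 + k * V" for x y u v
    by algebra
  from this[OF J i1 i2 WW] have J1: "J = - G1 - F1 + k * V" .
  have R: "?I (\<lambda>s t. defect a b s t * W s t) + (- k * q) * V
      = ?I (\<lambda>s t. damped2 a s * damped b t * W s t) + ?I (\<lambda>s t. damped a s * damped2 b t * W s t)"
  proof -
    have cR: "continuous_on ({0..L} \<times> {0..L}) (\<lambda>z. defect a b (fst z) (snd z) * W (fst z) (snd z))"
      unfolding defect_def by (intro continuous_intros c continuous_on_compose2[OF damped_cont(1)[of UNIV]] continuous_on_compose2[OF damped_cont(3)[of UNIV]]) auto
    have cV: "continuous_on ({0..L} \<times> {0..L}) (\<lambda>z. (- k * q) * (damped a (fst z) * damped b (snd z) * W (fst z) (snd z)))"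
      by (intro continuous_intros cXX[OF damped_cont(1) damped_cont(1) c(1)])
    have "?I (\<lambda>s t. defect a b s t * W s t) + (- k * q) * V = ?I (\<lambda>s t. defect a b s t * W s t
        + (- k * q) * (damped a s * damped b t * W s t))"
      unfolding V_def scal[symmetric] by (rule lin[OF cR cV, symmetric])
    also have "\<dots> = ?I (\<lambda>s t. damped2 a s * damped b t * W s t + damped a s * damped2 b t * W s t)"
      unfolding ab[symmetric] by (intro integral_cong) (simp add: defect_def algebra_simps)
    also have "\<dots> = ?I (\<lambda>s t. damped2 a s * damped b t * W s t) + ?I (\<lambda>s t. damped a s * damped2 b t * W s t)"
      by (rule lin; rule cXX; (rule damped_cont c))
    finally show ?thesis .
  qed
  have J2: "J = a * G0 + b * F0 - ?I (\<lambda>s t. defect a b s t * W s t) + k * q * V"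
  proof -
    have "J = x + y \<Longrightarrow> r + (- k * q) * V = u + v \<Longrightarrow> u = a * G0 - x \<Longrightarrow> v = b * F0 - y \<Longrightarrow>
        J = a * G0 + b * F0 - r + k * q * V" for x y r u v
      by algebra
    from this[OF J R i3 i4] show ?thesis .
  qed
  have "(q - 1) * J = q * J - J" by (simp add: algebra_simps)
  also have "\<dots> = q * (- G1 - F1 + k * V) - (a * G0 + b * F0 - ?I (\<lambda>s t. defect a b s t * W s t) + k * q * V)"
    using J1 J2 by metis
  finally show ?thesis by (simp add: algebra_simps)
qed

end

section \<open>Laplace asymptotics of the side integrals\<close>

lemma norm_integral_le_Icc:
  fixes g :: "real \<Rightarrow> complex"
  assumes "continuous_on {0..L} g" "0 \<le> L" "\<And>t. t \<in> {0..L} \<Longrightarrow> norm (g t) \<le> B"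
  shows "norm (integral {0..L} g) \<le> B * L"
proof -
  have "norm (integral {0..L} g) \<le> integral {0..L} (\<lambda>_. B)"
    by (rule integral_norm_bound_integral) (use assms integrable_continuous_real in auto)
  then show ?thesis using assms(2) by (simp add: mult.commute)
qed

lemma continuous_on_compact_bound:
  fixes g :: "'a::metric_space \<Rightarrow> complex"
  assumes "compact K" "continuous_on K g"
  obtains B where "0 \<le> B" "\<And>x. x \<in> K \<Longrightarrow> norm (g x) \<le> B"
proof -
  have "bounded (g ` K)" by (intro compact_imp_bounded compact_continuous_image assms)
  then obtain b where "\<forall>y\<in>g ` K. norm y \<le> b" unfolding bounded_iff by blast
  then show ?thesis using that[of "max 0 b"] by (auto simp: le_max_iff_disj)
qed

lemma power_le_fact_exp: "0 \<le> x \<Longrightarrow> x ^ m \<le> fact m * exp (x::real)"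
proof -
  assume x: "0 \<le> x"
  have "x ^ m / fact m \<le> (\<Sum>n<Suc m. x ^ n / fact n)"
    by (rule member_le_sum[of m]) (use x in auto)
  also have "\<dots> \<le> exp x"
    using sum_le_suminf[OF summable_exp_generic[of x], of "{..<Suc m}"] x
    by (simp add: exp_def scaleR_conv_of_real divide_inverse mult.commute)
  finally show ?thesis by (simp add: divide_le_eq mult.commute)
qed

lemma exp_decay:
  fixes c S :: real
  assumes "0 < c" "0 < S"
  shows "exp (- (c * S)) \<le> fact m / c ^ m / S ^ m"
proof -
  have "(c * S) ^ m \<le> fact m * exp (c * S)" by (rule power_le_fact_exp) (use assms in simp)
  then have "exp (- (c * S)) * (c * S) ^ m \<le> exp (- (c * S)) * (fact m * exp (c * S))" by (intro mult_left_mono) auto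
  also have "\<dots> = fact m" by (simp add: exp_minus)
  finally have "exp (- (c * S)) \<le> fact m / (c * S) ^ m" using assms by (subst pos_le_divide_eq) auto
  also have "fact m / (c * S) ^ m = fact m / c ^ m / S ^ m" by (simp only: power_mult_distrib divide_divide_eq_left)
  finally show ?thesis .
qed

context cutoff begin

text \<open>Watson's lemma by repeated integration by parts: each one splits off h k 0 / a and
  passes to the next derivative. The error from the cutoff is exponentially small and is absorbed
  into S^(-M).\<close>

lemma laplace_expansion:
  fixes h :: "nat \<Rightarrow> real \<Rightarrow> complex"
  assumes h: "\<And>k t. t \<in> {0..3*\<eta>} \<Longrightarrow> (h k has_vector_derivative h (Suc k) t) (at t within {0..3*\<eta>})"
    and \<delta>: "0 < \<delta>"
  shows "\<exists>C. \<forall>S a. 1 \<le> S \<longrightarrow> \<delta> * S \<le> Re a \<longrightarrow>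
     norm (integral {0..3*\<eta>} (\<lambda>t. damped a t * h k t) - (\<Sum>n<M. h (k + n) 0 / a ^ Suc n)) \<le> C / S ^ M"
proof (induction M arbitrary: k)
  case 0
  have ch: "continuous_on {0..3*\<eta>} (h k)"
    using has_vector_derivative_continuous[OF h] by (auto simp: continuous_on_eq_continuous_within)
  obtain B where B: "0 \<le> B" "\<And>t. t \<in> {0..3*\<eta>} \<Longrightarrow> norm (h k t) \<le> B"
      by (rule continuous_on_compact_bound[OF compact_Icc ch]) (rule that)
  have "norm (integral {0..3*\<eta>} (\<lambda>t. damped a t * h k t)) \<le> B * (3*\<eta>)" if "1 \<le> S" "\<delta> * S \<le> Re a" for S a
  proof (rule norm_integral_le_Icc)
    show "continuous_on {0..3*\<eta>} (\<lambda>t. damped a t * h k t)" by (intro continuous_intros damped_cont ch)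
    fix t assume t: "t \<in> {0..3*\<eta>}"
    have "0 \<le> Re a" using that \<delta> by (smt (verit) mult_nonneg_nonneg)
    then show "norm (damped a t * h k t) \<le> B"
      using damped_bound[of t a] B(2)[OF t] t mult_mono[of "norm (damped a t)" 1 "norm (h k t)" B]
          by (simp add: norm_mult)
  qed (use \<eta> in auto)
  then show ?case by auto
next
  case (Suc M)
  have ch: "continuous_on {0..3*\<eta>} (h j)" for j
    using has_vector_derivative_continuous[OF h] by (auto simp: continuous_on_eq_continuous_within)
  obtain B where B: "0 \<le> B" "\<And>t. t \<in> {0..3*\<eta>} \<Longrightarrow> norm (h k t) \<le> B"
      by (rule continuous_on_compact_bound[OF compact_Icc ch[of k]]) (rule that)
  obtain C where C: "\<And>S a. 1 \<le> S \<Longrightarrow> \<delta> * S \<le> Re a \<Longrightarrow>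
     norm (integral {0..3*\<eta>} (\<lambda>t. damped a t * h (Suc k) t) - (\<Sum>n<M. h (Suc k + n) 0 / a ^ Suc n)) \<le> C / S ^ M"
    using Suc.IH[of "Suc k"] by blast
  define C2 where "C2 = cut_bound * B * (3*\<eta>) * (fact M / (\<delta> * \<eta>) ^ M)"
  show ?case
  proof (intro exI allI impI)
    fix S :: real and a :: complex assume S: "1 \<le> S" and a: "\<delta> * S \<le> Re a"
    have pos: "0 < \<delta> * S" using \<delta> S by simp
    have a0: "a \<noteq> 0" and na: "\<delta> * S \<le> norm a" using a pos complex_Re_le_cmod[of a] by auto
    define E where "E = integral {0..3*\<eta>} (\<lambda>t. of_real (\<zeta>1 t) * exp (- a * of_real t) * h k t)"
    have E: "norm E \<le> C2 / S ^ M"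
    proof -
      have "norm E \<le> (cut_bound * exp (- (\<delta> * S * \<eta>)) * B) * (3*\<eta>)"
        unfolding E_def
      proof (rule norm_integral_le_Icc)
        show "continuous_on {0..3*\<eta>} (\<lambda>t. of_real (\<zeta>1 t) * exp (- a * of_real t) * h k t)"
          by (intro continuous_intros cont_\<zeta> ch)
        fix t assume t: "t \<in> {0..3*\<eta>}"
        show "norm (of_real (\<zeta>1 t) * exp (- a * of_real t) * h k t) \<le> cut_bound * exp (- (\<delta> * S * \<eta>)) * B"
        proof (cases "t < \<eta>")
          case True
          then have "\<zeta>1 t = 0" using \<zeta>_flat(1)[of t] t by auto
          then show ?thesis using cut_bound(1) B(1) by simp
        next
          case False
          have "\<delta> * S * \<eta> \<le> Re a * t" using a False pos \<eta> by (intro mult_mono) auto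
          then have "norm (exp (- a * of_real t)) \<le> exp (- (\<delta> * S * \<eta>))" by simp
          then show ?thesis unfolding norm_mult using cut_bound t B by (intro mult_mono) auto
        qed
      qed (use \<eta> in auto)
      also have "\<dots> = (cut_bound * B * (3*\<eta>)) * exp (- (\<delta> * \<eta> * S))" by (simp add: mult_ac)
      also have "\<dots> \<le> (cut_bound * B * (3*\<eta>)) * (fact M / (\<delta> * \<eta>) ^ M / S ^ M)"
        using exp_decay[of "\<delta> * \<eta>" S M] \<delta> \<eta> S cut_bound(1) B(1) by (intro mult_left_mono) auto
      finally show ?thesis by (simp add: C2_def)
    qed
    define I where "I = integral {0..3*\<eta>} (\<lambda>t. damped a t * h k t)"
    define I' where "I' = integral {0..3*\<eta>} (\<lambda>t. damped a t * h (Suc k) t)"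
    have XL: "damped a (3*\<eta>) = 0" using damped_zero[of "3*\<eta>" a] \<eta> by auto
    have "integral {0..3*\<eta>} (\<lambda>t. damped1 a t * h k t) = - (damped a 0 * h k 0) - I'"
      unfolding I'_def by (rule by_parts_1d[of "3*\<eta>" "damped a" "damped1 a" "h k" "h (Suc k)"])
        (use \<eta> damped_deriv XL h ch damped_cont in \<open>auto intro: has_vector_derivative_at_within\<close>)
    moreover have "integral {0..3*\<eta>} (\<lambda>t. damped1 a t * h k t) = E - a * I"
    proof -
      have "integral {0..3*\<eta>} (\<lambda>t. damped1 a t * h k t) = integral {0..3*\<eta>} (\<lambda>t. of_real (\<zeta>1 t) * exp (- a * of_real t) * h k t - a * (damped a t * h k t))"
        by (rule integral_cong) (simp add: damped1_def damped_def algebra_simps)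
      also have "\<dots> = E - integral {0..3*\<eta>} (\<lambda>t. a * (damped a t * h k t))" unfolding E_def
        by (intro integral_diff integrable_continuous_real continuous_intros cont_\<zeta> ch damped_cont)
      finally show ?thesis by (simp add: I_def)
    qed
    ultimately have "E - a * I = - h k 0 - I'" by (simp add: damped_at_0)
    then have "a * I = h k 0 + I' + E" by algebra
    then have I: "I = (h k 0 + I' + E) / a" using a0 by (simp add: eq_divide_eq mult.commute)
    have "(\<Sum>n<Suc M. h (k + n) 0 / a ^ Suc n) = (h k 0 + (\<Sum>n<M. h (Suc k + n) 0 / a ^ Suc n)) / a"
      unfolding sum.lessThan_Suc_shift by (simp add: sum_divide_distrib add_divide_distrib mult_ac)
    then have "I - (\<Sum>n<Suc M. h (k + n) 0 / a ^ Suc n) = ((I' - (\<Sum>n<M. h (Suc k + n) 0 / a ^ Suc n)) + E) / a"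
      unfolding I by (simp add: diff_divide_distrib[symmetric] algebra_simps)
    then have "norm (I - (\<Sum>n<Suc M. h (k + n) 0 / a ^ Suc n)) \<le> (C / S ^ M + C2 / S ^ M) / norm a"
      using C[OF S a] E a0 unfolding I'_def
      by (simp only: norm_divide) (intro divide_right_mono order_trans[OF norm_triangle_ineq] add_mono, auto)
    also have "\<dots> \<le> (C / S ^ M + C2 / S ^ M) / (\<delta> * S)"
    proof (rule divide_left_mono[OF na])
      have "0 \<le> C / S ^ M" using order_trans[OF norm_ge_zero C[OF S a]] .
      moreover have "0 \<le> C2 / S ^ M" using order_trans[OF norm_ge_zero E] .
      ultimately show "0 \<le> C / S ^ M + C2 / S ^ M" by simp
    qed (use a0 pos in auto)
    also have "\<dots> = ((C + C2) / \<delta>) / S ^ Suc M" using S \<delta> by (simp add: field_simps)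
    finally show "norm (integral {0..3*\<eta>} (\<lambda>t. damped a t * h k t) - (\<Sum>n<Suc M. h (k + n) 0 / a ^ Suc n))
        \<le> ((C + C2) / \<delta>) / S ^ Suc M"
      by (simp only: I_def)
  qed
qed

text \<open>\<open>corner_identity\<close> and \<open>quarter_integrals\<close> are combined in the
  frame of the corner. Two defect integrals remain, one against \<open>w - w'\<close> and one
  against \<open>w'\<close>, and both are exponentially small in \<open>S\<close>.\<close>

lemma corner_estimate:
  fixes e f p :: pt
  assumes TE: "TE_total_field \<kappa> d q0 D u w" and TE': "TE_total_field \<kappa> d q0 D' u' w'" and \<kappa>: "0 < \<kappa>"
    and B: "open B" "B \<inter> closure D' = {}" "\<And>x. x \<in> B - closure D \<Longrightarrow> w x = w' x" "cball p (6 * \<eta>) \<subseteq> B"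
    and on: "norm e = 1" "norm f = 1" "e \<bullet> f = 0"
    and quad: "\<And>s t. \<bar>s\<bar> \<le> 3 * \<eta> \<Longrightarrow> \<bar>t\<bar> \<le> 3 * \<eta> \<Longrightarrow> p + s *\<^sub>R e + t *\<^sub>R f \<in> closure D \<longleftrightarrow> 0 \<le> s \<and> 0 \<le> t"
    and \<delta>: "0 < \<delta>"
  defines "F0 \<equiv> \<lambda>a. integral {0..3*\<eta>} (\<lambda>s. damped a s * w' (p + s *\<^sub>R e))"
    and "F1 \<equiv> \<lambda>a. integral {0..3*\<eta>} (\<lambda>s. damped a s * pd f w' (p + s *\<^sub>R e))"
    and "G0 \<equiv> \<lambda>b. integral {0..3*\<eta>} (\<lambda>t. damped b t * w' (p + t *\<^sub>R f))"
    and "G1 \<equiv> \<lambda>b. integral {0..3*\<eta>} (\<lambda>t. damped b t * pd e w' (p + t *\<^sub>R f))"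
  shows "\<exists>C. \<forall>S a b. 1 \<le> S \<longrightarrow> a\<^sup>2 + b\<^sup>2 = - of_real (\<kappa>\<^sup>2) * q0 \<longrightarrow> \<delta> * S \<le> Re a \<longrightarrow> \<delta> * S \<le> Re b \<longrightarrow> norm a \<le> S \<longrightarrow> norm b \<le> S \<longrightarrow>
     norm (a * G0 b + b * F0 a + q0 * (G1 b + F1 a)) \<le> C * S * exp (- (\<delta> * \<eta> * S))"
proof -
  define L where "L = 3 * \<eta>"
  have L: "0 < L" using \<eta> by (simp add: L_def)
  define T where "T s t = p + s *\<^sub>R e + t *\<^sub>R f" for s t
  have "B \<subseteq> - closure D'" using B(2) by auto
  then have v: "wsol \<kappa> B w'" by (rule wsol_subset[OF TE_wsol[OF TE'] B(1)])
  have \<kappa>0: "0 \<le> \<kappa>" using \<kappa> by simp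
  note v1 = wsol_pd[OF v \<kappa>0] and v2 = wsol_pd[OF wsol_pd[OF v \<kappa>0] \<kappa>0]
  have TB: "T s t \<in> B" if "\<bar>s\<bar> \<le> L" "\<bar>t\<bar> \<le> L" for s t
  proof -
    have "norm (s *\<^sub>R e + t *\<^sub>R f) \<le> \<bar>s\<bar> * norm e + \<bar>t\<bar> * norm f" by (metis norm_scaleR norm_triangle_ineq)
    moreover have "dist p (T s t) = norm (s *\<^sub>R e + t *\<^sub>R f)"
      unfolding T_def dist_norm by (subst norm_minus_commute) (simp add: add.assoc)
    ultimately have "T s t \<in> cball p (6 * \<eta>)" using that on by (simp add: L_def)
    then show ?thesis using B(4) by blast
  qed
  have TB': "T s t \<in> B" if "s \<in> {0..L}" "t \<in> {0..L}" for s t using TB that by auto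
  define W where "W s t = w' (T s t)" for s t
  define W1 where "W1 s t = pd e w' (T s t)" for s t
  define W2 where "W2 s t = pd f w' (T s t)" for s t
  have lin1: "((\<lambda>s. g (T s t)) has_vector_derivative pd e g (T s t)) (at s within {0..L})"
    if "wsol \<kappa> B g" "s \<in> {0..L}" "t \<in> {0..L}" for g s t
  proof -
    have "((\<lambda>s. g ((p + t *\<^sub>R f) + s *\<^sub>R e)) has_vector_derivative pd e g ((p + t *\<^sub>R f) + s *\<^sub>R e)) (at s within {0..L})"
      by (rule has_vector_derivative_line) (use wsol_differentiable[OF that(1) \<kappa>0 TB'[OF that(2,3)]] in \<open>simp add: T_def algebra_simps\<close>)
    then show ?thesis by (simp add: T_def algebra_simps)
  qed
  have lin2: "((\<lambda>t. g (T s t)) has_vector_derivative pd f g (T s t)) (at t within {0..L})"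
    if "wsol \<kappa> B g" "s \<in> {0..L}" "t \<in> {0..L}" for g s t
    using has_vector_derivative_line[of g "p + s *\<^sub>R e" t f] wsol_differentiable[OF that(1) \<kappa>0 TB'[OF that(2,3)]]
        by (simp add: T_def)
  have cT: "continuous_on ({0..L} \<times> {0..L}) (\<lambda>z. g (T (fst z) (snd z)))" if "wsol \<kappa> B g" for g
    by (rule continuous_on_compose2[OF wsol_D(2)[OF that]]) (use TB' in \<open>auto simp: T_def intro!: continuous_intros\<close>)
  define k where "k = complex_of_real (\<kappa>\<^sup>2)"
  obtain BW where BW: "0 \<le> BW" "\<And>z. z \<in> {0..L} \<times> {0..L} \<Longrightarrow> norm (W (fst z) (snd z)) \<le> BW"
    using continuous_on_compact_bound[OF compact_Times[OF compact_Icc compact_Icc] cT[OF v]] unfolding W_def by blast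
  \<comment> \<open>The unknown field inside \<open>D\<close> enters the estimate only through this
    number, which does not depend on a, b and S.\<close>
  define N0 where "N0 = (\<integral>x. indicator (cball p (6*\<eta>)) x *\<^sub>R norm (w x - w' x) \<partial>lborel)"
  have iN: "integrable lborel (\<lambda>x. indicator (cball p (6*\<eta>)) x *\<^sub>R norm (w x - w' x))"
  proof -
    \<comment> \<open>\<open>L2_loc_integrable_mult\<close> asks for a continuous multiplier, so the
      indicator of the ball is first replaced by a continuous cutoff that is 1 on it.\<close>
    obtain g :: "pt \<Rightarrow> real" where g: "continuous_on UNIV g" "\<And>x. x \<in> cball p (6*\<eta>) \<Longrightarrow> g x = 1" "\<And>x. x \<notin> cball p (7*\<eta>) \<Longrightarrow>
        g x = 0"
    proof
      let ?g = "\<lambda>x. max 0 (min 1 (7 - dist p x / \<eta>))"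
      show "continuous_on UNIV ?g" using \<eta> by (intro continuous_intros) auto
      show "?g x = 1" if "x \<in> cball p (6*\<eta>)" for x
      proof -
        have "dist p x / \<eta> \<le> 6" using that \<eta> by (simp add: divide_le_eq)
        then show ?thesis by simp
      qed
      show "?g x = 0" if "x \<notin> cball p (7*\<eta>)" for x
      proof -
        have "7 \<le> dist p x / \<eta>" using that \<eta> by (simp add: le_divide_eq)
        then show ?thesis by simp
      qed
    qed
    have i: "integrable lborel (\<lambda>x. h x * complex_of_real (g x))" if "L2_loc h" for h
      by (rule L2_loc_integrable_mult[OF that _ compact_cball[of p "7*\<eta>"]]) (use g in \<open>auto intro!: continuous_intros\<close>)
    have "integrable lborel (\<lambda>x. indicator (cball p (6*\<eta>)) x *\<^sub>R norm (w x * of_real (g x) - w' x * of_real (g x)))"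
      by (intro integrable_mult_indicator integrable_norm Bochner_Integration.integrable_diff i TE_D(3)[OF TE] TE_D(3)[OF TE']) auto
    moreover have eqn: "indicator (cball p (6*\<eta>)) x *\<^sub>R norm (w x * of_real (g x) - w' x * of_real (g x))
        = indicator (cball p (6*\<eta>)) x *\<^sub>R norm (w x - w' x)" for x
      using g(2)[of x] by (auto simp: indicator_def)
    ultimately show ?thesis by (simp only: eqn)
  qed
  show ?thesis
  proof (intro exI allI impI)
    fix S :: real and a b :: complex
    assume S: "1 \<le> S" and ab: "a\<^sup>2 + b\<^sup>2 = - of_real (\<kappa>\<^sup>2) * q0" and a: "\<delta> * S \<le> Re a" and b: "\<delta> * S \<le> Re b"
      and na: "norm a \<le> S" and nb: "norm b \<le> S"
    define M where "M = 6 * cut_bound * S * exp (- (\<delta> * \<eta> * S))"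
    have M0: "0 \<le> M" using cut_bound(1) S by (simp add: M_def)
    have Rb: "norm (defect a b s t) \<le> M" if "s \<in> {0..L}" "t \<in> {0..L}" for s t
      using defect_bound[of s t "\<delta> * S" a b S] that a b na nb S \<delta> by (simp add: L_def M_def mult_ac)
    define \<phi> where "\<phi> = frame_product p e f (damped a) (damped b)"
    have z: "damped c t = 0" if "2 * \<eta> \<le> \<bar>t\<bar>" for c t using zero[OF that] by (simp add: damped_def)
    have \<eta>0: "0 \<le> 2 * \<eta>" using \<eta> by simp
    note pt2 = frame_product_complex_test_fn2[OF on damped_deriv damped1_deriv damped_cont(3) damped_deriv damped1_deriv damped_cont(3) z z \<eta>0, of p a b, folded \<phi>_def]
    have lap\<phi>: "lap \<phi> y = frame_product p e f (damped2 a) (damped b) y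
        + frame_product p e f (damped a) (damped2 b) y" for y
      unfolding \<phi>_def by (rule frame_product_complex_test_fn2(3)[OF on damped_deriv damped1_deriv damped_cont(3) damped_deriv damped1_deriv damped_cont(3) z z \<eta>0])
    have s\<phi>: "supp \<phi> \<subseteq> B" using pt2(2) B(4) \<eta> subset_cball[of "2 * (2 * \<eta>)" "6 * \<eta>" p] by auto
    have dec: "x = T ((x - p) \<bullet> e) ((x - p) \<bullet> f)" for x using frame_decomp[OF on, of "x - p"]
        by (simp add: T_def add.assoc)
    have ee: "e \<bullet> e = 1" "f \<bullet> f = 1" "e \<bullet> f = 0" "f \<bullet> e = 0" using on by (simp_all add: norm_eq_1 inner_commute)
    have Tc: "(T s t - p) \<bullet> e = s" "(T s t - p) \<bullet> f = t" for s t by (simp_all add: T_def inner_add_left ee)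
    define Tm where "Tm = (\<integral>x. indicator (closure D) x *\<^sub>R ((w x - w' x) * (lap \<phi> x + of_real (\<kappa>\<^sup>2) * q0 * \<phi> x)) \<partial>lborel)"
    define Jm where "Jm = (\<integral>x. indicator (closure D) x *\<^sub>R (pd (axis 1 1) w' x * pd (axis 1 1) \<phi> x
        + pd (axis 2 1) w' x * pd (axis 2 1) \<phi> x) \<partial>lborel)"
    have id: "Tm + (q0 - 1) * Jm = 0" unfolding Tm_def Jm_def by (rule corner_identity[OF TE TE' \<kappa> B(1-3) pt2(1) s\<phi>])
    have Tb: "norm Tm \<le> M * N0"
    proof -
      let ?t = "\<lambda>x. indicator (closure D) x *\<^sub>R ((w x - w' x) * (lap \<phi> x + of_real (\<kappa>\<^sup>2) * q0 * \<phi> x))"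
      have plane_wave: "norm (?t x) \<le> M * (indicator (cball p (6*\<eta>)) x *\<^sub>R norm (w x - w' x))" for x
      proof -
        define s where "s = (x - p) \<bullet> e"
        define t where "t = (x - p) \<bullet> f"
        have x: "x = T s t" using dec[of x] by (simp add: s_def t_def)
        have R: "lap \<phi> x + of_real (\<kappa>\<^sup>2) * q0 * \<phi> x = defect a b s t"
        proof -
          have k: "of_real (\<kappa>\<^sup>2) * q0 = - (a\<^sup>2 + b\<^sup>2)" using ab by simp
          show ?thesis unfolding lap\<phi> k unfolding \<phi>_def frame_product_def s_def[symmetric] t_def[symmetric] defect_def
              by (simp add: algebra_simps)
        qed
        show ?thesis
        proof (cases "\<bar>s\<bar> \<le> 2 * \<eta> \<and> \<bar>t\<bar> \<le> 2 * \<eta>")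
          case True
          then have st: "\<bar>s\<bar> \<le> 3 * \<eta>" "\<bar>t\<bar> \<le> 3 * \<eta>" using \<eta> by auto
          have "norm (s *\<^sub>R e + t *\<^sub>R f) \<le> \<bar>s\<bar> * norm e + \<bar>t\<bar> * norm f" by (metis norm_scaleR norm_triangle_ineq)
          moreover have "dist p x = norm (s *\<^sub>R e + t *\<^sub>R f)"
            unfolding x T_def dist_norm by (subst norm_minus_commute) (simp add: add.assoc)
          ultimately have xc: "x \<in> cball p (6*\<eta>)" using st on by simp
          show ?thesis
          proof (cases "x \<in> closure D")
            case True
            then have "s \<in> {0..L}" "t \<in> {0..L}" using quad[OF st] st by (auto simp: x T_def L_def)
            then have "norm (defect a b s t) \<le> M" by (rule Rb)
            then show ?thesis using True xc unfolding R
              by (simp add: norm_mult mult.commute[of M] mult_left_mono)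
          qed (use M0 in simp)
        next
          case False
          then have "defect a b s t = 0" using damped_zero[of s a] damped_zero[of t b] by (auto simp: defect_def)
          then show ?thesis unfolding R using M0 by simp
        qed
      qed
      show ?thesis
      proof (cases "integrable lborel ?t")
        case True
        have "norm Tm \<le> (\<integral>x. norm (?t x) \<partial>lborel)" unfolding Tm_def by (rule integral_norm_bound)
        also have "\<dots> \<le> (\<integral>x. M * (indicator (cball p (6*\<eta>)) x *\<^sub>R norm (w x - w' x)) \<partial>lborel)"
          by (rule integral_mono[OF integrable_norm[OF True] _ plane_wave]) (intro integrable_mult_right iN)
        also have "\<dots> = M * N0" unfolding N0_def by (rule integral_mult_right_zero)
        finally show ?thesis .
      next
        case False
        \<comment> \<open>In the non-integrable case \<open>Tm\<close> is the default value
          0.\<close>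
        have "0 \<le> N0" unfolding N0_def by (rule Bochner_Integration.integral_nonneg) simp
        then show ?thesis using False M0 by (simp add: Tm_def not_integrable_integral_eq)
      qed
    qed
    define K where "K = (\<lambda>z. damped1 a (fst z) * damped b (snd z) * W1 (fst z) (snd z)
        + damped a (fst z) * damped1 b (snd z) * W2 (fst z) (snd z))"
    have sqr: "cbox (0,0) (L,L) = {0..L} \<times> {0..L}" by (simp add: cbox_Pair_eq)
    have cK: "continuous_on (cbox (0,0) (L,L)) K"
      unfolding K_def W1_def W2_def sqr
      by (intro continuous_intros cT v1 continuous_on_compose2[OF damped_cont(1)[of UNIV]] continuous_on_compose2[OF damped_cont(2)[of UNIV]]) auto
    have JK: "Jm = integral {0..L} (\<lambda>s. integral {0..L} (\<lambda>t. damped1 a s * damped b t * W1 s t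
        + damped a s * damped1 b t * W2 s t))"
    proof -
      let ?g = "\<lambda>x. pd (axis 1 1) w' x * pd (axis 1 1) \<phi> x + pd (axis 2 1) w' x * pd (axis 2 1) \<phi> x"
      have "continuous_on UNIV (\<lambda>x. pd h w' x * pd h \<phi> x)" for h
      proof (rule integrable_mult_test(1)[OF B(1) wsol_D(2)[OF v1] _ complex_test_fn2_D(1)[OF pt2(1)] s\<phi>])
        show "continuous_on B (pd h \<phi>)" by (rule continuous_on_subset[OF complex_test_fn2_D(4)[OF pt2(1)] subset_UNIV])
        show "pd h \<phi> x = 0" if "x \<notin> supp \<phi>" for x using that by (rule pd_outside_supp)
      qed
      then have cg: "continuous_on UNIV ?g" by (intro continuous_on_add)
      have mF: "(\<lambda>x. indicator (closure D) x *\<^sub>R ?g x) \<in> borel_measurable borel"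
        using borel_measurable_continuous_onI[OF cg] by (intro borel_measurable_scaleR borel_measurable_indicator) auto
      have pg: "pd g \<phi> x = (g \<bullet> e) *\<^sub>R (damped1 a ((x - p) \<bullet> e) * damped b ((x - p) \<bullet> f))
          + (g \<bullet> f) *\<^sub>R (damped a ((x - p) \<bullet> e) * damped1 b ((x - p) \<bullet> f))" for g x
        unfolding \<phi>_def frame_product_deriv(3)[OF damped_deriv damped_deriv] by (simp add: frame_product_def)
      \<comment> \<open>In frame coordinates \<open>closure D\<close> is the first quadrant wherever
        phi is nonzero, so the integrand becomes one over the square.\<close>
      have F: "indicator (closure D) (p + fst z *\<^sub>R e + snd z *\<^sub>R f) *\<^sub>R ?g (p + fst z *\<^sub>R e + snd z *\<^sub>R f)
          = indicator (cbox (0,0) (L,L)) z *\<^sub>R K z" for z :: "real \<times> real"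
      proof -
        define s t where "s = fst z" and "t = snd z"
        have T: "p + fst z *\<^sub>R e + snd z *\<^sub>R f = T s t" by (simp add: T_def s_def t_def)
        have ic: "z \<in> cbox (0,0) (L,L) \<longleftrightarrow> s \<in> {0..L} \<and> t \<in> {0..L}" by (cases z) (auto simp: s_def t_def cbox_Pair_eq)
        show ?thesis
        proof (cases "\<bar>s\<bar> \<le> 3 * \<eta> \<and> \<bar>t\<bar> \<le> 3 * \<eta>")
          case True
          then have st: "\<bar>s\<bar> \<le> 3 * \<eta>" "\<bar>t\<bar> \<le> 3 * \<eta>" by auto
          have dw: "w' differentiable (at (T s t))" by (rule wsol_differentiable[OF v \<kappa>0]) (use TB st in \<open>simp add: L_def\<close>)
          have g: "?g (T s t) = K z"
          proof -
            have pe: "pd h w' (T s t) = of_real (h $ 1) * pd (axis 1 1) w' (T s t)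
                + of_real (h $ 2) * pd (axis 2 1) w' (T s t)" for h
              using pd_decomp[OF dw, of h] by (simp add: scaleR_conv_of_real)
            have ax: "axis 1 1 \<bullet> h = h $ 1" "axis 2 1 \<bullet> h = h $ 2" for h :: pt by (simp_all add: inner_axis' )
            show ?thesis unfolding pg Tc K_def W1_def W2_def s_def[symmetric] t_def[symmetric] pe[of e] pe[of f] ax
              by (simp add: scaleR_conv_of_real algebra_simps)
          qed
          have "T s t \<in> closure D \<longleftrightarrow> z \<in> cbox (0,0) (L,L)" unfolding ic
              using quad[OF st, folded T_def] st by (auto simp: L_def)
          then show ?thesis unfolding T g by (simp add: indicator_def)
        next
          case False
          then have "z \<notin> cbox (0,0) (L,L)" using ic by (auto simp: L_def)
          moreover have "pd g \<phi> (T s t) = 0" for g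
            unfolding pg Tc using False damped_zero[of s a] damped_zero[of t b] \<eta> by auto
          ultimately show ?thesis unfolding T by simp
        qed
      qed
      have si: "set_integrable lborel (cbox (0,0) (L,L)) K"
        unfolding set_integrable_def using borel_integrable_compact[OF compact_cbox cK] .
      have "Jm = (\<integral>z. indicator (cbox (0,0) (L,L)) z *\<^sub>R K z \<partial>lborel)"
        unfolding Jm_def integral_frame[OF on mF, of p] F ..
      also have "\<dots> = integral (cbox (0,0) (L,L)) K"
        using set_borel_integral_eq_integral(2)[OF si] by (simp add: set_lebesgue_integral_def)
      also have "\<dots> = integral (cbox 0 L) (\<lambda>s. integral (cbox 0 L) (\<lambda>t. K (s, t)))"
        by (rule integral_prod_continuous[OF cK])
      finally show ?thesis by (simp add: K_def)
    qed
    define \<rho> where "\<rho> = integral {0..L} (\<lambda>s. integral {0..L} (\<lambda>t. defect a b s t * W s t))"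
    have "(q0 - 1) * Jm = - q0 * (integral {0..3*\<eta>} (\<lambda>t. damped b t * W1 0 t)
        + integral {0..3*\<eta>} (\<lambda>s. damped a s * W2 s 0))
        - (a * integral {0..3*\<eta>} (\<lambda>t. damped b t * W 0 t) + b * integral {0..3*\<eta>} (\<lambda>s. damped a s * W s 0))
        + integral {0..3*\<eta>} (\<lambda>s. integral {0..3*\<eta>} (\<lambda>t. defect a b s t * W s t))"
      unfolding JK L_def
      by (rule quarter_integrals[where k=k and ?W11.0="\<lambda>s t. pd e (pd e w') (T s t)"
          and ?W22.0="\<lambda>s t. pd f (pd f w') (T s t)"];
        (unfold L_def[symmetric] W_def[abs_def] W1_def[abs_def] W2_def[abs_def])?;
        (rule lin1 lin2 cT; (rule v v1 v2 | assumption))?)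
        (use helmholtz_orthonormal[OF v \<kappa>0 TB' on] ab in \<open>auto simp: k_def\<close>)
    then have J2: "(q0 - 1) * Jm = - q0 * (G1 b + F1 a) - (a * G0 b + b * F0 a) + \<rho>"
      by (simp add: G1_def F1_def G0_def F0_def W_def W1_def W2_def T_def \<rho>_def L_def)
    have cR: "continuous_on ({0..L} \<times> {0..L}) (\<lambda>z. defect a b (fst z) (snd z) * W (fst z) (snd z))"
      unfolding defect_def W_def by (intro continuous_intros cT v continuous_on_compose2[OF damped_cont(1)[of UNIV]] continuous_on_compose2[OF damped_cont(3)[of UNIV]]) auto
    have \<rho>b: "norm \<rho> \<le> M * BW * L * L" unfolding \<rho>_def
    proof (rule norm_integral_le_Icc)
      show "continuous_on {0..L} (\<lambda>s. integral {0..L} (\<lambda>t. defect a b s t * W s t))"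
        using integral_continuous_on_param[of "{0..L}" 0 L "\<lambda>s t. defect a b s t * W s t"] cR
            by (simp add: case_prod_unfold)
      fix s assume s: "s \<in> {0..L}"
      show "norm (integral {0..L} (\<lambda>t. defect a b s t * W s t)) \<le> M * BW * L"
      proof (rule norm_integral_le_Icc)
        show "continuous_on {0..L} (\<lambda>t. defect a b s t * W s t)" by (rule continuous_on_slices(2)[OF cR s])
        fix t assume "t \<in> {0..L}"
        then show "norm (defect a b s t * W s t) \<le> M * BW"
          unfolding norm_mult using Rb[of s t] BW(2)[of "(s, t)"] s M0 by (intro mult_mono) auto
      qed (use L in simp)
    qed (use L in simp)
    have "a * G0 b + b * F0 a + q0 * (G1 b + F1 a) = \<rho> + Tm"
      using id J2 by algebra
    then have "norm (a * G0 b + b * F0 a + q0 * (G1 b + F1 a)) \<le> M * BW * L * L + M * N0"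
      using norm_triangle_ineq[of \<rho> Tm] \<rho>b Tb by simp
    also have "\<dots> = (6 * cut_bound * (BW * L * L + N0)) * S * exp (- (\<delta> * \<eta> * S))" by (simp add: M_def algebra_simps)
    finally show "norm (a * G0 b + b * F0 a + q0 * (G1 b + F1 a))
        \<le> (6 * cut_bound * (BW * L * L + N0)) * S * exp (- (\<delta> * \<eta> * S))" .
  qed
qed

end

text \<open>The Laplace expansions are inserted for the four side integrals. The integrals are
  multiplied by a, b or q0, which are O(S), so the total error is O(S / S^M).\<close>

lemma corner_asymptotics:
  fixes e f p :: pt
  assumes TE: "TE_total_field \<kappa> d q0 D u w" and TE': "TE_total_field \<kappa> d q0 D' u' w'" and \<kappa>: "0 < \<kappa>"
    and B: "open B" "B \<inter> closure D' = {}" "\<And>x. x \<in> B - closure D \<Longrightarrow> w x = w' x" "cball p (6 * \<eta>) \<subseteq> B"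
    and on: "norm e = 1" "norm f = 1" "e \<bullet> f = 0" and \<eta>: "0 < \<eta>"
    and quad: "\<And>s t. \<bar>s\<bar> \<le> 3 * \<eta> \<Longrightarrow> \<bar>t\<bar> \<le> 3 * \<eta> \<Longrightarrow> p + s *\<^sub>R e + t *\<^sub>R f \<in> closure D \<longleftrightarrow> 0 \<le> s \<and> 0 \<le> t"
    and \<delta>: "0 < \<delta>"
  shows "\<exists>C. \<forall>S a b. 1 \<le> S \<longrightarrow> a\<^sup>2 + b\<^sup>2 = - of_real (\<kappa>\<^sup>2) * q0 \<longrightarrow> \<delta> * S \<le> Re a \<longrightarrow> \<delta> * S \<le> Re b \<longrightarrow> norm a \<le> S \<longrightarrow> norm b \<le> S \<longrightarrow>
     norm (\<Sum>n<M. a * (pdn f n w' p / b ^ Suc n) + b * (pdn e n w' p / a ^ Suc n)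
        + q0 * (pdn f n (pd e w') p / b ^ Suc n + pdn e n (pd f w') p / a ^ Suc n)) \<le> C * S / S ^ M"
proof -
  obtain \<zeta> \<zeta>1 \<zeta>2 where "cutoff \<eta> \<zeta> \<zeta>1 \<zeta>2"
    by (rule cutoff_exists[OF \<eta>]) (rule that, unfold cutoff_def, intro conjI allI impI, (rule \<eta> | assumption | blast)+)
  then interpret cutoff \<eta> \<zeta> \<zeta>1 \<zeta>2 .
  have \<kappa>0: "0 \<le> \<kappa>" using \<kappa> by simp
  have "B \<subseteq> - closure D'" using B(2) by auto
  then have v: "wsol \<kappa> B w'" by (rule wsol_subset[OF TE_wsol[OF TE'] B(1)])
  have line: "\<exists>C. \<forall>S a. 1 \<le> S \<longrightarrow> \<delta> * S \<le> Re a \<longrightarrow>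
     norm (integral {0..3*\<eta>} (\<lambda>t. damped a t * g (p + t *\<^sub>R h)) - (\<Sum>n<M. pdn h n g p / a ^ Suc n)) \<le> C / S ^ M"
    if g: "wsol \<kappa> B g" and h: "norm h = 1" for g h
  proof -
    have "\<exists>C. \<forall>S a. 1 \<le> S \<longrightarrow> \<delta> * S \<le> Re a \<longrightarrow>
     norm (integral {0..3*\<eta>} (\<lambda>t. damped a t * pdn h 0 g (p + t *\<^sub>R h)) - (\<Sum>n<M. pdn h (0 + n) g (p
         + 0 *\<^sub>R h) / a ^ Suc n)) \<le> C / S ^ M"
    proof (rule laplace_expansion[of "\<lambda>k t. pdn h k g (p + t *\<^sub>R h)", OF _ \<delta>])
      fix k t assume t: "t \<in> {0..3 * \<eta>}"
      then have "p + t *\<^sub>R h \<in> cball p (6 * \<eta>)" using h \<eta> by (simp add: dist_norm)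
      then have "p + t *\<^sub>R h \<in> B" using B(4) by blast
      from has_vector_derivative_line[OF wsol_differentiable[OF wsol_pdn[OF g \<kappa>0] \<kappa>0 this]]
      show "((\<lambda>t. pdn h k g (p + t *\<^sub>R h)) has_vector_derivative pdn h (Suc k) g (p + t *\<^sub>R h)) (at t within {0..3 * \<eta>})"
          by simp
    qed
    then show ?thesis by simp
  qed
  let ?F0 = "\<lambda>a. integral {0..3*\<eta>} (\<lambda>s. damped a s * w' (p + s *\<^sub>R e))"
  let ?F1 = "\<lambda>a. integral {0..3*\<eta>} (\<lambda>s. damped a s * pd f w' (p + s *\<^sub>R e))"
  let ?G0 = "\<lambda>b. integral {0..3*\<eta>} (\<lambda>t. damped b t * w' (p + t *\<^sub>R f))"
  let ?G1 = "\<lambda>b. integral {0..3*\<eta>} (\<lambda>t. damped b t * pd e w' (p + t *\<^sub>R f))"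
  obtain C0 where C0: "\<And>S a b. 1 \<le> S \<Longrightarrow> a\<^sup>2 + b\<^sup>2 = - of_real (\<kappa>\<^sup>2) * q0 \<Longrightarrow> \<delta> * S \<le> Re a \<Longrightarrow> \<delta> * S \<le> Re b \<Longrightarrow> norm a \<le> S \<Longrightarrow>
      norm b \<le> S \<Longrightarrow>
     norm (a * ?G0 b + b * ?F0 a + q0 * (?G1 b + ?F1 a)) \<le> C0 * S * exp (- (\<delta> * \<eta> * S))"
    using corner_estimate[OF TE TE' \<kappa> B on quad \<delta>] by blast
  obtain C1 where C1: "\<And>S a. 1 \<le> S \<Longrightarrow> \<delta> * S \<le> Re a \<Longrightarrow> norm (?F0 a - (\<Sum>n<M. pdn e n w' p / a ^ Suc n)) \<le> C1 / S ^ M"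
    using line[OF v on(1)] by blast
  obtain C2 where C2: "\<And>S a. 1 \<le> S \<Longrightarrow> \<delta> * S \<le> Re a \<Longrightarrow> norm (?F1 a - (\<Sum>n<M. pdn e n (pd f w') p / a ^ Suc n)) \<le> C2 / S ^ M"
    using line[OF wsol_pd[OF v \<kappa>0] on(1)] by blast
  obtain C3 where C3: "\<And>S a. 1 \<le> S \<Longrightarrow> \<delta> * S \<le> Re a \<Longrightarrow> norm (?G0 a - (\<Sum>n<M. pdn f n w' p / a ^ Suc n)) \<le> C3 / S ^ M"
    using line[OF v on(2)] by blast
  obtain C4 where C4: "\<And>S a. 1 \<le> S \<Longrightarrow> \<delta> * S \<le> Re a \<Longrightarrow> norm (?G1 a - (\<Sum>n<M. pdn f n (pd e w') p / a ^ Suc n)) \<le> C4 / S ^ M"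
    using line[OF wsol_pd[OF v \<kappa>0] on(2)] by blast
  define E where "E = \<bar>C0\<bar> * (fact M / (\<delta> * \<eta>) ^ M)"
  show ?thesis
  proof (intro exI allI impI)
    fix S :: real and a b :: complex
    assume S: "1 \<le> S" and ab: "a\<^sup>2 + b\<^sup>2 = - of_real (\<kappa>\<^sup>2) * q0" and a: "\<delta> * S \<le> Re a" and b: "\<delta> * S \<le> Re b"
      and na: "norm a \<le> S" and nb: "norm b \<le> S"
    define f0 where "f0 = (\<Sum>n<M. pdn e n w' p / a ^ Suc n)"
    define f1 where "f1 = (\<Sum>n<M. pdn e n (pd f w') p / a ^ Suc n)"
    define g0 where "g0 = (\<Sum>n<M. pdn f n w' p / b ^ Suc n)"
    define g1 where "g1 = (\<Sum>n<M. pdn f n (pd e w') p / b ^ Suc n)"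
    have sum: "(\<Sum>n<M. a * (pdn f n w' p / b ^ Suc n) + b * (pdn e n w' p / a ^ Suc n)
        + q0 * (pdn f n (pd e w') p / b ^ Suc n + pdn e n (pd f w') p / a ^ Suc n)) = a * g0 + b * f0 + q0 * (g1 + f1)"
      unfolding f0_def f1_def g0_def g1_def by (simp only: sum.distrib sum_distrib_left[symmetric])
    have "norm (a * ?G0 b + b * ?F0 a + q0 * (?G1 b + ?F1 a)) \<le> C0 * S * exp (- (\<delta> * \<eta> * S))"
        by (rule C0[OF S ab a b na nb])
    also have "\<dots> \<le> \<bar>C0\<bar> * S * exp (- (\<delta> * \<eta> * S))" using S by (intro mult_right_mono) auto
    also have "\<dots> \<le> \<bar>C0\<bar> * S * (fact M / (\<delta> * \<eta>) ^ M / S ^ M)"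
      using exp_decay[of "\<delta> * \<eta>" S M] \<delta> \<eta> S by (intro mult_left_mono) auto
    also have "\<dots> = E * S / S ^ M" by (simp add: E_def)
    finally have 0: "norm (a * ?G0 b + b * ?F0 a + q0 * (?G1 b + ?F1 a)) \<le> E * S / S ^ M" .
    have 1: "norm (b * (?F0 a - f0)) \<le> S * (C1 / S ^ M)" unfolding norm_mult f0_def
        using S by (intro mult_mono nb C1 a) auto
    have 2: "norm (a * (?G0 b - g0)) \<le> S * (C3 / S ^ M)" unfolding norm_mult g0_def
        using S by (intro mult_mono na C3 b) auto
    have "norm (q0 * ((?G1 b - g1) + (?F1 a - f1))) \<le> norm q0 * (C4 / S ^ M + C2 / S ^ M)"
      unfolding norm_mult g1_def f1_def by (intro mult_left_mono order_trans[OF norm_triangle_ineq] add_mono C4 C2 S a b) auto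
    also have "\<dots> \<le> S * (norm q0 * (C4 / S ^ M + C2 / S ^ M))"
    proof -
      have "0 \<le> C4 / S ^ M" "0 \<le> C2 / S ^ M" using order_trans[OF norm_ge_zero C4[OF S b]] order_trans[OF norm_ge_zero C2[OF S a]] by auto
      then have "0 \<le> norm q0 * (C4 / S ^ M + C2 / S ^ M)" by simp
      then show ?thesis using S mult_right_mono[of 1 S "norm q0 * (C4 / S ^ M + C2 / S ^ M)"] by simp
    qed
    finally have 3: "norm (q0 * ((?G1 b - g1) + (?F1 a - f1))) \<le> S * (norm q0 * (C4 / S ^ M + C2 / S ^ M))" .
    have tri: "norm (x - (y + (z + t))) \<le> norm x + (norm y + (norm z + norm t))" for x y z t :: complex
      using norm_triangle_ineq4[of x "y + (z + t)"] norm_triangle_ineq[of y "z + t"] norm_triangle_ineq[of z t]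
          by linarith
    have split: "a * g + b * f + q0 * (g' + f') = (a * G0 + b * F0 + q0 * (G1 + F1))
        - (b * (F0 - f) + (a * (G0 - g) + q0 * ((G1 - g') + (F1 - f'))))" for g f g' f' G0 F0 G1 F1
            by (simp add: algebra_simps)
    have "a * g0 + b * f0 + q0 * (g1 + f1) = (a * ?G0 b + b * ?F0 a + q0 * (?G1 b + ?F1 a))
        - (b * (?F0 a - f0) + (a * (?G0 b - g0) + q0 * ((?G1 b - g1) + (?F1 a - f1))))" by (rule split)
    then have "norm (a * g0 + b * f0 + q0 * (g1 + f1)) \<le> norm (a * ?G0 b + b * ?F0 a + q0 * (?G1 b + ?F1 a))
        + (norm (b * (?F0 a - f0)) + (norm (a * (?G0 b - g0)) + norm (q0 * ((?G1 b - g1) + (?F1 a - f1)))))"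
      by (simp only: tri)
    also have "\<dots> \<le> E * S / S ^ M + (S * (C1 / S ^ M) + (S * (C3 / S ^ M) + S * (norm q0 * (C4 / S ^ M + C2 / S ^ M))))"
      by (intro add_mono 0 1 2 3)
    also have "\<dots> = (E + C1 + C3 + norm q0 * (C4 + C2)) * S / S ^ M" by (simp add: add_divide_distrib algebra_simps)
    finally show "norm (\<Sum>n<M. a * (pdn f n w' p / b ^ Suc n) + b * (pdn e n w' p / a ^ Suc n)
        + q0 * (pdn f n (pd e w') p / b ^ Suc n + pdn e n (pd f w') p / a ^ Suc n))
            \<le> (E + C1 + C3 + norm q0 * (C4 + C2)) * S / S ^ M"
      unfolding sum .
  qed
qed

section \<open>Recurrences for the Taylor coefficients at the corner\<close>

text \<open>Growth along a single ray bounds the degree, and the degree bounds the growth in every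
  direction.\<close>

lemma poly_bound_from_ray:
  fixes p :: "complex poly"
  assumes \<omega>: "norm \<omega> = 1" and bound: "\<And>s. s0 \<le> s \<Longrightarrow> norm (poly p (of_real s * \<omega>)) \<le> C * s ^ N"
  obtains C' where "\<And>z. 1 \<le> norm z \<Longrightarrow> norm (poly p z) \<le> C' * norm z ^ N"
proof -
  have deg: "degree p \<le> N"
  proof (rule ccontr)
    assume "\<not> degree p \<le> N"
    then have N: "N < degree p" by simp
    have "filterlim (\<lambda>s. of_real s * \<omega>) at_infinity at_top"
      unfolding filterlim_at_infinity[OF order_refl] using \<omega>
      by (auto simp: norm_mult eventually_at_top_linorder intro!: exI[of _ "_ :: real"] order_trans[OF _ abs_ge_self])
    then have "((\<lambda>s. poly p (of_real s * \<omega>) / (of_real s * \<omega>) ^ degree p) \<longlongrightarrow> lead_coeff p) at_top"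
      by (rule filterlim_compose[OF poly_divide_tendsto_aux])
    moreover have "((\<lambda>s. poly p (of_real s * \<omega>) / (of_real s * \<omega>) ^ degree p) \<longlongrightarrow> 0) at_top"
    proof (rule Lim_null_comparison)
      show "((\<lambda>s. \<bar>C\<bar> / s) \<longlongrightarrow> 0) at_top" by real_asymp
      show "\<forall>\<^sub>F s in at_top. norm (poly p (of_real s * \<omega>) / (of_real s * \<omega>) ^ degree p) \<le> \<bar>C\<bar> / s"
        using eventually_ge_at_top[of "max 1 s0"]
      proof eventually_elim
        case (elim s)
        then have s: "1 \<le> s" "s0 \<le> s" by auto
        have "norm (poly p (of_real s * \<omega>) / (of_real s * \<omega>) ^ degree p) = norm (poly p (of_real s * \<omega>)) / s ^ degree p"
          using s \<omega> by (simp add: norm_divide norm_power norm_mult)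
        also have "\<dots> \<le> (\<bar>C\<bar> * s ^ N) / s ^ Suc N"
        proof (intro frac_le)
          show "norm (poly p (of_real s * \<omega>)) \<le> \<bar>C\<bar> * s ^ N"
            by (rule order_trans[OF bound[OF s(2)]]) (use s in \<open>auto intro: mult_right_mono\<close>)
          show "s ^ Suc N \<le> s ^ degree p" using N s by (intro power_increasing) auto
        qed (use s in auto)
        also have "\<dots> = \<bar>C\<bar> / s" using s by simp
        finally show ?case .
      qed
    qed
    ultimately have "lead_coeff p = 0" using tendsto_unique trivial_limit_at_top_linorder by blast
    then show False using N by simp
  qed
  show ?thesis
  proof (rule that)
    fix z :: complex assume z: "1 \<le> norm z"
    have "norm (poly p z) \<le> (\<Sum>i\<le>degree p. norm (coeff p i * z ^ i))" unfolding poly_altdef by (rule norm_sum)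
    also have "\<dots> \<le> (\<Sum>i\<le>degree p. norm (coeff p i) * norm z ^ N)"
      using z deg by (intro sum_mono) (auto simp: norm_mult norm_power intro!: mult_left_mono power_increasing)
    finally show "norm (poly p z) \<le> (\<Sum>i\<le>degree p. norm (coeff p i)) * norm z ^ N" by (simp add: sum_distrib_right)
  qed
qed

text \<open>The angle of 45 degrees makes t and - i sigma t equally large in real part, namely |t| /
  sqrt 2 each.\<close>

lemma ray_direction:
  fixes \<sigma> :: real
  assumes "\<sigma> = 1 \<or> \<sigma> = - 1"
  defines "\<omega> \<equiv> Complex (1 / sqrt 2) (\<sigma> / sqrt 2)"
  shows "norm \<omega> = 1" "- \<i> * of_real \<sigma> * \<omega> = Complex (1 / sqrt 2) (- \<sigma> / sqrt 2)"
proof -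
  have "\<sigma>\<^sup>2 = 1" using assms by auto
  then show "norm \<omega> = 1" by (simp add: \<omega>_def cmod_def power_divide)
  show "- \<i> * of_real \<sigma> * \<omega> = Complex (1 / sqrt 2) (- \<sigma> / sqrt 2)"
    using assms(1) unfolding \<omega>_def by (auto simp: complex_eq_iff)
qed

text \<open>A rational parametrisation of a^2 + b^2 = mu, with sigma choosing the sign of b. The
  condition 5 |mu| <= s^2 keeps a and b within s/10 of their leading terms, which have modulus
  s/2.\<close>

lemma hyperbola_param:
  fixes \<mu> t :: complex and \<sigma> s :: real
  assumes t: "norm t = s" and s: "0 < s" "5 * norm \<mu> \<le> s\<^sup>2" and \<sigma>: "\<sigma> = 1 \<or> \<sigma> = - 1"
  defines "a \<equiv> (t + \<mu> / t) / 2" and "b \<equiv> - \<i> * of_real \<sigma> * (t - \<mu> / t) / 2"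
  shows "a\<^sup>2 + b\<^sup>2 = \<mu>" "norm (a - t / 2) \<le> s / 10" "norm (b - (- \<i> * of_real \<sigma> * t / 2)) \<le> s / 10"
    "norm a \<le> s" "norm b \<le> s" "s / 4 \<le> norm a" "s / 4 \<le> norm b"
proof -
  have t0: "t \<noteq> 0" using t s by auto
  have s2: "(of_real \<sigma>)\<^sup>2 = (1::complex)" and ns: "\<bar>\<sigma>\<bar> = 1" using \<sigma> by auto
  have "(t + \<mu> / t)\<^sup>2 - (t - \<mu> / t)\<^sup>2 = 4 * \<mu>" using t0 by (simp add: power2_eq_square field_simps)
  then show "a\<^sup>2 + b\<^sup>2 = \<mu>" unfolding a_def b_def power_divide power_mult_distrib s2 by (simp add: field_simps)
  have small: "norm (\<mu> / t) / 2 \<le> s / 10" using s t by (simp add: norm_divide field_simps power2_eq_square)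
  have "a - t / 2 = \<mu> / t / 2" unfolding a_def by (simp add: add_divide_distrib)
  then show ea: "norm (a - t / 2) \<le> s / 10" using small by (simp add: norm_divide)
  have "b - (- \<i> * of_real \<sigma> * t / 2) = \<i> * of_real \<sigma> * (\<mu> / t) / 2" unfolding b_def by (simp add: field_simps)
  then have "norm (b - (- \<i> * of_real \<sigma> * t / 2)) = norm (\<mu> / t) / 2" using ns by (simp add: norm_divide norm_mult)
  then show eb: "norm (b - (- \<i> * of_real \<sigma> * t / 2)) \<le> s / 10" using small by simp
  have nt: "norm (t / 2) = s / 2" using t by (simp add: norm_divide)
  have nt': "norm (- \<i> * of_real \<sigma> * t / 2) = s / 2" using t ns by (simp add: norm_divide norm_mult)
  show "norm a \<le> s" "s / 4 \<le> norm a"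
    using norm_triangle_sub[of a "t / 2"] norm_triangle_sub[of "t / 2" a] norm_minus_commute[of a "t/2"] ea s nt
        by linarith+
  show "norm b \<le> s" "s / 4 \<le> norm b"
    using norm_triangle_sub[of b "- \<i> * of_real \<sigma> * t / 2"] norm_triangle_sub[of "- \<i> * of_real \<sigma> * t / 2" b]
      norm_minus_commute[of b "- \<i> * of_real \<sigma> * t / 2"] eb s nt' by linarith+
qed

text \<open>The leading terms have real part s / (2 sqrt 2) >= 0.35 s and the perturbations are at
  most 0.1 s, which leaves s/4.\<close>

lemma hyperbola_ray:
  fixes \<mu> :: complex and \<sigma> s :: real
  assumes s: "0 < s" "5 * norm \<mu> \<le> s\<^sup>2" and \<sigma>: "\<sigma> = 1 \<or> \<sigma> = - 1"
  defines "t \<equiv> of_real s * Complex (1 / sqrt 2) (\<sigma> / sqrt 2)"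
  shows "s / 4 \<le> Re ((t + \<mu> / t) / 2)" "s / 4 \<le> Re (- \<i> * of_real \<sigma> * (t - \<mu> / t) / 2)"
proof -
  have nt: "norm t = s" unfolding t_def using ray_direction(1)[OF \<sigma>] s by (simp add: norm_mult)
  note * = hyperbola_param(2,3)[OF nt s \<sigma>]
  have "14 / 10 \<le> sqrt 2" by (rule real_le_rsqrt) (simp add: power2_eq_square)
  then have "(14 / 10 :: real) \<le> 2 / sqrt 2" by (simp only: real_div_sqrt)
  then have r: "s * (14 / 40) \<le> s / sqrt 2 / 2" using s mult_left_mono[of "14/10" "2 / sqrt 2" s] by simp
  have "Re (t / 2) = s / sqrt 2 / 2" unfolding t_def by simp
  then show "s / 4 \<le> Re ((t + \<mu> / t) / 2)"
    using r *(1) abs_Re_le_cmod[of "(t + \<mu> / t) / 2 - t / 2"] by (simp only: minus_complex.sel)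
  have "- \<i> * of_real \<sigma> * t / 2 = of_real s * (- \<i> * of_real \<sigma> * Complex (1 / sqrt 2) (\<sigma> / sqrt 2)) / 2"
    unfolding t_def by simp
  then have "Re (- \<i> * of_real \<sigma> * t / 2) = s / sqrt 2 / 2" unfolding ray_direction(2)[OF \<sigma>] by simp
  then show "s / 4 \<le> Re (- \<i> * of_real \<sigma> * (t - \<mu> / t) / 2)"
    using r *(2) abs_Re_le_cmod[of "- \<i> * of_real \<sigma> * (t - \<mu> / t) / 2 - (- \<i> * of_real \<sigma> * t / 2)"]
    by (simp only: minus_complex.sel)
qed

text \<open>The sum of \<open>corner_asymptotics\<close> multiplied by a b. There
  \<open>\<alpha>\<close> and \<open>\<beta>\<close> are the derivatives of w' along e and f,
  \<open>\<gamma>\<close> those of \<open>pd e w'\<close> along f, and \<open>\<delta>\<close> those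
  of \<open>pd f w'\<close> along e.\<close>

definition corner_sum ::
  "complex \<Rightarrow> (nat \<Rightarrow> complex) \<Rightarrow> (nat \<Rightarrow> complex) \<Rightarrow> (nat \<Rightarrow> complex) \<Rightarrow> (nat \<Rightarrow> complex) \<Rightarrow> nat \<Rightarrow> complex \<Rightarrow> complex \<Rightarrow> complex"
  where "corner_sum q \<alpha> \<beta> \<gamma> \<delta> M a b = (\<Sum>n<M. \<beta> n * a\<^sup>2 / b ^ n + \<alpha> n * b\<^sup>2 / a ^ n + q * \<gamma> n * a / b ^ n
      + q * \<delta> n * b / a ^ n)"

text \<open>The products a t and b t are polynomials in t of degree at most 2. The factor (a b)^M
  clears the powers a^n and b^n with n < M, and t^(2M+2) supplies the powers of t that complete the
  remaining factors to a t and b t.\<close>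

lemma corner_sum_poly:
  fixes \<mu> \<tau> q :: complex
  shows "\<exists>p. \<forall>t a b. t \<noteq> 0 \<longrightarrow> a \<noteq> 0 \<longrightarrow> b \<noteq> 0 \<longrightarrow> a = (t + \<mu> / t) / 2 \<longrightarrow> b = \<tau> * (t - \<mu> / t) / 2 \<longrightarrow>
    poly p t = t ^ (2 * M + 2) * (a * b) ^ M * corner_sum q \<alpha> \<beta> \<gamma> \<delta> M a b"
proof -
  define P R where "P = [:\<mu> / 2, 0, 1 / 2:]" and "R = [:- (\<tau> * \<mu> / 2), 0, \<tau> / 2:]"
  define p where "p = (\<Sum>n<M. smult (\<beta> n) (P ^ (M + 2) * R ^ (M - n) * [:0, 1:] ^ n)
    + smult (\<alpha> n) (R ^ (M + 2) * P ^ (M - n) * [:0, 1:] ^ n)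
    + smult (q * \<gamma> n) (P ^ (M + 1) * R ^ (M - n) * [:0, 1:] ^ (n + 1))
    + smult (q * \<delta> n) (R ^ (M + 1) * P ^ (M - n) * [:0, 1:] ^ (n + 1)))"
  have "poly p t = t ^ (2 * M + 2) * (a * b) ^ M * corner_sum q \<alpha> \<beta> \<gamma> \<delta> M a b"
    if t: "t \<noteq> 0" and a0: "a \<noteq> 0" and b0: "b \<noteq> 0" and a: "a = (t + \<mu> / t) / 2" and b: "b = \<tau> * (t - \<mu> / t) / 2" for t a b
  proof -
    have P: "poly P t = a * t" and R: "poly R t = b * t" using t by (simp_all add: P_def R_def a b field_simps)
    have 1: "(x * t) ^ (M + 2) * (y * t) ^ (M - n) * t ^ n = t ^ (2 * M + 2) * (a * b) ^ M * (x\<^sup>2 / y ^ n)"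
      and 2: "(x * t) ^ (M + 1) * (y * t) ^ (M - n) * t ^ (n + 1) = t ^ (2 * M + 2) * (a * b) ^ M * (x / y ^ n)"
      if n: "n < M" and xy: "x * y = a * b" and y: "y \<noteq> 0" for x y n
    proof -
      have [simp]: "y ^ (M - n) = y ^ M / y ^ n" using n y by (simp add: power_diff)
      have [simp]: "t ^ (M - n) = t ^ M / t ^ n" using n t by (simp add: power_diff)
      have e: "z ^ (M + 2) = z ^ M * (z * z)" "z ^ (M + 1) = z ^ M * z" "z ^ (n + 1) = z ^ n * z" "z\<^sup>2 = z * z"
        "z ^ (2 * M + 2) = z ^ M * z ^ M * (z * z)" for z :: complex by (simp_all add: power_add power2_eq_square mult_2)
      show "(x * t) ^ (M + 2) * (y * t) ^ (M - n) * t ^ n = t ^ (2 * M + 2) * (a * b) ^ M * (x\<^sup>2 / y ^ n)"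
        "(x * t) ^ (M + 1) * (y * t) ^ (M - n) * t ^ (n + 1) = t ^ (2 * M + 2) * (a * b) ^ M * (x / y ^ n)"
        using t y unfolding xy[symmetric] power_mult_distrib e by simp_all
    qed
    have "poly p t = (\<Sum>n<M. \<beta> n * ((a * t) ^ (M + 2) * (b * t) ^ (M - n) * t ^ n)
      + \<alpha> n * ((b * t) ^ (M + 2) * (a * t) ^ (M - n) * t ^ n)
      + q * \<gamma> n * ((a * t) ^ (M + 1) * (b * t) ^ (M - n) * t ^ (n + 1))
      + q * \<delta> n * ((b * t) ^ (M + 1) * (a * t) ^ (M - n) * t ^ (n + 1)))"
      unfolding p_def poly_sum poly_add poly_smult poly_mult poly_power P R by simp
    also have "\<dots> = (\<Sum>n<M. t ^ (2 * M + 2) * (a * b) ^ M * (\<beta> n * a\<^sup>2 / b ^ n + \<alpha> n * b\<^sup>2 / a ^ n + q * \<gamma> n * a / b ^ n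
        + q * \<delta> n * b / a ^ n))"
    proof (rule sum.cong[OF refl])
      fix n assume "n \<in> {..<M}"
      then have n: "n < M" by simp
      have ba: "b * a = a * b" by simp
      show "\<beta> n * ((a * t) ^ (M + 2) * (b * t) ^ (M - n) * t ^ n)
      + \<alpha> n * ((b * t) ^ (M + 2) * (a * t) ^ (M - n) * t ^ n)
      + q * \<gamma> n * ((a * t) ^ (M + 1) * (b * t) ^ (M - n) * t ^ (n + 1))
      + q * \<delta> n * ((b * t) ^ (M + 1) * (a * t) ^ (M - n) * t ^ (n + 1))
      = t ^ (2 * M + 2) * (a * b) ^ M * (\<beta> n * a\<^sup>2 / b ^ n + \<alpha> n * b\<^sup>2 / a ^ n + q * \<gamma> n * a / b ^ n
          + q * \<delta> n * b / a ^ n)"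
        unfolding 1[OF n refl b0] 1[OF n ba a0] 2[OF n refl b0] 2[OF n ba a0] by (simp add: algebra_simps)
    qed
    also have "\<dots> = t ^ (2 * M + 2) * (a * b) ^ M * corner_sum q \<alpha> \<beta> \<gamma> \<delta> M a b"
      by (simp only: corner_sum_def sum_distrib_left)
    finally show ?thesis .
  qed
  then show ?thesis by blast
qed

text \<open>Clearing denominators turns the sum into a polynomial in the parameter of the hyperbola; this
  transports the bound from one ray, where both real parts are large, to the whole plane.\<close>
lemma corner_sum_bound:
  fixes \<mu> q :: complex
  assumes bound: "\<And>S a b. 1 \<le> S \<Longrightarrow> a\<^sup>2 + b\<^sup>2 = \<mu> \<Longrightarrow> S / 4 \<le> Re a \<Longrightarrow> S / 4 \<le> Re b \<Longrightarrow> norm a \<le> S \<Longrightarrow> norm b \<le> S \<Longrightarrow>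
     norm (\<Sum>n<M. a * (\<beta> n / b ^ Suc n) + b * (\<alpha> n / a ^ Suc n) + q * (\<gamma> n / b ^ Suc n + \<delta> n / a ^ Suc n)) \<le> C * S / S ^ M"
    and \<sigma>: "\<sigma> = 1 \<or> \<sigma> = - 1"
  shows "\<exists>C'. \<forall>s t. 1 \<le> s \<longrightarrow> 5 * norm \<mu> \<le> s\<^sup>2 \<longrightarrow> norm t = s \<longrightarrow>
     norm (corner_sum q \<alpha> \<beta> \<gamma> \<delta> M ((t + \<mu> / t) / 2) (- \<i> * of_real \<sigma> * (t - \<mu> / t) / 2)) \<le> C' * s ^ 3 / s ^ M"
proof -
  define aa where "aa t = (t + \<mu> / t) / 2" for t
  define bb where "bb t = - \<i> * of_real \<sigma> * (t - \<mu> / t) / 2" for t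
  obtain p where p: "\<And>t a b. t \<noteq> 0 \<Longrightarrow> a \<noteq> 0 \<Longrightarrow> b \<noteq> 0 \<Longrightarrow> a = (t + \<mu> / t) / 2 \<Longrightarrow> b = - \<i> * of_real \<sigma> * (t - \<mu> / t) / 2 \<Longrightarrow>
    poly p t = t ^ (2 * M + 2) * (a * b) ^ M * corner_sum q \<alpha> \<beta> \<gamma> \<delta> M a b"
    using corner_sum_poly[of \<mu> "- \<i> * of_real \<sigma>" M q \<alpha> \<beta> \<gamma> \<delta>] by blast
  have param: "aa t \<noteq> 0 \<and> bb t \<noteq> 0 \<and> norm (aa t) \<le> s \<and> norm (bb t) \<le> s \<and> s / 4 \<le> norm (aa t) \<and> s / 4 \<le> norm (bb t)
      \<and> poly p t = t ^ (2 * M + 2) * (aa t * bb t) ^ M * corner_sum q \<alpha> \<beta> \<gamma> \<delta> M (aa t) (bb t)"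
    if s: "1 \<le> s" "5 * norm \<mu> \<le> s\<^sup>2" and t: "norm t = s" for s t
  proof -
    have "0 < s" using s by simp
    note h = hyperbola_param(4-7)[OF t this s(2) \<sigma>, folded aa_def bb_def]
    have nz: "aa t \<noteq> 0" "bb t \<noteq> 0" "t \<noteq> 0" using h s t by auto
    show ?thesis using h nz p[OF nz(3,1,2) aa_def bb_def] by blast
  qed
  define \<omega> where "\<omega> = Complex (1 / sqrt 2) (\<sigma> / sqrt 2)"
  define s0 where "s0 = 1 + 5 * norm \<mu>"
  have s0: "1 \<le> s \<and> 5 * norm \<mu> \<le> s\<^sup>2" if "s0 \<le> s" for s
  proof -
    have 1: "1 \<le> s" and "5 * norm \<mu> \<le> s" using that by (auto simp: s0_def intro: order_trans[rotated])
    moreover have "s \<le> s\<^sup>2" using 1 mult_right_mono[of 1 s s] by (simp add: power2_eq_square)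
    ultimately show ?thesis by linarith
  qed
  have n\<omega>: "norm \<omega> = 1" unfolding \<omega>_def by (rule ray_direction(1)[OF \<sigma>])
  \<comment> \<open>The exponent is (2M + 2) + 2 (M + 1) + 1 - M, from the power of t, from (a
    b)^(M+1) and from the assumed bound.\<close>
  have ray: "norm (poly p (of_real s * \<omega>)) \<le> C * s ^ (3 * M + 5)" if "s0 \<le> s" for s
  proof -
    have s: "1 \<le> s" "5 * norm \<mu> \<le> s\<^sup>2" using s0[OF that] by auto
    have s': "0 < s" using s by simp
    define t where "t = of_real s * \<omega>"
    have t: "norm t = s" using s n\<omega> by (simp add: t_def norm_mult)
    note pr = param[OF s t]
    define a b where "a = aa t" and "b = bb t"
    have nz: "a \<noteq> 0" "b \<noteq> 0" and na: "norm a \<le> s" and nb: "norm b \<le> s" using pr by (auto simp: a_def b_def)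
    have "a\<^sup>2 + b\<^sup>2 = \<mu>" unfolding a_def b_def aa_def bb_def by (rule hyperbola_param(1)[OF t s' s(2) \<sigma>])
    from bound[OF s(1) this _ _ na nb]
    have bd: "norm (\<Sum>n<M. a * (\<beta> n / b ^ Suc n) + b * (\<alpha> n / a ^ Suc n) + q * (\<gamma> n / b ^ Suc n + \<delta> n / a ^ Suc n))
        \<le> C * s / s ^ M"
      (is "norm ?\<Sigma> \<le> _")
      using hyperbola_ray[OF s' s(2) \<sigma>] unfolding a_def b_def aa_def bb_def t_def \<omega>_def by blast
    have "a * b * ?\<Sigma> = corner_sum q \<alpha> \<beta> \<gamma> \<delta> M a b"
      unfolding corner_sum_def sum_distrib_left using nz
      by (intro sum.cong refl) (simp add: algebra_simps power2_eq_square)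
    then have "poly p t = t ^ (2 * M + 2) * (a * b) ^ Suc M * ?\<Sigma>" using pr by (simp add: a_def b_def mult_ac)
    then have "norm (poly p t) = s ^ (2 * M + 2) * (norm a * norm b) ^ Suc M * norm ?\<Sigma>"
      by (simp only: norm_mult norm_power t)
    also have "\<dots> \<le> s ^ (2 * M + 2) * (s * s) ^ Suc M * (C * s / s ^ M)"
      using s by (intro mult_mono mult_left_mono power_mono bd na nb) auto
    also have "\<dots> = C * s ^ (3 * M + 5)"
    proof -
      have "3 * M + 5 = M + M + M + 5" by simp
      then show ?thesis using s' by (simp add: power_add power_mult_distrib mult_2 eval_nat_numeral)
    qed
    finally show ?thesis unfolding t_def .
  qed
  obtain C1 where C1: "\<And>z. 1 \<le> norm z \<Longrightarrow> norm (poly p z) \<le> C1 * norm z ^ (3 * M + 5)"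
    using poly_bound_from_ray[OF n\<omega> ray] by blast
  show ?thesis
  proof (intro exI allI impI)
    fix s :: real and t :: complex assume s: "1 \<le> s" "5 * norm \<mu> \<le> s\<^sup>2" and t: "norm t = s"
    have s': "0 < s" using s by simp
    define Q where "Q = corner_sum q \<alpha> \<beta> \<gamma> \<delta> M (aa t) (bb t)"
    note pr = param[OF s t]
    \<comment> \<open>On the whole circle |t| = s the factor in front of \<open>Q\<close> is at
      least s^(4M+2) / 16^M, which leaves the order s^(3-M).\<close>
    have "s ^ (2 * M + 2) * ((s / 4) * (s / 4)) ^ M * norm Q \<le> s ^ (2 * M + 2) * (norm (aa t) * norm (bb t)) ^ M * norm Q"
      using s pr by (intro mult_right_mono mult_left_mono power_mono mult_mono) auto
    also have "\<dots> = norm (poly p t)" using pr by (simp add: Q_def norm_mult norm_power t)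
    also have "\<dots> \<le> C1 * s ^ (3 * M + 5)" using C1[of t] s t by simp
    finally have "s ^ (2 * M + 2) * ((s / 4) * (s / 4)) ^ M * norm Q \<le> C1 * s ^ (3 * M + 5)" .
    moreover have "s ^ (2 * M + 2) * ((s / 4) * (s / 4)) ^ M = s ^ (3 * M + 2) * s ^ M / 16 ^ M"
    proof -
      have "3 * M + 2 = M + M + M + 2" "2 * M + 2 = M + M + 2" "s / 4 * (s / 4) = s * s / 16" by simp_all
      then show ?thesis by (simp only: power_add power_mult_distrib power_divide) simp
    qed
    moreover have "C1 * s ^ (3 * M + 5) = C1 * s ^ 3 * s ^ (3 * M + 2)" by (simp add: power_add eval_nat_numeral)
    moreover have "X * Y / Z * W = X * (Y / Z * W)" "C1 * Y * X = X * (C1 * Y)" for X Y Z W :: real by simp_all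
    ultimately have "s ^ (3 * M + 2) * (s ^ M / 16 ^ M * norm Q) \<le> s ^ (3 * M + 2) * (C1 * s ^ 3)" by (simp only:)
    then have "s ^ M / 16 ^ M * norm Q \<le> C1 * s ^ 3" by (simp only: mult_le_cancel_left_pos[OF zero_less_power[OF s']])
    then have "norm Q \<le> (C1 * 16 ^ M) * s ^ 3 / s ^ M" using s' by (simp add: field_simps)
    then show "norm (corner_sum q \<alpha> \<beta> \<gamma> \<delta> M ((t + \<mu> / t) / 2) (- \<i> * of_real \<sigma> * (t - \<mu> / t) / 2))
        \<le> (C1 * 16 ^ M) * s ^ 3 / s ^ M"
      unfolding Q_def aa_def bb_def .
  qed
qed

text \<open>Replacing t by - t turns (a, b) into (- a, - b), and changing sigma flips the sign of b
  alone, so the bound holds at all four sign choices. Signed averages isolate the part even in both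
  variables and the part odd in a and even in b; the \<open>\<delta>\<close> terms are odd in b and
  drop out of both.\<close>

lemma corner_sum_parity:
  fixes \<mu> q :: complex
  assumes bound: "\<And>S a b. 1 \<le> S \<Longrightarrow> a\<^sup>2 + b\<^sup>2 = \<mu> \<Longrightarrow> S / 4 \<le> Re a \<Longrightarrow> S / 4 \<le> Re b \<Longrightarrow> norm a \<le> S \<Longrightarrow> norm b \<le> S \<Longrightarrow>
     norm (\<Sum>n<M. a * (\<beta> n / b ^ Suc n) + b * (\<alpha> n / a ^ Suc n) + q * (\<gamma> n / b ^ Suc n + \<delta> n / a ^ Suc n)) \<le> C * S / S ^ M"
  defines "a \<equiv> \<lambda>s. (of_real s + \<mu> / of_real s) / 2" and "b \<equiv> \<lambda>s. - \<i> * (of_real s - \<mu> / of_real s) / 2"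
  shows "((\<lambda>s. (\<Sum>n<M. if even n then \<beta> n * (a s)\<^sup>2 / b s ^ n
      + \<alpha> n * (b s)\<^sup>2 / a s ^ n else 0) * (of_real s) ^ M / of_real s ^ 4) \<longlongrightarrow> 0) at_top"
    "((\<lambda>s. (\<Sum>n<M. if even n then q * \<gamma> n * a s / b s ^ n else \<alpha> n * (b s)\<^sup>2 / a s ^ n) * (of_real s) ^ M / of_real s ^ 4) \<longlongrightarrow> 0) at_top"
proof -
  let ?Q = "corner_sum q \<alpha> \<beta> \<gamma> \<delta> M"
  have ex: "\<exists>C'. \<forall>s t. 1 \<le> s \<longrightarrow> 5 * norm \<mu> \<le> s\<^sup>2 \<longrightarrow> norm t = s \<longrightarrow>
     norm (?Q ((t + \<mu> / t) / 2) (- \<i> * of_real \<sigma> * (t - \<mu> / t) / 2)) \<le> C' * s ^ 3 / s ^ M" if "\<sigma> = 1 \<or> \<sigma> = - 1" for \<sigma>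
    by (rule corner_sum_bound[OF bound that])
  obtain C1 where C1: "\<And>s t. 1 \<le> s \<Longrightarrow> 5 * norm \<mu> \<le> s\<^sup>2 \<Longrightarrow> norm t = s \<Longrightarrow>
     norm (?Q ((t + \<mu> / t) / 2) (- \<i> * of_real 1 * (t - \<mu> / t) / 2)) \<le> C1 * s ^ 3 / s ^ M"
    using ex[OF disjI1[OF refl]] by blast
  obtain C2 where C2: "\<And>s t. 1 \<le> s \<Longrightarrow> 5 * norm \<mu> \<le> s\<^sup>2 \<Longrightarrow> norm t = s \<Longrightarrow>
     norm (?Q ((t + \<mu> / t) / 2) (- \<i> * of_real (- 1) * (t - \<mu> / t) / 2)) \<le> C2 * s ^ 3 / s ^ M"
    using ex[OF disjI2[OF refl]] by blast
  have ee: "4 * (\<Sum>n<M. if even n then \<beta> n * a\<^sup>2 / b ^ n + \<alpha> n * b\<^sup>2 / a ^ n else 0)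
      = ?Q a b + ?Q (- a) b + (?Q a (- b) + ?Q (- a) (- b))" for a b
    unfolding corner_sum_def sum_distrib_left sum.distrib[symmetric] by (intro sum.cong refl) (simp add: uminus_power_if)
  have oe: "4 * (\<Sum>n<M. if even n then q * \<gamma> n * a / b ^ n else \<alpha> n * b\<^sup>2 / a ^ n)
      = ?Q a b - ?Q (- a) b + (?Q a (- b) - ?Q (- a) (- b))" for a b
    unfolding corner_sum_def sum_distrib_left sum.distrib[symmetric] sum_subtractf[symmetric]
        by (intro sum.cong refl) (simp add: uminus_power_if)
  \<comment> \<open>For s >= 1 the inequality 5 |mu| <= s implies 5 |mu| <= s^2.\<close>
  define L where "L = max 1 (5 * norm \<mu>)"
  have four: "norm (?Q (a s) (b s)) \<le> C1 * s ^ 3 / s ^ M" "norm (?Q (- a s) (- b s)) \<le> C1 * s ^ 3 / s ^ M"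
    "norm (?Q (a s) (- b s)) \<le> C2 * s ^ 3 / s ^ M" "norm (?Q (- a s) (b s)) \<le> C2 * s ^ 3 / s ^ M" and s1: "1 \<le> s"
    if "L \<le> s" for s
  proof -
    show s: "1 \<le> s" using that by (simp add: L_def)
    have "5 * norm \<mu> \<le> s" using that by (simp add: L_def)
    moreover have "s \<le> s\<^sup>2" using s mult_right_mono[of 1 s s] by (simp add: power2_eq_square)
    ultimately have s2: "5 * norm \<mu> \<le> s\<^sup>2" by linarith
    have m: "a s = (of_real s + \<mu> / of_real s) / 2" "- a s = (- of_real s + \<mu> / (- of_real s)) / 2"
      "b s = - \<i> * of_real 1 * (of_real s - \<mu> / of_real s) / 2" "- b s
          = - \<i> * of_real 1 * (- of_real s - \<mu> / (- of_real s)) / 2"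
      "- b s = - \<i> * of_real (- 1) * (of_real s - \<mu> / of_real s) / 2" "b s
          = - \<i> * of_real (- 1) * (- of_real s - \<mu> / (- of_real s)) / 2"
      unfolding a_def b_def by (simp_all add: algebra_simps add_divide_distrib diff_divide_distrib)
    have n: "norm (of_real s :: complex) = s" "norm (- of_real s :: complex) = s" using s by auto
    show "norm (?Q (a s) (b s)) \<le> C1 * s ^ 3 / s ^ M" using C1[OF s s2 n(1), folded m(1) m(3)] .
    show "norm (?Q (- a s) (- b s)) \<le> C1 * s ^ 3 / s ^ M" using C1[OF s s2 n(2), folded m(2) m(4)] .
    show "norm (?Q (a s) (- b s)) \<le> C2 * s ^ 3 / s ^ M" using C2[OF s s2 n(1), folded m(1) m(5)] .
    show "norm (?Q (- a s) (b s)) \<le> C2 * s ^ 3 / s ^ M" using C2[OF s s2 n(2), folded m(2) m(6)] .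
  qed
  have lim: "((\<lambda>s. F s * of_real s ^ M / of_real s ^ 4) \<longlongrightarrow> 0) at_top"
    if F: "\<And>s. 4 * F s = x s + x' s + (y s + y' s)" and
      b: "\<And>s. L \<le> s \<Longrightarrow> norm (x s) \<le> C1 * s ^ 3 / s ^ M" "\<And>s. L \<le> s \<Longrightarrow> norm (y' s) \<le> C1 * s ^ 3 / s ^ M"
        "\<And>s. L \<le> s \<Longrightarrow> norm (y s) \<le> C2 * s ^ 3 / s ^ M" "\<And>s. L \<le> s \<Longrightarrow> norm (x' s) \<le> C2 * s ^ 3 / s ^ M"
    for F x x' y y' :: "real \<Rightarrow> complex"
  proof (rule Lim_null_comparison)
    show "((\<lambda>s. (C1 + C2) / 2 / s) \<longlongrightarrow> 0) at_top" by real_asymp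
    show "\<forall>\<^sub>F s in at_top. norm (F s * of_real s ^ M / of_real s ^ 4) \<le> (C1 + C2) / 2 / s"
      using eventually_ge_at_top[of L]
    proof eventually_elim
      case (elim s)
      have s: "0 < s" using s1[OF elim] by simp
      have "norm (4 * F s) \<le> norm (x s) + norm (x' s) + (norm (y s) + norm (y' s))" unfolding F
        by (intro norm_triangle_mono order_refl)
      also have "\<dots> \<le> C1 * s ^ 3 / s ^ M + C2 * s ^ 3 / s ^ M + (C2 * s ^ 3 / s ^ M + C1 * s ^ 3 / s ^ M)"
        by (intro add_mono b elim)
      also have "\<dots> = 4 * ((C1 + C2) / 2 * s ^ 3 / s ^ M)" by (simp add: add_divide_distrib algebra_simps)
      finally have "norm (F s) \<le> (C1 + C2) / 2 * s ^ 3 / s ^ M" by (simp add: norm_mult)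
      then have "norm (F s) * s ^ M / s ^ 4 \<le> (C1 + C2) / 2 * s ^ 3 / s ^ M * s ^ M / s ^ 4"
        using s by (intro divide_right_mono mult_right_mono) auto
      also have "\<dots> = (C1 + C2) / 2 / s" using s by (simp add: eval_nat_numeral)
      finally show ?case using s by (simp add: norm_mult norm_divide norm_power)
    qed
  qed
  show "((\<lambda>s. (\<Sum>n<M. if even n then \<beta> n * (a s)\<^sup>2 / b s ^ n + \<alpha> n * (b s)\<^sup>2 / a s ^ n else 0) * (of_real s) ^ M / of_real s ^ 4) \<longlongrightarrow> 0) at_top"
    by (rule lim[OF ee]) (intro four, assumption)+
  show "((\<lambda>s. (\<Sum>n<M. if even n then q * \<gamma> n * a s / b s ^ n else \<alpha> n * (b s)\<^sup>2 / a s ^ n) * (of_real s) ^ M / of_real s ^ 4) \<longlongrightarrow> 0) at_top"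
  proof (rule lim)
    fix s
    show "4 * (\<Sum>n<M. if even n then q * \<gamma> n * a s / b s ^ n else \<alpha> n * (b s)\<^sup>2 / a s ^ n)
      = ?Q (a s) (b s) + - ?Q (- a s) (b s) + (?Q (a s) (- b s) + - ?Q (- a s) (- b s))" by (simp add: oe)
  qed (use four in auto)
qed

text \<open>\<open>A j i\<close> stands for a derivative of order 2 i along e and 2 j along f; the
  equation trades two f-derivatives for two e-derivatives. Once the first row vanishes below m, the
  antidiagonal m is determined up to sign, and the next one picks up the lower-order term k once per
  step.\<close>

lemma helmholtz_table:
  fixes A :: "nat \<Rightarrow> nat \<Rightarrow> complex"
  assumes rec: "\<And>j i. A (Suc j) i = - A j (Suc i) - k * A j i" and z: "\<And>i. i < m \<Longrightarrow> A 0 i = 0"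
  shows "i + j < m \<Longrightarrow> A j i = 0" "i + j = m \<Longrightarrow> A j i = (-1) ^ j * A 0 m"
    "i + j = Suc m \<Longrightarrow> A j i = (-1) ^ j * (A 0 (Suc m) + of_nat j * k * A 0 m)"
proof -
  show 1: "i + j < m \<Longrightarrow> A j i = 0" for i j
    by (induction j arbitrary: i) (auto simp: rec z)
  show 2: "i + j = m \<Longrightarrow> A j i = (-1) ^ j * A 0 m" for i j
  proof (induction j arbitrary: i)
    case (Suc j)
    then show ?case using Suc.IH[of "Suc i"] 1[of i j] by (simp add: rec)
  qed simp
  show "i + j = Suc m \<Longrightarrow> A j i = (-1) ^ j * (A 0 (Suc m) + of_nat j * k * A 0 m)"
  proof (induction j arbitrary: i)
    case (Suc j)
    then show ?case using Suc.IH[of "Suc i"] 2[of i j] by (simp add: rec algebra_simps)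
  qed simp
qed

text \<open>Induction on the order. For odd order the leading \<open>\<gamma>\<close> and
  \<open>\<alpha>\<close> terms combine to a multiple of q - 1. For even order the leading terms
  cancel; two powers lower the constraint contributes mu = - k q, while the terms of order n + 2
  contribute k after their unknown coefficient has cancelled.\<close>

lemma corner_algebra:
  fixes \<alpha> \<beta> \<gamma> \<delta> :: "nat \<Rightarrow> complex" and A A' :: "nat \<Rightarrow> nat \<Rightarrow> complex" and k q :: complex
  assumes bound: "\<And>M. \<exists>C. \<forall>S a b. 1 \<le> S \<longrightarrow> a\<^sup>2 + b\<^sup>2 = - k * q \<longrightarrow> S / 4 \<le> Re a \<longrightarrow> S / 4 \<le> Re b \<longrightarrow> norm a \<le> S \<longrightarrow> norm b \<le> S \<longrightarrow>
     norm (\<Sum>n<M. a * (\<beta> n / b ^ Suc n) + b * (\<alpha> n / a ^ Suc n) + q * (\<gamma> n / b ^ Suc n + \<delta> n / a ^ Suc n)) \<le> C * S / S ^ M"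
    and A: "\<And>j i. A (Suc j) i = - A j (Suc i) - k * A j i" "\<And>i. A 0 i = \<alpha> (2 * i)" "\<And>j. A j 0 = \<beta> (2 * j)"
    and A': "\<And>j i. A' (Suc j) i = - A' j (Suc i) - k * A' j i" "\<And>i. A' 0 i = \<alpha> (2 * i + 1)" "\<And>j. A' j 0 = \<gamma> (2 * j)"
    and k: "k \<noteq> 0" and q: "q \<noteq> 1"
  shows "\<alpha> n = 0"
proof (induction n rule: less_induct)
  case (less N)
  define \<mu> where "\<mu> = - k * q"
  define a where "a s = (of_real s + \<mu> / of_real s) / 2" for s :: real
  define b where "b s = - \<i> * (of_real s - \<mu> / of_real s) / 2" for s :: real
  define x where "x s = a s / of_real s" for s
  define y where "y s = b s / of_real s" for s
  have small: "((\<lambda>s. \<mu> / of_real s / of_real s) \<longlongrightarrow> 0) at_top"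
  proof (rule Lim_null_comparison)
    show "((\<lambda>s. norm \<mu> / s\<^sup>2) \<longlongrightarrow> 0) at_top" by real_asymp
    show "\<forall>\<^sub>F s in at_top. norm (\<mu> / of_real s / of_real s) \<le> norm \<mu> / s\<^sup>2"
      by (simp add: norm_divide norm_mult power2_eq_square)
  qed
  have pos: "\<forall>\<^sub>F s in at_top. (0::real) < s" by (rule eventually_gt_at_top)
  have "(x \<longlongrightarrow> (1 + 0) / 2) at_top"
  proof (rule Lim_transform_eventually)
    show "((\<lambda>s. (1 + \<mu> / of_real s / of_real s) / 2) \<longlongrightarrow> (1 + 0) / 2) at_top" by (intro tendsto_intros small) simp
    show "\<forall>\<^sub>F s in at_top. (1 + \<mu> / of_real s / of_real s) / 2 = x s"
      using pos by eventually_elim (simp add: x_def a_def add_divide_distrib)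
  qed
  then have x: "(x \<longlongrightarrow> 1 / 2) at_top" by simp
  have "(y \<longlongrightarrow> - \<i> * (1 - 0) / 2) at_top"
  proof (rule Lim_transform_eventually)
    show "((\<lambda>s. - \<i> * (1 - \<mu> / of_real s / of_real s) / 2) \<longlongrightarrow> - \<i> * (1 - 0) / 2) at_top"
        by (intro tendsto_intros small) simp
    show "\<forall>\<^sub>F s in at_top. - \<i> * (1 - \<mu> / of_real s / of_real s) / 2 = y s"
      using pos by eventually_elim (simp add: y_def b_def field_simps)
  qed
  then have y: "(y \<longlongrightarrow> - \<i> / 2) at_top" by simp
  have inv: "((\<lambda>s. c / (of_real s)\<^sup>2) \<longlongrightarrow> (0::complex)) at_top" for c
  proof (rule Lim_null_comparison)
    show "((\<lambda>s. norm c / s\<^sup>2) \<longlongrightarrow> 0) at_top" by real_asymp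
    show "\<forall>\<^sub>F s in at_top. norm (c / (of_real s)\<^sup>2) \<le> norm c / s\<^sup>2" by (simp add: norm_divide norm_power)
  qed
  have "\<forall>\<^sub>F s in at_top. x s \<noteq> 0" by (rule tendsto_imp_eventually_ne[OF x]) simp
  moreover have "\<forall>\<^sub>F s in at_top. y s \<noteq> 0" by (rule tendsto_imp_eventually_ne[OF y]) simp
  ultimately have nz: "\<forall>\<^sub>F s in at_top. 0 < s \<and> x s \<noteq> 0 \<and> y s \<noteq> 0" using pos by eventually_elim auto
  have ab: "a s = x s * of_real s" "b s = y s * of_real s" if "0 < s" for s using that by (auto simp: x_def y_def)
  have sq: "(a s)\<^sup>2 + (b s)\<^sup>2 = \<mu>" if "0 < s" for s
  proof -
    have "(of_real s + \<mu> / of_real s)\<^sup>2 - (of_real s - \<mu> / of_real s)\<^sup>2 = 4 * \<mu>"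
        using that by (simp add: power2_eq_square field_simps)
    then show ?thesis unfolding a_def b_def power_divide power_mult_distrib by (simp add: diff_divide_distrib[symmetric])
  qed
  have par: "((\<lambda>s. (\<Sum>n<M. if even n then \<beta> n * (a s)\<^sup>2 / b s ^ n
      + \<alpha> n * (b s)\<^sup>2 / a s ^ n else 0) * (of_real s) ^ M / of_real s ^ 4) \<longlongrightarrow> 0) at_top"
    "((\<lambda>s. (\<Sum>n<M. if even n then q * \<gamma> n * a s / b s ^ n else \<alpha> n * (b s)\<^sup>2 / a s ^ n) * (of_real s) ^ M / of_real s ^ 4) \<longlongrightarrow> 0) at_top" for M
  proof -
    obtain C where C: "\<And>S a b. 1 \<le> S \<Longrightarrow> a\<^sup>2 + b\<^sup>2 = \<mu> \<Longrightarrow> S / 4 \<le> Re a \<Longrightarrow> S / 4 \<le> Re b \<Longrightarrow> norm a \<le> S \<Longrightarrow> norm b \<le> S \<Longrightarrow>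
     norm (\<Sum>n<M. a * (\<beta> n / b ^ Suc n) + b * (\<alpha> n / a ^ Suc n) + q * (\<gamma> n / b ^ Suc n + \<delta> n / a ^ Suc n)) \<le> C * S / S ^ M"
      using bound[of M, folded \<mu>_def] by blast
    show "((\<lambda>s. (\<Sum>n<M. if even n then \<beta> n * (a s)\<^sup>2 / b s ^ n
        + \<alpha> n * (b s)\<^sup>2 / a s ^ n else 0) * (of_real s) ^ M / of_real s ^ 4) \<longlongrightarrow> 0) at_top"
      "((\<lambda>s. (\<Sum>n<M. if even n then q * \<gamma> n * a s / b s ^ n else \<alpha> n * (b s)\<^sup>2 / a s ^ n) * (of_real s) ^ M / of_real s ^ 4) \<longlongrightarrow> 0) at_top"
      using corner_sum_parity[OF C] unfolding a_def b_def by auto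
  qed
  have uniq: "L = 0" if "((f :: real \<Rightarrow> complex) \<longlongrightarrow> 0) at_top" "(g \<longlongrightarrow> L) at_top" "\<forall>\<^sub>F s in at_top. f s = g s" for f g L
    by (rule tendsto_unique[OF trivial_limit_at_top_linorder Lim_transform_eventually[OF that(2)] that(1)])
      (use that(3) in eventually_elim, simp)
  show ?case
  proof (cases "even N")
    case False
    then obtain m where N: "N = 2 * m + 1" by (auto elim: oddE)
    have z: "A' 0 i = 0" if "i < m" for i using less[of "2 * i + 1"] that by (simp add: A'(2) N)
    have \<gamma>0: "\<gamma> (2 * j) = 0" if "j < m" for j using helmholtz_table(1)[of "A'" k m 0 j, OF A'(1) z] that
        by (simp add: A'(3))
    have \<gamma>m: "\<gamma> (2 * m) = (-1) ^ m * \<alpha> N" using helmholtz_table(2)[of "A'" k m 0 m, OF A'(1) z] by (simp add: A'(2,3) N)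
    have low: "(\<Sum>n<2 * m. if even n then q * \<gamma> n * a s / b s ^ n else \<alpha> n * (b s)\<^sup>2 / a s ^ n) = 0" for s
      by (intro sum.neutral ballI) (auto simp: N less \<gamma>0 elim!: evenE)
    define g where "g s = q * \<gamma> (2 * m) * x s / y s ^ (2 * m) + \<alpha> N * (y s)\<^sup>2 / x s ^ N + (q * \<gamma> (2 * m
        + 2) * x s / y s ^ (2 * m + 2)) * (1 / (of_real s)\<^sup>2)" for s
    have "q * \<gamma> (2 * m) * (1/2) / (- \<i> / 2) ^ (2 * m) + \<alpha> N * (- \<i> / 2)\<^sup>2 / (1/2) ^ N
       + (q * \<gamma> (2 * m + 2) * (1/2) / (- \<i> / 2) ^ (2 * m + 2)) * 0 = 0"
    \<comment> \<open>With 2 m + 3 terms the scaling s^M / s^4 is s^(2m-1), which makes the leading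
      terms of order 1; the term with index 2 m + 2 survives only with a factor s^(-2).\<close>
    proof (rule uniq[OF par(2)[of "2 * m + 3"], of g])
      show "(g \<longlongrightarrow> q * \<gamma> (2 * m) * (1/2) / (- \<i> / 2) ^ (2 * m) + \<alpha> N * (- \<i> / 2)\<^sup>2 / (1/2) ^ N
       + (q * \<gamma> (2 * m + 2) * (1/2) / (- \<i> / 2) ^ (2 * m + 2)) * 0) at_top"
        unfolding g_def by (intro tendsto_intros x y inv) auto
      show "\<forall>\<^sub>F s in at_top. (\<Sum>n<2 * m + 3. if even n then q * \<gamma> n * a s / b s ^ n else \<alpha> n * (b s)\<^sup>2 / a s ^ n) * (of_real s) ^ (2 * m + 3) / of_real s ^ 4 = g s"
        using nz
      proof eventually_elim
        case (elim s)
        have "(\<Sum>n<2 * m + 3. if even n then q * \<gamma> n * a s / b s ^ n else \<alpha> n * (b s)\<^sup>2 / a s ^ n)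
          = q * \<gamma> (2 * m) * a s / b s ^ (2 * m) + \<alpha> N * (b s)\<^sup>2 / a s ^ N + q * \<gamma> (2 * m + 2) * a s / b s ^ (2 * m + 2)"
        proof -
          have *: "2 * m + 3 = Suc (Suc (Suc (2 * m)))" by simp
          show ?thesis unfolding * sum.lessThan_Suc low by (simp add: N)
        qed
        moreover have "(c1 * (x * r) / (y2 * R) + c2 * ((y * y) * (r * r)) / (xN * x * (R * r))
            + c3 * (x * r) / (y2 * (y * y) * (R * (r * r)))) * (R * (r * r * r)) / (r * r * r * r)
          = c1 * x / y2 + c2 * (y * y) / (xN * x) + (c3 * x / (y2 * (y * y))) * (1 / (r * r))"
          if "x \<noteq> 0" "y \<noteq> 0" "r \<noteq> 0" "R \<noteq> 0" "xN \<noteq> 0" "y2 \<noteq> 0" for c1 c2 c3 x y xN y2 r R :: complex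
          using that by (simp add: field_simps)
        note this[of "x s" "y s" "of_real s" "of_real s ^ (2 * m)" "x s ^ (2 * m)" "y s ^ (2 * m)" "q * \<gamma> (2 * m)" "\<alpha> N" "q * \<gamma> (2 * m + 2)"]
        moreover have "z ^ (2 * m + 2) = z ^ (2 * m) * (z * z)" "z ^ (2 * m + 3) = z ^ (2 * m) * (z * z * z)" "z ^ N
            = z ^ (2 * m) * z"
          "z\<^sup>2 = z * z" "z ^ 4 = z * z * z * z" for z :: complex
          unfolding N power_add by (simp_all add: eval_nat_numeral)
        ultimately show ?case using elim unfolding g_def ab[OF conjunct1[OF elim]] power_mult_distrib
            by (simp add: mult_ac)
      qed
    qed
    then have "\<alpha> N * (4 ^ m * (q - 1) / 2) = 0"
    proof -
      have "(- \<i> / 2) ^ (2 * m) = (-1) ^ m / (4 :: complex) ^ m" "(1/2) ^ N = 1 / (2 * (4 :: complex) ^ m)"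
        unfolding N power_mult by (simp_all add: power_mult power_divide uminus_power_if)
      moreover have "(-1) ^ m * (-1) ^ m = (1 :: complex)" "(-1) ^ m / (-1) ^ m = (1 :: complex)"
          by (simp_all add: power_add[symmetric])
      moreover assume "q * \<gamma> (2 * m) * (1/2) / (- \<i> / 2) ^ (2 * m) + \<alpha> N * (- \<i> / 2)\<^sup>2 / (1/2) ^ N
       + (q * \<gamma> (2 * m + 2) * (1/2) / (- \<i> / 2) ^ (2 * m + 2)) * 0 = 0"
      ultimately show ?thesis unfolding \<gamma>m by (simp add: power2_eq_square field_simps)
    qed
    then show ?thesis using q by simp
  next
    case True
    then obtain m where N: "N = 2 * m" by (auto elim: evenE)
    have z: "A 0 i = 0" if "i < m" for i using less[of "2 * i"] that by (simp add: A(2) N)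
    have \<beta>0: "\<beta> (2 * j) = 0" if "j < m" for j using helmholtz_table(1)[of A k m 0 j, OF A(1) z] that by (simp add: A(3))
    have \<beta>m: "\<beta> (2 * m) = (-1) ^ m * \<alpha> N" using helmholtz_table(2)[of A k m 0 m, OF A(1) z] by (simp add: A(2,3) N)
    have \<beta>m': "\<beta> (2 * m + 2) = - ((-1) ^ m) * (\<alpha> (2 * m + 2) + (of_nat m + 1) * k * \<alpha> N)"
      using helmholtz_table(3)[of A k m 0 "Suc m", OF A(1) z] A(2)[of "Suc m"] A(2)[of m] A(3)[of "Suc m"]
          by (simp add: N)
    have low: "(\<Sum>n<2 * m. if even n then \<beta> n * (a s)\<^sup>2 / b s ^ n + \<alpha> n * (b s)\<^sup>2 / a s ^ n else 0) = 0" for s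
      by (intro sum.neutral ballI) (auto simp: N less \<beta>0 elim!: evenE)
    \<comment> \<open>\<open>X\<close> and the sign-adjusted \<open>Y\<close> both tend to 4. The
      cancelling pair is governed by Y^(m+1) - X^(m+1), whose factor Y - X the constraint makes
      equal to mu X Y / s^2.\<close>
    define X where "X s = 1 / (x s)\<^sup>2" for s
    define Y where "Y s = - 1 / (y s)\<^sup>2" for s
    define g where "g s = \<alpha> N * \<mu> * (\<Sum>i<Suc m. X s ^ (m - i) * Y s ^ i)
       + (\<alpha> (2 * m + 2) * (y s)\<^sup>2 * X s ^ (m + 1) + \<beta> (2 * m + 2) * (x s)\<^sup>2 * ((-1) ^ (m + 1) * Y s ^ (m + 1)))" for s
    have "\<alpha> N * \<mu> * (\<Sum>i<Suc m. (1 / (1/2)\<^sup>2) ^ (m - i) * (- 1 / (- \<i> / 2)\<^sup>2) ^ i)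
       + (\<alpha> (2 * m + 2) * (- \<i> / 2)\<^sup>2 * (1 / (1/2)\<^sup>2) ^ (m + 1) + \<beta> (2 * m + 2) * (1/2)\<^sup>2 * ((-1) ^ (m
           + 1) * (- 1 / (- \<i> / 2)\<^sup>2) ^ (m + 1))) = 0"
    \<comment> \<open>With 2 m + 4 terms the scaling is s^(2m), two powers finer than the leading
      terms, which would diverge like s^2 if they did not cancel.\<close>
    proof (rule uniq[OF par(1)[of "2 * m + 4"], of g])
      show "(g \<longlongrightarrow> \<alpha> N * \<mu> * (\<Sum>i<Suc m. (1 / (1/2)\<^sup>2) ^ (m - i) * (- 1 / (- \<i> / 2)\<^sup>2) ^ i)
       + (\<alpha> (2 * m + 2) * (- \<i> / 2)\<^sup>2 * (1 / (1/2)\<^sup>2) ^ (m + 1) + \<beta> (2 * m + 2) * (1/2)\<^sup>2 * ((-1) ^ (m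
           + 1) * (- 1 / (- \<i> / 2)\<^sup>2) ^ (m + 1)))) at_top"
        unfolding g_def X_def Y_def by (intro tendsto_intros x y) auto
      show "\<forall>\<^sub>F s in at_top. (\<Sum>n<2 * m + 4. if even n then \<beta> n * (a s)\<^sup>2 / b s ^ n
          + \<alpha> n * (b s)\<^sup>2 / a s ^ n else 0) * (of_real s) ^ (2 * m + 4) / of_real s ^ 4 = g s"
        using nz
      proof eventually_elim
        case (elim s)
        define r :: complex where "r = of_real s"
        have r: "r \<noteq> 0" using elim by (simp add: r_def)
        have abr: "a s = x s * r" "b s = y s * r" using ab elim by (auto simp: r_def)
        have XY: "(x s)\<^sup>2 * X s = 1" "(y s)\<^sup>2 * Y s = - 1" using elim by (auto simp: X_def Y_def)
        have plane_wave: "1 / x s ^ (2 * j) = X s ^ j" "1 / y s ^ (2 * j) = (-1) ^ j * Y s ^ j" for j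
          unfolding X_def Y_def power_mult power_divide power_mult_distrib[symmetric]
              by (simp_all add: power_divide power_mult_distrib[symmetric])
        have "(x s)\<^sup>2 * r\<^sup>2 + (y s)\<^sup>2 * r\<^sup>2 = \<mu>" using sq[of s] elim unfolding abr power_mult_distrib by simp
        moreover have "M * X * Y = r\<^sup>2 * (Y - X)" if "x\<^sup>2 * r\<^sup>2 + y\<^sup>2 * r\<^sup>2 = M" "x\<^sup>2 * X = 1" "y\<^sup>2 * Y
            = - 1" for x y X Y M :: complex
        proof -
          have "M * X * Y = r\<^sup>2 * ((x\<^sup>2 * X) * Y + (y\<^sup>2 * Y) * X)"
              unfolding that(1)[symmetric] by (simp only: algebra_simps)
          then show ?thesis unfolding that(2,3) by simp
        qed
        ultimately have "\<mu> * X s * Y s = r\<^sup>2 * (Y s - X s)" using XY by blast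
        then have "\<mu> * X s * Y s * (\<Sum>i<Suc m. X s ^ (m - i) * Y s ^ i)
            = r\<^sup>2 * ((Y s - X s) * (\<Sum>i<Suc m. Y s ^ i * X s ^ (m - i)))"
          by (simp add: mult.commute)
        also have "\<dots> = r\<^sup>2 * (Y s * Y s ^ m - X s * X s ^ m)" using diff_power_eq_sum[of "Y s" m "X s"] by simp
        also have "\<dots> = X s * Y s * (r\<^sup>2 * ((y s)\<^sup>2 * X s ^ m + (x s)\<^sup>2 * Y s ^ m))"
        proof -
          have "r\<^sup>2 * (Y * Ym - X * Xm) = X * Y * (r\<^sup>2 * (y\<^sup>2 * Xm + x\<^sup>2 * Ym))" if "x\<^sup>2 * X = 1" "y\<^sup>2 * Y
              = - 1" for x y X Y Xm Ym :: complex
            using that by algebra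
          then show ?thesis using XY by blast
        qed
        finally have "X s * Y s * (r\<^sup>2 * ((y s)\<^sup>2 * X s ^ m + (x s)\<^sup>2 * Y s ^ m))
            = X s * Y s * (\<mu> * (\<Sum>i<Suc m. X s ^ (m - i) * Y s ^ i))"
          by (simp only: mult_ac)
        then have lead: "r\<^sup>2 * ((y s)\<^sup>2 * X s ^ m + (x s)\<^sup>2 * Y s ^ m) = \<mu> * (\<Sum>i<Suc m. X s ^ (m - i) * Y s ^ i)"
          using XY by auto
        have trm: "c * (x s * r)\<^sup>2 / (y s * r) ^ (2 * j) = c * (x s)\<^sup>2 * ((-1) ^ j * Y s ^ j) * (r\<^sup>2 / r ^ (2 * j))"
          "c * (y s * r)\<^sup>2 / (x s * r) ^ (2 * j) = c * (y s)\<^sup>2 * X s ^ j * (r\<^sup>2 / r ^ (2 * j))" for c j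
          unfolding plane_wave[symmetric] power_mult_distrib by simp_all
        have e: "r ^ (2 * (m + 1)) = r ^ (2 * m) * r\<^sup>2" "r ^ (2 * m + 4) = r ^ (2 * m) * r ^ 4"
            by (simp_all only: power_add distrib_left mult_1_right)
        have "(\<Sum>n<2 * m + 4. if even n then \<beta> n * (a s)\<^sup>2 / b s ^ n + \<alpha> n * (b s)\<^sup>2 / a s ^ n else 0)
          = \<beta> (2 * m) * (a s)\<^sup>2 / b s ^ (2 * m) + \<alpha> N * (b s)\<^sup>2 / a s ^ (2 * m)
          + (\<beta> (2 * m + 2) * (a s)\<^sup>2 / b s ^ (2 * m + 2) + \<alpha> (2 * m + 2) * (b s)\<^sup>2 / a s ^ (2 * m + 2))"
        proof -
          have *: "2 * m + 4 = Suc (Suc (Suc (Suc (2 * m))))" by simp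
          show ?thesis unfolding * sum.lessThan_Suc low by (simp add: N)
        qed
        also have "\<dots> = \<alpha> N * (r\<^sup>2 * ((y s)\<^sup>2 * X s ^ m + (x s)\<^sup>2 * Y s ^ m)) / r ^ (2 * m)
          + (\<beta> (2 * m + 2) * (x s)\<^sup>2 * ((-1) ^ (m + 1) * Y s ^ (m + 1)) + \<alpha> (2 * m + 2) * (y s)\<^sup>2 * X s ^ (m
              + 1)) / r ^ (2 * m)"
        proof -
          have sgn: "(-1) ^ m * (-1) ^ m = (1 :: complex)" by (simp add: power_add[symmetric])
          have "2 * m + 2 = 2 * (m + 1)" by simp
          then have "\<beta> (2 * m + 2) * (a s)\<^sup>2 / b s ^ (2 * m + 2) + \<alpha> (2 * m + 2) * (b s)\<^sup>2 / a s ^ (2 * m + 2)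
            = (\<beta> (2 * m + 2) * (x s)\<^sup>2 * ((-1) ^ (m + 1) * Y s ^ (m + 1)) + \<alpha> (2 * m + 2) * (y s)\<^sup>2 * X s ^ (m
                + 1)) * (r\<^sup>2 / r ^ (2 * (m + 1)))"
            unfolding abr by (simp only: trm distrib_right)
          also have "\<dots> = (\<beta> (2 * m + 2) * (x s)\<^sup>2 * ((-1) ^ (m + 1) * Y s ^ (m + 1)) + \<alpha> (2 * m + 2) * (y s)\<^sup>2 * X s ^ (m
              + 1)) / r ^ (2 * m)"
            unfolding e(1) using r by simp
          moreover have "\<beta> (2 * m) * (a s)\<^sup>2 / b s ^ (2 * m) + \<alpha> N * (b s)\<^sup>2 / a s ^ (2 * m)
            = (\<beta> (2 * m) * (x s)\<^sup>2 * ((-1) ^ m * Y s ^ m) + \<alpha> N * (y s)\<^sup>2 * X s ^ m) * (r\<^sup>2 / r ^ (2 * m))"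
            unfolding abr by (simp only: trm distrib_right)
          moreover have "\<dots> = \<alpha> N * (r\<^sup>2 * ((y s)\<^sup>2 * X s ^ m + (x s)\<^sup>2 * Y s ^ m)) / r ^ (2 * m)"
          proof -
            have "\<beta>' * x * (sg * Ym) + \<alpha>' * y * Xm = \<alpha>' * (y * Xm + x * Ym)" if "sg * sg = 1" "\<beta>'
                = sg * \<alpha>'" for \<alpha>' \<beta>' sg x y Xm Ym :: complex
              using that by algebra
            then have "\<beta> (2 * m) * (x s)\<^sup>2 * ((-1) ^ m * Y s ^ m) + \<alpha> N * (y s)\<^sup>2 * X s ^ m
                = \<alpha> N * ((y s)\<^sup>2 * X s ^ m + (x s)\<^sup>2 * Y s ^ m)"
              using sgn \<beta>m by blast
            then show ?thesis by simp
          qed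
          ultimately show ?thesis by simp
        qed
        finally show ?case unfolding lead g_def r_def[symmetric] e(2) using r by (simp add: add_divide_distrib[symmetric])
      qed
    qed
    note lim = this
    have four: "(- 1 / (- \<i> / 2)\<^sup>2) = (4::complex)" "(1 / (1/2)\<^sup>2) = (4::complex)" by (simp_all add: power2_eq_square)
    have "(\<Sum>i<Suc m. (4::complex) ^ (m - i) * 4 ^ i) = (\<Sum>i<Suc m. 4 ^ m)"
      by (intro sum.cong refl) (simp add: power_add[symmetric])
    also have "\<dots> = (of_nat m + 1) * 4 ^ m" by (simp only: sum_constant card_lessThan of_nat_Suc add.commute)
    finally have *: "\<alpha> N * \<mu> * ((of_nat m + 1) * 4 ^ m)
       + (\<alpha> (2 * m + 2) * (- \<i> / 2)\<^sup>2 * 4 ^ (m + 1) + \<beta> (2 * m + 2) * (1/2)\<^sup>2 * ((-1) ^ (m + 1) * 4 ^ (m + 1))) = 0"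
      using lim unfolding four by simp
    \<comment> \<open>Inserting \<open>\<beta>m'\<close> cancels the coefficient of order 2 m + 2;
      what remains is (m + 1) 4^m times - k q + k.\<close>
    have "(of_nat m + 1) * 4 ^ m * (\<alpha> N * (k * (1 - q))) = 0"
    proof -
      have "(-1) ^ m * (-1) ^ m = (1 :: complex)" by (simp add: power_add[symmetric])
      moreover have "c * (- \<i> / 2)\<^sup>2 * 4 ^ (m + 1) = - (c * 4 ^ m)" "c * (1/2)\<^sup>2 * ((-1) ^ (m + 1) * 4 ^ (m + 1))
          = - (c * ((-1) ^ m * 4 ^ m))" for c :: complex
        by (simp_all add: power2_eq_square)
      moreover have "\<alpha> N * (- k * q) * ((of_nat m + 1) * 4 ^ m) + (- (\<alpha> (2 * m + 2) * 4 ^ m) + - (\<beta> (2 * m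
          + 2) * ((-1) ^ m * 4 ^ m))) = 0"
        using * unfolding calculation(2,3) \<mu>_def .
      moreover have "m1 * F * (\<alpha>' * (k * (1 - q))) = 0" if "sg * sg
          = 1" "\<alpha>' * (- k * q) * (m1 * F) + (- (\<alpha>2 * F) + - (\<beta>' * (sg * F))) = 0"
        "\<beta>' = - sg * (\<alpha>2 + m1 * k * \<alpha>')" for sg \<alpha>' \<alpha>2 \<beta>' m1 F :: complex
        using that by algebra
      ultimately show ?thesis using \<beta>m' by blast
    qed
    moreover have "(of_nat m + 1 :: complex) \<noteq> 0" using of_nat_neq_0[of m] by (simp add: add.commute)
    ultimately show ?thesis using q k by simp
  qed
qed

section \<open>Rectangles\<close>

lemma pdn_lincomb:
  assumes g: "wsol \<kappa> G g" and h: "wsol \<kappa> G h" and \<kappa>: "0 \<le> \<kappa>" and x: "x \<in> G"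
  shows "pdn e n (\<lambda>x. c * g x + c' * h x) x = c * pdn e n g x + c' * pdn e n h x"
  using x
proof (induction n arbitrary: x)
  case (Suc n)
  note dg = wsol_differentiable[OF wsol_pdn[OF g \<kappa>] \<kappa> Suc.prems]
  note dh = wsol_differentiable[OF wsol_pdn[OF h \<kappa>] \<kappa> Suc.prems]
  have "pdn e (Suc n) (\<lambda>x. c * g x + c' * h x) x = pd e (\<lambda>x. c * pdn e n g x + c' * pdn e n h x) x"
    using pd_cong_open[OF wsol_D(1)[OF g] Suc.prems Suc.IH] by simp
  also have "\<dots> = c * pd e (pdn e n g) x + c' * pd e (pdn e n h) x"
    by (rule pd_eqI) (intro derivative_intros has_derivative_pd dg dh)
  finally show ?case by simp
qed simp

text \<open>Derivatives along \<open>f\<close> are solutions again, so the equation in the frame e,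
  f applies to them. This is the recurrence required by \<open>helmholtz_table\<close>.\<close>

lemma pdn_helmholtz:
  assumes v: "wsol \<kappa> G v" and \<kappa>: "0 \<le> \<kappa>" and x: "x \<in> G" and on: "norm e = 1" "norm f = 1" "e \<bullet> f = 0"
  shows "pdn e n (pdn f (2 * Suc j) v) x = - pdn e (n + 2) (pdn f (2 * j) v) x
      - of_real (\<kappa>\<^sup>2) * pdn e n (pdn f (2 * j) v) x"
proof -
  define g where "g = pdn f (2 * j) v"
  have g: "wsol \<kappa> G g" unfolding g_def by (rule wsol_pdn[OF v \<kappa>])
  have gg: "wsol \<kappa> G (pd e (pd e g))" by (intro wsol_pd g \<kappa>)
  have "pdn e n (pdn f (2 * Suc j) v) x = pdn e n (pd f (pd f g)) x" by (simp add: g_def)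
  also have "\<dots> = pdn e n (\<lambda>y. (- 1) * pd e (pd e g) y + (- of_real (\<kappa>\<^sup>2)) * g y) x"
  proof (rule pdn_cong_open[OF wsol_D(1)[OF v] _ x])
    fix y assume "y \<in> G"
    from helmholtz_orthonormal[OF g \<kappa> this on]
    show "pd f (pd f g) y = (- 1) * pd e (pd e g) y + (- of_real (\<kappa>\<^sup>2)) * g y"
        by (simp add: algebra_simps eq_neg_iff_add_eq_0)
  qed
  also have "\<dots> = (- 1) * pdn e n (pd e (pd e g)) x + (- of_real (\<kappa>\<^sup>2)) * pdn e n g x"
    by (rule pdn_lincomb[OF gg g \<kappa> x])
  also have "pdn e n (pd e (pd e g)) = pdn e (n + 2) g" by (simp add: funpow_swap1)
  finally show ?thesis by (simp add: g_def)
qed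

text \<open>The recurrence changes orders by two, hence two tables: \<open>A\<close> for even orders
  of \<open>w'\<close> along e, and \<open>A'\<close>, built from \<open>pd e w'\<close>, for odd
  ones. The slope 1/4 is the one achieved by \<open>hyperbola_ray\<close>.\<close>

lemma corner_derivatives_vanish:
  fixes e f p :: pt
  assumes TE: "TE_total_field \<kappa> d q0 D u w" and TE': "TE_total_field \<kappa> d q0 D' u' w'" and \<kappa>: "0 < \<kappa>" and q0: "q0 \<noteq> 1"
    and B: "open B" "B \<inter> closure D' = {}" "\<And>x. x \<in> B - closure D \<Longrightarrow> w x = w' x" "cball p (6 * \<eta>) \<subseteq> B"
    and on: "norm e = 1" "norm f = 1" "e \<bullet> f = 0" and \<eta>: "0 < \<eta>"
    and quad: "\<And>s t. \<bar>s\<bar> \<le> 3 * \<eta> \<Longrightarrow> \<bar>t\<bar> \<le> 3 * \<eta> \<Longrightarrow> p + s *\<^sub>R e + t *\<^sub>R f \<in> closure D \<longleftrightarrow> 0 \<le> s \<and> 0 \<le> t"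
  shows "pdn e n w' p = 0"
proof (rule corner_algebra[where \<alpha> = "\<lambda>n. pdn e n w' p" and \<beta> = "\<lambda>n. pdn f n w' p" and \<gamma> = "\<lambda>n. pdn f n (pd e w') p"
      and \<delta> = "\<lambda>n. pdn e n (pd f w') p" and A = "\<lambda>j i. pdn e (2 * i) (pdn f (2 * j) w') p"
      and A' = "\<lambda>j i. pdn e (2 * i) (pdn f (2 * j) (pd e w')) p" and k = "of_real (\<kappa>\<^sup>2)" and q = q0])
  have \<kappa>0: "0 \<le> \<kappa>" using \<kappa> by simp
  have v: "wsol \<kappa> B w'" by (rule wsol_subset[OF TE_wsol[OF TE'] B(1)]) (use B(2) in auto)
  have p: "p \<in> B" using B(4) \<eta> by (auto simp: subset_iff)
  show "\<exists>C. \<forall>S a b. 1 \<le> S \<longrightarrow> a\<^sup>2 + b\<^sup>2 = - of_real (\<kappa>\<^sup>2) * q0 \<longrightarrow> S / 4 \<le> Re a \<longrightarrow> S / 4 \<le> Re b \<longrightarrow> norm a \<le> S \<longrightarrow> norm b \<le> S \<longrightarrow>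
     norm (\<Sum>n<M. a * (pdn f n w' p / b ^ Suc n) + b * (pdn e n w' p / a ^ Suc n)
        + q0 * (pdn f n (pd e w') p / b ^ Suc n + pdn e n (pd f w') p / a ^ Suc n)) \<le> C * S / S ^ M" for M
    using corner_asymptotics[OF TE TE' \<kappa> B on \<eta> quad, of "1/4" M] by simp
  show "pdn e (2 * i) (pdn f (2 * Suc j) w') p = - pdn e (2 * Suc i) (pdn f (2 * j) w') p
      - of_real (\<kappa>\<^sup>2) * pdn e (2 * i) (pdn f (2 * j) w') p" for i j
    using pdn_helmholtz[OF v \<kappa>0 p on, of "2 * i" j] by simp
  show "pdn e (2 * i) (pdn f (2 * Suc j) (pd e w')) p = - pdn e (2 * Suc i) (pdn f (2 * j) (pd e w')) p
      - of_real (\<kappa>\<^sup>2) * pdn e (2 * i) (pdn f (2 * j) (pd e w')) p" for i j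
    using pdn_helmholtz[OF wsol_pd[OF v \<kappa>0] \<kappa>0 p on, of "2 * i" j] by simp
qed (use \<kappa> q0 in \<open>auto simp: funpow_swap1\<close>)

section \<open>Geometry of rectangles and their corners\<close>

definition rect :: "pt \<Rightarrow> pt \<Rightarrow> pt \<Rightarrow> pt set" where
  "rect c a b = {y. 0 \<le> (y - c) \<bullet> a \<and> (y - c) \<bullet> a \<le> a \<bullet> a \<and> 0 \<le> (y - c) \<bullet> b \<and> (y - c) \<bullet> b \<le> b \<bullet> b}"

text \<open>Re-basing a rectangle at an adjacent corner. Since \<open>rect\<close> is described by
  inner products with its sides, this is a change of sign of one side.\<close>

lemma rect_flip: "a \<bullet> b = 0 \<Longrightarrow> rect (c + a) (- a) b = rect c a b" "a \<bullet> b = 0 \<Longrightarrow> rect (c + b) a (- b) = rect c a b"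
  by (auto simp: rect_def inner_diff_left inner_add_left inner_commute[of b a])

lemma orthogonal_decomp:
  fixes a b y :: pt
  assumes "a \<noteq> 0" "b \<noteq> 0" "a \<bullet> b = 0"
  shows "y = (y \<bullet> a / (a \<bullet> a)) *\<^sub>R a + (y \<bullet> b / (b \<bullet> b)) *\<^sub>R b"
proof -
  define e f where "e = a /\<^sub>R norm a" and "f = b /\<^sub>R norm b"
  have "norm e = 1" "norm f = 1" "e \<bullet> f = 0" using assms by (auto simp: e_def f_def)
  from frame_decomp[OF this, of y]
  have "y = (y \<bullet> e) *\<^sub>R e + (y \<bullet> f) *\<^sub>R f" by simp
  then show ?thesis by (simp add: e_def f_def dot_square_norm power2_eq_square divide_simps)
qed

lemma open_rectangle_iff:
  fixes a b :: pt
  assumes ab: "a \<noteq> 0" "b \<noteq> 0" "a \<bullet> b = 0"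
  shows "{c + s *\<^sub>R a + t *\<^sub>R b | s t. 0 < s \<and> s < 1 \<and> 0 < t \<and> t < 1}
    = {y. 0 < (y - c) \<bullet> a \<and> (y - c) \<bullet> a < a \<bullet> a \<and> 0 < (y - c) \<bullet> b \<and> (y - c) \<bullet> b < b \<bullet> b}" (is "?L = ?R")
proof (intro set_eqI iffI)
  have pos: "0 < a \<bullet> a" "0 < b \<bullet> b" using ab by auto
  have ba: "b \<bullet> a = 0" using ab by (simp add: inner_commute)
  fix y
  { assume "y \<in> ?L"
    then show "y \<in> ?R" using pos ab(3) ba by (auto simp: inner_add_left) }
  { assume y: "y \<in> ?R"
    define s t where "s = (y - c) \<bullet> a / (a \<bullet> a)" and "t = (y - c) \<bullet> b / (b \<bullet> b)"
    have "y = c + s *\<^sub>R a + t *\<^sub>R b"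
      using orthogonal_decomp[OF ab, of "y - c"] unfolding s_def t_def by (simp add: algebra_simps)
    moreover have "0 < s" "s < 1" "0 < t" "t < 1" unfolding s_def t_def using y pos by auto
    ultimately show "y \<in> ?L" by blast }
qed

lemma convex_rect: "convex (rect c a b)" and closed_rect: "closed (rect c a b)"
proof -
  have e: "(y - c) \<bullet> z = z \<bullet> y - c \<bullet> z" for y z by (simp add: inner_diff_left inner_commute[of z y])
  have r: "rect c a b = {y. a \<bullet> y \<ge> c \<bullet> a} \<inter> {y. a \<bullet> y \<le> c \<bullet> a + a \<bullet> a} \<inter> {y. b \<bullet> y \<ge> c \<bullet> b} \<inter> {y. b \<bullet> y \<le> c \<bullet> b + b \<bullet> b}"
    by (auto simp: rect_def e)
  show "convex (rect c a b)" unfolding r by (intro convex_Int convex_halfspace_ge convex_halfspace_le)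
  show "closed (rect c a b)" unfolding r by (intro closed_Int closed_halfspace_ge closed_halfspace_le)
qed

lemma open_rectangleD:
  assumes "is_open_rectangle D"
  shows "open D" "convex D" "bounded D" "\<exists>c a b. a \<noteq> 0 \<and> b \<noteq> 0 \<and> a \<bullet> b = 0 \<and> closure D = rect c a b"
proof -
  obtain c a b where ab: "a \<noteq> 0" "b \<noteq> 0" "a \<bullet> b = 0"
    and D: "D = {c + s *\<^sub>R a + t *\<^sub>R b | s t. 0 < s \<and> s < 1 \<and> 0 < t \<and> t < 1}"
    using assms unfolding is_open_rectangle_def by blast
  note D' = D[unfolded open_rectangle_iff[OF ab]]
  have e: "(y - c) \<bullet> z = z \<bullet> y - c \<bullet> z" for y z by (simp add: inner_diff_left inner_commute[of z y])
  have r: "D = {y. a \<bullet> y > c \<bullet> a} \<inter> {y. a \<bullet> y < c \<bullet> a + a \<bullet> a} \<inter> {y. b \<bullet> y > c \<bullet> b} \<inter> {y. b \<bullet> y < c \<bullet> b + b \<bullet> b}"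
    unfolding D' by (auto simp: e)
  show "open D" unfolding r by (intro open_Int open_halfspace_gt open_halfspace_lt)
  show "convex D" unfolding r by (intro convex_Int convex_halfspace_gt convex_halfspace_lt)
  show "bounded D"
  proof (rule boundedI)
    fix x assume "x \<in> D"
    then obtain s t where x: "x = c + s *\<^sub>R a + t *\<^sub>R b" and st: "0 < s" "s < 1" "0 < t" "t < 1" unfolding D by blast
    have "norm x \<le> norm c + norm (s *\<^sub>R a) + norm (t *\<^sub>R b)" unfolding x by (intro norm_triangle_mono order_refl)
    also have "\<dots> \<le> norm c + 1 * norm a + 1 * norm b" unfolding norm_scaleR
        using st by (intro add_mono mult_right_mono) auto
    finally show "norm x \<le> norm c + norm a + norm b" by simp
  qed
  have "closure D = rect c a b"
  proof
    show "closure D \<subseteq> rect c a b" by (rule closure_minimal[OF _ closed_rect]) (auto simp: D' rect_def)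
    show "rect c a b \<subseteq> closure D"
    proof
      fix x assume x: "x \<in> rect c a b"
      \<comment> \<open>The centre: a segment from it to any point of the closed rectangle runs
        inside \<open>D\<close> except for the end point.\<close>
      define m where "m = c + (1/2) *\<^sub>R a + (1/2) *\<^sub>R b"
      have m: "(m - c) \<bullet> a = a \<bullet> a / 2" "(m - c) \<bullet> b = b \<bullet> b / 2"
          using ab(3) by (auto simp: m_def inner_add_left inner_commute[of b a])
      have pos: "0 < a \<bullet> a" "0 < b \<bullet> b" using ab by auto
      have mD: "m \<in> D" unfolding D' using m pos by (intro CollectI conjI) linarith+
      show "x \<in> closure D"
      proof (cases "x = m")
        case True
        then show ?thesis using mD closure_subset by blast
      next
        case False
        have "open_segment m x \<subseteq> D"
        proof
          fix y assume "y \<in> open_segment m x"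
          then obtain \<theta> where \<theta>: "0 < \<theta>" "\<theta> < 1" and y: "y = (1 - \<theta>) *\<^sub>R m + \<theta> *\<^sub>R x" by (auto simp: in_segment)
          have "y - c = (1 - \<theta>) *\<^sub>R (m - c) + \<theta> *\<^sub>R (x - c)" by (simp add: y algebra_simps)
          then have e: "(y - c) \<bullet> z = (1 - \<theta>) * ((m - c) \<bullet> z) + \<theta> * ((x - c) \<bullet> z)" for z
              by (simp only: inner_add_left inner_scaleR_left)
          have between: "0 < (1 - \<theta>) * (P / 2) + \<theta> * q \<and> (1 - \<theta>) * (P / 2) + \<theta> * q < P" if "0 < P" "0 \<le> q" "q \<le> P" for P q
          proof
            show "0 < (1 - \<theta>) * (P / 2) + \<theta> * q" using \<theta> that by (intro add_pos_nonneg) auto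
            have "(1 - \<theta>) * (P / 2) + \<theta> * q < (1 - \<theta>) * P + \<theta> * P"
                using \<theta> that by (intro add_less_le_mono mult_strict_left_mono mult_left_mono) auto
            then show "(1 - \<theta>) * (P / 2) + \<theta> * q < P" by (simp add: algebra_simps)
          qed
          show "y \<in> D" unfolding D' mem_Collect_eq e m
            using between[OF pos(1), of "(x - c) \<bullet> a"] between[OF pos(2), of "(x - c) \<bullet> b"] x by (auto simp: rect_def)
        qed
        then have "closure (open_segment m x) \<subseteq> closure D" by (rule closure_mono)
        then show ?thesis using False by auto
      qed
    qed
  qed
  then show "\<exists>c a b. a \<noteq> 0 \<and> b \<noteq> 0 \<and> a \<bullet> b = 0 \<and> closure D = rect c a b" using ab by blast
qed

text \<open>An open convex set is the interior of its closure.\<close>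

lemma open_rectangle_eqI:
  assumes "is_open_rectangle D" "is_open_rectangle D'" "closure D = closure D'"
  shows "D = D'"
proof -
  have "interior (closure E) = E" if "is_open_rectangle E" for E
    using convex_interior_closure[OF open_rectangleD(2)[OF that]] interior_open[OF open_rectangleD(1)[OF that]] by simp
  then show ?thesis using assms by metis
qed

lemma midpoint_not_extreme:
  fixes x h :: "'a::real_vector"
  assumes "x extreme_point_of K" "x - h \<in> K" "x + h \<in> K"
  shows "h = 0"
proof (rule ccontr)
  assume "h \<noteq> 0"
  have "x - h \<noteq> x + h"
  proof
    assume "x - h = x + h"
    then have "2 *\<^sub>R h = 0" by (simp add: scaleR_2 diff_eq_eq add.assoc)
    then show False using \<open>h \<noteq> 0\<close> by simp
  qed
  moreover have "x = (1 - 1/2) *\<^sub>R (x - h) + (1/2) *\<^sub>R (x + h)"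
    using scaleR_half_double[of x] by (simp add: scaleR_diff_right scaleR_add_right)
  ultimately have "x \<in> open_segment (x - h) (x + h)" unfolding in_segment by (intro conjI exI[of _ "1/2"]) auto
  then show False using assms unfolding extreme_point_of_def by blast
qed

text \<open>If a side coordinate of \<open>x\<close> were strictly between its bounds,
  \<open>x\<close> could be moved both ways along that side and would be a midpoint. So both
  coordinates are extremal, and the rectangle is re-based at \<open>x\<close> by flipping
  sides.\<close>

lemma rect_corner:
  assumes ab: "a \<noteq> 0" "b \<noteq> 0" "a \<bullet> b = 0" and x: "x extreme_point_of rect c a b"
  shows "\<exists>a' b'. a' \<noteq> 0 \<and> b' \<noteq> 0 \<and> a' \<bullet> b' = 0 \<and> rect c a b = rect x a' b'"
proof -
  have xr: "x \<in> rect c a b" using x by (simp add: extreme_point_of_def)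
  have pos: "0 < a \<bullet> a" "0 < b \<bullet> b" using ab by auto
  have ba: "b \<bullet> a = 0" using ab by (simp add: inner_commute)
  have step: "\<exists>\<epsilon>>0. \<epsilon> * P \<le> z \<and> z + \<epsilon> * P \<le> P" if "0 < P" "0 < z" "z < P" for P z :: real
    using that by (intro exI[of _ "min z (P - z) / P"]) (auto simp: min_def)
  have 1: "(x - c) \<bullet> a = 0 \<or> (x - c) \<bullet> a = a \<bullet> a"
  proof (rule ccontr)
    assume "\<not> ?thesis"
    then have "0 < (x - c) \<bullet> a" "(x - c) \<bullet> a < a \<bullet> a" using xr by (auto simp: rect_def)
    from step[OF pos(1) this] obtain \<epsilon> where \<epsilon>: "0 < \<epsilon>" "\<epsilon> * (a \<bullet> a) \<le> (x - c) \<bullet> a" "(x - c) \<bullet> a + \<epsilon> * (a \<bullet> a) \<le> a \<bullet> a"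
        by blast
    define P where "P = \<epsilon> * (a \<bullet> a)"
    have P: "0 \<le> P" "P \<le> (x - c) \<bullet> a" "(x - c) \<bullet> a + P \<le> a \<bullet> a" unfolding P_def using \<epsilon> by auto
    have "x - \<epsilon> *\<^sub>R a \<in> rect c a b" "x + \<epsilon> *\<^sub>R a \<in> rect c a b"
      using xr P ab(3) by (auto simp: rect_def inner_diff_left inner_add_left P_def[symmetric])
    then show False using midpoint_not_extreme[OF x, of "\<epsilon> *\<^sub>R a"] \<open>0 < \<epsilon>\<close> ab by auto
  qed
  have 2: "(x - c) \<bullet> b = 0 \<or> (x - c) \<bullet> b = b \<bullet> b"
  proof (rule ccontr)
    assume "\<not> ?thesis"
    then have "0 < (x - c) \<bullet> b" "(x - c) \<bullet> b < b \<bullet> b" using xr by (auto simp: rect_def)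
    from step[OF pos(2) this] obtain \<epsilon> where \<epsilon>: "0 < \<epsilon>" "\<epsilon> * (b \<bullet> b) \<le> (x - c) \<bullet> b" "(x - c) \<bullet> b + \<epsilon> * (b \<bullet> b) \<le> b \<bullet> b"
        by blast
    define P where "P = \<epsilon> * (b \<bullet> b)"
    have P: "0 \<le> P" "P \<le> (x - c) \<bullet> b" "(x - c) \<bullet> b + P \<le> b \<bullet> b" unfolding P_def using \<epsilon> by auto
    have "x - \<epsilon> *\<^sub>R b \<in> rect c a b" "x + \<epsilon> *\<^sub>R b \<in> rect c a b"
      using xr P ba by (auto simp: rect_def inner_diff_left inner_add_left P_def[symmetric])
    then show False using midpoint_not_extreme[OF x, of "\<epsilon> *\<^sub>R b"] \<open>0 < \<epsilon>\<close> ab by auto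
  qed
  have "x = c + ((x - c) \<bullet> a / (a \<bullet> a)) *\<^sub>R a + ((x - c) \<bullet> b / (b \<bullet> b)) *\<^sub>R b"
    using orthogonal_decomp[OF ab, of "x - c"] by (simp add: algebra_simps)
  then consider "x = c" | "x = c + a" | "x = c + b" | "x = c + a + b"
    using 1 2 pos by (elim disjE) (auto simp del: inner_eq_zero_iff)
  then show ?thesis
  proof cases
    case 1 then show ?thesis using ab by blast
  next
    case 2 then show ?thesis using rect_flip(1)[OF ab(3)] ab by (intro exI[of _ "- a"] exI[of _ b]) auto
  next
    case 3 then show ?thesis using rect_flip(2)[OF ab(3)] ab by (intro exI[of _ a] exI[of _ "- b"]) auto
  next
    case 4
    then show ?thesis using rect_flip(1)[OF ab(3), of c] rect_flip(2)[of "- a" b "c + a"] ab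
      by (intro exI[of _ "- a"] exI[of _ "- b"]) auto
  qed
qed

section \<open>An exposed corner is impossible\<close>

lemma no_exposed_corner:
  assumes TE: "TE_total_field \<kappa> d q0 D u w" "TE_total_field \<kappa> d q0 D' u' w'" and \<kappa>: "0 < \<kappa>" and q0: "q0 \<noteq> 1"
    and fb: "far_bound \<kappa> d u uinf" "far_bound \<kappa> d u' uinf'" and eq: "\<forall>xh\<in>unit_circle. uinf xh = uinf' xh"
    and D: "is_open_rectangle D" "is_open_rectangle D'"
    and x: "x extreme_point_of (convex hull (closure D \<union> closure D'))" "x \<notin> closure D'"
  shows False
proof -
  define K where "K = convex hull (closure D \<union> closure D')"
  have bd: "bounded D" "bounded D'" using D open_rectangleD(3) by blast+
  have "compact K" unfolding K_def using bd by (intro compact_convex_hull compact_Un compact_closure[THEN iffD2])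
  then have K: "compact K" "closed K" "bounded K" "convex K" by (auto simp: K_def compact_imp_closed compact_imp_bounded)
  have DK: "closure D \<subseteq> K" "closure D' \<subseteq> K" unfolding K_def using hull_subset[of "closure D \<union> closure D'" convex] by auto
  have xK: "x extreme_point_of K" using x by (simp add: K_def)
  have xD: "x \<in> closure D" using extreme_point_of_convex_hull[OF x(1)] x(2) by blast
  have "x extreme_point_of closure D" using xK xD DK unfolding extreme_point_of_def by blast
  then obtain a b where ab: "a \<noteq> 0" "b \<noteq> 0" "a \<bullet> b = 0" and r: "closure D = rect x a b"
    using open_rectangleD(4)[OF D(1)] rect_corner by metis
  define e f where "e = a /\<^sub>R norm a" and "f = b /\<^sub>R norm b"
  have on: "norm e = 1" "norm f = 1" "e \<bullet> f = 0" using ab by (auto simp: e_def f_def)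
  have a: "a = norm a *\<^sub>R e" and b: "b = norm b *\<^sub>R f" using ab by (auto simp: e_def f_def)

  define v where "v y = w y - w' y" for y
  have v: "wsol \<kappa> G v" if "open G" "G \<inter> closure D = {}" "G \<inter> closure D' = {}" for G
  proof -
    have "wsol \<kappa> G w" "wsol \<kappa> G w'" using that
      by (auto intro!: wsol_subset[OF TE_wsol[OF TE(1)]] wsol_subset[OF TE_wsol[OF TE(2)]])
    then have "wsol \<kappa> G (\<lambda>y. 1 * w y + (- 1) * w' y)" by (rule wsol_lincomb)
    then show ?thesis by (simp add: v_def[abs_def])
  qed
  \<comment> \<open>Rellich's lemma outside a large disc, then continuation through the complement
    of \<open>K\<close>, which is connected because \<open>K\<close> is bounded and convex in the
    plane.\<close>
  have vK: "v y = 0" if y: "y \<notin> K" for y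
  proof -
    obtain R where R: "0 \<le> R" "\<And>y. y \<in> K \<Longrightarrow> norm y \<le> R"
      using K(3) unfolding bounded_pos by (metis less_imp_le)
    have U: "open {y :: pt. R < norm y}" by (intro open_Collect_less continuous_intros)
    have disj: "{y. R < norm y} \<inter> K = {}" using R(2) by fastforce
    have far: "v y = 0" if "R < norm y" for y
    proof (rule wsol_rellich[OF _ \<kappa> R(1) _ that])
      show "wsol \<kappa> {y. R < norm y} v" by (rule v[OF U]) (use disj DK in auto)
      show "((\<lambda>y. of_real (sqrt (norm y)) * v y) \<longlongrightarrow> 0) at_infinity"
        unfolding v_def by (rule far_field_difference[OF TE fb eq])
    qed
    have vK: "wsol \<kappa> (- K) v" by (rule v) (use K(2) DK in auto)
    have con: "connected (- K)" by (rule connected_complement_bounded_convex[OF K(3,4)]) simp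
    have "norm ((R + 1) *\<^sub>R e) = R + 1" using R(1) on by simp
    then have "(R + 1) *\<^sub>R e \<in> {y. R < norm y}" by simp
    then have "{y. R < norm y} \<inter> - K \<noteq> {}" using disj by blast
    from wsol_unique_continuation[OF vK less_imp_le[OF \<kappa>] con U this] far y show ?thesis by blast
  qed

  obtain \<epsilon>0 where \<epsilon>0: "0 < \<epsilon>0" "ball x \<epsilon>0 \<subseteq> - closure D'"
    using x(2) open_contains_ball[of "- closure D'"] by auto
  \<comment> \<open>Within this distance of \<open>x\<close> neither \<open>D'\<close> nor the two
    opposite sides of \<open>D\<close> are met, so \<open>D\<close> looks like a quadrant.\<close>
  define \<epsilon> where "\<epsilon> = min \<epsilon>0 (min (norm a) (norm b))"
  have \<epsilon>: "0 < \<epsilon>" "\<epsilon> \<le> norm a" "\<epsilon> \<le> norm b" using \<epsilon>0 ab by (auto simp: \<epsilon>_def)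
  have BD': "ball x \<epsilon> \<inter> closure D' = {}" using \<epsilon>0(2) by (auto simp: \<epsilon>_def)
  have inD: "y \<in> closure D \<longleftrightarrow> 0 \<le> (y - x) \<bullet> a \<and> 0 \<le> (y - x) \<bullet> b" if "y \<in> ball x \<epsilon>" for y
  proof -
    have n: "norm (y - x) < \<epsilon>" using that by (simp add: dist_norm norm_minus_commute)
    have "(y - x) \<bullet> z \<le> z \<bullet> z" if "\<epsilon> \<le> norm z" for z
    proof -
      have "(y - x) \<bullet> z \<le> norm (y - x) * norm z" by (rule norm_cauchy_schwarz)
      also have "\<dots> \<le> norm z * norm z" using n that by (intro mult_right_mono) auto
      finally show ?thesis by (simp add: dot_square_norm power2_eq_square)
    qed
    then show ?thesis using \<epsilon> by (auto simp: r rect_def)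
  qed
  define W where "W = ball x \<epsilon> - closure D"
  \<comment> \<open>Outside the right angle the disc is a union of two convex half-discs; a point on
    the outer bisector lies in both, so the union is connected.\<close>
  have W: "W = (ball x \<epsilon> \<inter> {y. a \<bullet> y < a \<bullet> x}) \<union> (ball x \<epsilon> \<inter> {y. b \<bullet> y < b \<bullet> x})"
  proof -
    have "(y - x) \<bullet> z = z \<bullet> y - z \<bullet> x" for y z by (simp add: inner_diff_right inner_commute[of _ z])
    then show ?thesis unfolding W_def using inD by (auto simp: not_le)
  qed
  have conW: "connected W" unfolding W
  proof (rule connected_Un)
    define z where "z = x - (\<epsilon> / 3) *\<^sub>R (e + f)"
    have "norm ((\<epsilon> / 3) *\<^sub>R (e + f)) \<le> \<epsilon> / 3 * (1 + 1)"
      using \<epsilon> norm_triangle_ineq[of e f] on unfolding norm_scaleR by (intro mult_mono) auto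
    then have "z \<in> ball x \<epsilon>" using \<epsilon> by (simp add: z_def dist_norm)
    moreover have "a \<bullet> z < a \<bullet> x"
    proof -
      have "a \<bullet> (e + f) = norm a" by (subst a) (use on in \<open>simp add: inner_add_right norm_eq_1\<close>)
      then show ?thesis using \<epsilon> ab by (simp add: z_def inner_diff_right)
    qed
    moreover have "b \<bullet> z < b \<bullet> x"
    proof -
      have "b \<bullet> (e + f) = norm b" by (subst b) (use on in \<open>simp add: inner_add_right norm_eq_1 inner_commute[of f e]\<close>)
      then show ?thesis using \<epsilon> ab by (simp add: z_def inner_diff_right)
    qed
    ultimately show "ball x \<epsilon> \<inter> {y. a \<bullet> y < a \<bullet> x} \<inter> (ball x \<epsilon> \<inter> {y. b \<bullet> y < b \<bullet> x}) \<noteq> {}" by blast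
  qed (intro convex_connected convex_Int convex_ball convex_halfspace_lt)+
  \<comment> \<open>Otherwise \<open>x\<close> would be the midpoint of x + h on a side of
    \<open>D\<close> and x - h in \<open>W\<close>, both in \<open>K\<close>, although it is an
    extreme point.\<close>
  have "- K \<inter> W \<noteq> {}"
  proof
    assume "- K \<inter> W = {}"
    define h where "h = (\<epsilon> / 2) *\<^sub>R e"
    have h: "norm h < \<epsilon>" "h \<noteq> 0" using \<epsilon> on by (auto simp: h_def)
    have eb: "e \<bullet> b = 0" "e \<bullet> a = norm a" using ab by (auto simp: e_def dot_square_norm power2_eq_square)
    have "x + h \<in> closure D" by (subst inD) (use h \<epsilon> eb in \<open>auto simp: dist_norm h_def\<close>)
    moreover have "x - h \<in> W"
    proof -
      have m: "x - h \<in> ball x \<epsilon>" using h by (simp add: dist_norm)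
      have "\<not> 0 \<le> (x - h - x) \<bullet> a" using \<epsilon> eb ab by (simp add: h_def not_le)
      then show ?thesis using m inD[OF m] by (simp add: W_def)
    qed
    ultimately have "x + h \<in> K" "x - h \<in> K" using DK \<open>- K \<inter> W = {}\<close> by blast+
    then show False using midpoint_not_extreme[OF xK] h by blast
  qed
  note meets = this
  have oW: "open W" unfolding W_def by (intro open_Diff open_ball closed_closure)
  have vW: "wsol \<kappa> W v" by (rule v[OF oW]) (use BD' in \<open>auto simp: W_def\<close>)
  have ww: "w y = w' y" if "y \<in> ball x \<epsilon> - closure D" for y
  proof -
    have "v y = 0"
      by (rule wsol_unique_continuation[OF vW less_imp_le[OF \<kappa>] conW _ meets]) (use vK K(2) that in \<open>auto simp: W_def\<close>)
    then show ?thesis by (simp add: v_def)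
  qed
  \<comment> \<open>One seventh lets the closed ball of radius 6 eta used by the corner lemmas fit
    into the open ball of radius epsilon.\<close>
  define \<eta> where "\<eta> = \<epsilon> / 7"
  have \<eta>: "0 < \<eta>" "3 * \<eta> \<le> norm a" "3 * \<eta> \<le> norm b" using \<epsilon> by (auto simp: \<eta>_def)
  have ball: "cball x (6 * \<eta>) \<subseteq> ball x \<epsilon>" using \<epsilon> by (auto simp: \<eta>_def)
  have quad: "x + s *\<^sub>R e + t *\<^sub>R f \<in> closure D \<longleftrightarrow> 0 \<le> s \<and> 0 \<le> t" if st: "\<bar>s\<bar> \<le> 3 * \<eta>" "\<bar>t\<bar> \<le> 3 * \<eta>" for s t
  proof -
    have "norm (s *\<^sub>R e + t *\<^sub>R f) \<le> \<bar>s\<bar> + \<bar>t\<bar>" using norm_triangle_ineq[of "s *\<^sub>R e" "t *\<^sub>R f"] on by simp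
    then have "norm (s *\<^sub>R e + t *\<^sub>R f) < \<epsilon>" using st \<epsilon> by (simp add: \<eta>_def)
    moreover have "dist x (x + s *\<^sub>R e + t *\<^sub>R f) = norm (s *\<^sub>R e + t *\<^sub>R f)"
        by (simp add: dist_norm add.assoc norm_minus_commute flip: norm_minus_cancel[of "s *\<^sub>R e + t *\<^sub>R f"])
    ultimately have m: "x + s *\<^sub>R e + t *\<^sub>R f \<in> ball x \<epsilon>" by simp
    have "e \<bullet> a = norm a" "f \<bullet> b = norm b" "e \<bullet> b = 0" "f \<bullet> a = 0" using ab
      by (auto simp: e_def f_def dot_square_norm power2_eq_square inner_commute)
    then have "(x + s *\<^sub>R e + t *\<^sub>R f - x) \<bullet> a = s * norm a" "(x + s *\<^sub>R e + t *\<^sub>R f - x) \<bullet> b = t * norm b"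
      by (simp_all add: inner_add_left inner_diff_left)
    then show ?thesis unfolding inD[OF m] using ab by (simp add: zero_le_mult_iff)
  qed
  have zero: "pdn e n w' x = 0" for n
    by (rule corner_derivatives_vanish[OF TE \<kappa> q0 open_ball BD' ww ball on \<eta>(1) quad])

  \<comment> \<open>A line strictly separates \<open>x\<close> from the convex set
    \<open>closure D'\<close>. At least one of e and - e does not point towards \<open>D'\<close>
    across it, and the ray from \<open>x\<close> in that direction stays outside.\<close>
  obtain n c where n: "n \<bullet> x < c" "\<And>y. y \<in> closure D' \<Longrightarrow> c < n \<bullet> y"
    using separating_hyperplane_closed_point[OF convex_closure[OF open_rectangleD(2)[OF D(2)]] closed_closure x(2)]
        by blast
  define g where "g = (if n \<bullet> e \<le> 0 then e else - e)"
  have g: "norm g = 1" "n \<bullet> g \<le> 0" using on by (auto simp: g_def)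
  have ray: "x + t *\<^sub>R g \<in> - closure D'" if "0 \<le> t" for t
  proof
    assume "x + t *\<^sub>R g \<in> closure D'"
    from n(2)[OF this] n(1) have "0 < t * (n \<bullet> g)" by (simp add: inner_add_right)
    then show False using g(2) that by (simp add: mult_nonneg_nonpos leD)
  qed
  have xG: "x \<in> - closure D'" using x(2) by simp
  note v' = TE_wsol[OF TE(2)] less_imp_le[OF \<kappa>]
  have "pdn g k w' x = 0" for k
    using zero[of k] pdn_uminus[OF v' xG, where e = e and n = k] by (simp add: g_def)
  from wsol_vanish_ray[OF v' g(1) ray this] have "w' (x + t *\<^sub>R g) = 0" if "0 \<le> t" for t using that by blast
  then show False by (rule total_field_nonzero_on_ray[OF TE(2) fb(2) bd(2) \<kappa> g(1)])
qed

theorem theorem1p1: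
  fixes \<kappa> :: real and d :: pt and q0 :: complex and D D' :: "pt set"
    and uinf uinf' :: "pt \<Rightarrow> complex"
  assumes "\<kappa> > 0" and "d \<in> unit_circle" and "q0 \<noteq> 1"
    and "is_open_rectangle D" and "is_open_rectangle D'"
    and "is_far_field \<kappa> d q0 D uinf" and "is_far_field \<kappa> d q0 D' uinf'"
    and "\<forall>xh\<in>unit_circle. uinf xh = uinf' xh"
  shows "D = D'"
proof -
  obtain u w u' w' where TE: "TE_total_field \<kappa> d q0 D u w" "TE_total_field \<kappa> d q0 D' u' w'"
    and fb: "far_bound \<kappa> d u uinf" "far_bound \<kappa> d u' uinf'"
    using assms(6,7) unfolding is_far_field_iff by blast
  have eq': "\<forall>xh\<in>unit_circle. uinf' xh = uinf xh" using assms(8) by simp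
  define K where "K = convex hull (closure D \<union> closure D')"
  have bd: "bounded D" "bounded D'" using assms(4,5) open_rectangleD(3) by blast+
  have K: "compact K" "convex K" unfolding K_def using bd
    by (auto intro!: compact_convex_hull compact_Un simp: compact_closure)
  \<comment> \<open>The roles of the two rectangles are symmetric, so every extreme point of the
    hull lies in both closures. By Minkowski's theorem the hull is then contained in each closure,
    and hence equal to it.\<close>
  have ext: "x \<in> closure D \<and> x \<in> closure D'" if "x extreme_point_of K" for x
    using no_exposed_corner[OF TE assms(1,3) fb assms(8,4,5), of x]
      no_exposed_corner[OF TE(2,1) assms(1,3) fb(2,1) eq' assms(5,4), of x] that unfolding K_def by (auto simp: Un_commute)
  have hull: "K \<subseteq> E" if "convex E" "\<And>x. x extreme_point_of K \<Longrightarrow> x \<in> E" for E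
    using Krein_Milman_Minkowski[OF K] hull_minimal[of "{x. x extreme_point_of K}" E convex] that by blast
  have "K \<subseteq> closure D" by (rule hull[OF convex_closure]) (use ext open_rectangleD(2)[OF assms(4)] in auto)
  moreover have "K \<subseteq> closure D'" by (rule hull[OF convex_closure]) (use ext open_rectangleD(2)[OF assms(5)] in auto)
  moreover have "closure D \<subseteq> K" "closure D' \<subseteq> K" unfolding K_def using hull_subset[of "closure D \<union> closure D'" convex] by auto
  ultimately have "closure D = closure D'" by blast
  then show ?thesis by (rule open_rectangle_eqI[OF assms(4,5)])
qed

end
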